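(* In $\mathbb C[[s_1,s_2]]$ put $\lambda_1=2s_1+3s_2$, $\lambda_2=3s_1+s_2$, $\lambda_3=s_1+s_2$. For every integer $q\ge1$ there exist a homogeneous $A$-hypergeometric system of lattice rank $2$ with $5q$ columns, with a connected column matroid and (for the direction below) with a normal affine semigroup $\mathcal C(w_q)$ generated by the reduced Gröbner basis vectors, a generic direction $w_q$ that is nonzero on every nonzero element of $L$, a binary fake exponent $v_q$ (all coordinates in $\{-1,0\}$), and an ordered negative support family $\mathcal N_q$ for $v_q$, with associated monomial $e_q=t^{\operatorname{nsupp}(v_q)\setminus K_{\mathcal N_q}}$, such that $$\operatorname{Hilb}\bigl(\mathfrak D_{\mathcal N_q}(e_q);u\bigr)=u^q(1+u+\cdots+u^{q-1})^2 .$$ In particular, $\dim_{\mathbb C}\mathfrak D_{\mathcal N_q}(e_q)=q^2$. Moreover, for a suitable Gale dual and the resulting map $\Phi$, $$\Phi\bigl(Q_{\mathcal N_q}(t):e_q\bigr)=\langle\lambda_2^q,\lambda_1^q\lambda_3^q\rangle,\qquad \Pi_{\mathcal N_q}:m_{v_q,\mathcal N_q}=\langle\lambda_1^q,\lambda_2^q\rangle,$$ and there is a graded isomorphism $$\mathfrak D_{\mathcal N_q}(e_q)\simeq\frac{\mathbb C[s_1,s_2]}{\langle\lambda_2^q,\lambda_3^q\rangle}(-q).$$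
   Context: System. $\mathbb N=\{0,1,2,\dots\}$. $A=(a_{ij})\in\mathbb Z^{d\times n}$ has rank $d$ and its columns lie in an affine hyperplane not containing the origin ("homogeneous"). $L=\ker_{\mathbb Z}(A)$; $r=\operatorname{rank}L=n-d$ is the lattice rank. The column matroid of $A$ is the matroid represented over $\mathbb Q$ by its columns. For $u\in L$ write $u=u_+-u_-$ with $u_\pm\in\mathbb N^n$ of disjoint support. $I_A=\langle\partial^{u_+}-\partial^{u_-}\mid u\in L\rangle\subseteq\mathbb C[\partial_1,\dots,\partial_n]$. For $\beta\in\mathbb C^d$, $H_A(\beta)$ is the left ideal of the Weyl algebra in $x_1,\dots,x_n$ generated by $I_A$ and $\sum_j a_{ij}x_j\partial_j-\beta_i$ $(1\le i\le d)$. $\operatorname{in}_w$ takes terms of largest $w$-weight; $\operatorname{in}_{(-w,w)}$ is the initial ideal in the Weyl algebra for weights $-w$ on $x$, $w$ on $\partial$. A direction $w\in\mathbb R^n$ is generic if $\operatorname{in}_w(I_A)$ is a monomial ideal and $w$ lies in the interior of a full-dimensional cone of the small Gröbner fan of $H_A(\beta)$ (so $\operatorname{in}_{(-w',w')}(H_A(\beta))$ is constant for $w'$ in that interior). For $z\in\mathbb C^n$, $p\in\mathbb N^n$: $[z]_p=\prod_j z_j(z_j-1)\cdots(z_j-p_j+1)$. A fake exponent of $H_A(\beta)$ in the direction $w$ is $v\in\mathbb C^n$ with $Av=\beta$ and $[v]_p=0$ for every monomial $\partial^p\in\operatorname{in}_w(I_A)$. Semigroup. Let $\{\partial^{g^{(i)}_+}-\partial^{g^{(i)}_-}\}_i$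 be the reduced Gröbner basis of $I_A$ in the direction $w$, the first monomial being initial ($g^{(i)}=g^{(i)}_+-g^{(i)}_-$). $\mathcal C(w)=\sum_i\mathbb Ng^{(i)}\subseteq L$; it is normal if it contains every element of the group it generates that lies in the real cone it spans. Negative supports. $\operatorname{nsupp}(z)=\{j\mid z_j\in\mathbb Z_{<0}\}$. For $u\in L$, $I_u=\operatorname{nsupp}(v+u)$; $I_0=\operatorname{nsupp}(v)$; $\mathcal S(v)=\{I_u\mid u\in L\}$. $\mathcal N_v=\{I\in\mathcal S(v)\mid w\cdot u\ge0\text{ for every }u\in L\text{ with }I_u=I\}$. A negative support family for $v$ is a set $\mathcal N$ with $I_0\in\mathcal N\subseteq\mathcal N_v$; it is ordered if $I\in\mathcal N$, $J\in\mathcal S(v)$, $J\subseteq I$ imply $J\in\mathcal N$. $K_{\mathcal N}=\bigcap_{I\in\mathcal N}I$. Obstruction module. $\widehat R=\mathbb C[[t_1,\dots,t_n]]$, $t^J=\prod_{j\in J}t_j$, $e=t^{I_0\setminus K_{\mathcal N}}$, $U=\langle At\rangle$, $M_{\mathcal N}=\langle t^{I\setminus K_{\mathcal N}}\mid I\in\mathcal N\rangle$, $P_{\mathcal N}(t)=\langle t^{(I\cup J)\setminus K_{\mathcal N}}\mid I\in\mathcal N,J\in\mathcal S(v)\setminus\mathcal N\rangle$, $Q_{\mathcal N}(t)=UM_{\mathcal N}+P_{\mathcal N}(t)$, $\mathfrak D_{\mathcal N}(e)=\dfrac{(U+P_{\mathcal N}(t)):e}{(UM_{\mathcal N}+P_{\mathcal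 N}(t)):e}$. A Gale dual $B$ is an $n\times r$ integer matrix whose columns form a $\mathbb Z$-basis of $L$; $\Phi:\widehat R\to\mathbb C[[s_1,\dots,s_r]]$, $t_j\mapsto(Bs)_j$; $\Pi_{\mathcal N}=\Phi(P_{\mathcal N}(t))$, $m_{v,\mathcal N}=\Phi(e)$. Grading and Hilbert series. $S_0=\mathbb C[s_1,\dots,s_r]$; $\ell_j=(Bs)_j$, $\ell^Y=\prod_{j\in Y}\ell_j$ ($\ell^\varnothing=1$), $E=I_0\setminus K_{\mathcal N}$. Let $\{G_1,\dots,G_g\}$ be the inclusion-minimal members of $\{I\setminus K_{\mathcal N}\mid I\in\mathcal N\}$ and $\{H_1,\dots,H_h\}$ the inclusion-minimal members of $\{(I\cup J)\setminus K_{\mathcal N}\mid I\in\mathcal N,\ J\in\mathcal S(v)\setminus\mathcal N\}$. Each $H_a$ contains some $G_i$; choose such an index $\iota(a)$. $F_{\mathcal N}=\bigoplus_{i}S_0(-|G_i|)\eta_i$, and $Z_{\mathcal N}\subseteq F_{\mathcal N}$ is generated by $\ell^{G_j\setminus G_i}\eta_i-\ell^{G_i\setminus G_j}\eta_j$ $(i<j)$ and $\ell^{H_a\setminus G_{\iota(a)}}\eta_{\iota(a)}$. Choose $i$ with $G_i\subseteq E$ and put $\epsilon_{\mathcal N}=\ell^{E\setminus G_i}\overline{\eta_i}\in F_{\mathcal N}/Z_{\mathcal N}$ (independent of the choices). $J_{\mathcal N}^{\mathrm{amb}}=\operatorname{Ann}_{S_0}(\epsilon_{\mathcal N})\subseteq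 J_{\mathcal N}^{\mathrm{intr}}=\langle\ell^{H_1},\dots,\ell^{H_h}\rangle:\ell^E$. By definition $\operatorname{Hilb}(\mathfrak D_{\mathcal N}(e);u)=\sum_{k\ge0}\dim_{\mathbb C}(J_{\mathcal N}^{\mathrm{intr}}/J_{\mathcal N}^{\mathrm{amb}})_ku^k$; $\mathfrak D_{\mathcal N}(e)\simeq\mathbb C[[s]]\otimes_{S_0}(J_{\mathcal N}^{\mathrm{intr}}/J_{\mathcal N}^{\mathrm{amb}})$, and "graded isomorphism" refers to the grading of $J_{\mathcal N}^{\mathrm{intr}}/J_{\mathcal N}^{\mathrm{amb}}$ (which coincides with $\mathfrak D_{\mathcal N}(e)$ when of finite length). *)

theory Defs
  imports
    "Jordan_Normal_Form.DL_Rank"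
    "Jordan_Normal_Form.Matrix_Kernel"
    "HOL-Library.Poly_Mapping"
    "HOL-Computational_Algebra.Formal_Power_Series"
begin

section \<open>Monomials, polynomials and power series in finitely many of the variables \<open>0, 1, 2, \<dots>\<close>\<close>

type_synonym expo = "nat \<Rightarrow>\<^sub>0 nat"
type_synonym cpoly = "expo \<Rightarrow>\<^sub>0 complex"

definition expos :: "nat \<Rightarrow> expo set" where
  "expos n = {m. Poly_Mapping.keys m \<subseteq> {..<n}}"

definition mdeg :: "expo \<Rightarrow> nat" where
  "mdeg m = (\<Sum>j\<in>Poly_Mapping.keys m. Poly_Mapping.lookup m j)"

definition poly_ring :: "nat \<Rightarrow> cpoly set" where
  "poly_ring n = {f. Poly_Mapping.keys f \<subseteq> expos n}"

definition pvar :: "nat \<Rightarrow> cpoly" where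
  "pvar j = Poly_Mapping.single (Poly_Mapping.single j 1) 1"

definition pconst :: "complex \<Rightarrow> cpoly" where
  "pconst c = Poly_Mapping.single 0 c"

definition hom_part :: "nat \<Rightarrow> cpoly set" where
  "hom_part k = {f. \<forall>m\<in>Poly_Mapping.keys f. mdeg m = k}"

text \<open>Formal power series: arbitrary coefficient functions on exponents, with the Cauchy product.
  The ring \<open>\<complex>[[t\<^sub>0, \<dots>, t\<^sub>n\<^sub>-\<^sub>1]]\<close> is the subring \<open>mfps_ring n\<close> below.\<close>

typedef mfps = "UNIV :: (expo \<Rightarrow> complex) set"
  morphisms mcoeff Abs_mfps by simp

setup_lifting type_definition_mfps

lemma mfps_eqI: "(\<And>m. mcoeff f m = mcoeff g m) \<Longrightarrow> f = g"
  by (simp add: mcoeff_inject[symmetric] fun_eq_iff)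

definition splits :: "expo \<Rightarrow> (expo \<times> expo) set" where
  "splits m = {(a, b). a + b = m}"

lemma finite_splits: "finite (splits m)"
proof -
  let ?F = "PiE (Poly_Mapping.keys m) (\<lambda>j. {..Poly_Mapping.lookup m j})"
  let ?r = "\<lambda>a. restrict (Poly_Mapping.lookup a) (Poly_Mapping.keys m)"
  let ?S = "{a. \<exists>b. a + b = m}"
  have le: "Poly_Mapping.lookup a j \<le> Poly_Mapping.lookup m j" if "a \<in> ?S" for a j
    using that by (auto simp: lookup_add)
  have "finite ?F"
    by (rule finite_PiE) auto
  moreover have "?r ` ?S \<subseteq> ?F"
    using le by (auto simp: PiE_def)
  ultimately have fin: "finite (?r ` ?S)"
    by (rule finite_subset[rotated])
  have "inj_on ?r ?S"
  proof (rule inj_onI)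
    fix a b assume a: "a \<in> ?S" and b: "b \<in> ?S" and eq: "?r a = ?r b"
    show "a = b"
    proof (rule poly_mapping_eqI)
      fix j
      show "Poly_Mapping.lookup a j = Poly_Mapping.lookup b j"
      proof (cases "j \<in> Poly_Mapping.keys m")
        case True
        then show ?thesis using fun_cong[OF eq, of j] by simp
      next
        case False
        then have "Poly_Mapping.lookup m j = 0" by (simp add: in_keys_iff)
        then show ?thesis using le[OF a, of j] le[OF b, of j] by simp
      qed
    qed
  qed
  then have "finite ?S" using fin finite_imageD by blast
  moreover have "splits m \<subseteq> (\<lambda>a. (a, m - a)) ` ?S"
    by (auto simp: splits_def)
  ultimately show ?thesis by (meson finite_imageI finite_subset)
qed

instantiation mfps :: comm_ring_1
begin

lift_definition zero_mfps :: mfps is "\<lambda>_. 0" .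
lift_definition one_mfps :: mfps is "\<lambda>m. if m = 0 then 1 else 0" .
lift_definition plus_mfps :: "mfps \<Rightarrow> mfps \<Rightarrow> mfps" is "\<lambda>f g m. f m + g m" .
lift_definition minus_mfps :: "mfps \<Rightarrow> mfps \<Rightarrow> mfps" is "\<lambda>f g m. f m - g m" .
lift_definition uminus_mfps :: "mfps \<Rightarrow> mfps" is "\<lambda>f m. - f m" .
lift_definition times_mfps :: "mfps \<Rightarrow> mfps \<Rightarrow> mfps" is
  "\<lambda>f g m. \<Sum>(a, b)\<in>splits m. f a * g b" .

instance
proof
  fix f g h :: mfps
  show "f * g * h = f * (g * h)"
  proof (transfer, rule ext)
    fix f g h :: "expo \<Rightarrow> complex" and m
    have "(\<Sum>(a, b)\<in>splits m. (\<Sum>(c, d)\<in>splits a. f c * g d) * h b)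
        = (\<Sum>x\<in>splits m. \<Sum>y\<in>splits (fst x). f (fst y) * g (snd y) * h (snd x))"
      by (simp add: case_prod_unfold sum_distrib_right)
    also have "\<dots> = (\<Sum>(x, y)\<in>Sigma (splits m) (\<lambda>x. splits (fst x)).
        f (fst y) * g (snd y) * h (snd x))"
      by (rule sum.Sigma) (auto simp: finite_splits)
    also have "\<dots> = (\<Sum>(x, y)\<in>Sigma (splits m) (\<lambda>x. splits (snd x)).
        f (fst x) * (g (fst y) * h (snd y)))"
      by (rule sum.reindex_bij_witness[where
            j = "\<lambda>((a, b), (c, d)). ((c, d + b), (d, b))" and
            i = "\<lambda>((c, e), (d, b)). ((c + d, b), (c, d))"])
        (auto simp: splits_def add.assoc mult.assoc)
    also have "\<dots> = (\<Sum>x\<in>splits m. \<Sum>y\<in>splits (snd x). f (fst x) * (g (fst y) * h (snd y)))"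
      by (rule sum.Sigma[symmetric]) (auto simp: finite_splits)
    also have "\<dots> = (\<Sum>(a, b)\<in>splits m. f a * (\<Sum>(c, d)\<in>splits b. g c * h d))"
      by (simp add: case_prod_unfold sum_distrib_left)
    finally show "(\<Sum>(a, b)\<in>splits m. (\<Sum>(c, d)\<in>splits a. f c * g d) * h b)
        = (\<Sum>(a, b)\<in>splits m. f a * (\<Sum>(c, d)\<in>splits b. g c * h d))" .
  qed
  show "f * g = g * f"
  proof (transfer, rule ext)
    fix f g :: "expo \<Rightarrow> complex" and m
    show "(\<Sum>(a, b)\<in>splits m. f a * g b) = (\<Sum>(a, b)\<in>splits m. g a * f b)"
      by (rule sum.reindex_bij_witness[where i = prod.swap and j = prod.swap])
        (auto simp: splits_def add.commute mult.commute)
  qed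
  show "1 * f = f"
  proof (transfer, rule ext)
    fix f :: "expo \<Rightarrow> complex" and m
    have "(\<Sum>(a, b)\<in>splits m. (if a = 0 then 1 else 0) * f b)
        = (\<Sum>x\<in>{(0 :: expo, m)}. case x of (a, b) \<Rightarrow> (if a = 0 then 1 else 0) * f b)"
      by (rule sum.mono_neutral_right) (auto simp: splits_def finite_splits[unfolded splits_def] split: if_splits)
    then show "(\<Sum>(a, b)\<in>splits m. (if a = 0 then 1 else 0) * f b) = f m" by simp
  qed
  show "(f + g) * h = f * h + g * h"
    by (transfer, rule ext) (simp add: case_prod_unfold distrib_right sum.distrib)
  show "f + g + h = f + (g + h)" by transfer (simp add: add.assoc)
  show "f + g = g + f" by transfer (simp add: add.commute)
  show "0 + f = f" by transfer simp
  show "- f + f = 0" by transfer simp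
  show "f - g = f + - g" by transfer simp
  show "(0 :: mfps) \<noteq> 1" by transfer (auto simp: fun_eq_iff)
qed

end

definition mfps_ring :: "nat \<Rightarrow> mfps set" where
  "mfps_ring n = {f. \<forall>m. mcoeff f m \<noteq> 0 \<longrightarrow> m \<in> expos n}"

definition mfps_of_poly :: "cpoly \<Rightarrow> mfps" where
  "mfps_of_poly f = Abs_mfps (Poly_Mapping.lookup f)"

section \<open>Ideals and modules\<close>

text \<open>The \<open>R\<close>-submodule generated by \<open>S\<close>, for the scalar action \<open>sc\<close> of \<open>R\<close>. With \<open>sc\<close> the
  multiplication of a (not necessarily commutative) ring \<open>R\<close> this is the (left) ideal generated
  by \<open>S \<subseteq> R\<close>.\<close>

inductive_set gen_submodule :: "'r set \<Rightarrow> ('r \<Rightarrow> 'a \<Rightarrow> 'a) \<Rightarrow> 'a set \<Rightarrow> ('a::ab_group_add) set"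
  for R :: "'r set" and sc :: "'r \<Rightarrow> 'a \<Rightarrow> 'a" and S :: "'a set" where
  zero: "0 \<in> gen_submodule R sc S"
| gen: "x \<in> S \<Longrightarrow> x \<in> gen_submodule R sc S"
| add: "x \<in> gen_submodule R sc S \<Longrightarrow> y \<in> gen_submodule R sc S \<Longrightarrow> x + y \<in> gen_submodule R sc S"
| scale: "a \<in> R \<Longrightarrow> x \<in> gen_submodule R sc S \<Longrightarrow> sc a x \<in> gen_submodule R sc S"

abbreviation gen_ideal :: "'a set \<Rightarrow> 'a set \<Rightarrow> ('a::comm_ring_1) set" where
  "gen_ideal R S \<equiv> gen_submodule R (*) S"

definition ideal_plus :: "'a set \<Rightarrow> 'a set \<Rightarrow> ('a::comm_ring_1) set" where
  "ideal_plus I J = {a + b | a b. a \<in> I \<and> b \<in> J}"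

definition ideal_times :: "'a set \<Rightarrow> 'a set \<Rightarrow> 'a set \<Rightarrow> ('a::comm_ring_1) set" where
  "ideal_times R I J = gen_ideal R {a * b | a b. a \<in> I \<and> b \<in> J}"

definition colon :: "'a set \<Rightarrow> 'a set \<Rightarrow> 'a \<Rightarrow> ('a::comm_ring_1) set" where
  "colon R I f = {g \<in> R. g * f \<in> I}"

text \<open>\<open>has_quot_dim sc V W k\<close>: the quotient of complex vector spaces \<open>V / W\<close> (\<open>W \<subseteq> V\<close>) is
  finite-dimensional of dimension \<open>k\<close>, i.e. some \<open>k\<close> elements of \<open>V\<close> represent a basis of it.\<close>

definition has_quot_dim ::
  "(complex \<Rightarrow> 'a \<Rightarrow> 'a) \<Rightarrow> ('a::ab_group_add) set \<Rightarrow> 'a set \<Rightarrow> nat \<Rightarrow> bool" where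
  "has_quot_dim sc V W k \<longleftrightarrow>
     (\<exists>X. finite X \<and> card X = k \<and> X \<subseteq> V \<and> V \<subseteq> module.span sc (W \<union> X) \<and>
       (\<forall>x\<in>X. x \<notin> module.span sc (W \<union> (X - {x}))))"

definition pscale :: "complex \<Rightarrow> cpoly \<Rightarrow> cpoly" where
  "pscale c f = pconst c * f"

definition mscale :: "complex \<Rightarrow> mfps \<Rightarrow> mfps" where
  "mscale c f = mfps_of_poly (pconst c) * f"

text \<open>For homogeneous ideals \<open>W \<subseteq> V\<close> of polynomials in finitely many variables, the graded pieces
  of \<open>V / W\<close> are finite-dimensional, so that the dimensions below exist.\<close>

definition hilbert_series :: "cpoly set \<Rightarrow> cpoly set \<Rightarrow> int fps" where
  "hilbert_series V W =
     Abs_fps (\<lambda>k. int (THE m. has_quot_dim pscale (V \<inter> hom_part k) (W \<inter> hom_part k) m))"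

text \<open>\<open>quotient_iso R \<sigma> M M' N N' \<phi>\<close>: the map \<open>\<phi>\<close>, given on representatives, induces a bijection
  \<open>M / M' \<rightarrow> N / N'\<close> that is additive and linear over the ring \<open>R\<close>, which acts on the target
  through the ring homomorphism \<open>\<sigma>\<close>.\<close>

definition quotient_iso :: "'a set \<Rightarrow> ('a \<Rightarrow> 'b) \<Rightarrow> 'a set \<Rightarrow> 'a set \<Rightarrow> 'b set \<Rightarrow> 'b set \<Rightarrow>
    (('a::comm_ring_1) \<Rightarrow> ('b::comm_ring_1)) \<Rightarrow> bool" where
  "quotient_iso R \<sigma> M M' N N' \<phi> \<longleftrightarrow>
     (\<forall>f\<in>M. \<phi> f \<in> N) \<and>
     (\<forall>f\<in>M. \<forall>g\<in>M. \<phi> (f + g) - (\<phi> f + \<phi> g) \<in> N') \<and>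
     (\<forall>a\<in>R. \<forall>f\<in>M. \<phi> (a * f) - \<sigma> a * \<phi> f \<in> N') \<and>
     (\<forall>f\<in>M. \<phi> f \<in> N' \<longleftrightarrow> f \<in> M') \<and>
     (\<forall>g\<in>N. \<exists>f\<in>M. \<phi> f - g \<in> N')"

text \<open>The isomorphism \<open>M / M' \<rightarrow> (N / N')(-k)\<close> induced by \<open>\<phi>\<close> is graded: \<open>(N / N')(-k)\<close> is
  \<open>(N / N')\<^sub>i\<^sub>-\<^sub>k\<close> in degree \<open>i\<close>, hence zero for \<open>i < k\<close>.\<close>

definition degree_shifting :: "nat \<Rightarrow> cpoly set \<Rightarrow> cpoly set \<Rightarrow> cpoly set \<Rightarrow> (cpoly \<Rightarrow> cpoly) \<Rightarrow> bool" where
  "degree_shifting k M N N' \<phi> \<longleftrightarrow>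
     (\<forall>i. \<forall>f\<in>M \<inter> hom_part i.
        if i < k then \<phi> f \<in> N' else \<exists>g\<in>N \<inter> hom_part (i - k). \<phi> f - g \<in> N')"

section \<open>The matrix, its lattice and its column matroid\<close>

text \<open>Rows and columns, hence also the variables, are indexed from 0: \<open>s\<^sub>1\<close> is \<open>pvar 0\<close> and
  \<open>s\<^sub>2\<close> is \<open>pvar 1\<close>.\<close>

definition homogeneous_matrix :: "int mat \<Rightarrow> bool" where
  "homogeneous_matrix A \<longleftrightarrow>
     vec_space.rank (dim_row A) (map_mat rat_of_int A) = dim_row A \<and>
     (\<exists>c\<in>carrier_vec (dim_row A). \<exists>b::real. b \<noteq> 0 \<and>
        (\<forall>j<dim_col A. c \<bullet> col (map_mat real_of_int A) j = b))"

abbreviation ker_lattice :: "int mat \<Rightarrow> int vec set" where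
  "ker_lattice A \<equiv> mat_kernel A"

text \<open>For \<open>A\<close> of full row rank this is the rank of the kernel lattice.\<close>

definition lattice_rank :: "int mat \<Rightarrow> nat" where
  "lattice_rank A = dim_col A - dim_row A"

definition gale_dual :: "int mat \<Rightarrow> int mat \<Rightarrow> bool" where
  "gale_dual A B \<longleftrightarrow> B \<in> carrier_mat (dim_col A) (lattice_rank A) \<and>
     bij_betw (\<lambda>c. B *\<^sub>v c) (carrier_vec (lattice_rank A)) (ker_lattice A)"

definition columns_indep :: "int mat \<Rightarrow> nat set \<Rightarrow> bool" where
  "columns_indep A J \<longleftrightarrow>
     (\<forall>c. (\<forall>i<dim_row A. (\<Sum>j\<in>J. c j * rat_of_int (A $$ (i, j))) = 0) \<longrightarrow> (\<forall>j\<in>J. c j = 0))"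

text \<open>Connectedness of the matroid represented by the columns over \<open>\<rat>\<close>: any two distinct
  elements lie on a common circuit.\<close>

definition matroid_circuit :: "int mat \<Rightarrow> nat set \<Rightarrow> bool" where
  "matroid_circuit A J \<longleftrightarrow> J \<subseteq> {..<dim_col A} \<and> \<not> columns_indep A J \<and>
     (\<forall>j\<in>J. columns_indep A (J - {j}))"

definition connected_column_matroid :: "int mat \<Rightarrow> bool" where
  "connected_column_matroid A \<longleftrightarrow>
     (\<forall>i<dim_col A. \<forall>j<dim_col A. i \<noteq> j \<longrightarrow> (\<exists>J. matroid_circuit A J \<and> i \<in> J \<and> j \<in> J))"

section \<open>Toric ideals and initial ideals\<close>

definition pos_expo :: "int vec \<Rightarrow> expo" where
  "pos_expo u = (\<Sum>j<dim_vec u. Poly_Mapping.single j (nat (u $ j)))"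

definition neg_expo :: "int vec \<Rightarrow> expo" where
  "neg_expo u = (\<Sum>j<dim_vec u. Poly_Mapping.single j (nat (- (u $ j))))"

abbreviation pmonom :: "expo \<Rightarrow> cpoly" where
  "pmonom m \<equiv> Poly_Mapping.single m 1"

definition toric_binomial :: "int vec \<Rightarrow> cpoly" where
  "toric_binomial u = pmonom (pos_expo u) - pmonom (neg_expo u)"

definition toric_ideal :: "int mat \<Rightarrow> cpoly set" where
  "toric_ideal A = gen_ideal (poly_ring (dim_col A)) (toric_binomial ` ker_lattice A)"

definition expo_weight :: "real vec \<Rightarrow> expo \<Rightarrow> real" where
  "expo_weight w m = (\<Sum>j<dim_vec w. w $ j * real (Poly_Mapping.lookup m j))"

definition initial_form :: "('k \<Rightarrow> real) \<Rightarrow> ('k \<Rightarrow>\<^sub>0 complex) \<Rightarrow> ('k \<Rightarrow>\<^sub>0 complex)" where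
  "initial_form \<omega> f =
     (\<Sum>m\<in>{m \<in> Poly_Mapping.keys f. \<forall>m'\<in>Poly_Mapping.keys f. \<omega> m' \<le> \<omega> m}.
        Poly_Mapping.single m (Poly_Mapping.lookup f m))"

definition initial_ideal :: "nat \<Rightarrow> real vec \<Rightarrow> cpoly set \<Rightarrow> cpoly set" where
  "initial_ideal n w I = gen_ideal (poly_ring n) (initial_form (expo_weight w) ` I)"

definition monomial_ideal :: "nat \<Rightarrow> cpoly set \<Rightarrow> bool" where
  "monomial_ideal n I \<longleftrightarrow> (\<exists>E\<subseteq>expos n. I = gen_ideal (poly_ring n) (pmonom ` E))"

definition reduced_groebner_basis :: "nat \<Rightarrow> real vec \<Rightarrow> cpoly set \<Rightarrow> cpoly set \<Rightarrow> bool" where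
  "reduced_groebner_basis n w I G \<longleftrightarrow>
     finite G \<and> G \<subseteq> I \<and>
     (\<forall>g\<in>G. \<exists>m. initial_form (expo_weight w) g = pmonom m) \<and>
     gen_ideal (poly_ring n) (initial_form (expo_weight w) ` G) = initial_ideal n w I \<and>
     (\<forall>g\<in>G. \<forall>m\<in>Poly_Mapping.keys g.
        pmonom m \<notin> gen_ideal (poly_ring n) (initial_form (expo_weight w) ` (G - {g})))"

text \<open>The vectors \<open>g\<^sup>(\<^sup>i\<^sup>)\<close> attached to the reduced Groebner basis of the toric ideal.\<close>

definition groebner_vectors :: "int mat \<Rightarrow> real vec \<Rightarrow> int vec set \<Rightarrow> bool" where
  "groebner_vectors A w \<Gamma> \<longleftrightarrow> \<Gamma> \<subseteq> ker_lattice A \<and>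
     reduced_groebner_basis (dim_col A) w (toric_ideal A) (toric_binomial ` \<Gamma>) \<and>
     (\<forall>g\<in>\<Gamma>. initial_form (expo_weight w) (toric_binomial g) = pmonom (pos_expo g))"

text \<open>Linear combinations of vectors in \<open>S\<close> with coefficients in \<open>K\<close>, where \<open>K\<close> is
  \<open>\<nat>\<close>, \<open>\<int>\<close> or the nonnegative reals: the semigroup and the group generated by \<open>S\<close>, and the
  integer points of the real cone spanned by \<open>S\<close>.\<close>

definition combinations :: "nat \<Rightarrow> real set \<Rightarrow> int vec set \<Rightarrow> int vec set" where
  "combinations n K S = {u \<in> carrier_vec n. \<exists>F c. finite F \<and> F \<subseteq> S \<and> (\<forall>g\<in>F. c g \<in> K) \<and>
     (\<forall>j<n. real_of_int (u $ j) = (\<Sum>g\<in>F. c g * real_of_int (g $ j)))}"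

definition normal_semigroup :: "nat \<Rightarrow> int vec set \<Rightarrow> bool" where
  "normal_semigroup n C \<longleftrightarrow> combinations n \<int> C \<inter> combinations n {0..} C \<subseteq> C"

section \<open>The Weyl algebra and hypergeometric ideals\<close>

text \<open>Elements of the Weyl algebra in normal form: \<open>(a, b)\<close> stands for \<open>x\<^sup>a \<partial>\<^sup>b\<close>. The product is
  \<open>weyl_mult\<close>, obtained by bilinearity from Leibniz' formula
  \<open>\<partial>\<^sup>b x\<^sup>c = (\<Sum>k. k! (b choose k) (c choose k) x\<^sup>c\<^sup>-\<^sup>k \<partial>\<^sup>b\<^sup>-\<^sup>k)\<close> in multi-index notation,
  and not the (commutative) product that the type \<open>_ \<Rightarrow>\<^sub>0 complex\<close> carries.\<close>

type_synonym weyl = "(expo \<times> expo) \<Rightarrow>\<^sub>0 complex"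

definition leibniz_coeff :: "expo \<Rightarrow> expo \<Rightarrow> expo \<Rightarrow> nat" where
  "leibniz_coeff b c k = (\<Prod>j\<in>Poly_Mapping.keys k.
     fact (Poly_Mapping.lookup k j) * (Poly_Mapping.lookup b j choose Poly_Mapping.lookup k j) *
       (Poly_Mapping.lookup c j choose Poly_Mapping.lookup k j))"

definition common_lower :: "expo \<Rightarrow> expo \<Rightarrow> expo set" where
  "common_lower b c = {k. \<forall>j. Poly_Mapping.lookup k j \<le> Poly_Mapping.lookup b j \<and>
     Poly_Mapping.lookup k j \<le> Poly_Mapping.lookup c j}"

definition weyl_mult :: "weyl \<Rightarrow> weyl \<Rightarrow> weyl" where
  "weyl_mult P Q =
     (\<Sum>(a, b)\<in>Poly_Mapping.keys P. \<Sum>(c, d)\<in>Poly_Mapping.keys Q. \<Sum>k\<in>common_lower b c.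
        Poly_Mapping.single (a + (c - k), (b - k) + d)
          (Poly_Mapping.lookup P (a, b) * Poly_Mapping.lookup Q (c, d) *
             of_nat (leibniz_coeff b c k)))"

definition weyl_algebra :: "nat \<Rightarrow> weyl set" where
  "weyl_algebra n = {P. Poly_Mapping.keys P \<subseteq> expos n \<times> expos n}"

definition weyl_of_poly :: "cpoly \<Rightarrow> weyl" where
  "weyl_of_poly f =
     (\<Sum>m\<in>Poly_Mapping.keys f. Poly_Mapping.single (0, m) (Poly_Mapping.lookup f m))"

definition euler_operator :: "int mat \<Rightarrow> complex vec \<Rightarrow> nat \<Rightarrow> weyl" where
  "euler_operator A \<beta> i =
     (\<Sum>j<dim_col A. Poly_Mapping.single (Poly_Mapping.single j 1, Poly_Mapping.single j 1)
        (of_int (A $$ (i, j)))) - Poly_Mapping.single (0, 0) (\<beta> $ i)"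

definition hypergeometric_ideal :: "int mat \<Rightarrow> complex vec \<Rightarrow> weyl set" where
  "hypergeometric_ideal A \<beta> = gen_submodule (weyl_algebra (dim_col A)) weyl_mult
     (weyl_of_poly ` toric_ideal A \<union> euler_operator A \<beta> ` {..<dim_row A})"

definition weyl_initial_ideal :: "nat \<Rightarrow> real vec \<Rightarrow> weyl set \<Rightarrow> weyl set" where
  "weyl_initial_ideal n w I = gen_submodule (weyl_algebra n) weyl_mult
     (initial_form (\<lambda>(a, b). expo_weight w b - expo_weight w a) ` I)"

text \<open>The small Groebner fan, represented by its relatively open cones: the classes of directions
  with the same initial ideal. The cones of the fan are their closures, and the interior of a
  full-dimensional cone is the corresponding open class, on which the initial ideal is constant.\<close>

definition small_groebner_fan :: "nat \<Rightarrow> weyl set \<Rightarrow> real vec set set" where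
  "small_groebner_fan n I =
     {{w' \<in> carrier_vec n. weyl_initial_ideal n w' I = weyl_initial_ideal n w I} | w.
       w \<in> carrier_vec n}"

definition weight_interior :: "nat \<Rightarrow> real vec set \<Rightarrow> real vec set" where
  "weight_interior n C = {w \<in> carrier_vec n. \<exists>\<epsilon>>0. \<forall>w'\<in>carrier_vec n.
     (\<forall>j<n. \<bar>w' $ j - w $ j\<bar> < \<epsilon>) \<longrightarrow> w' \<in> C}"

definition generic_direction :: "int mat \<Rightarrow> complex vec \<Rightarrow> real vec \<Rightarrow> bool" where
  "generic_direction A \<beta> w \<longleftrightarrow> w \<in> carrier_vec (dim_col A) \<and>
     monomial_ideal (dim_col A) (initial_ideal (dim_col A) w (toric_ideal A)) \<and>
     (\<exists>C\<in>small_groebner_fan (dim_col A) (hypergeometric_ideal A \<beta>).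
        w \<in> weight_interior (dim_col A) C)"

definition weight_pairing :: "real vec \<Rightarrow> int vec \<Rightarrow> real" where
  "weight_pairing w u = w \<bullet> map_vec real_of_int u"

definition falling :: "complex vec \<Rightarrow> expo \<Rightarrow> complex" where
  "falling z p = (\<Prod>j<dim_vec z. \<Prod>k<Poly_Mapping.lookup p j. z $ j - of_nat k)"

definition fake_exponent :: "int mat \<Rightarrow> complex vec \<Rightarrow> real vec \<Rightarrow> complex vec \<Rightarrow> bool" where
  "fake_exponent A \<beta> w v \<longleftrightarrow> v \<in> carrier_vec (dim_col A) \<and>
     map_mat complex_of_int A *\<^sub>v v = \<beta> \<and>
     (\<forall>p\<in>expos (dim_col A).
        pmonom p \<in> initial_ideal (dim_col A) w (toric_ideal A) \<longrightarrow> falling v p = 0)"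

section \<open>Negative supports\<close>

definition nsupp :: "complex vec \<Rightarrow> nat set" where
  "nsupp z = {j. j < dim_vec z \<and> z $ j \<in> \<int> \<and> Re (z $ j) < 0}"

definition nsupp_shift :: "complex vec \<Rightarrow> int vec \<Rightarrow> nat set" where
  "nsupp_shift v u = nsupp (v + map_vec complex_of_int u)"

definition all_nsupps :: "int mat \<Rightarrow> complex vec \<Rightarrow> nat set set" where
  "all_nsupps A v = nsupp_shift v ` ker_lattice A"

definition weight_minimal_nsupps :: "int mat \<Rightarrow> real vec \<Rightarrow> complex vec \<Rightarrow> nat set set" where
  "weight_minimal_nsupps A w v = {I \<in> all_nsupps A v.
     \<forall>u\<in>ker_lattice A. nsupp_shift v u = I \<longrightarrow> weight_pairing w u \<ge> 0}"

definition negative_support_family ::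
    "int mat \<Rightarrow> real vec \<Rightarrow> complex vec \<Rightarrow> nat set set \<Rightarrow> bool" where
  "negative_support_family A w v \<N> \<longleftrightarrow> nsupp v \<in> \<N> \<and> \<N> \<subseteq> weight_minimal_nsupps A w v"

definition ordered_family :: "int mat \<Rightarrow> complex vec \<Rightarrow> nat set set \<Rightarrow> bool" where
  "ordered_family A v \<N> \<longleftrightarrow> (\<forall>I\<in>\<N>. \<forall>J\<in>all_nsupps A v. J \<subseteq> I \<longrightarrow> J \<in> \<N>)"

abbreviation core :: "nat set set \<Rightarrow> nat set" where
  "core \<N> \<equiv> \<Inter>\<N>"

definition M_supports :: "nat set set \<Rightarrow> nat set set" where
  "M_supports \<N> = (\<lambda>I. I - core \<N>) ` \<N>"

definition P_supports :: "int mat \<Rightarrow> complex vec \<Rightarrow> nat set set \<Rightarrow> nat set set" where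
  "P_supports A v \<N> = {(I \<union> J) - core \<N> | I J. I \<in> \<N> \<and> J \<in> all_nsupps A v - \<N>}"

section \<open>The obstruction module\<close>

definition tvar :: "nat \<Rightarrow> mfps" where
  "tvar j = mfps_of_poly (pvar j)"

definition tmonom :: "nat set \<Rightarrow> mfps" where
  "tmonom J = (\<Prod>j\<in>J. tvar j)"

definition e_monom :: "complex vec \<Rightarrow> nat set set \<Rightarrow> mfps" where
  "e_monom v \<N> = tmonom (nsupp v - core \<N>)"

definition U_ideal :: "int mat \<Rightarrow> mfps set" where
  "U_ideal A = gen_ideal (mfps_ring (dim_col A))
     ((\<lambda>i. \<Sum>j<dim_col A. of_int (A $$ (i, j)) * tvar j) ` {..<dim_row A})"

definition M_ideal :: "int mat \<Rightarrow> nat set set \<Rightarrow> mfps set" where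
  "M_ideal A \<N> = gen_ideal (mfps_ring (dim_col A)) (tmonom ` M_supports \<N>)"

definition P_ideal :: "int mat \<Rightarrow> complex vec \<Rightarrow> nat set set \<Rightarrow> mfps set" where
  "P_ideal A v \<N> = gen_ideal (mfps_ring (dim_col A)) (tmonom ` P_supports A v \<N>)"

definition Q_ideal :: "int mat \<Rightarrow> complex vec \<Rightarrow> nat set set \<Rightarrow> mfps set" where
  "Q_ideal A v \<N> = ideal_plus
     (ideal_times (mfps_ring (dim_col A)) (U_ideal A) (M_ideal A \<N>)) (P_ideal A v \<N>)"

text \<open>The obstruction module is the quotient of the ideal \<open>D_num\<close> by the ideal \<open>D_den\<close>.\<close>

definition D_num :: "int mat \<Rightarrow> complex vec \<Rightarrow> nat set set \<Rightarrow> mfps set" where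
  "D_num A v \<N> =
     colon (mfps_ring (dim_col A)) (ideal_plus (U_ideal A) (P_ideal A v \<N>)) (e_monom v \<N>)"

definition D_den :: "int mat \<Rightarrow> complex vec \<Rightarrow> nat set set \<Rightarrow> mfps set" where
  "D_den A v \<N> = colon (mfps_ring (dim_col A)) (Q_ideal A v \<N>) (e_monom v \<N>)"

definition ell :: "int mat \<Rightarrow> nat \<Rightarrow> cpoly" where
  "ell B j = (\<Sum>k<dim_col B. of_int (B $$ (j, k)) * pvar k)"

definition ell_prod :: "int mat \<Rightarrow> nat set \<Rightarrow> cpoly" where
  "ell_prod B Y = (\<Prod>j\<in>Y. ell B j)"

text \<open>Substitution of \<open>ell B j\<close> for \<open>t\<^sub>j\<close>. As \<open>ell B j\<close> is a linear form, only the finitely many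
  exponents \<open>m\<close> of degree \<open>|k|\<close> contribute to the coefficient at \<open>k\<close>.\<close>

definition gale_subst :: "int mat \<Rightarrow> mfps \<Rightarrow> mfps" where
  "gale_subst B f = Abs_mfps (\<lambda>k. \<Sum>m\<in>{m \<in> expos (dim_row B). mdeg m = mdeg k}.
     mcoeff f m *
       Poly_Mapping.lookup (\<Prod>j<dim_row B. ell B j ^ Poly_Mapping.lookup m j) k)"

definition Pi_ideal :: "int mat \<Rightarrow> int mat \<Rightarrow> complex vec \<Rightarrow> nat set set \<Rightarrow> mfps set" where
  "Pi_ideal A B v \<N> = gale_subst B ` P_ideal A v \<N>"

section \<open>The graded model of the obstruction module\<close>

definition min_sets :: "nat set set \<Rightarrow> nat set set" where
  "min_sets F = {X \<in> F. \<forall>Y\<in>F. Y \<subseteq> X \<longrightarrow> Y = X}"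

text \<open>The free module \<open>F\<close> has a basis indexed by the minimal sets \<open>G\<^sub>i\<close> themselves. Its grading is
  not needed to form annihilators and is omitted.\<close>

type_synonym free_elem = "nat set \<Rightarrow>\<^sub>0 cpoly"

definition fscale :: "cpoly \<Rightarrow> free_elem \<Rightarrow> free_elem" where
  "fscale a x = Poly_Mapping.map (\<lambda>b. a * b) x"

text \<open>Some minimal \<open>G\<^sub>i\<close> contained in \<open>H\<close>; used for \<open>\<iota>(a)\<close> and for the choice of \<open>G\<^sub>i \<subseteq> E\<close>.\<close>

definition some_G :: "nat set set \<Rightarrow> nat set \<Rightarrow> nat set" where
  "some_G \<N> H = (SOME G. G \<in> min_sets (M_supports \<N>) \<and> G \<subseteq> H)"

definition Z_submodule :: "int mat \<Rightarrow> int mat \<Rightarrow> complex vec \<Rightarrow> nat set set \<Rightarrow> free_elem set" where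
  "Z_submodule A B v \<N> = gen_submodule (poly_ring (dim_col B)) fscale
     ({Poly_Mapping.single G (ell_prod B (G' - G)) - Poly_Mapping.single G' (ell_prod B (G - G'))
        | G G'. G \<in> min_sets (M_supports \<N>) \<and> G' \<in> min_sets (M_supports \<N>) \<and> G \<noteq> G'} \<union>
      {Poly_Mapping.single (some_G \<N> H) (ell_prod B (H - some_G \<N> H))
        | H. H \<in> min_sets (P_supports A v \<N>)})"

definition eps_elem :: "int mat \<Rightarrow> complex vec \<Rightarrow> nat set set \<Rightarrow> free_elem" where
  "eps_elem B v \<N> = (let E = nsupp v - core \<N>; G = some_G \<N> E in
     Poly_Mapping.single G (ell_prod B (E - G)))"

definition J_amb :: "int mat \<Rightarrow> int mat \<Rightarrow> complex vec \<Rightarrow> nat set set \<Rightarrow> cpoly set" where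
  "J_amb A B v \<N> =
     {a \<in> poly_ring (dim_col B). fscale a (eps_elem B v \<N>) \<in> Z_submodule A B v \<N>}"

definition J_intr :: "int mat \<Rightarrow> int mat \<Rightarrow> complex vec \<Rightarrow> nat set set \<Rightarrow> cpoly set" where
  "J_intr A B v \<N> = colon (poly_ring (dim_col B))
     (gen_ideal (poly_ring (dim_col B)) (ell_prod B ` min_sets (P_supports A v \<N>)))
     (ell_prod B (nsupp v - core \<N>))"

definition D_hilbert_series ::
    "int mat \<Rightarrow> int mat \<Rightarrow> complex vec \<Rightarrow> nat set set \<Rightarrow> int fps" where
  "D_hilbert_series A B v \<N> = hilbert_series (J_intr A B v \<N>) (J_amb A B v \<N>)"

end

theory Submission
  imports Defs "HOL-Analysis.Continuum_Not_Denumerable"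
begin

text \<open>Everything is explicit. The columns have five types, each occurring \<open>q\<close> times, and a lattice
  vector takes at all columns of one type the value of one linear form. In the coordinates
  \<open>s\<^sub>1, s\<^sub>2\<close> of the lattice the five forms are \<open>\<lambda>\<^sub>3, - \<lambda>\<^sub>1, - \<lambda>\<^sub>3, \<lambda>\<^sub>2, \<lambda>\<^sub>1 - \<lambda>\<^sub>2\<close>. The fake exponent
  is \<open>-1\<close> at the types 0 and 4 and zero elsewhere, and the family consists of two negative supports,
  the columns of types 0 and 4 and the columns of types 2 and 4. Write \<open>T\<^sub>k\<close> for the product of the
  variables of type \<open>k\<close>. After division by the core, the ideal \<open>M\<close> is generated by \<open>T\<^sub>0, T\<^sub>2\<close> and the
  ideal \<open>P\<close> by \<open>T\<^sub>0 T\<^sub>3, T\<^sub>1 T\<^sub>2\<close>, and \<open>e = T\<^sub>0\<close>.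

  The obstruction comes from the pair of forms \<open>\<lambda>\<^sub>3, - \<lambda>\<^sub>3\<close>: the monomials \<open>T\<^sub>0\<close> and \<open>T\<^sub>2\<close> are coprime,
  but up to sign both are sent to \<open>\<lambda>\<^sub>3\<^sup>q\<close>. Modulo \<open>U + P\<close> only the images matter; the factor \<open>\<lambda>\<^sub>3\<^sup>q\<close>
  cancels, and \<open>f e\<close> belongs to \<open>U + P\<close> if and only if the image of \<open>f\<close> lies in
  \<open>\<langle>\<lambda>\<^sub>1\<^sup>q, \<lambda>\<^sub>2\<^sup>q\<rangle>\<close> (\<open>D_num_eq\<close>). In \<open>U M + P\<close> the two monomials are kept apart: by coprimality the
  coefficient of \<open>T\<^sub>1 T\<^sub>2\<close> must be compensated by a multiple of \<open>T\<^sub>0\<close>, so that its image is divisible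
  by \<open>\<lambda>\<^sub>3\<^sup>q\<close>, and the image of \<open>f\<close> lies in \<open>\<langle>\<lambda>\<^sub>2\<^sup>q, \<lambda>\<^sub>1\<^sup>q \<lambda>\<^sub>3\<^sup>q\<rangle>\<close> (\<open>D_den_eq\<close>). Multiplication by
  \<open>\<lambda>\<^sub>1\<^sup>q\<close> identifies the quotient by \<open>\<langle>\<lambda>\<^sub>2\<^sup>q, \<lambda>\<^sub>3\<^sup>q\<rangle>\<close>, shifted by \<open>q\<close>, with the quotient of these two
  ideals; the products \<open>\<lambda>\<^sub>2\<^sup>i \<lambda>\<^sub>3\<^sup>j\<close> with \<open>i, j < q\<close> are a basis, which gives the Hilbert series. The
  graded model is computed in the same way (\<open>J_intr_eq\<close>, \<open>J_amb_eq\<close>). It uses nothing but the pairwise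
  independence of three forms, and therefore holds for every Gale dual.

  Power series are treated as sequences of homogeneous polynomials. Ideals with homogeneous generators
  and coprimality pass from polynomials to series degree by degree (\<open>gen_ideal_series_iff\<close>,
  \<open>series_coprime\<close>), and so does the computation of the kernel of \<open>\<Phi>\<close>, which is \<open>U\<close> (\<open>\<Phi>_kernel\<close>).

  The direction has to meet two kinds of conditions. Two linear inequalities place it in an open cone
  in which the reduced Groebner basis of the toric ideal is given by three lattice vectors, one of them
  the sum of the other two, which form a lattice basis; hence the semigroup is free. Besides, it has to
  lie in an open cone of the small Groebner fan of the hypergeometric ideal. No computation with that
  ideal is made: the union of these open cones is dense for every left ideal of the Weyl algebra, with
  rationally independent directions (\<open>groebner_fan_interior_dense\<close>).\<close>

abbreviation "lookup \<equiv> Poly_Mapping.lookup"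
abbreviation "keys \<equiv> Poly_Mapping.keys"
abbreviation "single \<equiv> Poly_Mapping.single"

section \<open>Directions with rationally independent entries\<close>

text \<open>The entries are chosen one after another. The values of the next entry that satisfy a rational
  relation with the previous ones are countable in number, and an interval is uncountable.\<close>

lemma rationally_independent_near:
  fixes x :: "nat \<Rightarrow> real"
  assumes "\<epsilon> > 0"
  shows "\<exists>y. (\<forall>j<n. \<bar>y j - x j\<bar> < \<epsilon>) \<and>
    (\<forall>u :: nat \<Rightarrow> int. (\<Sum>j<n. of_int (u j) * y j) = 0 \<longrightarrow> (\<forall>j<n. u j = 0))"
proof (induction n)
  case 0
  then show ?case by auto
next
  case (Suc n)
  then obtain y where near: "\<And>j. j < n \<Longrightarrow> \<bar>y j - x j\<bar> < \<epsilon>"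
    and ind: "\<And>u :: nat \<Rightarrow> int. (\<Sum>j<n. of_int (u j) * y j) = 0 \<Longrightarrow> (\<forall>j<n. u j = 0)" by blast
  let ?val = "\<lambda>(us, k). - (\<Sum>j<n. of_int (us ! j) * y j) / of_int k"
  have "countable (?val ` (UNIV :: (int list \<times> int) set))" by simp
  moreover have "uncountable {x n - \<epsilon><..<x n + \<epsilon>}"
    using assms by (simp add: uncountable_open_interval)
  ultimately obtain t where t: "t \<in> {x n - \<epsilon><..<x n + \<epsilon>}"
    and notin: "t \<notin> ?val ` (UNIV :: (int list \<times> int) set)"
    by (meson countable_subset subsetI)
  let ?y = "y(n := t)"
  have "\<forall>j<Suc n. u j = 0" if "(\<Sum>j<Suc n. of_int (u j) * ?y j) = 0" for u :: "nat \<Rightarrow> int"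
  proof -
    have "(\<Sum>j<n. of_int (u j) * ?y j) = (\<Sum>j<n. of_int (u j) * y j)"
      by (rule sum.cong) auto
    then have eq: "(\<Sum>j<n. of_int (u j) * y j) + of_int (u n) * t = 0" using that by simp
    have un: "u n = 0"
    proof (rule ccontr)
      assume "u n \<noteq> 0"
      have "(\<Sum>j<n. of_int (map u [0..<n] ! j) * y j) = (\<Sum>j<n. of_int (u j) * y j)"
        by (rule sum.cong) auto
      with \<open>u n \<noteq> 0\<close> eq have "t = ?val (map u [0..<n], u n)"
        by (simp add: field_simps)
      with notin show False by blast
    qed
    have "(\<Sum>j<n. of_int (u j) * y j) = 0" using eq un by simp
    then have "\<forall>j<n. u j = 0" by (rule ind)
    then show ?thesis using un by (simp add: less_Suc_eq)
  qed
  moreover have "\<bar>?y j - x j\<bar> < \<epsilon>" if "j < Suc n" for j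
  proof (cases "j = n")
    case True
    with t show ?thesis by (simp add: abs_less_iff)
  next
    case False
    with that near[of j] show ?thesis by simp
  qed
  ultimately show ?case by blast
qed

definition rat_indep :: "real vec \<Rightarrow> bool" where
  "rat_indep w \<longleftrightarrow>
     (\<forall>u :: nat \<Rightarrow> int. (\<Sum>j<dim_vec w. of_int (u j) * w $ j) = 0 \<longrightarrow> (\<forall>j<dim_vec w. u j = 0))"

lemma rat_indep_near:
  fixes x :: "real vec"
  assumes "\<epsilon> > 0" and "x \<in> carrier_vec n"
  obtains y where "y \<in> carrier_vec n" "rat_indep y" "\<And>j. j < n \<Longrightarrow> \<bar>y $ j - x $ j\<bar> < \<epsilon>"
proof -
  obtain y where "\<forall>j<n. \<bar>y j - x $ j\<bar> < \<epsilon>"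
    and "\<forall>u :: nat \<Rightarrow> int. (\<Sum>j<n. of_int (u j) * y j) = 0 \<longrightarrow> (\<forall>j<n. u j = 0)"
    using rationally_independent_near[OF assms(1), of n "\<lambda>j. x $ j"] by blast
  then show ?thesis
    by (intro that[of "vec n y"]) (auto simp: rat_indep_def)
qed

section \<open>Exponents and initial forms\<close>

lemma expos_iff: "m \<in> expos n \<longleftrightarrow> (\<forall>j. lookup m j \<noteq> 0 \<longrightarrow> j < n)"
  unfolding expos_def by (auto simp del: lookup_not_eq_zero_eq_in_keys simp: in_keys_iff subset_iff)

lemma lookup_outside: "m \<in> expos n \<Longrightarrow> \<not> j < n \<Longrightarrow> lookup m j = 0"
  unfolding expos_iff by blast

lemma zero_in_expos [simp]: "0 \<in> expos n"
  by (simp add: expos_iff)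

lemma expos_add: "a \<in> expos n \<Longrightarrow> b \<in> expos n \<Longrightarrow> a + b \<in> expos n"
  by (auto simp: expos_iff lookup_add)

lemma expos_minus: "a \<in> expos n \<Longrightarrow> a - b \<in> expos n"
  by (auto simp: expos_iff lookup_minus)

lemma expos_add_iff: "a + b \<in> expos n \<longleftrightarrow> a \<in> expos n \<and> b \<in> expos n"
  by (auto simp: expos_iff lookup_add)

lemma expos_eqI:
  assumes "a \<in> expos n" "b \<in> expos n" "\<And>j. j < n \<Longrightarrow> lookup a j = lookup b j"
  shows "a = b"
proof (rule poly_mapping_eqI)
  fix j
  show "lookup a j = lookup b j"
    using assms(3)[of j] lookup_outside[OF assms(1)] lookup_outside[OF assms(2)]
    by (cases "j < n") auto
qed

lemma finite_bounded_expos: "finite {m \<in> expos n. \<forall>j<n. lookup m j \<le> K}"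
proof -
  let ?S = "{m \<in> expos n. \<forall>j<n. lookup m j \<le> K}"
  let ?r = "\<lambda>m. restrict (lookup m) {..<n}"
  have "?r ` ?S \<subseteq> PiE {..<n} (\<lambda>_. {..K})" by (auto simp: PiE_iff split: if_splits)
  then have "finite (?r ` ?S)" by (rule finite_subset) (auto intro: finite_PiE)
  moreover have "inj_on ?r ?S"
    proof (rule inj_onI, rule expos_eqI[where n = n])
    fix a b j assume eq: "?r a = ?r b" and j: "j < n"
    show "lookup a j = lookup b j"
      using fun_cong[OF eq, of j] j by simp
  qed auto
  ultimately show ?thesis by (rule finite_imageD)
qed

lemma expo_weight_add: "expo_weight w (a + b) = expo_weight w a + expo_weight w b"
  by (simp add: expo_weight_def lookup_add algebra_simps sum.distrib)

lemma expo_weight_minus: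
  assumes "\<And>j. lookup b j \<le> lookup a j"
  shows "expo_weight w (a - b) = expo_weight w a - expo_weight w b"
  using assms by (simp add: expo_weight_def lookup_minus of_nat_diff algebra_simps sum_subtractf)

lemma expo_weight_zero [simp]: "expo_weight w 0 = 0"
  by (simp add: expo_weight_def)

lemma expo_weight_inj:
  assumes "rat_indep w" "w \<in> carrier_vec n" "a \<in> expos n" "b \<in> expos n"
    and "expo_weight w a = expo_weight w b"
  shows "a = b"
proof (rule expos_eqI[OF assms(3,4)])
  let ?u = "\<lambda>j. int (lookup a j) - int (lookup b j)"
  have "(\<Sum>j<dim_vec w. of_int (?u j) * w $ j) = expo_weight w a - expo_weight w b"
    by (simp add: expo_weight_def algebra_simps sum_subtractf)
  then show "lookup a j = lookup b j" if "j < n" for j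
    using assms that unfolding rat_indep_def by (auto dest!: spec[of _ ?u])
qed

definition restrict_keys :: "'k set \<Rightarrow> ('k \<Rightarrow>\<^sub>0 complex) \<Rightarrow> ('k \<Rightarrow>\<^sub>0 complex)" where
  "restrict_keys S f = (\<Sum>m\<in>keys f \<inter> S. single m (lookup f m))"

lemma lookup_restrict_keys:
  "lookup (restrict_keys S f) m = (if m \<in> S then lookup f m else 0)"
proof -
  have "lookup (restrict_keys S f) m
      = (\<Sum>m'\<in>keys f \<inter> S. if m' = m then lookup f m else 0)"
    unfolding restrict_keys_def lookup_sum by (rule sum.cong) (auto simp: lookup_single when_def)
  then show ?thesis by (auto simp: sum.delta in_keys_iff)
qed

lemma keys_restrict_keys: "keys (restrict_keys S f) = keys f \<inter> S"
  by (auto simp: in_keys_iff lookup_restrict_keys split: if_splits)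

lemma restrict_keys_add: "restrict_keys S (f + g) = restrict_keys S f + restrict_keys S g"
  by (rule poly_mapping_eqI) (simp add: lookup_restrict_keys lookup_add)

lemma restrict_keys_split: "f = restrict_keys S f + restrict_keys (- S) f"
  by (rule poly_mapping_eqI) (simp add: lookup_restrict_keys lookup_add)

lemma restrict_keys_eq_0: "(\<And>m. m \<in> keys f \<Longrightarrow> m \<notin> S) \<Longrightarrow> restrict_keys S f = 0"
  by (rule poly_mapping_eqI) (auto simp: lookup_restrict_keys in_keys_iff)

lemma restrict_keys_id: "(\<And>m. m \<in> keys f \<Longrightarrow> m \<in> S) \<Longrightarrow> restrict_keys S f = f"
  by (rule poly_mapping_eqI) (auto simp: lookup_restrict_keys in_keys_iff)

lemma initial_form_restrict_keys:
  "initial_form \<omega> f = restrict_keys {m. \<forall>m'\<in>keys f. \<omega> m' \<le> \<omega> m} f"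
  unfolding initial_form_def restrict_keys_def by (rule sum.cong) auto

lemma initial_form_eqI:
  assumes "Q \<noteq> 0" "\<And>m. m \<in> keys Q \<Longrightarrow> \<omega> m = \<delta>" "\<And>m. m \<in> keys R \<Longrightarrow> \<omega> m < \<delta>"
  shows "initial_form \<omega> (Q + R) = Q"
proof -
  obtain m0 where m0: "m0 \<in> keys Q" using assms(1) by (metis ex_in_conv keys_eq_empty)
  have disj: "lookup R m = 0" if "lookup Q m \<noteq> 0" for m
    using that assms(2)[of m] assms(3)[of m] by (auto simp: in_keys_iff)
  have keys: "keys (Q + R) = keys Q \<union> keys R" (is "?L = ?R")
  proof (rule Set.set_eqI)
    fix m
    show "m \<in> ?L \<longleftrightarrow> m \<in> ?R"
      using disj[of m] by (cases "lookup Q m = 0") (auto simp: in_keys_iff lookup_add)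
  qed
  have "(\<forall>m'\<in>keys (Q + R). \<omega> m' \<le> \<omega> m) \<longleftrightarrow> \<delta> \<le> \<omega> m" for m
    using m0 assms(2,3) unfolding keys by force
  then have "initial_form \<omega> (Q + R) = restrict_keys {m. \<delta> \<le> \<omega> m} (Q + R)"
    by (simp add: initial_form_restrict_keys)
  also have "\<dots> = restrict_keys {m. \<delta> \<le> \<omega> m} Q + restrict_keys {m. \<delta> \<le> \<omega> m} R"
    by (rule restrict_keys_add)
  also have "\<dots> = Q"
    using assms(2,3) by (subst restrict_keys_id, force, subst restrict_keys_eq_0) force+
  finally show ?thesis .
qed

lemma initial_form_decomp:
  assumes "P \<noteq> 0"
  obtains \<delta> R where "P = initial_form \<omega> P + R" "initial_form \<omega> P \<noteq> 0"
    "\<And>m. m \<in> keys (initial_form \<omega> P) \<Longrightarrow> \<omega> m = \<delta>" "\<And>m. m \<in> keys R \<Longrightarrow> \<omega> m < \<delta>"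
    "keys (initial_form \<omega> P) \<subseteq> keys P" "keys R \<subseteq> keys P"
proof -
  let ?M = "\<omega> ` keys P"
  have ne: "?M \<noteq> {}" "finite ?M" using assms by auto
  define \<delta> where "\<delta> = Max ?M"
  define R where "R = restrict_keys (- {m. \<forall>m'\<in>keys P. \<omega> m' \<le> \<omega> m}) P"
  have le: "\<omega> m \<le> \<delta>" if "m \<in> keys P" for m using that ne by (simp add: \<delta>_def)
  obtain m0 where m0: "m0 \<in> keys P" "\<omega> m0 = \<delta>"
    using Max_in[OF ne(2,1)] by (auto simp: \<delta>_def)
  show ?thesis
  proof (rule that[of R \<delta>])
    show "P = initial_form \<omega> P + R"
      unfolding initial_form_restrict_keys R_def by (rule restrict_keys_split)
    have "m0 \<in> keys (initial_form \<omega> P)"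
      using m0 le by (simp add: initial_form_restrict_keys keys_restrict_keys)
    then show "initial_form \<omega> P \<noteq> 0" by auto
    show "\<omega> m = \<delta>" if "m \<in> keys (initial_form \<omega> P)" for m
      using that m0 le by (force simp: initial_form_restrict_keys keys_restrict_keys)
    show "\<omega> m < \<delta>" if "m \<in> keys R" for m
      using that m0 le by (force simp: R_def keys_restrict_keys)
    show "keys (initial_form \<omega> P) \<subseteq> keys P"
      by (simp add: initial_form_restrict_keys keys_restrict_keys)
    show "keys R \<subseteq> keys P"
      by (simp add: R_def keys_restrict_keys)
  qed
qed

lemma initial_form_zero [simp]: "initial_form \<omega> 0 = 0"
  by (simp add: initial_form_def)

section \<open>Dickson's lemma\<close>

text \<open>Induction on the number of coordinates: a finite cover for the first coordinates alone covers all
  elements whose last coordinate is large.\<close>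

lemma dickson:
  fixes S :: "(nat \<Rightarrow> nat) set"
  shows "\<exists>F\<subseteq>S. finite F \<and> (\<forall>s\<in>S. \<exists>f\<in>F. \<forall>j<N. f j \<le> s j)"
proof (induction N arbitrary: S)
  case 0
  show ?case
  proof (cases "S = {}")
    case False
    then obtain s where "s \<in> S" by blast
    then show ?thesis by (intro exI[of _ "{s}"]) auto
  qed auto
next
  case (Suc N)
  obtain F0 where F0: "F0 \<subseteq> S" "finite F0" "\<And>s. s \<in> S \<Longrightarrow> \<exists>f\<in>F0. \<forall>j<N. f j \<le> s j"
    using Suc.IH[of S] by blast
  have "\<forall>k. \<exists>F\<subseteq>{s \<in> S. s N = k}. finite F \<and> (\<forall>s\<in>{s \<in> S. s N = k}. \<exists>f\<in>F. \<forall>j<N. f j \<le> s j)"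
    using Suc.IH by (intro allI)
  from choice[OF this] obtain F1 where "\<forall>k. F1 k \<subseteq> {s \<in> S. s N = k} \<and> finite (F1 k) \<and>
      (\<forall>s\<in>{s \<in> S. s N = k}. \<exists>f\<in>F1 k. \<forall>j<N. f j \<le> s j)" ..
  then have F1: "\<And>k. F1 k \<subseteq> {s \<in> S. s N = k}" "\<And>k. finite (F1 k)"
      "\<And>k s. s \<in> S \<Longrightarrow> s N = k \<Longrightarrow> \<exists>f\<in>F1 k. \<forall>j<N. f j \<le> s j"
    by simp_all
  \<comment> \<open>Beyond the last coordinates occurring in \<open>F0\<close> the first cover suffices; the finitely many
    smaller values of the last coordinate are covered one by one.\<close>
  define b where "b = (\<Sum>f\<in>F0. f N)"
  have b: "f N \<le> b" if "f \<in> F0" for f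
    unfolding b_def using that F0(2) by (intro member_le_sum[of f F0 "\<lambda>f. f N"]) simp_all
  let ?F = "F0 \<union> (\<Union>k\<le>b. F1 k)"
  have "\<exists>f\<in>?F. \<forall>j<Suc N. f j \<le> s j" if s: "s \<in> S" for s
  proof (cases "s N \<le> b")
    case True
    obtain f where f: "f \<in> F1 (s N)" "\<forall>j<N. f j \<le> s j" using F1(3)[OF s refl] by blast
    then have "f N = s N" using F1(1) by blast
    with f True show ?thesis by (intro bexI[of _ f]) (auto simp: less_Suc_eq)
  next
    case False
    obtain f where f: "f \<in> F0" "\<forall>j<N. f j \<le> s j" using F0(3)[OF s] by blast
    with b[OF f(1)] False show ?thesis by (intro bexI[of _ f]) (auto simp: less_Suc_eq)
  qed
  moreover have "?F \<subseteq> S" using F0(1) F1(1) by blast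
  moreover have "finite ?F" using F0(2) F1(2) by simp
  ultimately show ?case by blast
qed

lemma dickson_expos:
  assumes "\<Lambda> \<subseteq> expos n \<times> expos n"
  obtains F where "F \<subseteq> \<Lambda>" "finite F"
    "\<And>a b. (a, b) \<in> \<Lambda> \<Longrightarrow> \<exists>c d. (c, d) \<in> F \<and> (\<forall>j. lookup c j \<le> lookup a j) \<and>
       (\<forall>j. lookup d j \<le> lookup b j)"
proof -
  let ?e = "\<lambda>(a, b) j. if j < n then lookup a j else lookup b (j - n)"
  obtain F where F: "F \<subseteq> ?e ` \<Lambda>" "finite F" "\<And>s. s \<in> ?e ` \<Lambda> \<Longrightarrow> \<exists>f\<in>F. \<forall>j<n + n. f j \<le> s j"
    using dickson[of "?e ` \<Lambda>" "n + n"] by blast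
  obtain F' where F': "F' \<subseteq> \<Lambda>" "finite F'" "F = ?e ` F'"
    using finite_subset_image[OF F(2,1)] by blast
  show ?thesis
  proof (rule that[OF F'(1,2)])
    fix a b assume ab: "(a, b) \<in> \<Lambda>"
    have "?e (a, b) \<in> ?e ` \<Lambda>" using ab by (rule imageI)
    from F(3)[OF this] obtain f where f: "f \<in> F" "\<forall>j<n + n. f j \<le> ?e (a, b) j" by blast
    obtain p where p: "p \<in> F'" "f = ?e p" using f(1) F'(3) by blast
    obtain c d where p_eq: "p = (c, d)" by fastforce
    have cd: "(c, d) \<in> F'" and le: "\<forall>j<n + n. ?e (c, d) j \<le> ?e (a, b) j"
      using p f(2) unfolding p_eq by simp_all
    have "(c, d) \<in> expos n \<times> expos n" using cd F'(1) assms by (meson subsetD)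
    then have cd': "c \<in> expos n" "d \<in> expos n" by simp_all
    have "lookup c j \<le> lookup a j" for j
      using le[rule_format, of j] lookup_outside[OF cd'(1), of j] by (cases "j < n") auto
    moreover have "lookup d j \<le> lookup b j" for j
      using le[rule_format, of "n + j"] lookup_outside[OF cd'(2), of j] by (cases "j < n") auto
    ultimately show "\<exists>c d. (c, d) \<in> F' \<and> (\<forall>j. lookup c j \<le> lookup a j) \<and>
       (\<forall>j. lookup d j \<le> lookup b j)"
      using cd by blast
  qed
qed

section \<open>Left ideals of the Weyl algebra\<close>

text \<open>Leibniz' formula for the product of the monomials with exponents \<open>p\<close> and \<open>r\<close>, of which the
  product of the Weyl algebra is the bilinear extension.\<close>

definition weyl_term :: "expo \<times> expo \<Rightarrow> expo \<times> expo \<Rightarrow> complex \<Rightarrow> weyl" where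
  "weyl_term p r \<kappa> = (\<Sum>k\<in>common_lower (snd p) (fst r).
     single (fst p + (fst r - k), (snd p - k) + snd r)
       (\<kappa> * of_nat (leibniz_coeff (snd p) (fst r) k)))"

lemma weyl_term_zero [simp]: "weyl_term p r 0 = 0"
  by (simp add: weyl_term_def)

lemma weyl_term_add: "weyl_term p r (c + d) = weyl_term p r c + weyl_term p r d"
  by (simp add: weyl_term_def distrib_right single_add sum.distrib)

lemma weyl_mult_terms: "weyl_mult P Q = (\<Sum>p\<in>keys P. \<Sum>r\<in>keys Q.
    weyl_term p r (lookup P p * lookup Q r))"
  unfolding weyl_mult_def weyl_term_def by (simp add: case_prod_unfold)

lemma weyl_mult_on:
  assumes "finite S" "keys P \<subseteq> S" "finite T" "keys Q \<subseteq> T"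
  shows "weyl_mult P Q = (\<Sum>p\<in>S. \<Sum>r\<in>T. weyl_term p r (lookup P p * lookup Q r))"
proof -
  have "weyl_mult P Q = (\<Sum>p\<in>keys P. \<Sum>r\<in>T.
      weyl_term p r (lookup P p * lookup Q r))"
    unfolding weyl_mult_terms
    by (rule sum.cong[OF refl], rule sum.mono_neutral_left) (use assms in \<open>auto simp: in_keys_iff\<close>)
  also have "\<dots> = (\<Sum>p\<in>S. \<Sum>r\<in>T. weyl_term p r (lookup P p * lookup Q r))"
    by (rule sum.mono_neutral_left) (use assms in \<open>auto simp: in_keys_iff\<close>)
  finally show ?thesis .
qed

lemma weyl_mult_add_left: "weyl_mult (P + P') Q = weyl_mult P Q + weyl_mult P' Q"
proof -
  let ?S = "keys P \<union> keys P'" and ?T = "keys Q"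
  have "keys (P + P') \<subseteq> ?S" by (rule Poly_Mapping.keys_add)
  then show ?thesis
    by (subst (1 2 3) weyl_mult_on[of ?S _ ?T])
      (auto simp: lookup_add distrib_right weyl_term_add sum.distrib)
qed

lemma weyl_mult_add_right: "weyl_mult P (Q + Q') = weyl_mult P Q + weyl_mult P Q'"
proof -
  let ?T = "keys Q \<union> keys Q'" and ?S = "keys P"
  have "keys (Q + Q') \<subseteq> ?T" by (rule Poly_Mapping.keys_add)
  then show ?thesis
    by (subst (1 2 3) weyl_mult_on[of ?S _ ?T])
      (auto simp: lookup_add distrib_left weyl_term_add sum.distrib)
qed

lemma weyl_mult_zero_left [simp]: "weyl_mult 0 Q = 0"
  by (simp add: weyl_mult_terms)

lemma weyl_mult_zero_right [simp]: "weyl_mult P 0 = 0"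
  by (simp add: weyl_mult_terms)

lemma weyl_mult_sum_left: "weyl_mult (sum f A) Q = (\<Sum>x\<in>A. weyl_mult (f x) Q)"
  by (induction A rule: infinite_finite_induct) (simp_all add: weyl_mult_add_left)

lemma weyl_mult_single: "weyl_mult (single p c) (single r d) = weyl_term p r (c * d)"
  by (subst weyl_mult_on[of "{p}" _ "{r}"]) auto

lemma poly_mapping_sum_single: "f = (\<Sum>m\<in>keys f. single m (lookup f m))"
proof (rule poly_mapping_eqI)
  fix k
  have "(\<Sum>m\<in>keys f. lookup (single m (lookup f m)) k)
      = (\<Sum>m\<in>keys f. if m = k then lookup f k else 0)"
    by (rule sum.cong) (auto simp: lookup_single when_def)
  then show "lookup f k = lookup
      (\<Sum>m\<in>keys f. single m (lookup f m)) k"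
    by (simp add: lookup_sum sum.delta in_keys_iff)
qed

lemma finite_common_lower: "finite (common_lower b c)"
proof (rule finite_subset)
  show "common_lower b c \<subseteq> fst ` splits b"
  proof
    fix k assume "k \<in> common_lower b c"
    then have "k + (b - k) = b"
      by (intro poly_mapping_eqI) (simp add: common_lower_def lookup_add lookup_minus)
    then have "(k, b - k) \<in> splits b" by (simp add: splits_def)
    then show "k \<in> fst ` splits b" by force
  qed
  show "finite (fst ` splits b)" by (simp add: finite_splits)
qed

lemma keys_weyl_term:
  "keys (weyl_term p r \<kappa>) \<subseteq>
     (\<lambda>k. (fst p + (fst r - k), (snd p - k) + snd r)) ` common_lower (snd p) (fst r)"
  unfolding weyl_term_def by (rule order_trans[OF keys_sum]) (auto split: if_splits)

lemma keys_weyl_mult: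
  assumes "m \<in> keys (weyl_mult P Q)"
  obtains p r k where "p \<in> keys P" "r \<in> keys Q"
    "k \<in> common_lower (snd p) (fst r)" "m = (fst p + (fst r - k), (snd p - k) + snd r)"
proof -
  have "keys (weyl_mult P Q) \<subseteq> (\<Union>p\<in>keys P. \<Union>r\<in>keys Q.
      keys (weyl_term p r (lookup P p * lookup Q r)))"
    unfolding weyl_mult_terms by (rule order_trans[OF keys_sum UN_mono[OF order_refl keys_sum]])
  with assms obtain p r where pr: "p \<in> keys P" "r \<in> keys Q"
    and "m \<in> keys (weyl_term p r (lookup P p * lookup Q r))"
    by blast
  with keys_weyl_term[of p r] have
    "m \<in> (\<lambda>k. (fst p + (fst r - k), (snd p - k) + snd r)) ` common_lower (snd p) (fst r)"
    by (meson subsetD)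
  with pr show ?thesis by (auto intro: that)
qed

definition weyl_weight :: "real vec \<Rightarrow> expo \<times> expo \<Rightarrow> real" where
  "weyl_weight w = (\<lambda>(a, b). expo_weight w b - expo_weight w a)"

text \<open>All terms in Leibniz' formula have the same weight for \<open>(- w, w)\<close>, as \<open>x\<close> and \<open>\<partial>\<close> cancel in pairs.\<close>

lemma weyl_weight_term:
  assumes "k \<in> common_lower (snd p) (fst r)"
  shows "weyl_weight w (fst p + (fst r - k), (snd p - k) + snd r) = weyl_weight w p + weyl_weight w r"
proof -
  have "expo_weight w (fst r - k) = expo_weight w (fst r) - expo_weight w k"
       "expo_weight w (snd p - k) = expo_weight w (snd p) - expo_weight w k"
    using assms by (simp_all add: expo_weight_minus common_lower_def)
  then show ?thesis by (simp add: weyl_weight_def case_prod_unfold expo_weight_add)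
qed

lemma weyl_algebra_add: "P \<in> weyl_algebra n \<Longrightarrow> Q \<in> weyl_algebra n \<Longrightarrow> P + Q \<in> weyl_algebra n"
  unfolding weyl_algebra_def using Poly_Mapping.keys_add[of P Q] by blast

lemma weyl_algebra_mult:
  assumes "P \<in> weyl_algebra n" "Q \<in> weyl_algebra n"
  shows "weyl_mult P Q \<in> weyl_algebra n"
  unfolding weyl_algebra_def
proof (intro CollectI subsetI)
  fix m assume "m \<in> keys (weyl_mult P Q)"
  then obtain p r k where "p \<in> keys P" "r \<in> keys Q"
    and m: "m = (fst p + (fst r - k), (snd p - k) + snd r)" by (rule keys_weyl_mult)
  then have "p \<in> expos n \<times> expos n" "r \<in> expos n \<times> expos n"
    using assms unfolding weyl_algebra_def by blast+
  then show "m \<in> expos n \<times> expos n"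
    unfolding m by (auto intro!: expos_add expos_minus)
qed

lemma weyl_algebra_single: "p \<in> expos n \<times> expos n \<Longrightarrow> single p c \<in> weyl_algebra n"
  by (simp add: weyl_algebra_def)

definition left_ideal :: "nat \<Rightarrow> weyl set \<Rightarrow> bool" where
  "left_ideal n I \<longleftrightarrow> I \<subseteq> weyl_algebra n \<and> 0 \<in> I \<and> (\<forall>x\<in>I. \<forall>y\<in>I. x + y \<in> I) \<and>
     (\<forall>a\<in>weyl_algebra n. \<forall>x\<in>I. weyl_mult a x \<in> I)"

abbreviation gen_left :: "nat \<Rightarrow> weyl set \<Rightarrow> weyl set" where
  "gen_left n S \<equiv> gen_submodule (weyl_algebra n) weyl_mult S"

lemma left_ideal_gen:
  assumes "S \<subseteq> weyl_algebra n"
  shows "left_ideal n (gen_left n S)"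
proof -
  have "x \<in> weyl_algebra n" if "x \<in> gen_left n S" for x
    using that
  proof induction
    case zero
    then show ?case by (simp add: weyl_algebra_def)
  qed (use assms in \<open>auto intro: weyl_algebra_add weyl_algebra_mult\<close>)
  then show ?thesis
    unfolding left_ideal_def by (auto intro: gen_submodule.intros)
qed

lemma gen_submodule_mono:
  assumes "S \<subseteq> gen_submodule R sc T"
  shows "gen_submodule R sc S \<subseteq> gen_submodule R sc T"
proof
  fix x assume "x \<in> gen_submodule R sc S"
  then show "x \<in> gen_submodule R sc T"
    by induction (use assms in \<open>auto intro: gen_submodule.intros\<close>)
qed

lemma left_ideal_contains_gen:
  assumes "left_ideal n I" "S \<subseteq> I"
  shows "gen_left n S \<subseteq> I"
proof
  fix x assume "x \<in> gen_left n S"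
  then show "x \<in> I"
    by induction (use assms in \<open>auto simp: left_ideal_def\<close>)
qed

lemma weyl_mult_minus_one: "weyl_mult (single (0, 0) (- 1)) Q = - Q"
proof -
  have [simp]: "common_lower 0 c = {0}" for c
  proof -
    have "k = 0" if "k \<in> common_lower 0 c" for k
      by (rule poly_mapping_eqI) (use that in \<open>simp add: common_lower_def\<close>)
    moreover have "0 \<in> common_lower 0 c" by (simp add: common_lower_def)
    ultimately show ?thesis by blast
  qed
  have "weyl_mult (single (0, 0) (- 1)) Q
      = (\<Sum>r\<in>keys Q. weyl_term (0, 0) r (- lookup Q r))"
    by (subst weyl_mult_on[of "{(0, 0)}" _ "keys Q"]) auto
  also have "\<dots> = (\<Sum>r\<in>keys Q. - single r (lookup Q r))"
    by (rule sum.cong) (auto simp: weyl_term_def leibniz_coeff_def single_uminus)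
  also have "\<dots> = - Q"
    by (subst (3) poly_mapping_sum_single) (simp add: sum_negf)
  finally show ?thesis .
qed

lemma left_ideal_diff:
  assumes "left_ideal n I" "x \<in> I" "y \<in> I"
  shows "x - y \<in> I"
proof -
  have "single (0, 0) (- 1) \<in> weyl_algebra n"
    by (intro weyl_algebra_single) simp
  then have "- y \<in> I"
    using assms unfolding left_ideal_def by (metis weyl_mult_minus_one)
  then have "x + - y \<in> I" using assms unfolding left_ideal_def by blast
  then show ?thesis by simp
qed

text \<open>If the entries of \<open>\<rho>, \<sigma>\<close> are positive and rationally independent, this weight is a term order: it
  separates monomials, reordering a product creates only terms of smaller weight, and the monomials
  below a given weight are finite in number.\<close>

definition height :: "real vec \<Rightarrow> real vec \<Rightarrow> expo \<times> expo \<Rightarrow> real" where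
  "height \<rho> \<sigma> = (\<lambda>(a, b). expo_weight \<rho> a + expo_weight \<sigma> b)"

definition leads :: "('k \<Rightarrow> real) \<Rightarrow> 'k \<Rightarrow> ('k \<Rightarrow>\<^sub>0 complex) \<Rightarrow> bool" where
  "leads h m f \<longleftrightarrow> m \<in> keys f \<and> (\<forall>m'\<in>keys f. m' = m \<or> h m' < h m)"

lemma leads_exists:
  assumes "f \<noteq> 0" "inj_on h (keys f)"
  shows "\<exists>m. leads h m f"
proof -
  let ?M = "h ` keys f"
  have ne: "finite ?M" "?M \<noteq> {}" using assms by auto
  obtain m where m: "m \<in> keys f" "h m = Max ?M"
    using Max_in[OF ne] by force
  have "m' = m \<or> h m' < h m" if "m' \<in> keys f" for m'
  proof -
    have "h m' \<le> h m" using that ne m by simp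
    then show ?thesis using assms(2) that m(1) by (metis inj_onD order_le_less)
  qed
  with m show ?thesis unfolding leads_def by blast
qed

lemma height_term:
  assumes "k \<in> common_lower (snd p) (fst r)"
  shows "height \<rho> \<sigma> (fst p + (fst r - k), (snd p - k) + snd r)
    = height \<rho> \<sigma> p + height \<rho> \<sigma> r - (expo_weight \<rho> k + expo_weight \<sigma> k)"
proof -
  have "expo_weight \<rho> (fst r - k) = expo_weight \<rho> (fst r) - expo_weight \<rho> k"
       "expo_weight \<sigma> (snd p - k) = expo_weight \<sigma> (snd p) - expo_weight \<sigma> k"
    using assms by (simp_all add: expo_weight_minus common_lower_def)
  then show ?thesis by (simp add: height_def case_prod_unfold expo_weight_add)
qed

lemma expo_weight_ge:
  assumes "w \<in> carrier_vec n" "\<And>j. j < n \<Longrightarrow> w $ j > 1 / 2" "j < n"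
  shows "expo_weight w k \<ge> real (lookup k j) / 2"
proof -
  have "real (lookup k j) / 2 \<le> w $ j * real (lookup k j)"
    using mult_right_mono[of "1/2" "w $ j" "real (lookup k j)"] assms(2,3) by force
  also have "\<dots> \<le> expo_weight w k"
    unfolding expo_weight_def
  proof (rule member_le_sum[of j "{..<dim_vec w}" "\<lambda>j. w $ j * real (lookup k j)"])
    show "0 \<le> w $ i * real (lookup k i)" if "i \<in> {..<dim_vec w} - {j}" for i
    proof -
      have "w $ i > 1/2" using that assms(1,2) by simp
      then show ?thesis by simp
    qed
  qed (use assms in auto)
  finally show ?thesis .
qed

lemma expo_weight_pos:
  assumes "w \<in> carrier_vec n" "\<And>j. j < n \<Longrightarrow> w $ j > 1 / 2" "k \<in> expos n" "k \<noteq> 0"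
  shows "expo_weight w k > 0"
proof -
  obtain j where j: "lookup k j \<noteq> 0"
    using assms(4) by (metis lookup_zero poly_mapping_eqI)
  then have "j < n" using assms(3) unfolding expos_iff by blast
  from expo_weight_ge[OF assms(1,2) this, of k] j show ?thesis by simp
qed

lemma expo_weight_nonneg:
  assumes "w \<in> carrier_vec n" "\<And>j. j < n \<Longrightarrow> w $ j > 1 / 2"
  shows "expo_weight w k \<ge> 0"
  unfolding expo_weight_def
proof (rule sum_nonneg)
  fix j assume "j \<in> {..<dim_vec w}"
  then have "w $ j > 1/2" using assms by simp
  then show "0 \<le> w $ j * real (lookup k j)" by simp
qed

text \<open>The leading terms multiply as in a commutative ring, since the terms of Leibniz' formula with
  \<open>k \<noteq> 0\<close> lose weight in both kinds of variables.\<close>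

lemma leads_weyl_mult:
  assumes pos: "\<rho> \<in> carrier_vec n" "\<And>j. j < n \<Longrightarrow> \<rho> $ j > 1 / 2"
      "\<sigma> \<in> carrier_vec n" "\<And>j. j < n \<Longrightarrow> \<sigma> $ j > 1 / 2"
    and Q: "leads (height \<rho> \<sigma>) r Q" "Q \<in> weyl_algebra n" and p: "p \<in> expos n \<times> expos n"
  obtains R where "weyl_mult (single p c) Q
      = single (fst p + fst r, snd p + snd r) (c * lookup Q r) + R"
    "\<And>m. m \<in> keys R \<Longrightarrow> height \<rho> \<sigma> m < height \<rho> \<sigma> (fst p + fst r, snd p + snd r)"
proof -
  let ?h = "height \<rho> \<sigma>" and ?lc = "lookup Q r" and ?m = "(fst p + fst r, snd p + snd r)"
  define Q' where "Q' = restrict_keys (- {r}) Q"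
  define R1 where "R1 = (\<Sum>k\<in>common_lower (snd p) (fst r) - {0}.
     single (fst p + (fst r - k), (snd p - k) + snd r)
       (c * ?lc * of_nat (leibniz_coeff (snd p) (fst r) k)))"
  have hm: "?h ?m = ?h p + ?h r"
    by (simp add: height_def case_prod_unfold expo_weight_add)
  have z: "0 \<in> common_lower (snd p) (fst r)" by (simp add: common_lower_def)
  have "Q = single r ?lc + Q'"
    by (rule poly_mapping_eqI) (auto simp: Q'_def lookup_restrict_keys lookup_add lookup_single when_def)
  then have "weyl_mult (single p c) Q
      = weyl_term p r (c * ?lc) + weyl_mult (single p c) Q'"
    by (metis weyl_mult_add_right weyl_mult_single)
  also have "weyl_term p r (c * ?lc) = single ?m (c * ?lc) + R1"
    unfolding weyl_term_def R1_def
    by (subst sum.remove[OF finite_common_lower z]) (simp add: leibniz_coeff_def)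
  finally have eq: "weyl_mult (single p c) Q
      = single ?m (c * ?lc) + (R1 + weyl_mult (single p c) Q')"
    by (simp add: add.assoc)
  have R1: "?h m < ?h ?m" if "m \<in> keys R1" for m
  proof -
    have "m \<in> (\<Union>k\<in>common_lower (snd p) (fst r) - {0}. keys
       (single (fst p + (fst r - k), (snd p - k) + snd r)
       (c * ?lc * of_nat (leibniz_coeff (snd p) (fst r) k))))"
      using that keys_sum unfolding R1_def by (rule subsetD[rotated])
    then obtain k where k: "k \<in> common_lower (snd p) (fst r)" "k \<noteq> 0"
        and m: "m = (fst p + (fst r - k), (snd p - k) + snd r)"
      by (auto split: if_splits)
    have "k \<in> expos n"
      unfolding expos_iff
    proof (intro allI impI)
      fix j assume "lookup k j \<noteq> 0"
      moreover have "lookup k j \<le> lookup (snd p) j"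
        using k(1) by (simp add: common_lower_def)
      ultimately have "lookup (snd p) j \<noteq> 0" by linarith
      moreover have "snd p \<in> expos n" using p by auto
      ultimately show "j < n" unfolding expos_iff by blast
    qed
    with k pos have "expo_weight \<rho> k > 0" "expo_weight \<sigma> k > 0" by (auto intro: expo_weight_pos)
    then show ?thesis unfolding m height_term[OF k(1)] hm by simp
  qed
  have R2: "?h m < ?h ?m" if m: "m \<in> keys (weyl_mult (single p c) Q')" for m
  proof -
    obtain p' r' k where pr: "p' \<in> keys (single p c)" "r' \<in> keys Q'"
      and k: "k \<in> common_lower (snd p') (fst r')" and m': "m = (fst p' + (fst r' - k), (snd p' - k) + snd r')"
      using m by (rule keys_weyl_mult)
    have p': "p' = p" using pr(1) by (auto split: if_splits)
    have "r' \<in> keys Q" "r' \<noteq> r" using pr(2) by (auto simp: Q'_def keys_restrict_keys)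
    then have "?h r' < ?h r" using Q(1) unfolding leads_def by blast
    moreover have "expo_weight \<rho> k \<ge> 0" "expo_weight \<sigma> k \<ge> 0"
      using pos by (auto intro: expo_weight_nonneg)
    ultimately show ?thesis unfolding m' hm using height_term[OF k, of \<rho> \<sigma>] by (simp add: p')
  qed
  show ?thesis
  proof (rule that[OF eq])
    fix m assume "m \<in> keys (R1 + weyl_mult (single p c) Q')"
    then have "m \<in> keys R1 \<or> m \<in> keys (weyl_mult (single p c) Q')"
      using Poly_Mapping.keys_add[of R1 "weyl_mult (single p c) Q'"] by blast
    then show "?h m < ?h ?m" using R1 R2 by blast
  qed
qed

text \<open>Division with remainder for the term order above: by Dickson's lemma finitely many elements of the
  ideal have leading exponents that lie below the leading exponents of all the others. Subtracting left
  multiples of them lowers the leading monomial, and the descent stops because only finitely many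
  monomials have a smaller weight.\<close>

lemma left_ideal_finitely_generated:
  assumes I: "left_ideal n I"
  obtains F where "finite F" "F \<subseteq> I" "I = gen_left n F"
proof -
  \<comment> \<open>Entries near 1 are positive; the first half weighs the \<open>x\<close>, the second half the \<open>\<partial>\<close>.\<close>
  obtain y where y: "y \<in> carrier_vec (n + n)" "rat_indep y"
      "\<And>j. j < n + n \<Longrightarrow> \<bar>y $ j - vec (n + n) (\<lambda>_. 1) $ j\<bar> < 1 / 2"
    by (rule rat_indep_near[of "1/2" "vec (n + n) (\<lambda>_. 1)"]) auto
  define \<rho> where "\<rho> = vec n (\<lambda>j. y $ j)"
  define \<sigma> where "\<sigma> = vec n (\<lambda>j. y $ (n + j))"
  let ?h = "height \<rho> \<sigma>"
  have gt: "y $ j > 1 / 2" if "j < n + n" for j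
    using y(3)[OF that] that unfolding abs_less_iff by simp
  have pos: "\<rho> \<in> carrier_vec n" "\<And>j. j < n \<Longrightarrow> \<rho> $ j > 1 / 2"
      "\<sigma> \<in> carrier_vec n" "\<And>j. j < n \<Longrightarrow> \<sigma> $ j > 1 / 2"
    using gt by (auto simp: \<rho>_def \<sigma>_def)
  have inj: "inj_on ?h (expos n \<times> expos n)"
  proof (rule inj_onI)
    fix p r assume p: "p \<in> expos n \<times> expos n" and r: "r \<in> expos n \<times> expos n" and eq: "?h p = ?h r"
    define u :: "nat \<Rightarrow> int" where "u = (\<lambda>j. if j < n
      then int (lookup (fst p) j) - int (lookup (fst r) j)
      else int (lookup (snd p) (j - n)) - int (lookup (snd r) (j - n)))"
    have split: "{..<n + n} = {..<n} \<union> (\<lambda>j. n + j) ` {..<n}" "{..<n} \<inter> (\<lambda>j. n + j) ` {..<n} = {}"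
    proof -
      have "x \<in> (\<lambda>j. n + j) ` {..<n}" if "x < n + n" "\<not> x < n" for x
        using that by (intro image_eqI[of _ _ "x - n"]) auto
      then show "{..<n + n} = {..<n} \<union> (\<lambda>j. n + j) ` {..<n}" by auto
    qed auto
    have "(\<Sum>j<n + n. of_int (u j) * y $ j) = (\<Sum>j<n. of_int (u j) * y $ j) + (\<Sum>j<n. of_int (u (n + j)) * y $ (n + j))"
      unfolding split(1) by (subst sum.union_disjoint) (auto simp: split(2) sum.reindex)
    also have "\<dots> = ?h p - ?h r"
      by (simp add: height_def case_prod_unfold expo_weight_def u_def \<rho>_def \<sigma>_def algebra_simps sum_subtractf)
    finally have "\<forall>j<n + n. u j = 0" using y(1,2) eq unfolding rat_indep_def by auto
    then have u0: "\<And>j. j < n \<Longrightarrow> u j = 0 \<and> u (n + j) = 0" by simp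
    show "p = r"
    proof (rule prod_eqI)
      show "fst p = fst r"
        by (rule expos_eqI[where n = n]) (use p r u0 in \<open>auto simp: u_def\<close>)
      show "snd p = snd r"
        by (rule expos_eqI[where n = n]) (use p r u0 in \<open>auto simp: u_def\<close>)
    qed
  qed
  have fin: "finite {m \<in> expos n \<times> expos n. ?h m < H}" for H
  proof (rule finite_subset)
    let ?B = "{m \<in> expos n. \<forall>j<n. lookup m j \<le> nat \<lceil>2 * H\<rceil>}"
    show "finite (?B \<times> ?B)" by (intro finite_cartesian_product finite_bounded_expos)
    show "{m \<in> expos n \<times> expos n. ?h m < H} \<subseteq> ?B \<times> ?B"
    proof
      fix m assume m: "m \<in> {m \<in> expos n \<times> expos n. ?h m < H}"
      obtain a b where ab: "m = (a, b)" by fastforce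
      have H: "expo_weight \<rho> a + expo_weight \<sigma> b < H" using m by (simp add: ab height_def)
      have le: "lookup a j \<le> nat \<lceil>2 * H\<rceil> \<and> lookup b j \<le> nat \<lceil>2 * H\<rceil>" if "j < n" for j
      proof -
        have "real (lookup a j) / 2 \<le> expo_weight \<rho> a" "real (lookup b j) / 2 \<le> expo_weight \<sigma> b"
          "expo_weight \<rho> a \<ge> 0" "expo_weight \<sigma> b \<ge> 0"
          using expo_weight_ge[OF pos(1,2) that] expo_weight_ge[OF pos(3,4) that]
            expo_weight_nonneg[OF pos(1,2)] expo_weight_nonneg[OF pos(3,4)] by blast+
        then have "real (lookup a j) \<le> 2 * H" "real (lookup b j) \<le> 2 * H"
          using H by linarith+
        then show ?thesis by linarith
      qed
      have "a \<in> expos n" "b \<in> expos n" using m by (simp_all add: ab)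
      with le show "m \<in> ?B \<times> ?B" by (simp add: ab)
    qed
  qed
  have sub: "keys f \<subseteq> expos n \<times> expos n" if "f \<in> I" for f
    using that I unfolding left_ideal_def weyl_algebra_def by blast
  define \<Lambda> where "\<Lambda> = {m. \<exists>f\<in>I. leads ?h m f}"
  have "\<Lambda> \<subseteq> expos n \<times> expos n" using sub unfolding \<Lambda>_def leads_def by blast
  from dickson_expos[OF this] obtain E where E: "E \<subseteq> \<Lambda>" "finite E"
    "\<And>a b. (a, b) \<in> \<Lambda> \<Longrightarrow> \<exists>c d. (c, d) \<in> E \<and> (\<forall>j. lookup c j \<le> lookup a j) \<and>
       (\<forall>j. lookup d j \<le> lookup b j)"
    by blast
  have "\<forall>m\<in>E. \<exists>f. f \<in> I \<and> leads ?h m f" using E(1) unfolding \<Lambda>_def by blast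
  from bchoice[OF this] obtain g where g: "\<And>m. m \<in> E \<Longrightarrow> g m \<in> I" "\<And>m. m \<in> E \<Longrightarrow> leads ?h m (g m)"
    by blast
  have gen: "left_ideal n (gen_left n (g ` E))"
    using g(1) I by (intro left_ideal_gen) (auto simp: left_ideal_def)
  have below: "f \<in> gen_left n (g ` E)" if "f \<in> I" "\<And>m. m \<in> keys f \<Longrightarrow> ?h m < H" for f H
    using that
  proof (induction "card {m \<in> expos n \<times> expos n. ?h m < H}" arbitrary: f H rule: less_induct)
    case less
    show ?case
    proof (cases "f = 0")
      case True
      then show ?thesis by (simp add: gen_submodule.zero)
    next
      case False
      obtain m where m: "leads ?h m f"
        using leads_exists[OF False inj_on_subset[OF inj sub[OF less.prems(1)]]] by blast
      obtain a b where ab: "m = (a, b)" by fastforce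
      have "(a, b) \<in> \<Lambda>" using less.prems(1) m unfolding \<Lambda>_def ab by blast
      from E(3)[OF this] obtain c d where cd: "(c, d) \<in> E"
        and le: "\<And>j. lookup c j \<le> lookup a j" "\<And>j. lookup d j \<le> lookup b j"
        by blast
      let ?g = "g (c, d)" and ?p = "(a - c, b - d)"
      have m_in: "m \<in> expos n \<times> expos n" "m \<in> keys f"
        using m sub[OF less.prems(1)] unfolding leads_def by blast+
      have p: "?p \<in> expos n \<times> expos n" using m_in(1) by (auto simp: ab intro: expos_minus)
      have sum: "(fst ?p + fst (c, d), snd ?p + snd (c, d)) = m"
        unfolding ab by (auto intro!: poly_mapping_eqI simp: lookup_add lookup_minus le)
      let ?\<kappa> = "lookup f m / lookup ?g (c, d)"
      have gD: "?g \<in> weyl_algebra n" using g(1)[OF cd] I unfolding left_ideal_def by blast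
      obtain R where R: "weyl_mult (single ?p ?\<kappa>) ?g
          = single m (?\<kappa> * lookup ?g (c, d)) + R"
        "\<And>m'. m' \<in> keys R \<Longrightarrow> ?h m' < ?h m"
        using leads_weyl_mult[OF pos g(2)[OF cd] gD p, of ?\<kappa>] unfolding sum by blast
      have "lookup ?g (c, d) \<noteq> 0"
        using g(2)[OF cd] unfolding leads_def by (simp add: in_keys_iff)
      then have R1: "weyl_mult (single ?p ?\<kappa>) ?g = single m (lookup f m) + R"
        using R(1) by simp
      let ?x = "weyl_mult (single ?p ?\<kappa>) ?g"
      have sD: "single ?p ?\<kappa> \<in> weyl_algebra n" by (rule weyl_algebra_single[OF p])
      have xI: "?x \<in> I" using I g(1)[OF cd] sD unfolding left_ideal_def by blast
      have xg: "?x \<in> gen_left n (g ` E)" using cd sD by (blast intro: gen_submodule.intros)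
      have diff: "?h m' < ?h m" if m': "m' \<in> keys (f - ?x)" for m'
      proof -
        have ne: "lookup f m' - lookup (single m (lookup f m)) m'
            - lookup R m' \<noteq> 0"
          using m' unfolding R1 by (simp add: in_keys_iff lookup_minus lookup_add algebra_simps)
        show ?thesis
        proof (cases "m' \<in> keys R")
          case True
          then show ?thesis by (rule R(2))
        next
          case False
          with ne have "m' \<noteq> m" "m' \<in> keys f"
            by (auto simp: in_keys_iff lookup_single when_def split: if_splits)
          then show ?thesis using m unfolding leads_def by blast
        qed
      qed
      have "{m' \<in> expos n \<times> expos n. ?h m' < ?h m} \<subset> {m' \<in> expos n \<times> expos n. ?h m' < H}"
        using less.prems(2)[OF m_in(2)] m_in(1) by force
      then have "card {m' \<in> expos n \<times> expos n. ?h m' < ?h m} < card {m' \<in> expos n \<times> expos n. ?h m' < H}"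
        using fin by (rule psubset_card_mono[rotated])
      then have "f - ?x \<in> gen_left n (g ` E)"
        by (rule less.hyps) (use diff left_ideal_diff[OF I less.prems(1) xI] in blast)+
      from gen_submodule.add[OF this xg] show ?thesis by simp
    qed
  qed
  then have inc: "f \<in> gen_left n (g ` E)" if "f \<in> I" for f
  proof -
    have "?h m < (\<Sum>m\<in>keys f. \<bar>?h m\<bar>) + 1" if "m \<in> keys f" for m
      using member_le_sum[of m "keys f" "\<lambda>m. \<bar>?h m\<bar>"] that by fastforce
    from below[OF \<open>f \<in> I\<close> this] show ?thesis .
  qed
  show ?thesis
  proof (rule that[of "g ` E"])
    show "finite (g ` E)" using E(2) by simp
    show "g ` E \<subseteq> I" using g(1) by blast
    then show "I = gen_left n (g ` E)" using inc left_ideal_contains_gen[OF I] by blast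
  qed
qed

section \<open>Weight vectors inside an open cone of the small Groebner fan\<close>

lemma initial_form_subset_keys: "keys (initial_form \<omega> P) \<subseteq> keys P"
  by (simp add: initial_form_restrict_keys keys_restrict_keys)

lemma initial_form_algebra: "P \<in> weyl_algebra n \<Longrightarrow> initial_form \<omega> P \<in> weyl_algebra n"
  unfolding weyl_algebra_def using initial_form_subset_keys[of \<omega> P] by blast

text \<open>The initial forms of weight \<open>\<delta>\<close> of elements of \<open>I\<close>, together with zero. In contrast to the set of
  initial forms this is a vector space.\<close>

definition top_parts :: "(expo \<times> expo \<Rightarrow> real) \<Rightarrow> weyl set \<Rightarrow> real \<Rightarrow> weyl set" where
  "top_parts \<omega> I \<delta> = {Q. (\<forall>m\<in>keys Q. \<omega> m = \<delta>) \<and>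
     (\<exists>R. Q + R \<in> I \<and> (\<forall>m\<in>keys R. \<omega> m < \<delta>))}"

lemma top_parts_add:
  assumes I: "left_ideal n I" and Q: "Q \<in> top_parts \<omega> I \<delta>" "Q' \<in> top_parts \<omega> I \<delta>"
  shows "Q + Q' \<in> top_parts \<omega> I \<delta>"
proof -
  obtain R R' where R: "Q + R \<in> I" "\<forall>m\<in>keys R. \<omega> m < \<delta>"
      "Q' + R' \<in> I" "\<forall>m\<in>keys R'. \<omega> m < \<delta>"
    using Q unfolding top_parts_def by blast
  have "(Q + R) + (Q' + R') \<in> I" using I R unfolding left_ideal_def by blast
  then have "(Q + Q') + (R + R') \<in> I" by (simp add: algebra_simps)
  moreover have "\<forall>m\<in>keys (R + R'). \<omega> m < \<delta>"
    using Poly_Mapping.keys_add[of R R'] R by blast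
  moreover have "\<forall>m\<in>keys (Q + Q'). \<omega> m = \<delta>"
    using Poly_Mapping.keys_add[of Q Q'] Q unfolding top_parts_def by blast
  ultimately show ?thesis unfolding top_parts_def by blast
qed

lemma top_parts_zero:
  assumes "left_ideal n I"
  shows "0 \<in> top_parts \<omega> I \<delta>"
proof -
  have "0 + 0 \<in> I" using assms by (simp add: left_ideal_def)
  then show ?thesis unfolding top_parts_def by fastforce
qed

lemma top_parts_mult:
  assumes I: "left_ideal n I" and Q: "Q \<in> top_parts (weyl_weight w) I \<delta>" and p: "p \<in> expos n \<times> expos n"
  shows "weyl_mult (single p c) Q \<in> top_parts (weyl_weight w) I (weyl_weight w p + \<delta>)"
proof -
  let ?s = "single p c" and ?\<omega> = "weyl_weight w"
  obtain R where R: "Q + R \<in> I" "\<forall>m\<in>keys R. ?\<omega> m < \<delta>"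
    using Q unfolding top_parts_def by blast
  have "weyl_mult ?s (Q + R) \<in> I"
    using I R(1) weyl_algebra_single[OF p] unfolding left_ideal_def by blast
  then have "weyl_mult ?s Q + weyl_mult ?s R \<in> I" by (simp add: weyl_mult_add_right)
  moreover have "\<exists>r\<in>keys S. ?\<omega> m = ?\<omega> p + ?\<omega> r"
    if m: "m \<in> keys (weyl_mult ?s S)" for m S
  proof -
    obtain p' r k where *: "p' \<in> keys ?s" "r \<in> keys S"
      "k \<in> common_lower (snd p') (fst r)" "m = (fst p' + (fst r - k), (snd p' - k) + snd r)"
      using m by (rule keys_weyl_mult)
    then have "p' = p" by (auto split: if_splits)
    then show ?thesis using * weyl_weight_term[OF *(3), of w] by blast
  qed
  ultimately show ?thesis using Q R(2) unfolding top_parts_def by fastforce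
qed

text \<open>The homogeneous parts of an initial left ideal consist of initial forms: this property holds
  for the generators, and multiplication by a monomial sends top parts to top parts.\<close>

lemma initial_ideal_parts:
  assumes I: "left_ideal n I" and Q: "Q \<in> weyl_initial_ideal n w I"
  shows "restrict_keys {m. weyl_weight w m = \<delta>} Q \<in> top_parts (weyl_weight w) I \<delta>"
  using Q unfolding weyl_initial_ideal_def weyl_weight_def[symmetric]
proof (induction arbitrary: \<delta>)
  case zero
  have "restrict_keys {m. weyl_weight w m = \<delta>} 0 = 0" by (rule restrict_keys_eq_0) simp
  then show ?case using top_parts_zero[OF I] by simp
next
  case (gen x)
  then obtain P where P: "P \<in> I" "x = initial_form (weyl_weight w) P" by blast
  show ?case
  proof (cases "P = 0")
    case True
    then have "restrict_keys {m. weyl_weight w m = \<delta>} x = 0" by (intro restrict_keys_eq_0) (simp add: P)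
    then show ?thesis using top_parts_zero[OF I] by simp
  next
    case False
    obtain \<gamma> R where R: "P = x + R" "\<And>m. m \<in> keys x \<Longrightarrow> weyl_weight w m = \<gamma>"
      "\<And>m. m \<in> keys R \<Longrightarrow> weyl_weight w m < \<gamma>"
      unfolding P(2) using initial_form_decomp[OF False, of "weyl_weight w"] by metis
    show ?thesis
    proof (cases "\<gamma> = \<delta>")
      case True
      then have "restrict_keys {m. weyl_weight w m = \<delta>} x = x" by (intro restrict_keys_id) (simp add: R)
      moreover have "x \<in> top_parts (weyl_weight w) I \<delta>"
        using P(1) R True unfolding top_parts_def by blast
      ultimately show ?thesis by simp
    next
      case False
      then have "restrict_keys {m. weyl_weight w m = \<delta>} x = 0"
        using R(2) by (intro restrict_keys_eq_0) auto
      then show ?thesis using top_parts_zero[OF I] by simp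
    qed
  qed
next
  case (add x y)
  then show ?case by (simp add: restrict_keys_add top_parts_add[OF I])
next
  case (scale a x)
  have part: "restrict_keys {m. weyl_weight w m = \<delta>} (weyl_mult (single p c) x)
      = weyl_mult (single p c) (restrict_keys {m. weyl_weight w m = \<delta> - weyl_weight w p} x)" for p c
  proof -
    let ?s = "single p c"
    let ?S = "{m. weyl_weight w m = \<delta> - weyl_weight w p}"
    have shift: "\<exists>r\<in>keys S. weyl_weight w m = weyl_weight w p + weyl_weight w r"
      if m: "m \<in> keys (weyl_mult ?s S)" for m S
    proof -
      obtain p' r k where *: "p' \<in> keys ?s" "r \<in> keys S"
        "k \<in> common_lower (snd p') (fst r)" "m = (fst p' + (fst r - k), (snd p' - k) + snd r)"
        using m by (rule keys_weyl_mult)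
      then have "p' = p" by (auto split: if_splits)
      then show ?thesis using * weyl_weight_term[OF *(3), of w] by blast
    qed
    have "weyl_mult ?s x = weyl_mult ?s (restrict_keys ?S x) + weyl_mult ?s (restrict_keys (- ?S) x)"
      by (metis restrict_keys_split weyl_mult_add_right)
    then have "restrict_keys {m. weyl_weight w m = \<delta>} (weyl_mult ?s x)
      = restrict_keys {m. weyl_weight w m = \<delta>} (weyl_mult ?s (restrict_keys ?S x))
        + restrict_keys {m. weyl_weight w m = \<delta>} (weyl_mult ?s (restrict_keys (- ?S) x))"
      by (simp add: restrict_keys_add)
    also have "restrict_keys {m. weyl_weight w m = \<delta>} (weyl_mult ?s (restrict_keys (- ?S) x)) = 0"
    proof (rule restrict_keys_eq_0)
      fix m assume "m \<in> keys (weyl_mult ?s (restrict_keys (- ?S) x))"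
      from shift[OF this] show "m \<notin> {m. weyl_weight w m = \<delta>}"
        by (auto simp: keys_restrict_keys)
    qed
    also have "restrict_keys {m. weyl_weight w m = \<delta>} (weyl_mult ?s (restrict_keys ?S x))
        = weyl_mult ?s (restrict_keys ?S x)"
    proof (rule restrict_keys_id)
      fix m assume "m \<in> keys (weyl_mult ?s (restrict_keys ?S x))"
      from shift[OF this] show "m \<in> {m. weyl_weight w m = \<delta>}"
        by (auto simp: keys_restrict_keys)
    qed
    finally show ?thesis by simp
  qed
  have keys: "p \<in> expos n \<times> expos n" if "p \<in> keys a" for p
    using scale.hyps(1) that unfolding weyl_algebra_def by blast
  have sum: "(\<Sum>p\<in>A. restrict_keys {m. weyl_weight w m = \<delta>} (weyl_mult (single p (f p)) x))
      \<in> top_parts (weyl_weight w) I \<delta>"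
    if "A \<subseteq> expos n \<times> expos n" for A and f :: "expo \<times> expo \<Rightarrow> complex"
    using that
  proof (induction A rule: infinite_finite_induct)
    case (insert p A)
    have "weyl_mult (single p (f p)) (restrict_keys {m. weyl_weight w m = \<delta> - weyl_weight w p} x)
        \<in> top_parts (weyl_weight w) I (weyl_weight w p + (\<delta> - weyl_weight w p))"
      by (rule top_parts_mult[OF I scale.IH]) (use insert.prems in blast)
    with insert show ?case by (simp add: part top_parts_add[OF I])
  qed (use top_parts_zero[OF I] in simp_all)
  have restr_sum: "restrict_keys S (sum f A) = (\<Sum>x\<in>A. restrict_keys S (f x))"
    for S and f :: "expo \<times> expo \<Rightarrow> weyl" and A
  proof -
    have "restrict_keys S 0 = 0" by (rule restrict_keys_eq_0) simp
    then show ?thesis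
      by (induction A rule: infinite_finite_induct) (simp_all add: restrict_keys_add)
  qed
  have "weyl_mult a x
      = (\<Sum>p\<in>keys a. weyl_mult (single p (lookup a p)) x)"
    by (subst (1) poly_mapping_sum_single) (rule weyl_mult_sum_left)
  then have "restrict_keys {m. weyl_weight w m = \<delta>} (weyl_mult a x) =
      (\<Sum>p\<in>keys a. restrict_keys {m. weyl_weight w m = \<delta>}
        (weyl_mult (single p (lookup a p)) x))"
    by (simp only: restr_sum)
  also have "\<dots> \<in> top_parts (weyl_weight w) I \<delta>" by (rule sum) (use keys in blast)
  finally show ?case .
qed

lemma left_ideal_initial:
  assumes "left_ideal n I"
  shows "left_ideal n (weyl_initial_ideal n w I)"
  unfolding weyl_initial_ideal_def
proof (rule left_ideal_gen)
  have "P \<in> weyl_algebra n" if "P \<in> I" for P using assms that unfolding left_ideal_def by blast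
  then show "initial_form (\<lambda>(a, b). expo_weight w b - expo_weight w a) ` I \<subseteq> weyl_algebra n"
    using initial_form_algebra by blast
qed

lemma initial_form_in_initial_ideal:
  "P \<in> I \<Longrightarrow> initial_form (weyl_weight w) P \<in> weyl_initial_ideal n w I"
  unfolding weyl_initial_ideal_def weyl_weight_def by (blast intro: gen_submodule.gen)

lemma homogeneous_in_initial_ideal:
  assumes I: "left_ideal n I" and Q: "Q \<in> weyl_initial_ideal n w I" "Q \<noteq> 0"
    "\<And>m. m \<in> keys Q \<Longrightarrow> weyl_weight w m = \<delta>"
  obtains P where "P \<in> I" "initial_form (weyl_weight w) P = Q"
    "\<And>m. m \<in> keys (P - Q) \<Longrightarrow> weyl_weight w m < \<delta>"
proof -
  have "restrict_keys {m. weyl_weight w m = \<delta>} Q = Q"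
    using Q(3) by (intro restrict_keys_id) simp
  then have "Q \<in> top_parts (weyl_weight w) I \<delta>"
    using initial_ideal_parts[OF I Q(1), of \<delta>] by simp
  then obtain R where R: "Q + R \<in> I" "\<And>m. m \<in> keys R \<Longrightarrow> weyl_weight w m < \<delta>"
    unfolding top_parts_def by blast
  show ?thesis
    by (rule that[OF R(1)]) (use initial_form_eqI[OF Q(2,3) R(2)] R(2) in simp_all)
qed

definition expo_size :: "nat \<Rightarrow> expo \<times> expo \<Rightarrow> real" where
  "expo_size n m = (\<Sum>j<n. real (lookup (fst m) j) + real (lookup (snd m) j))"

lemma expo_size_nonneg: "expo_size n m \<ge> 0"
  unfolding expo_size_def by (rule sum_nonneg) simp

lemma weyl_weight_perturb:
  assumes "w \<in> carrier_vec n" "w' \<in> carrier_vec n" "\<And>j. j < n \<Longrightarrow> \<bar>w' $ j - w $ j\<bar> \<le> \<epsilon>"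
  shows "\<bar>weyl_weight w' m - weyl_weight w m\<bar>
    \<le> \<epsilon> * expo_size n m"
proof -
  let ?d = "\<lambda>j. real (lookup (snd m) j) - real (lookup (fst m) j)"
  have "weyl_weight w' m - weyl_weight w m = (\<Sum>j<n. (w' $ j - w $ j) * ?d j)"
    using assms(1,2) by (simp add: weyl_weight_def case_prod_unfold expo_weight_def algebra_simps
        sum.distrib sum_subtractf)
  also have "\<bar>\<dots>\<bar> \<le> (\<Sum>j<n. \<bar>(w' $ j - w $ j) * ?d j\<bar>)" by (rule sum_abs)
  also have "\<dots> \<le> (\<Sum>j<n. \<epsilon> * (real (lookup (fst m) j) + real (lookup (snd m) j)))"
  proof (rule sum_mono)
    fix j assume "j \<in> {..<n}"
    then have "\<bar>w' $ j - w $ j\<bar> \<le> \<epsilon>" using assms(3) by simp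
    then show "\<bar>(w' $ j - w $ j) * ?d j\<bar>
        \<le> \<epsilon> * (real (lookup (fst m) j) + real (lookup (snd m) j))"
      unfolding abs_mult by (intro mult_mono) auto
  qed
  finally show ?thesis unfolding expo_size_def sum_distrib_left .
qed

lemma strict_order_stable:
  assumes "w \<in> carrier_vec n" "finite (M :: (expo \<times> expo) set)" "finite N"
    and less: "\<And>m m'. m \<in> M \<Longrightarrow> m' \<in> N \<Longrightarrow> weyl_weight w m < weyl_weight w m'"
  obtains \<epsilon> where "\<epsilon> > 0" "\<And>w' m m'. w' \<in> carrier_vec n \<Longrightarrow> (\<And>j. j < n \<Longrightarrow> \<bar>w' $ j - w $ j\<bar> < \<epsilon>) \<Longrightarrow>
     m \<in> M \<Longrightarrow> m' \<in> N \<Longrightarrow> weyl_weight w' m < weyl_weight w' m'"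
proof -
  let ?s = "expo_size n"
  let ?gap = "\<lambda>(m, m'). (weyl_weight w m' - weyl_weight w m) / (?s m + ?s m' + 1)"
  let ?G = "insert 1 (?gap ` (M \<times> N))"
  note s0 = expo_size_nonneg[of n]
  have fin: "finite ?G" using assms(2,3) by simp
  have pos: "g > 0" if "g \<in> ?G" for g
    using that
  proof
    assume "g \<in> ?gap ` (M \<times> N)"
    then obtain m m' where m: "m \<in> M" "m' \<in> N"
      and g: "g = (weyl_weight w m' - weyl_weight w m) / (?s m + ?s m' + 1)" by auto
    show ?thesis unfolding g using less[OF m] s0[of m] s0[of m'] by (intro divide_pos_pos) linarith+
  qed simp
  define \<epsilon> where "\<epsilon> = Min ?G"
  have eps: "\<epsilon> > 0" unfolding \<epsilon>_def using pos Min_in[OF fin] by blast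
  show ?thesis
  proof (rule that[OF eps])
    fix w' m m'
    assume w': "w' \<in> carrier_vec n" "\<And>j. j < n \<Longrightarrow> \<bar>w' $ j - w $ j\<bar> < \<epsilon>" and m: "m \<in> M" "m' \<in> N"
    have "?gap (m, m') \<in> ?G" using m by blast
    then have "\<epsilon> \<le> ?gap (m, m')" unfolding \<epsilon>_def using fin by (rule Min_le[rotated])
    then have "\<epsilon> \<le> (weyl_weight w m' - weyl_weight w m) / (?s m + ?s m' + 1)" by simp
    then have "\<epsilon> * (?s m + ?s m' + 1) \<le> weyl_weight w m' - weyl_weight w m"
      using s0[of m] s0[of m'] by (subst (asm) pos_le_divide_eq) auto
    then have "\<epsilon> * ?s m + \<epsilon> * ?s m' + \<epsilon> \<le> weyl_weight w m' - weyl_weight w m"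
      by (simp add: distrib_left)
    moreover have "\<bar>weyl_weight w' x - weyl_weight w x\<bar> \<le> \<epsilon> * ?s x" for x
      using weyl_weight_perturb[OF assms(1) w'(1), of \<epsilon> x] w'(2) by force
    from this[of m] this[of m'] have "weyl_weight w' m - weyl_weight w m \<le> \<epsilon> * ?s m"
      "weyl_weight w m' - weyl_weight w' m' \<le> \<epsilon> * ?s m'"
      by linarith+
    ultimately show "weyl_weight w' m < weyl_weight w' m'" using eps by linarith
  qed
qed

text \<open>Rational independence turns an equality of weights into equality of the differences of the
  exponents of \<open>\<partial>\<close> and \<open>x\<close>, and every weight depends only on these.\<close>

lemma weyl_weight_eq_rat_indep:
  assumes "rat_indep w" "w \<in> carrier_vec n" "w' \<in> carrier_vec n" "weyl_weight w m = weyl_weight w m'"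
  shows "weyl_weight w' m = weyl_weight w' m'"
proof -
  let ?u = "\<lambda>j. int (lookup (snd m) j) - int (lookup (fst m) j)
    - (int (lookup (snd m') j) - int (lookup (fst m') j))"
  have diff: "(\<Sum>j<n. of_int (?u j) * x $ j) = weyl_weight x m - weyl_weight x m'" if "x \<in> carrier_vec n" for x
    using that by (simp add: weyl_weight_def case_prod_unfold expo_weight_def algebra_simps
        sum.distrib sum_subtractf)
  have "\<forall>j<n. ?u j = 0"
    using assms(1,2,4) diff[OF assms(2)] unfolding rat_indep_def by (auto dest!: spec[of _ ?u])
  then have "(\<Sum>j<n. of_int (?u j) * w' $ j) = 0" by (intro sum.neutral) auto
  then show ?thesis using diff[OF assms(3)] by simp
qed

text \<open>For rationally independent weights an initial form is homogeneous for the finest grading of the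
  Weyl algebra, in which \<open>x\<^sup>a \<partial>\<^sup>b\<close> has degree \<open>b - a\<close>; and the finitely many strict inequalities with
  the other terms persist under small perturbations.\<close>

lemma initial_form_stable:
  assumes w: "rat_indep w" "w \<in> carrier_vec n"
  obtains \<epsilon> where "\<epsilon> > 0" "\<And>w'. w' \<in> carrier_vec n \<Longrightarrow> (\<And>j. j < n \<Longrightarrow> \<bar>w' $ j - w $ j\<bar> < \<epsilon>) \<Longrightarrow>
     initial_form (weyl_weight w') P = initial_form (weyl_weight w) P"
proof (cases "P = 0")
  case True
  then show ?thesis by (intro that[of 1]) auto
next
  case False
  let ?Q = "initial_form (weyl_weight w) P"
  obtain \<delta> R where R: "P = ?Q + R" "?Q \<noteq> 0" "\<And>m. m \<in> keys ?Q \<Longrightarrow> weyl_weight w m = \<delta>"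
    "\<And>m. m \<in> keys R \<Longrightarrow> weyl_weight w m < \<delta>"
    using initial_form_decomp[OF False, of "weyl_weight w"] by metis
  have less: "weyl_weight w m < weyl_weight w m'"
    if "m \<in> keys R" "m' \<in> keys ?Q" for m m'
    using R(3)[OF that(2)] R(4)[OF that(1)] by simp
  obtain \<epsilon> where \<epsilon>: "\<epsilon> > 0" and stable: "\<And>w' m m'. w' \<in> carrier_vec n \<Longrightarrow> (\<And>j. j < n \<Longrightarrow> \<bar>w' $ j - w $ j\<bar> < \<epsilon>) \<Longrightarrow>
     m \<in> keys R \<Longrightarrow> m' \<in> keys ?Q \<Longrightarrow> weyl_weight w' m < weyl_weight w' m'"
    using strict_order_stable[OF w(2) finite_keys finite_keys less] by blast
  obtain m0 where m0: "m0 \<in> keys ?Q" using R(2) by (metis ex_in_conv keys_eq_empty)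
  show ?thesis
  proof (rule that[OF \<epsilon>])
    fix w' assume w': "w' \<in> carrier_vec n" "\<And>j. j < n \<Longrightarrow> \<bar>w' $ j - w $ j\<bar> < \<epsilon>"
    have "initial_form (weyl_weight w') (?Q + R) = ?Q"
    proof (rule initial_form_eqI[OF R(2), where \<delta> = "weyl_weight w' m0"])
      show "weyl_weight w' m = weyl_weight w' m0" if "m \<in> keys ?Q" for m
        by (rule weyl_weight_eq_rat_indep[OF w w'(1)]) (simp add: R(3)[OF that] R(3)[OF m0])
      show "weyl_weight w' m < weyl_weight w' m0" if "m \<in> keys R" for m
        using stable[OF w' that m0] .
    qed
    with R(1) show "initial_form (weyl_weight w') P = ?Q" by simp
  qed
qed

lemma common_positive_bound:
  assumes "finite A" "\<And>a. a \<in> A \<Longrightarrow> e a > (0 :: real)"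
  obtains \<epsilon> where "\<epsilon> > 0" "\<And>a. a \<in> A \<Longrightarrow> \<epsilon> \<le> e a"
proof (rule that[of "Min (insert 1 (e ` A))"])
  have "Min (insert 1 (e ` A)) \<in> insert 1 (e ` A)" by (rule Min_in) (use assms in auto)
  then show "Min (insert 1 (e ` A)) > 0" using assms(2) by auto
  show "Min (insert 1 (e ` A)) \<le> e a" if "a \<in> A" for a
    by (rule Min_le) (use assms(1) that in auto)
qed

text \<open>The homogeneous parts of finitely many generators still generate, and every one of them is an
  initial form by the description of the homogeneous parts.\<close>

lemma initial_ideal_generated_by_initial_forms:
  assumes H: "left_ideal n H"
  obtains F where "finite F" "F \<subseteq> H"
    "weyl_initial_ideal n w H \<subseteq> gen_left n (initial_form (weyl_weight w) ` F)"
proof -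
  let ?\<omega> = "weyl_weight w" and ?I = "weyl_initial_ideal n w H"
  obtain F0 where F0: "finite F0" "F0 \<subseteq> ?I" "?I = gen_left n F0"
    using left_ideal_finitely_generated[OF left_ideal_initial[OF H]] by blast
  let ?part = "\<lambda>f \<delta>. restrict_keys {m. ?\<omega> m = \<delta>} f"
  define G where "G = (\<Union>f\<in>F0. ?part f ` (?\<omega> ` keys f))"
  have finG: "finite G" unfolding G_def using F0(1) by simp
  have "\<exists>P. P \<in> H \<and> initial_form ?\<omega> P = g" if g_in: "g \<in> G" for g
  proof -
    obtain f m where f: "f \<in> F0" "m \<in> keys f" and g: "g = ?part f (?\<omega> m)"
      using g_in unfolding G_def by blast
    have "g \<in> top_parts ?\<omega> H (?\<omega> m)"
      unfolding g by (rule initial_ideal_parts[OF H]) (use f F0(2) in blast)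
    then obtain R where R: "g + R \<in> H" "\<And>k. k \<in> keys R \<Longrightarrow> ?\<omega> k < ?\<omega> m"
      unfolding top_parts_def by blast
    have "m \<in> keys g" unfolding g using f(2) by (simp add: keys_restrict_keys)
    then have "g \<noteq> 0" by auto
    then have "initial_form ?\<omega> (g + R) = g"
      by (rule initial_form_eqI[OF _ _ R(2)]) (simp_all add: g keys_restrict_keys)
    with R(1) show ?thesis by blast
  qed
  then have "\<forall>g\<in>G. \<exists>P. P \<in> H \<and> initial_form ?\<omega> P = g" by blast
  from bchoice[OF this] obtain P where P: "\<forall>g\<in>G. P g \<in> H \<and> initial_form ?\<omega> (P g) = g" by blast
  have img: "initial_form ?\<omega> ` (P ` G) = G"
  proof -
    have "(\<lambda>g. initial_form ?\<omega> (P g)) ` G = (\<lambda>g. g) ` G" by (rule image_cong) (use P in auto)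
    then show ?thesis by (simp add: image_image)
  qed
  have "f \<in> gen_left n G" if f: "f \<in> F0" for f
  proof -
    have sum: "(\<Sum>\<delta>\<in>A. ?part f \<delta>) \<in> gen_left n G" if "A \<subseteq> ?\<omega> ` keys f" for A
      using that
    proof (induction A rule: infinite_finite_induct)
      case (insert \<delta> A)
      have "\<delta> \<in> ?\<omega> ` keys f" using insert.prems by simp
      then have "?part f \<delta> \<in> ?part f ` (?\<omega> ` keys f)" by (rule imageI)
      with f have "?part f \<delta> \<in> G" unfolding G_def by (rule UN_I)
      moreover have "(\<Sum>\<delta>\<in>A. ?part f \<delta>) \<in> gen_left n G" using insert.IH insert.prems by simp
      ultimately have "?part f \<delta> + (\<Sum>\<delta>\<in>A. ?part f \<delta>) \<in> gen_left n G"
        by (rule gen_submodule.add[OF gen_submodule.gen])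
      then show ?case using insert.hyps by simp
    qed (simp_all add: gen_submodule.zero)
    have "f = (\<Sum>\<delta>\<in>?\<omega> ` keys f. ?part f \<delta>)"
    proof (rule poly_mapping_eqI)
      fix k
      have "lookup (\<Sum>\<delta>\<in>?\<omega> ` keys f. ?part f \<delta>) k
          = (\<Sum>\<delta>\<in>?\<omega> ` keys f. if \<delta> = ?\<omega> k then lookup f k else 0)"
        unfolding lookup_sum lookup_restrict_keys by (rule sum.cong[OF refl]) simp
      also have "\<dots> = (if ?\<omega> k \<in> ?\<omega> ` keys f then lookup f k else 0)"
        by (rule sum.delta) simp
      also have "\<dots> = lookup f k"
      proof (cases "lookup f k = 0")
        case False
        then have "k \<in> keys f" unfolding in_keys_iff .
        then have "?\<omega> k \<in> ?\<omega> ` keys f" by (rule imageI)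
        then show ?thesis by (rule if_P)
      qed simp
      finally show "lookup f k = lookup (\<Sum>\<delta>\<in>?\<omega> ` keys f. ?part f \<delta>) k" ..
    qed
    then show ?thesis by (rule ssubst) (rule sum[OF order_refl])
  qed
  then have "gen_left n F0 \<subseteq> gen_left n G" by (intro gen_submodule_mono) blast
  then show ?thesis
  proof (intro that[of "P ` G"])
    show "finite (P ` G)" using finG by simp
    show "P ` G \<subseteq> H" using P by blast
    show "?I \<subseteq> gen_left n (initial_form ?\<omega> ` (P ` G))"
      unfolding img F0(3) using \<open>gen_left n F0 \<subseteq> gen_left n G\<close> .
  qed
qed

text \<open>Among the initial left ideals of \<open>H\<close> for rationally independent weights in an open box there
  is a maximal one, because the Weyl algebra is Noetherian. Its finitely many generators are initial
  forms that a small perturbation \<open>w'\<close> of the weight preserves, so that it is contained in the initial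
  left ideal for \<open>w'\<close>. Conversely, refine \<open>w'\<close> to a rationally independent \<open>w''\<close>: by maximality the
  initial form of \<open>P\<close> for \<open>w''\<close> lies in the maximal ideal, and subtracting an element of \<open>H\<close> with this
  initial form removes terms from the initial form of \<open>P\<close> for \<open>w'\<close>.\<close>

theorem groebner_fan_interior_dense:
  assumes H: "left_ideal n H" and x: "x \<in> carrier_vec n" and \<epsilon>: "\<epsilon> > 0"
  obtains w where "w \<in> carrier_vec n" "rat_indep w" "\<And>j. j < n \<Longrightarrow> \<bar>w $ j - x $ j\<bar> < \<epsilon>"
    "\<exists>C\<in>small_groebner_fan n H. w \<in> weight_interior n C"
proof -
  let ?in = "\<lambda>w. weyl_initial_ideal n w H"
  define \<Omega> where "\<Omega> = {w \<in> carrier_vec n. rat_indep w \<and> (\<forall>j<n. \<bar>w $ j - x $ j\<bar> < \<epsilon>)}"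
  obtain y where "y \<in> carrier_vec n" "rat_indep y" "\<And>j. j < n \<Longrightarrow> \<bar>y $ j - x $ j\<bar> < \<epsilon>"
    using rat_indep_near[OF \<epsilon> x] by blast
  then have ne: "?in ` \<Omega> \<noteq> {}" unfolding \<Omega>_def by blast
  have "\<exists>M\<in>?in ` \<Omega>. \<forall>X\<in>?in ` \<Omega>. M \<subseteq> X \<longrightarrow> X = M"
  proof (rule subset_Zorn_nonempty[OF ne])
    fix \<C> assume C: "\<C> \<noteq> {}" "subset.chain (?in ` \<Omega>) \<C>"
    have lid: "left_ideal n J" if "J \<in> \<C>" for J
      using that C(2) left_ideal_initial[OF H] unfolding subset.chain_def by blast
    have "left_ideal n (\<Union>\<C>)"
      unfolding left_ideal_def
    proof (intro conjI ballI)
      show "\<Union>\<C> \<subseteq> weyl_algebra n" using lid unfolding left_ideal_def by blast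
      show "0 \<in> \<Union>\<C>" using lid C(1) unfolding left_ideal_def by blast
      show "weyl_mult a f \<in> \<Union>\<C>" if "a \<in> weyl_algebra n" "f \<in> \<Union>\<C>" for a f
        using lid that unfolding left_ideal_def by blast
      fix f g assume "f \<in> \<Union>\<C>" "g \<in> \<Union>\<C>"
      then obtain J J' where J: "f \<in> J" "g \<in> J'" "J \<in> \<C>" "J' \<in> \<C>" by blast
      then have "J \<subseteq> J' \<or> J' \<subseteq> J" using C(2) unfolding subset.chain_def by blast
      then show "f + g \<in> \<Union>\<C>" using J lid unfolding left_ideal_def by blast
    qed
    then obtain F where F: "finite F" "F \<subseteq> \<Union>\<C>" "\<Union>\<C> = gen_left n F"
      by (rule left_ideal_finitely_generated)
    obtain J where J: "J \<in> \<C>" "F \<subseteq> J"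
      using finite_subset_Union_chain[OF F(1,2) C] by blast
    then have "\<Union>\<C> = J" using left_ideal_contains_gen[OF lid[OF J(1)] J(2)] F(3) by blast
    then show "\<Union>\<C> \<in> ?in ` \<Omega>" using J(1) C(2) unfolding subset.chain_def by blast
  qed
  then obtain w where w: "w \<in> \<Omega>" and max: "\<And>w'. w' \<in> \<Omega> \<Longrightarrow> ?in w \<subseteq> ?in w' \<Longrightarrow> ?in w' = ?in w" by blast
  have wc: "w \<in> carrier_vec n" and wr: "rat_indep w" and wx: "\<And>j. j < n \<Longrightarrow> \<bar>w $ j - x $ j\<bar> < \<epsilon>"
    using w unfolding \<Omega>_def by blast+
  obtain F where F: "finite F" "F \<subseteq> H" "?in w \<subseteq> gen_left n (initial_form (weyl_weight w) ` F)"
    by (rule initial_ideal_generated_by_initial_forms[OF H])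
  have "\<forall>P. \<exists>e>0. \<forall>w'\<in>carrier_vec n. (\<forall>j<n. \<bar>w' $ j - w $ j\<bar> < e) \<longrightarrow>
     initial_form (weyl_weight w') P = initial_form (weyl_weight w) P"
  proof
    fix P
    show "\<exists>e>0. \<forall>w'\<in>carrier_vec n. (\<forall>j<n. \<bar>w' $ j - w $ j\<bar> < e) \<longrightarrow>
        initial_form (weyl_weight w') P = initial_form (weyl_weight w) P"
      by (rule initial_form_stable[OF wr wc, of P]) blast
  qed
  from choice[OF this] obtain e where e: "\<And>P. e P > 0" "\<And>P w'. w' \<in> carrier_vec n \<Longrightarrow>
      (\<forall>j<n. \<bar>w' $ j - w $ j\<bar> < e P) \<Longrightarrow>
      initial_form (weyl_weight w') P = initial_form (weyl_weight w) P" by blast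
  obtain \<epsilon>1 where \<epsilon>1: "\<epsilon>1 > 0" "\<And>P. P \<in> F \<Longrightarrow> \<epsilon>1 \<le> e P"
    using common_positive_bound[OF F(1), of e] e(1) by blast
  obtain \<epsilon>2 where \<epsilon>2: "\<epsilon>2 > 0" "\<And>j. j < n \<Longrightarrow> \<epsilon>2 \<le> \<epsilon> - \<bar>w $ j - x $ j\<bar>"
    using common_positive_bound[of "{..<n}" "\<lambda>j. \<epsilon> - \<bar>w $ j - x $ j\<bar>"] wx by auto
  define \<eta> where "\<eta> = min \<epsilon>1 \<epsilon>2"
  have \<eta>: "\<eta> > 0" unfolding \<eta>_def using \<epsilon>1(1) \<epsilon>2(1) by simp
  define near where "near = {w' \<in> carrier_vec n. \<forall>j<n. \<bar>w' $ j - w $ j\<bar> < \<eta>}"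
  have sub: "?in w \<subseteq> ?in w'" if w': "w' \<in> near" for w'
  proof -
    have "initial_form (weyl_weight w') P = initial_form (weyl_weight w) P" if P: "P \<in> F" for P
    proof (rule e(2))
      show "w' \<in> carrier_vec n" using w' unfolding near_def by blast
      show "\<forall>j<n. \<bar>w' $ j - w $ j\<bar> < e P"
        using w' \<epsilon>1(2)[OF P] unfolding near_def \<eta>_def by force
    qed
    then have "initial_form (weyl_weight w) ` F = initial_form (weyl_weight w') ` F" by simp
    also have "\<dots> \<subseteq> ?in w'" using F(2) initial_form_in_initial_ideal by blast
    finally have "gen_left n (initial_form (weyl_weight w) ` F) \<subseteq> ?in w'"
      by (rule left_ideal_contains_gen[OF left_ideal_initial[OF H]])
    with F(3) show ?thesis by blast
  qed
  have eq: "?in w' = ?in w" if w': "w' \<in> near" "rat_indep w'" for w'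
  proof (rule max)
    have "\<bar>w' $ j - x $ j\<bar> < \<epsilon>" if "j < n" for j
    proof -
      have "\<bar>w' $ j - w $ j\<bar> < \<epsilon>2" using w' that unfolding near_def \<eta>_def by simp
      with \<epsilon>2(2)[OF that] show ?thesis by linarith
    qed
    with w' show "w' \<in> \<Omega>" unfolding near_def \<Omega>_def by blast
    show "?in w \<subseteq> ?in w'" by (rule sub[OF w'(1)])
  qed
  have init: "initial_form (weyl_weight w') P \<in> ?in w" if w': "w' \<in> near" and "P \<in> H" for w' P
    using that(2)
  proof (induction "card (keys (initial_form (weyl_weight w') P))" arbitrary: P rule: less_induct)
    case less
    have w'c: "w' \<in> carrier_vec n" using w' unfolding near_def by blast
    have lid: "left_ideal n (?in w)" by (rule left_ideal_initial[OF H])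
    show ?case
    proof (cases "P = 0")
      case True
      then show ?thesis using lid by (simp add: left_ideal_def)
    next
      case False
      define Q where "Q = initial_form (weyl_weight w') P"
      obtain \<delta> R where R: "P = Q + R" "Q \<noteq> 0" "\<And>m. m \<in> keys Q \<Longrightarrow> weyl_weight w' m = \<delta>"
        "\<And>m. m \<in> keys R \<Longrightarrow> weyl_weight w' m < \<delta>"
        using initial_form_decomp[OF False, of "weyl_weight w'"] unfolding Q_def by metis
      have lt: "weyl_weight w' m < weyl_weight w' m'" if "m \<in> keys R" "m' \<in> keys Q" for m m'
        using R(3)[OF that(2)] R(4)[OF that(1)] by simp
      obtain \<epsilon>3 where \<epsilon>3: "\<epsilon>3 > 0" and stable: "\<And>w'' m m'. w'' \<in> carrier_vec n \<Longrightarrow>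
         (\<And>j. j < n \<Longrightarrow> \<bar>w'' $ j - w' $ j\<bar> < \<epsilon>3) \<Longrightarrow>
         m \<in> keys R \<Longrightarrow> m' \<in> keys Q \<Longrightarrow> weyl_weight w'' m < weyl_weight w'' m'"
        using strict_order_stable[OF w'c finite_keys finite_keys lt] by blast
      have pos: "\<eta> - \<bar>w' $ j - w $ j\<bar> > 0" if "j < n" for j using w' that unfolding near_def by simp
      obtain \<epsilon>4 where \<epsilon>4: "\<epsilon>4 > 0" "\<And>j. j < n \<Longrightarrow> \<epsilon>4 \<le> \<eta> - \<bar>w' $ j - w $ j\<bar>"
        using common_positive_bound[of "{..<n}" "\<lambda>j. \<eta> - \<bar>w' $ j - w $ j\<bar>"] pos by auto
      obtain w'' where w'': "w'' \<in> carrier_vec n" "rat_indep w''" "\<And>j. j < n \<Longrightarrow> \<bar>w'' $ j - w' $ j\<bar> < min \<epsilon>3 \<epsilon>4"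
        using rat_indep_near[of "min \<epsilon>3 \<epsilon>4" w' n] \<epsilon>3 \<epsilon>4(1) w'c by auto
      have "w'' \<in> near"
      proof -
        have "\<bar>w'' $ j - w $ j\<bar> < \<eta>" if "j < n" for j
          using w''(3)[OF that] \<epsilon>4(2)[OF that] by (simp add: abs_if split: if_splits)
        with w''(1) show ?thesis unfolding near_def by blast
      qed
      define Q0 where "Q0 = initial_form (weyl_weight w'') Q"
      obtain \<delta>0 R0 where R0: "Q = Q0 + R0" "Q0 \<noteq> 0" "\<And>m. m \<in> keys Q0 \<Longrightarrow> weyl_weight w'' m = \<delta>0"
        "\<And>m. m \<in> keys R0 \<Longrightarrow> weyl_weight w'' m < \<delta>0"
        using initial_form_decomp[OF R(2), of "weyl_weight w''"] unfolding Q0_def by metis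
      have Q0_keys: "keys Q0 \<subseteq> keys Q"
        unfolding Q0_def by (rule initial_form_subset_keys)
      have "R0 = Q - Q0" using R0(1) by simp
      then have R0_keys: "keys R0 \<subseteq> keys Q"
        using keys_diff[of Q Q0] Q0_keys by blast
      obtain m0 where m0: "m0 \<in> keys Q0" using R0(2) by (metis ex_in_conv keys_eq_empty)
      have "initial_form (weyl_weight w'') (Q0 + (R0 + R)) = Q0"
      proof (rule initial_form_eqI[OF R0(2,3)])
        fix m assume "m \<in> keys (R0 + R)"
        then consider "m \<in> keys R0" | "m \<in> keys R"
          using Poly_Mapping.keys_add[of R0 R] by blast
        then show "weyl_weight w'' m < \<delta>0"
        proof cases
          case 1
          then show ?thesis by (rule R0(4))
        next
          case 2
          have "weyl_weight w'' m < weyl_weight w'' m0"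
            by (rule stable[OF w''(1) _ 2]) (use w''(3) m0 Q0_keys in auto)
          then show ?thesis using R0(3)[OF m0] by simp
        qed
      qed
      then have "initial_form (weyl_weight w'') P = Q0" using R(1) R0(1) by (simp add: add.assoc)
      then have Q0w: "Q0 \<in> ?in w"
        using initial_form_in_initial_ideal[OF less.prems, of w'' n] eq[OF \<open>w'' \<in> near\<close> w''(2)] by simp
      then have "Q0 \<in> ?in w'" using sub[OF w'] by blast
      moreover have Q0\<delta>: "weyl_weight w' m = \<delta>" if "m \<in> keys Q0" for m
        using R(3) Q0_keys that by blast
      from homogeneous_in_initial_ideal[OF H calculation R0(2) this]
      obtain P0 where P0: "P0 \<in> H" "\<And>m. m \<in> keys (P0 - Q0) \<Longrightarrow> weyl_weight w' m < \<delta>"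
        by metis
      have "R0 \<in> ?in w"
      proof (cases "R0 = 0")
        case True
        then show ?thesis using lid by (simp add: left_ideal_def)
      next
        case False
        have "initial_form (weyl_weight w') (R0 + (R - (P0 - Q0))) = R0"
        proof (rule initial_form_eqI[OF False])
          show "weyl_weight w' m = \<delta>" if "m \<in> keys R0" for m
            using R(3) R0_keys that by blast
          fix m assume "m \<in> keys (R - (P0 - Q0))"
          then have "m \<in> keys R \<or> m \<in> keys (P0 - Q0)"
            using keys_diff[of R "P0 - Q0"] by blast
          then show "weyl_weight w' m < \<delta>" using R(4) P0(2) by blast
        qed
        moreover have "R0 + (R - (P0 - Q0)) = P - P0" using R(1) R0(1) by simp
        ultimately have ini: "initial_form (weyl_weight w') (P - P0) = R0" by simp
        have "m0 \<notin> keys R0" using R0(3)[OF m0] R0(4)[of m0] by auto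
        moreover have "m0 \<in> keys Q" using m0 Q0_keys by blast
        ultimately have "keys R0 \<subset> keys Q" using R0_keys by blast
        then have "card (keys R0) < card (keys Q)"
          by (rule psubset_card_mono[OF finite_keys])
        then have "initial_form (weyl_weight w') (P - P0) \<in> ?in w"
          by (intro less.hyps) (simp_all add: ini Q_def left_ideal_diff[OF H less.prems P0(1)])
        then show ?thesis by (simp add: ini)
      qed
      with Q0w have "Q0 + R0 \<in> ?in w" using lid unfolding left_ideal_def by blast
      then show ?thesis using R0(1) Q_def by simp
    qed
  qed
  have const: "?in w' = ?in w" if w': "w' \<in> near" for w'
  proof
    show "?in w \<subseteq> ?in w'" by (rule sub[OF w'])
    have "initial_form (weyl_weight w') ` H \<subseteq> ?in w" using init[OF w'] by blast
    then have "gen_left n (initial_form (weyl_weight w') ` H) \<subseteq> ?in w"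
      by (rule left_ideal_contains_gen[OF left_ideal_initial[OF H]])
    then show "?in w' \<subseteq> ?in w" by (simp add: weyl_initial_ideal_def weyl_weight_def)
  qed
  let ?C = "{w' \<in> carrier_vec n. ?in w' = ?in w}"
  have "?C \<in> small_groebner_fan n H" unfolding small_groebner_fan_def using wc by blast
  moreover have "w \<in> weight_interior n ?C"
  proof -
    have "w' \<in> ?C" if "w' \<in> carrier_vec n" "\<forall>j<n. \<bar>w' $ j - w $ j\<bar> < \<eta>" for w'
      using const[of w'] that unfolding near_def by blast
    then show ?thesis unfolding weight_interior_def using wc \<eta> by blast
  qed
  ultimately show ?thesis using that[OF wc wr wx] by blast
qed

section \<open>The matrix, its lattice and its matroid\<close>

text \<open>A lattice vector \<open>u\<close> has the entry \<open>ca j * u\<^sub>0 + cb j * u\<^sub>1\<close> in column \<open>j\<close>, which depends only on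
  the type \<open>j mod 5\<close>. In terms of \<open>\<lambda>\<^sub>3 = u\<^sub>0\<close> and \<open>- \<lambda>\<^sub>1 = u\<^sub>1\<close> the five forms are
  \<open>\<lambda>\<^sub>3, - \<lambda>\<^sub>1, - \<lambda>\<^sub>3, \<lambda>\<^sub>2, \<lambda>\<^sub>1 - \<lambda>\<^sub>2\<close>. The opposite pair \<open>\<lambda>\<^sub>3, - \<lambda>\<^sub>3\<close> produces the obstruction; the last
  form makes the sum vanish, which is homogeneity.\<close>

definition ca :: "nat \<Rightarrow> int" where
  "ca j = (if j mod 5 = 0 then 1 else if j mod 5 = 1 then 0 else if j mod 5 = 2 then - 1
     else if j mod 5 = 3 then 7 else - 7)"

definition cb :: "nat \<Rightarrow> int" where
  "cb j = (if j mod 5 = 0 then 0 else if j mod 5 = 1 then 1 else if j mod 5 = 2 then 0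
     else if j mod 5 = 3 then 2 else - 3)"

text \<open>Row \<open>i\<close> is the relation that expresses the entry \<open>i + 2\<close> of a lattice vector by its entries 0 and 1.\<close>

definition A_mat :: "nat \<Rightarrow> int mat" where
  "A_mat q = mat (5 * q - 2) (5 * q)
     (\<lambda>(i, j). if j = i + 2 then 1 else if j = 0 then - ca (i + 2) else if j = 1 then - cb (i + 2) else 0)"

lemma A_mat_carrier: "A_mat q \<in> carrier_mat (5 * q - 2) (5 * q)"
  by (simp add: A_mat_def)

lemma dim_A_mat [simp]: "dim_row (A_mat q) = 5 * q - 2" "dim_col (A_mat q) = 5 * q"
  by (simp_all add: A_mat_def)

lemma A_mat_row_sum:
  fixes f :: "nat \<Rightarrow> 'a :: comm_ring_1"
  assumes "i < 5 * q - 2"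
  shows "(\<Sum>j<5 * q. of_int (A_mat q $$ (i, j)) * f j) = f (i + 2) - of_int (ca (i + 2)) * f 0 - of_int (cb (i + 2)) * f 1"
proof -
  have "(\<Sum>j<5 * q. of_int (A_mat q $$ (i, j)) * f j) = (\<Sum>j\<in>{0, 1, i + 2}. of_int (A_mat q $$ (i, j)) * f j)"
    by (rule sum.mono_neutral_right) (use assms in \<open>auto simp: A_mat_def\<close>)
  also have "\<dots> = f (i + 2) - of_int (ca (i + 2)) * f 0 - of_int (cb (i + 2)) * f 1"
    using assms by (simp add: A_mat_def)
  finally show ?thesis .
qed

definition latt :: "nat \<Rightarrow> int \<Rightarrow> int \<Rightarrow> int vec" where
  "latt q a b = vec (5 * q) (\<lambda>j. ca j * a + cb j * b)"

lemma dim_latt [simp]: "dim_vec (latt q a b) = 5 * q"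
  by (simp add: latt_def)

lemma latt_carrier [simp]: "latt q a b \<in> carrier_vec (5 * q)"
  by (simp add: latt_def)

lemma latt_index [simp]: "j < 5 * q \<Longrightarrow> latt q a b $ j = ca j * a + cb j * b"
  by (simp add: latt_def)

lemma ca_cb_01 [simp]: "ca 0 = 1" "cb 0 = 0" "ca 1 = 0" "cb 1 = 1" "ca (Suc 0) = 0" "cb (Suc 0) = 1"
  by (simp_all add: ca_def cb_def)

lemma zero_one_or_more: "(j :: nat) = 0 \<or> j = 1 \<or> (\<exists>i. j = i + 2)"
  by presburger

lemma A_mat_ker_iff:
  assumes "q \<ge> 1" "u \<in> carrier_vec (5 * q)"
  shows "u \<in> ker_lattice (A_mat q) \<longleftrightarrow> u = latt q (u $ 0) (u $ 1)"
proof -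
  have idx: "(A_mat q *\<^sub>v u) $ i = u $ (i + 2) - ca (i + 2) * u $ 0 - cb (i + 2) * u $ 1" if "i < 5 * q - 2" for i
  proof -
    have "(A_mat q *\<^sub>v u) $ i = (\<Sum>j<5 * q. of_int (A_mat q $$ (i, j)) * u $ j)"
      using that assms(2) by (simp add: scalar_prod_def atLeast0LessThan)
    then show ?thesis using A_mat_row_sum[OF that, of "\<lambda>j. u $ j"] by simp
  qed
  show ?thesis
  proof
    assume "u \<in> ker_lattice (A_mat q)"
    then have z: "(A_mat q *\<^sub>v u) $ i = 0" if "i < 5 * q - 2" for i
      using that by (simp add: mat_kernel_def)
    have entry: "u $ j = ca j * u $ 0 + cb j * u $ 1" if "j < 5 * q" for j
    proof -
      consider "j = 0" | "j = 1" | i where "j = i + 2"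
        using zero_one_or_more[of j] by auto
      then show ?thesis
      proof cases
        case 3
        then have "i < 5 * q - 2" using that by simp
        from idx[OF this] z[OF this] show ?thesis using 3 by simp
      qed simp_all
    qed
    show "u = latt q (u $ 0) (u $ 1)"
    proof (rule eq_vecI)
      show "u $ j = latt q (u $ 0) (u $ 1) $ j" if "j < dim_vec (latt q (u $ 0) (u $ 1))" for j
        using that entry[of j] by simp
      show "dim_vec u = dim_vec (latt q (u $ 0) (u $ 1))" using assms(2) by simp
    qed
  next
    assume u: "u = latt q (u $ 0) (u $ 1)"
    have "(A_mat q *\<^sub>v u) $ i = 0" if "i < 5 * q - 2" for i
    proof -
      have "i + 2 < 5 * q" using that by simp
      then have "latt q (u $ 0) (u $ 1) $ (i + 2) = ca (i + 2) * u $ 0 + cb (i + 2) * u $ 1"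
        by (rule latt_index)
      moreover have "u $ (i + 2) = latt q (u $ 0) (u $ 1) $ (i + 2)" by (rule arg_cong[OF u])
      ultimately have "u $ (i + 2) = ca (i + 2) * u $ 0 + cb (i + 2) * u $ 1" by (rule trans[rotated])
      then show ?thesis unfolding idx[OF that] by simp
    qed
    then have "A_mat q *\<^sub>v u = 0\<^sub>v (5 * q - 2)" by (intro eq_vecI) simp_all
    then show "u \<in> ker_lattice (A_mat q)"
      using assms(2) unfolding mat_kernel_def by simp
  qed
qed

lemma ker_A_mat:
  assumes "q \<ge> 1"
  shows "ker_lattice (A_mat q) = {latt q a b | a b. True}"
proof -
  have "u \<in> carrier_vec (5 * q)" if "u \<in> ker_lattice (A_mat q)" for u
    using that by (simp add: mat_kernel_def)
  moreover have "latt q a b = latt q (latt q a b $ 0) (latt q a b $ 1)" for a b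
    using assms by simp
  ultimately show ?thesis using A_mat_ker_iff[OF assms] by (blast intro: latt_carrier)
qed

lemma latt_in_ker: "q \<ge> 1 \<Longrightarrow> latt q a b \<in> ker_lattice (A_mat q)"
  using ker_A_mat by blast

lemma latt_inj:
  assumes "q \<ge> 1" "latt q a b = latt q a' b'"
  shows "a = a' \<and> b = b'"
proof -
  have "latt q a b $ 0 = latt q a' b' $ 0" "latt q a b $ 1 = latt q a' b' $ 1"
    by (simp_all only: assms(2))
  then show ?thesis using assms(1) by simp
qed

lemma rank_A_mat:
  "vec_space.rank (5 * q - 2) (map_mat rat_of_int (A_mat q)) = 5 * q - 2"
proof -
  let ?n = "5 * q - 2" and ?A = "map_mat rat_of_int (A_mat q)"
  interpret vec_space "TYPE(rat)" ?n .
  have A: "?A \<in> carrier_mat ?n (5 * q)" using A_mat_carrier by simp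
  have cols: "set (cols ?A) \<subseteq> carrier_vec ?n" using cols_dim[of ?A] A by simp
  have "unit_vec ?n i \<in> set (cols ?A)" if "i < ?n" for i
  proof -
    have "col ?A (i + 2) = unit_vec ?n i"
      by (rule eq_vecI) (use that in \<open>auto simp: A_mat_def\<close>)
    moreover have "col ?A (i + 2) \<in> set (cols ?A)" using that by (simp add: cols_def)
    ultimately show ?thesis by simp
  qed
  then have "set (unit_vecs ?n) \<subseteq> set (cols ?A)" by (auto simp: unit_vecs_def)
  then have "span (set (unit_vecs ?n)) \<subseteq> span (set (cols ?A))" by (rule span_is_monotone)
  then have "carrier_vec ?n \<subseteq> span (set (cols ?A))" by (simp add: span_unit_vecs_is_carrier)
  moreover have "span (set (cols ?A)) \<subseteq> carrier_vec ?n" using span_is_subset2[OF cols] by simp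
  ultimately have "span (set (cols ?A)) = carrier V" by simp
  then have "span_vs (set (cols ?A)) = V" by simp
  then show ?thesis using dim_is_n by (simp add: rank_def)
qed

lemma sum_types:
  fixes f :: "nat \<Rightarrow> int"
  shows "(\<Sum>j<5 * q. f (j mod 5)) = int q * (f 0 + f 1 + f 2 + f 3 + f 4)"
proof (induction q)
  case (Suc q)
  have "5 * Suc q = Suc (Suc (Suc (Suc (Suc (5 * q)))))" by simp
  moreover have "(5 * q) mod 5 = 0" "Suc (5 * q) mod 5 = 1" "Suc (Suc (5 * q)) mod 5 = 2"
    "Suc (Suc (Suc (5 * q))) mod 5 = 3" "Suc (Suc (Suc (Suc (5 * q)))) mod 5 = 4" by presburger+
  ultimately show ?case using Suc by (simp only: sum.lessThan_Suc) (simp add: algebra_simps)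
qed simp

lemma ca_mod: "ca (j mod 5) = ca j" and cb_mod: "cb (j mod 5) = cb j"
  by (simp_all add: ca_def cb_def)

lemma sum_ca: "(\<Sum>j<5 * q. ca j) = 0" and sum_cb: "(\<Sum>j<5 * q. cb j) = 0"
proof -
  show "(\<Sum>j<5 * q. ca j) = 0" using sum_types[of ca q] by (simp add: ca_mod) (simp add: ca_def)
  show "(\<Sum>j<5 * q. cb j) = 0" using sum_types[of cb q] by (simp add: cb_mod) (simp add: cb_def)
qed

text \<open>The sum of all rows is the all-one row, since the five forms add up to zero. The rank is full
  because the columns from the third on are the unit vectors.\<close>

lemma homogeneous_A_mat:
  assumes "q \<ge> 1"
  shows "homogeneous_matrix (A_mat q)"
proof -
  let ?n = "5 * q - 2"
  let ?c = "vec ?n (\<lambda>_. 1 :: real)"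
  have "?c \<bullet> col (map_mat real_of_int (A_mat q)) j = 1" if j: "j < 5 * q" for j
  proof -
    have "?c \<bullet> col (map_mat real_of_int (A_mat q)) j = (\<Sum>i<?n. real_of_int (A_mat q $$ (i, j)))"
      using j by (simp add: scalar_prod_def atLeast0LessThan)
    also have "\<dots> = real_of_int (\<Sum>i<?n. A_mat q $$ (i, j))" by simp
    also have "(\<Sum>i<?n. A_mat q $$ (i, j)) = 1"
    proof -
      have split: "{..<5 * q} = {0, 1} \<union> (\<lambda>i. i + 2) ` {..<?n}"
      proof -
        have "x \<in> (\<lambda>i. i + 2) ` {..<?n}" if "x < 5 * q" "x \<noteq> 0" "x \<noteq> 1" for x
          using that by (intro image_eqI[of _ _ "x - 2"]) auto
        then show ?thesis using assms by auto
      qed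
      have shift: "(\<Sum>j<5 * q. f j) = f 0 + f 1 + (\<Sum>i<?n. f (i + 2))" for f :: "nat \<Rightarrow> int"
        unfolding split by (subst sum.union_disjoint) (auto simp: sum.reindex inj_on_def o_def)
      consider "j = 0" | "j = 1" | k where "j = k + 2" "k < ?n"
        using j zero_one_or_more[of j] by fastforce
      then show ?thesis
      proof cases
        case 1
        then have "(\<Sum>i<?n. A_mat q $$ (i, j)) = (\<Sum>i<?n. - ca (i + 2))"
          using j by (intro sum.cong) (auto simp: A_mat_def)
        then show ?thesis using shift[of ca] sum_ca[of q] by (simp add: sum_negf)
      next
        case 2
        then have "(\<Sum>i<?n. A_mat q $$ (i, j)) = (\<Sum>i<?n. - cb (i + 2))"
          using j by (intro sum.cong) (auto simp: A_mat_def)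
        then show ?thesis using shift[of cb] sum_cb[of q] by (simp add: sum_negf)
      next
        case 3
        then have "(\<Sum>i<?n. A_mat q $$ (i, j)) = (\<Sum>i<?n. if i = k then 1 else 0)"
          using j by (intro sum.cong) (auto simp: A_mat_def)
        then show ?thesis using 3(2) by simp
      qed
    qed
    finally show ?thesis by simp
  qed
  then have "\<exists>c\<in>carrier_vec ?n. \<exists>b::real. b \<noteq> 0 \<and> (\<forall>j<5 * q. c \<bullet> col (map_mat real_of_int (A_mat q)) j = b)"
    by (intro bexI[of _ ?c] exI[of _ "1::real"]) auto
  then show ?thesis unfolding homogeneous_matrix_def using rank_A_mat[of q] by simp
qed

lemma lattice_rank_A_mat: "q \<ge> 1 \<Longrightarrow> lattice_rank (A_mat q) = 2"
  by (simp add: lattice_rank_def)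

subsection \<open>Circuits\<close>

text \<open>A linear relation between the columns in \<open>J\<close> is a rational point of the kernel that vanishes outside
  \<open>J\<close>. The points of the kernel are parametrized by their entries \<open>p, r\<close> at the columns 0 and 1.\<close>

lemma columns_indep_A_mat:
  assumes q: "q \<ge> 1" and J: "J \<subseteq> {..<5 * q}"
  shows "columns_indep (A_mat q) J \<longleftrightarrow>
    (\<forall>p r. (\<forall>j<5 * q. j \<notin> J \<longrightarrow> rat_of_int (ca j) * p + rat_of_int (cb j) * r = 0) \<longrightarrow>
       (\<forall>j\<in>J. rat_of_int (ca j) * p + rat_of_int (cb j) * r = 0))"
proof -
  have fin: "finite J" using J finite_subset by blast
  have sum: "(\<Sum>j\<in>J. c j * rat_of_int (A_mat q $$ (i, j))) =
      f (i + 2) - of_int (ca (i + 2)) * f 0 - of_int (cb (i + 2)) * f 1"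
    if "i < 5 * q - 2" and f: "f = (\<lambda>j. if j \<in> J then c j else 0)" for c f i
  proof -
    have "(\<Sum>j\<in>J. c j * rat_of_int (A_mat q $$ (i, j)))
        = (\<Sum>j<5 * q. rat_of_int (A_mat q $$ (i, j)) * f j)"
      using J by (intro sum.mono_neutral_cong_left) (auto simp: f)
    then show ?thesis using A_mat_row_sum[OF that(1), of f] by simp
  qed
  show ?thesis
  proof
    assume ind: "columns_indep (A_mat q) J"
    show "\<forall>p r. (\<forall>j<5 * q. j \<notin> J \<longrightarrow> rat_of_int (ca j) * p + rat_of_int (cb j) * r = 0) \<longrightarrow>
       (\<forall>j\<in>J. rat_of_int (ca j) * p + rat_of_int (cb j) * r = 0)"
    proof (intro allI impI)
      fix p r assume off: "\<forall>j<5 * q. j \<notin> J \<longrightarrow> rat_of_int (ca j) * p + rat_of_int (cb j) * r = 0"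
      let ?c = "\<lambda>j. rat_of_int (ca j) * p + rat_of_int (cb j) * r"
      have f: "(if j \<in> J then ?c j else 0) = ?c j" if "j < 5 * q" for j using off that by simp
      have "(\<Sum>j\<in>J. ?c j * rat_of_int (A_mat q $$ (i, j))) = 0" if "i < 5 * q - 2" for i
      proof -
        have "i + 2 < 5 * q" "0 < 5 * q" "1 < 5 * q" using that q by auto
        then show ?thesis unfolding sum[OF that refl] by (simp only: f) simp
      qed
      then have "\<forall>i<dim_row (A_mat q). (\<Sum>j\<in>J. ?c j * rat_of_int (A_mat q $$ (i, j))) = 0" by simp
      with spec[OF ind[unfolded columns_indep_def], of ?c] show "\<forall>j\<in>J. ?c j = 0" by (rule mp)
    qed
  next
    assume van: "\<forall>p r. (\<forall>j<5 * q. j \<notin> J \<longrightarrow> rat_of_int (ca j) * p + rat_of_int (cb j) * r = 0) \<longrightarrow>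
       (\<forall>j\<in>J. rat_of_int (ca j) * p + rat_of_int (cb j) * r = 0)"
    show "columns_indep (A_mat q) J"
      unfolding columns_indep_def
    proof (intro allI impI)
      fix c assume c: "\<forall>i<dim_row (A_mat q). (\<Sum>j\<in>J. c j * rat_of_int (A_mat q $$ (i, j))) = 0"
      define f where "f = (\<lambda>j. if j \<in> J then c j else 0)"
      have f: "f j = rat_of_int (ca j) * f 0 + rat_of_int (cb j) * f 1" if "j < 5 * q" for j
      proof -
        consider "j = 0" | "j = 1" | i where "j = i + 2"
          using zero_one_or_more[of j] by blast
        then show ?thesis
        proof cases
          case 3
          then have i: "i < 5 * q - 2" using that by simp
          have "i < dim_row (A_mat q)" using i by simp
          with c have "(\<Sum>j\<in>J. c j * rat_of_int (A_mat q $$ (i, j))) = 0" by blast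
          then have "f (i + 2) - of_int (ca (i + 2)) * f 0 - of_int (cb (i + 2)) * f 1 = 0"
            unfolding sum[OF i f_def] .
          then show ?thesis unfolding 3 by (simp add: algebra_simps)
        next
          case 1
          show ?thesis unfolding 1 by simp
        next
          case 2
          show ?thesis unfolding 2 by simp
        qed
      qed
      have "\<forall>j<5 * q. j \<notin> J \<longrightarrow> rat_of_int (ca j) * f 0 + rat_of_int (cb j) * f 1 = 0"
      proof (intro allI impI)
        fix j assume "j < 5 * q" "j \<notin> J"
        then show "rat_of_int (ca j) * f 0 + rat_of_int (cb j) * f 1 = 0"
          unfolding f[symmetric, OF \<open>j < 5 * q\<close>] by (simp add: f_def)
      qed
      then have on: "\<forall>j\<in>J. rat_of_int (ca j) * f 0 + rat_of_int (cb j) * f 1 = 0" using van by blast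
      show "\<forall>j\<in>J. c j = 0"
      proof
        fix j assume j: "j \<in> J"
        then have "j < 5 * q" using J by auto
        from f[OF this] on j have "f j = 0" by simp
        with j show "c j = 0" by (simp add: f_def)
      qed
    qed
  qed
qed

definition cdet :: "nat \<Rightarrow> nat \<Rightarrow> int" where
  "cdet i j = ca i * cb j - cb i * ca j"

text \<open>The points of the kernel that vanish at column \<open>k\<close> form a line, and \<open>J\<close> is the support of its
  nonzero points. Hence no smaller set supports a relation.\<close>

lemma matroid_circuit_A_mat:
  assumes q: "q \<ge> 1" and k: "k < 5 * q" and J: "J = {j. j < 5 * q \<and> cdet k j \<noteq> 0}" "J \<noteq> {}"
  shows "matroid_circuit (A_mat q) J"
  unfolding matroid_circuit_def
proof (intro conjI ballI)
  show sub: "J \<subseteq> {..<dim_col (A_mat q)}" using J by auto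
  have subJ: "J \<subseteq> {..<5 * q}" using J by auto
  show "\<not> columns_indep (A_mat q) J"
  proof
    assume "columns_indep (A_mat q) J"
    moreover have "rat_of_int (ca j) * rat_of_int (- cb k) + rat_of_int (cb j) * rat_of_int (ca k) = rat_of_int (cdet k j)" for j
      by (simp add: cdet_def)
    ultimately have "\<forall>j\<in>J. cdet k j = 0"
      using columns_indep_A_mat[OF q subJ] J(1) by (metis (mono_tags, lifting) mem_Collect_eq of_int_0 of_int_eq_0_iff)
    then show False using J by blast
  qed
  fix j assume j: "j \<in> J"
  have "J - {j} \<subseteq> {..<5 * q}" using subJ by blast
  moreover have "p = 0 \<and> r = 0"
    if off: "\<forall>i<5 * q. i \<notin> J - {j} \<longrightarrow> rat_of_int (ca i) * p + rat_of_int (cb i) * r = 0" for p r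
  proof -
    have "k \<notin> J" using J by (simp add: cdet_def)
    then have 1: "rat_of_int (ca k) * p + rat_of_int (cb k) * r = 0" using off k by blast
    have 2: "rat_of_int (ca j) * p + rat_of_int (cb j) * r = 0" using off j subJ by blast
    have d: "rat_of_int (cdet k j) \<noteq> 0" using j J by simp
    have "rat_of_int (cdet k j) * p = rat_of_int (cb j) * (rat_of_int (ca k) * p + rat_of_int (cb k) * r)
        - rat_of_int (cb k) * (rat_of_int (ca j) * p + rat_of_int (cb j) * r)"
      by (simp add: cdet_def algebra_simps)
    moreover have "rat_of_int (cdet k j) * r = rat_of_int (ca k) * (rat_of_int (ca j) * p + rat_of_int (cb j) * r)
        - rat_of_int (ca j) * (rat_of_int (ca k) * p + rat_of_int (cb k) * r)"
      by (simp add: cdet_def algebra_simps)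
    ultimately have "rat_of_int (cdet k j) * p = 0" "rat_of_int (cdet k j) * r = 0"
      unfolding 1 2 by simp_all
    with d show ?thesis by simp
  qed
  ultimately show "columns_indep (A_mat q) (J - {j})"
    using columns_indep_A_mat[OF q, of "J - {j}"] by (metis add.right_neutral mult_zero_right)
qed

text \<open>The forms at the columns 0, 1 and 3 are pairwise independent and the forms at \<open>i\<close> and \<open>j\<close> are each
  proportional to at most one of them. A circuit attached to a remaining one contains \<open>i\<close> and \<open>j\<close>.\<close>

lemma connected_A_mat:
  assumes "q \<ge> 1"
  shows "connected_column_matroid (A_mat q)"
  unfolding connected_column_matroid_def
proof (intro allI impI)
  fix i j assume ij: "i < dim_col (A_mat q)" "j < dim_col (A_mat q)"
  have types: "t mod 5 = 0 \<or> t mod 5 = 1 \<or> t mod 5 = 2 \<or> t mod 5 = 3 \<or> t mod 5 = 4" for t :: nat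
    using mod_less_divisor[of 5 t] by linarith
  have "\<exists>k\<in>{0, 1, 3}. cdet k i \<noteq> 0 \<and> cdet k j \<noteq> 0"
    using types[of i] types[of j]
    by (elim disjE) (simp_all add: cdet_def ca_def cb_def)
  then obtain k where k: "k \<in> {0, 1, 3}" "cdet k i \<noteq> 0" "cdet k j \<noteq> 0" by blast
  let ?J = "{j. j < 5 * q \<and> cdet k j \<noteq> 0}"
  have "k < 5 * q" using k(1) assms by auto
  moreover have "i \<in> ?J" "j \<in> ?J" using k ij by auto
  ultimately show "\<exists>J. matroid_circuit (A_mat q) J \<and> i \<in> J \<and> j \<in> J"
    using matroid_circuit_A_mat[OF assms, of k ?J] by blast
qed

subsection \<open>Gale duals\<close>

text \<open>The columns of \<open>B\<close> lie in the lattice, which determines all rows by the first two; if these were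
  dependent, multiplication by \<open>B\<close> would not be injective.\<close>

lemma gale_dual_rows:
  assumes q: "q \<ge> 1" and B: "gale_dual (A_mat q) B"
  shows "B \<in> carrier_mat (5 * q) 2"
    and "\<And>j k. j < 5 * q \<Longrightarrow> k < 2 \<Longrightarrow> B $$ (j, k) = ca j * B $$ (0, k) + cb j * B $$ (1, k)"
    and "B $$ (0, 0) * B $$ (1, 1) - B $$ (0, 1) * B $$ (1, 0) \<noteq> 0"
proof -
  show c: "B \<in> carrier_mat (5 * q) 2"
    using B lattice_rank_A_mat[OF q] unfolding gale_dual_def by simp
  have bij: "bij_betw (\<lambda>c. B *\<^sub>v c) (carrier_vec 2) (ker_lattice (A_mat q))"
    using B lattice_rank_A_mat[OF q] unfolding gale_dual_def by simp
  have im: "B *\<^sub>v c = latt q ((B *\<^sub>v c) $ 0) ((B *\<^sub>v c) $ 1)" if "c \<in> carrier_vec 2" for c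
  proof -
    have "B *\<^sub>v c \<in> ker_lattice (A_mat q)" using bij that by (rule bij_betwE[THEN bspec])
    moreover have "B *\<^sub>v c \<in> carrier_vec (5 * q)" using c that by simp
    ultimately show ?thesis using A_mat_ker_iff[OF q] by blast
  qed
  have idx: "(B *\<^sub>v c) $ j = B $$ (j, 0) * c $ 0 + B $$ (j, 1) * c $ 1" if "j < 5 * q" "c \<in> carrier_vec 2" for c j
    using that c by (simp add: scalar_prod_def numeral_2_eq_2)
  show rows: "B $$ (j, k) = ca j * B $$ (0, k) + cb j * B $$ (1, k)" if j: "j < 5 * q" and k: "k < 2" for j k
  proof -
    let ?e = "unit_vec 2 k :: int vec"
    have e: "(B *\<^sub>v ?e) $ i = B $$ (i, k)" if "i < 5 * q" for i
    proof -
      have "k = 0 \<or> k = 1" using k by auto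
      then show ?thesis using idx[OF that, of ?e] by auto
    qed
    have "(B *\<^sub>v ?e) $ j = latt q ((B *\<^sub>v ?e) $ 0) ((B *\<^sub>v ?e) $ 1) $ j"
      using arg_cong[OF im[of ?e], of "\<lambda>x. x $ j"] by simp
    then show ?thesis using j q by (simp add: e)
  qed
  show "B $$ (0, 0) * B $$ (1, 1) - B $$ (0, 1) * B $$ (1, 0) \<noteq> 0"
  proof
    assume det: "B $$ (0, 0) * B $$ (1, 1) - B $$ (0, 1) * B $$ (1, 0) = 0"
    have zero: "c = 0\<^sub>v 2" if cc: "c \<in> carrier_vec 2" and r: "B $$ (0, 0) * c $ 0 + B $$ (0, 1) * c $ 1 = 0"
      "B $$ (1, 0) * c $ 0 + B $$ (1, 1) * c $ 1 = 0" for c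
    proof -
      have "(B *\<^sub>v c) $ 0 = 0" "(B *\<^sub>v c) $ 1 = 0" using idx[OF _ cc] q r by auto
      then have "B *\<^sub>v c = latt q 0 0" using im[OF cc] by simp
      also have "\<dots> = 0\<^sub>v (5 * q)" by (rule eq_vecI) simp_all
      also have "\<dots> = B *\<^sub>v 0\<^sub>v 2" using c by (intro eq_vecI) (auto simp: scalar_prod_def)
      finally show ?thesis using bij_betw_imp_inj_on[OF bij] cc by (auto dest: inj_onD)
    qed
    have zero': "x = 0 \<and> y = 0" if "B $$ (0, 0) * x + B $$ (0, 1) * y = 0" "B $$ (1, 0) * x + B $$ (1, 1) * y = 0" for x y
    proof -
      let ?c = "vec 2 (\<lambda>i. if i = 0 then x else y)"
      have c: "?c $ 0 = x" "?c $ 1 = y" by simp_all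
      have "?c = 0\<^sub>v 2" by (rule zero) (unfold c, simp, rule that(1), rule that(2))
      then have "?c $ 0 = 0\<^sub>v 2 $ 0" "?c $ 1 = 0\<^sub>v 2 $ 1" by (simp_all only:)
      then show ?thesis unfolding c by simp
    qed
    have "B $$ (0, 1) = 0 \<and> - B $$ (0, 0) = 0"
      using det by (intro zero') (simp_all add: algebra_simps)
    moreover have "B $$ (1, 1) = 0 \<and> - B $$ (1, 0) = 0"
      using det by (intro zero') (simp_all add: algebra_simps)
    ultimately show False using zero'[of 1 0] by simp
  qed
qed

text \<open>The columns are the lattice vectors with entries \<open>(1, -2)\<close> and \<open>(1, -3)\<close> at the columns 0 and 1;
  with this basis the forms are \<open>\<lambda>\<^sub>3 = s\<^sub>1 + s\<^sub>2\<close> and \<open>- \<lambda>\<^sub>1 = - 2 s\<^sub>1 - 3 s\<^sub>2\<close> there.\<close>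

definition B_mat :: "nat \<Rightarrow> int mat" where
  "B_mat q = mat (5 * q) 2 (\<lambda>(j, k). if k = 0 then ca j - 2 * cb j else ca j - 3 * cb j)"

lemma gale_dual_B_mat:
  assumes "q \<ge> 1"
  shows "gale_dual (A_mat q) (B_mat q)"
proof -
  have mult: "B_mat q *\<^sub>v c = latt q (c $ 0 + c $ 1) (- 2 * c $ 0 - 3 * c $ 1)" if "c \<in> carrier_vec 2" for c
    by (rule eq_vecI) (use that in \<open>auto simp: B_mat_def scalar_prod_def numeral_2_eq_2 algebra_simps\<close>)
  have "bij_betw (\<lambda>c. B_mat q *\<^sub>v c) (carrier_vec 2) (ker_lattice (A_mat q))"
  proof (rule bij_betwI')
    fix c d :: "int vec" assume cd: "c \<in> carrier_vec 2" "d \<in> carrier_vec 2"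
    show "B_mat q *\<^sub>v c = B_mat q *\<^sub>v d \<longleftrightarrow> c = d"
    proof
      assume "B_mat q *\<^sub>v c = B_mat q *\<^sub>v d"
      then have "c $ 0 + c $ 1 = d $ 0 + d $ 1 \<and> - 2 * c $ 0 - 3 * c $ 1 = - 2 * d $ 0 - 3 * d $ 1"
        unfolding mult[OF cd(1)] mult[OF cd(2)] by (rule latt_inj[OF assms])
      then have "c $ 0 = d $ 0" "c $ 1 = d $ 1" by linarith+
      then show "c = d" using cd by (intro eq_vecI) (auto simp: less_2_cases_iff)
    qed simp
  next
    fix c :: "int vec" assume "c \<in> carrier_vec 2"
    then show "B_mat q *\<^sub>v c \<in> ker_lattice (A_mat q)" using mult latt_in_ker[OF assms] by simp
  next
    fix u assume "u \<in> ker_lattice (A_mat q)"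
    then obtain a b where u: "u = latt q a b" using ker_A_mat[OF assms] by blast
    let ?c = "vec 2 (\<lambda>i. if i = 0 then 3 * a + b else - 2 * a - b) :: int vec"
    have "B_mat q *\<^sub>v ?c = u" unfolding u by (subst mult) auto
    then show "\<exists>c\<in>carrier_vec 2. u = B_mat q *\<^sub>v c" by (intro bexI[of _ ?c]) auto
  qed
  moreover have "B_mat q \<in> carrier_mat (5 * q) 2" by (simp add: B_mat_def)
  ultimately show ?thesis unfolding gale_dual_def by (simp add: lattice_rank_A_mat[OF assms])
qed

section \<open>Negative supports\<close>

definition types :: "nat \<Rightarrow> nat set \<Rightarrow> nat set" where
  "types q T = {j. j < 5 * q \<and> j mod 5 \<in> T}"

definition v_entry :: "nat \<Rightarrow> int" where
  "v_entry j = (if j mod 5 \<in> {0, 4} then - 1 else 0)"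

definition v_vec :: "nat \<Rightarrow> complex vec" where
  "v_vec q = vec (5 * q) (\<lambda>j. of_int (v_entry j))"

text \<open>The types at which the sum of the fake exponent and the lattice vector \<open>latt q a b\<close> is negative.
  At the types 0 and 4, where the fake exponent is \<open>-1\<close>, the lattice vector only has to be nonpositive.\<close>

definition neg_types :: "int \<Rightarrow> int \<Rightarrow> nat set" where
  "neg_types a b = {t. t = 0 \<and> a \<le> 0 \<or> t = 1 \<and> b < 0 \<or> t = 2 \<and> a > 0 \<or> t = 3 \<and> 7 * a + 2 * b < 0 \<or>
     t = 4 \<and> 7 * a + 3 * b \<ge> 0}"

lemma mod5_cases: "t mod 5 = 0 \<or> t mod 5 = 1 \<or> t mod 5 = 2 \<or> t mod 5 = 3 \<or> t mod 5 = (4 :: nat)"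
  using mod_less_divisor[of 5 t] by linarith

lemma dim_v_vec [simp]: "dim_vec (v_vec q) = 5 * q"
  by (simp add: v_vec_def)

lemma v_vec_carrier [simp]: "v_vec q \<in> carrier_vec (5 * q)"
  by (simp add: v_vec_def)

lemma neg_types_mem:
  "0 \<in> neg_types a b \<longleftrightarrow> a \<le> 0" "1 \<in> neg_types a b \<longleftrightarrow> b < 0" "2 \<in> neg_types a b \<longleftrightarrow> a > 0"
  "3 \<in> neg_types a b \<longleftrightarrow> 7 * a + 2 * b < 0" "4 \<in> neg_types a b \<longleftrightarrow> 7 * a + 3 * b \<ge> 0"
  by (simp_all add: neg_types_def)

lemma coefficients_by_type:
  "j mod 5 = 0 \<Longrightarrow> ca j = 1 \<and> cb j = 0 \<and> v_entry j = - 1"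
  "j mod 5 = 1 \<Longrightarrow> ca j = 0 \<and> cb j = 1 \<and> v_entry j = 0"
  "j mod 5 = 2 \<Longrightarrow> ca j = - 1 \<and> cb j = 0 \<and> v_entry j = 0"
  "j mod 5 = 3 \<Longrightarrow> ca j = 7 \<and> cb j = 2 \<and> v_entry j = 0"
  "j mod 5 = 4 \<Longrightarrow> ca j = - 7 \<and> cb j = - 3 \<and> v_entry j = - 1"
  by (simp_all add: ca_def cb_def v_entry_def)

lemma neg_types_iff: "j mod 5 \<in> neg_types a b \<longleftrightarrow> v_entry j + (ca j * a + cb j * b) < 0"
  using mod5_cases[of j]
proof (elim disjE)
  assume t: "j mod 5 = 0"
  show ?thesis unfolding t neg_types_mem using coefficients_by_type(1)[OF t] by auto
next
  assume t: "j mod 5 = 1"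
  show ?thesis unfolding t neg_types_mem using coefficients_by_type(2)[OF t] by auto
next
  assume t: "j mod 5 = 2"
  show ?thesis unfolding t neg_types_mem using coefficients_by_type(3)[OF t] by auto
next
  assume t: "j mod 5 = 3"
  show ?thesis unfolding t neg_types_mem using coefficients_by_type(4)[OF t] by auto
next
  assume t: "j mod 5 = 4"
  have "7 * a + 3 * b \<ge> 0 \<longleftrightarrow> - 1 + (- 7 * a + - 3 * b) < 0" by linarith
  then show ?thesis unfolding t neg_types_mem using coefficients_by_type(5)[OF t] by simp
qed

lemma nsupp_shift_latt: "nsupp_shift (v_vec q) (latt q a b) = types q (neg_types a b)"
proof (rule Set.set_eqI)
  fix j
  have "(v_vec q + map_vec complex_of_int (latt q a b)) $ j = of_int (v_entry j + (ca j * a + cb j * b))"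
    if "j < 5 * q" using that by (simp add: v_vec_def)
  moreover have "of_int k \<in> \<int> \<and> Re (of_int k) < 0 \<longleftrightarrow> k < 0" for k :: int by simp
  ultimately have "(v_vec q + map_vec complex_of_int (latt q a b)) $ j \<in> \<int> \<and>
      Re ((v_vec q + map_vec complex_of_int (latt q a b)) $ j) < 0 \<longleftrightarrow> v_entry j + (ca j * a + cb j * b) < 0"
    if "j < 5 * q" using that by (simp only:)
  moreover have "dim_vec (v_vec q + map_vec complex_of_int (latt q a b)) = 5 * q" by simp
  ultimately show "j \<in> nsupp_shift (v_vec q) (latt q a b) \<longleftrightarrow> j \<in> types q (neg_types a b)"
    unfolding nsupp_shift_def nsupp_def types_def mem_Collect_eq neg_types_iff by metis
qed

lemma nsupp_v_vec: "nsupp (v_vec q) = types q {0, 4}"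
proof -
  have "v_vec q + map_vec complex_of_int (latt q 0 0) = v_vec q" by (rule eq_vecI) (simp_all add: v_vec_def)
  then have "nsupp (v_vec q) = types q (neg_types 0 0)"
    using nsupp_shift_latt[of q 0 0] unfolding nsupp_shift_def by simp
  also have "neg_types 0 0 = {0, 4}" by (auto simp: neg_types_def)
  finally show ?thesis .
qed

lemma all_nsupps_A_mat:
  assumes "q \<ge> 1"
  shows "all_nsupps (A_mat q) (v_vec q) = {types q (neg_types a b) | a b. True}"
proof -
  have "all_nsupps (A_mat q) (v_vec q) = {nsupp_shift (v_vec q) (latt q a b) | a b. True}"
    unfolding all_nsupps_def ker_A_mat[OF assms] by blast
  then show ?thesis unfolding nsupp_shift_latt .
qed

lemma types_subset_iff:
  assumes "q \<ge> 1" "T \<subseteq> {0, 1, 2, 3, 4}"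
  shows "types q T \<subseteq> types q T' \<longleftrightarrow> T \<subseteq> T'"
proof
  assume sub: "types q T \<subseteq> types q T'"
  show "T \<subseteq> T'"
  proof
    fix t assume "t \<in> T"
    then have t: "t < 5" "t < 5 * q" "t mod 5 = t" using assms by auto
    then have "t \<in> types q T" using \<open>t \<in> T\<close> by (simp add: types_def)
    then have "t \<in> types q T'" using sub by blast
    then show "t \<in> T'" using t by (simp add: types_def)
  qed
qed (auto simp: types_def)

lemma types_eq_iff:
  assumes "q \<ge> 1" "T \<subseteq> {0, 1, 2, 3, 4}" "T' \<subseteq> {0, 1, 2, 3, 4}"
  shows "types q T = types q T' \<longleftrightarrow> T = T'"
  unfolding set_eq_subset types_subset_iff[OF assms(1,2)] types_subset_iff[OF assms(1,3)] ..

lemma types_Un: "types q S \<union> types q T = types q (S \<union> T)"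
  and types_Diff: "types q S - types q T = types q (S - T)"
  by (auto simp: types_def)

lemma finite_types [simp]: "finite (types q T)"
  by (simp add: types_def)

definition fam :: "nat \<Rightarrow> nat set set" where
  "fam q = {types q {0, 4}, types q {2, 4}}"

lemma neg_types_sub: "neg_types a b \<subseteq> {0, 1, 2, 3, 4}"
  by (auto simp: neg_types_def)

text \<open>Nonnegativity at the types 1 and 3 gives \<open>7 a + 3 b \<ge> 0\<close>, which is negativity at type 4; what is
  left is the sign of \<open>a\<close>, which decides between the types 0 and 2.\<close>

lemma neg_types_fam:
  assumes "1 \<notin> neg_types a b" "3 \<notin> neg_types a b"
  shows "neg_types a b = {0, 4} \<or> neg_types a b = {2, 4}"
proof -
  have "b \<ge> 0" "7 * a + 2 * b \<ge> 0" using assms unfolding neg_types_mem by linarith+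
  then have 4: "7 * a + 3 * b \<ge> 0" by linarith
  show ?thesis
  proof (cases "a \<le> 0")
    case True
    then have "neg_types a b = {0, 4}"
      using 4 \<open>b \<ge> 0\<close> \<open>7 * a + 2 * b \<ge> 0\<close> unfolding neg_types_def by (intro Set.set_eqI) auto
    then show ?thesis ..
  next
    case False
    then have "neg_types a b = {2, 4}"
      using 4 \<open>b \<ge> 0\<close> \<open>7 * a + 2 * b \<ge> 0\<close> unfolding neg_types_def by (intro Set.set_eqI) auto
    then show ?thesis ..
  qed
qed

lemma core_fam: "core (fam q) = types q {4}"
  unfolding fam_def by (auto simp: types_def)

lemma M_supports_fam: "M_supports (fam q) = {types q {0}, types q {2}}"
  unfolding M_supports_def core_fam by (simp add: fam_def types_Diff insert_Diff_if)

lemma nsupp_minus_core: "nsupp (v_vec q) - core (fam q) = types q {0}"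
  unfolding nsupp_v_vec core_fam by (simp add: types_Diff insert_Diff_if)

text \<open>A support outside of the family contains type 1 or type 3. If it contains only type 3, then
  \<open>b \<ge> 0\<close> forces \<open>a < 0\<close> and type 0 occurs; if it contains only type 1, then \<open>a > 0\<close> and type 2 occurs;
  if it contains both, the member of the family contributes type 0 or type 2.\<close>

lemma P_supports_fam_large:
  assumes q: "q \<ge> 1" and X: "X \<in> P_supports (A_mat q) (v_vec q) (fam q)"
  shows "types q {0, 3} \<subseteq> X \<or> types q {1, 2} \<subseteq> X"
proof -
  obtain I a b where I: "I \<in> fam q" and J: "types q (neg_types a b) \<notin> fam q"
    and X: "X = (I \<union> types q (neg_types a b)) - types q {4}"
    using X unfolding P_supports_def all_nsupps_A_mat[OF q] core_fam by blast
  obtain S where S: "S = {0, 4} \<or> S = {2, 4}" "I = types q S" using I unfolding fam_def by blast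
  have X': "X = types q ((S \<union> neg_types a b) - {4})" unfolding X S(2) types_Un types_Diff ..
  have "neg_types a b \<noteq> {0, 4}" "neg_types a b \<noteq> {2, 4}" using J unfolding fam_def by auto
  then have "1 \<in> neg_types a b \<or> 3 \<in> neg_types a b" using neg_types_fam[of a b] by blast
  moreover have "0 \<in> neg_types a b" if "1 \<notin> neg_types a b" "3 \<in> neg_types a b"
    using that by (auto simp: neg_types_def)
  moreover have "2 \<in> neg_types a b" if "3 \<notin> neg_types a b" "1 \<in> neg_types a b"
    using that by (auto simp: neg_types_def)
  ultimately have "{0, 3} \<subseteq> (S \<union> neg_types a b) - {4} \<or> {1, 2} \<subseteq> (S \<union> neg_types a b) - {4}"
    using S(1) by auto
  moreover have s: "{0, 3} \<subseteq> {0, 1, 2, 3, 4 :: nat}" "{1, 2} \<subseteq> {0, 1, 2, 3, 4 :: nat}" by auto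
  ultimately show ?thesis unfolding X' types_subset_iff[OF q s(1)] types_subset_iff[OF q s(2)] by argo
qed

lemma P_supports_fam_mem:
  assumes q: "q \<ge> 1"
  shows "types q {0, 3} \<in> P_supports (A_mat q) (v_vec q) (fam q)"
    and "types q {1, 2} \<in> P_supports (A_mat q) (v_vec q) (fam q)"
proof -
  have 1: "neg_types (- 1) 3 = {0, 3, 4}" and 2: "neg_types 1 (- 2) = {1, 2, 4}"
    by (auto simp: neg_types_def)
  have all: "types q {0, 3, 4} \<in> all_nsupps (A_mat q) (v_vec q)" "types q {1, 2, 4} \<in> all_nsupps (A_mat q) (v_vec q)"
    unfolding all_nsupps_A_mat[OF q] using 1 2 by (metis (mono_tags, lifting) mem_Collect_eq)+
  have s: "{0, 3, 4} \<subseteq> {0, 1, 2, 3, 4 :: nat}" "{1, 2, 4} \<subseteq> {0, 1, 2, 3, 4 :: nat}" by auto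
  have "\<not> types q {0, 3, 4} \<subseteq> types q {0, 4}" "\<not> types q {0, 3, 4} \<subseteq> types q {2, 4}"
    "\<not> types q {1, 2, 4} \<subseteq> types q {0, 4}" "\<not> types q {1, 2, 4} \<subseteq> types q {2, 4}"
    unfolding types_subset_iff[OF q s(1)] types_subset_iff[OF q s(2)] by simp_all
  then have "types q {0, 3, 4} \<notin> fam q" "types q {1, 2, 4} \<notin> fam q"
    unfolding fam_def by blast+
  moreover have "types q {0, 4} \<in> fam q" "types q {2, 4} \<in> fam q" by (simp_all add: fam_def)
  moreover have "types q {0, 3} = (types q {0, 4} \<union> types q {0, 3, 4}) - types q {4}"
    "types q {1, 2} = (types q {2, 4} \<union> types q {1, 2, 4}) - types q {4}"
    by (auto simp: types_def)
  ultimately show "types q {0, 3} \<in> P_supports (A_mat q) (v_vec q) (fam q)"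
    "types q {1, 2} \<in> P_supports (A_mat q) (v_vec q) (fam q)"
    using all unfolding P_supports_def core_fam by blast+
qed

lemma min_M_supports:
  assumes "q \<ge> 1"
  shows "min_sets (M_supports (fam q)) = {types q {0}, types q {2}}"
proof -
  have "\<not> types q {0} \<subseteq> types q {2}" "\<not> types q {2} \<subseteq> types q {0}"
    using types_subset_iff[OF assms, of "{0}" "{2}"] types_subset_iff[OF assms, of "{2}" "{0}"] by simp_all
  then show ?thesis unfolding min_sets_def M_supports_fam by auto
qed

lemma min_P_supports:
  assumes q: "q \<ge> 1"
  shows "min_sets (P_supports (A_mat q) (v_vec q) (fam q)) = {types q {0, 3}, types q {1, 2}}"
proof -
  have a: "\<not> types q {0, 3} \<subseteq> types q {1, 2}" "\<not> types q {1, 2} \<subseteq> types q {0, 3}"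
    using types_subset_iff[OF q, of "{0, 3}" "{1, 2}"] types_subset_iff[OF q, of "{1, 2}" "{0, 3}"] by simp_all
  show ?thesis
  proof (intro equalityI subsetI)
    fix X assume "X \<in> min_sets (P_supports (A_mat q) (v_vec q) (fam q))"
    then have X: "X \<in> P_supports (A_mat q) (v_vec q) (fam q)"
      "\<And>Y. Y \<in> P_supports (A_mat q) (v_vec q) (fam q) \<Longrightarrow> Y \<subseteq> X \<Longrightarrow> Y = X"
      unfolding min_sets_def by blast+
    show "X \<in> {types q {0, 3}, types q {1, 2}}"
      using P_supports_fam_large[OF q X(1)] X(2) P_supports_fam_mem[OF q] by blast
  next
    fix X assume X: "X \<in> {types q {0, 3}, types q {1, 2}}"
    have "Y = X" if "Y \<in> P_supports (A_mat q) (v_vec q) (fam q)" "Y \<subseteq> X" for Y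
      using P_supports_fam_large[OF q that(1)] that(2) X a by blast
    then show "X \<in> min_sets (P_supports (A_mat q) (v_vec q) (fam q))"
      unfolding min_sets_def using X P_supports_fam_mem[OF q] by blast
  qed
qed

text \<open>The choice is unique for the sets that occur, each of which contains exactly one of the two minimal
  supports.\<close>

lemma some_G_fam:
  assumes q: "q \<ge> 1" and S: "S \<subseteq> {0, 1, 2, 3, 4}" "(0 \<in> S) \<noteq> (2 \<in> S)"
  shows "some_G (fam q) (types q S) = (if 0 \<in> S then types q {0} else types q {2})"
  unfolding some_G_def min_M_supports[OF q]
proof (rule some_equality)
  have t: "types q {0} \<subseteq> types q S \<longleftrightarrow> 0 \<in> S" "types q {2} \<subseteq> types q S \<longleftrightarrow> 2 \<in> S"
    using types_subset_iff[OF q, of "{0}" S] types_subset_iff[OF q, of "{2}" S] by simp_all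
  show "(if 0 \<in> S then types q {0} else types q {2}) \<in> {types q {0}, types q {2}} \<and>
    (if 0 \<in> S then types q {0} else types q {2}) \<subseteq> types q S"
    using t S(2) by auto
  fix G assume "G \<in> {types q {0}, types q {2}} \<and> G \<subseteq> types q S"
  then show "G = (if 0 \<in> S then types q {0} else types q {2})" using t S(2) by auto
qed

lemma ordered_fam:
  assumes q: "q \<ge> 1"
  shows "ordered_family (A_mat q) (v_vec q) (fam q)"
  unfolding ordered_family_def
proof (intro ballI impI)
  fix I J assume I: "I \<in> fam q" and J: "J \<in> all_nsupps (A_mat q) (v_vec q)" "J \<subseteq> I"
  obtain a b where ab: "J = types q (neg_types a b)" using J(1) all_nsupps_A_mat[OF q] by blast
  obtain S where S: "S = {0, 4} \<or> S = {2, 4}" "I = types q S" using I unfolding fam_def by blast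
  have "neg_types a b \<subseteq> S" using J(2) types_subset_iff[OF q neg_types_sub] unfolding ab S(2) by blast
  then have "1 \<notin> neg_types a b" "3 \<notin> neg_types a b" using S(1) by auto
  then have "neg_types a b = {0, 4} \<or> neg_types a b = {2, 4}" by (rule neg_types_fam)
  then show "J \<in> fam q" unfolding ab fam_def by auto
qed

definition w_a :: "nat \<Rightarrow> real vec \<Rightarrow> real" where
  "w_a q w = (\<Sum>j<5 * q. w $ j * of_int (ca j))"

definition w_b :: "nat \<Rightarrow> real vec \<Rightarrow> real" where
  "w_b q w = (\<Sum>j<5 * q. w $ j * of_int (cb j))"

lemma weight_latt:
  assumes "w \<in> carrier_vec (5 * q)"
  shows "weight_pairing w (latt q a b) = of_int a * w_a q w + of_int b * w_b q w"
proof -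
  have "weight_pairing w (latt q a b) = (\<Sum>j<5 * q. w $ j * (of_int (ca j) * of_int a + of_int (cb j) * of_int b))"
    unfolding weight_pairing_def by (simp add: scalar_prod_def atLeast0LessThan)
  then show ?thesis
    unfolding w_a_def w_b_def sum_distrib_left sum.distrib[symmetric]
    by (simp add: algebra_simps)
qed

text \<open>The two inequalities say that the lattice vectors \<open>(1, -2)\<close> and \<open>(-1, 3)\<close> have positive weight.\<close>

definition good_weight :: "nat \<Rightarrow> real vec \<Rightarrow> bool" where
  "good_weight q w \<longleftrightarrow> w \<in> carrier_vec (5 * q) \<and> 2 * w_b q w < w_a q w \<and> w_a q w < 3 * w_b q w"

text \<open>A lattice vector that belongs to one of the two supports satisfies \<open>b \<ge> 0\<close> and \<open>7 a + 2 b \<ge> 0\<close>,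
  hence also \<open>3 a + b \<ge> 0\<close> if \<open>a < 0\<close>. This cone is contained in the cone of vectors of nonnegative
  weight.\<close>

lemma weight_minimal_fam:
  assumes q: "q \<ge> 1" and w: "good_weight q w"
  shows "negative_support_family (A_mat q) w (v_vec q) (fam q)"
  unfolding negative_support_family_def
proof (intro conjI subsetI)
  show "nsupp (v_vec q) \<in> fam q" unfolding nsupp_v_vec fam_def by simp
  have wc: "w \<in> carrier_vec (5 * q)" "2 * w_b q w < w_a q w" "w_a q w < 3 * w_b q w"
    using w unfolding good_weight_def by blast+
  then have wb: "w_b q w > 0" by linarith
  fix I assume I: "I \<in> fam q"
  obtain S where S: "S = {0, 4} \<or> S = {2, 4}" "I = types q S" using I unfolding fam_def by blast
  have "neg_types 0 0 = {0, 4}" "neg_types 1 0 = {2, 4}" by (auto simp: neg_types_def)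
  then have "\<exists>a b. neg_types a b = S" using S(1) by metis
  then have "I \<in> all_nsupps (A_mat q) (v_vec q)" unfolding all_nsupps_A_mat[OF q] S(2) by blast
  moreover have "weight_pairing w u \<ge> 0" if u: "u \<in> ker_lattice (A_mat q)" "nsupp_shift (v_vec q) u = I" for u
  proof -
    obtain a b where ab: "u = latt q a b" using u(1) ker_A_mat[OF q] by blast
    have "types q (neg_types a b) = types q S" using u(2) unfolding ab nsupp_shift_latt S(2) .
    then have "neg_types a b = S" using types_eq_iff[OF q neg_types_sub] S(1) by auto
    then have "1 \<notin> neg_types a b" "3 \<notin> neg_types a b" using S(1) by auto
    then have b: "b \<ge> 0" "7 * a + 2 * b \<ge> 0" by (auto simp: neg_types_def)
    have "of_int a * w_a q w + of_int b * w_b q w \<ge> 0"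
    proof (cases "a \<ge> 0")
      case True
      then show ?thesis using b(1) wb wc(2) by simp
    next
      case False
      then have "of_int a * w_a q w \<ge> of_int a * (3 * w_b q w)"
        using wc(3) by (intro mult_left_mono_neg) auto
      moreover have "(3 * real_of_int a + of_int b) * w_b q w \<ge> 0"
      proof (rule mult_nonneg_nonneg)
        have "3 * a + b \<ge> 0" using b False by linarith
        then show "3 * real_of_int a + of_int b \<ge> 0" by linarith
      qed (use wb in simp)
      ultimately show ?thesis by (simp add: algebra_simps)
    qed
    then show ?thesis unfolding ab weight_latt[OF wc(1)] .
  qed
  ultimately show "I \<in> weight_minimal_nsupps (A_mat q) w (v_vec q)"
    unfolding weight_minimal_nsupps_def by blast
qed

section \<open>Linear extension from monomials\<close>

definition lin_ext :: "('k \<Rightarrow> complex \<Rightarrow> 'b) \<Rightarrow> ('k \<Rightarrow>\<^sub>0 complex) \<Rightarrow> 'b::ab_group_add" where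
  "lin_ext \<phi> f = (\<Sum>m\<in>keys f. \<phi> m (lookup f m))"

lemma lin_ext_on:
  assumes "\<And>m. \<phi> m 0 = 0" "finite S" "keys f \<subseteq> S"
  shows "lin_ext \<phi> f = (\<Sum>m\<in>S. \<phi> m (lookup f m))"
  unfolding lin_ext_def
  by (rule sum.mono_neutral_left[OF assms(2,3)]) (simp add: assms(1) not_in_keys_iff_lookup_eq_zero)

lemma lin_ext_zero [simp]: "lin_ext \<phi> 0 = 0"
  by (simp add: lin_ext_def)

lemma lin_ext_add:
  assumes add: "\<And>m c d. \<phi> m (c + d) = \<phi> m c + \<phi> m d"
  shows "lin_ext \<phi> (f + g) = lin_ext \<phi> f + lin_ext \<phi> g"
proof -
  have z: "\<phi> m 0 = 0" for m using add[of m 0 0] by simp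
  let ?S = "keys f \<union> keys g"
  have "finite ?S" "keys f \<subseteq> ?S" "keys g \<subseteq> ?S" "keys (f + g) \<subseteq> ?S"
    using Poly_Mapping.keys_add[of f g] by auto
  then show ?thesis
    by (simp add: lin_ext_on[of \<phi> ?S, OF z] lookup_add add sum.distrib)
qed

lemma lin_ext_single:
  assumes "\<And>m. \<phi> m 0 = 0"
  shows "lin_ext \<phi> (single m c) = \<phi> m c"
  by (subst lin_ext_on[of \<phi> "{m}"]) (use assms in auto)

lemma cpoly_induct [case_names zero single add]:
  assumes "P 0" "\<And>m c. P (single m c)" "\<And>f g. P f \<Longrightarrow> P g \<Longrightarrow> P (f + g)"
  shows "P (f :: 'k \<Rightarrow>\<^sub>0 complex)"
proof -
  have "P (\<Sum>m\<in>A. single m (lookup f m))" for A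
    by (induction A rule: infinite_finite_induct) (simp_all add: assms)
  from this[of "keys f"] show ?thesis by (simp flip: poly_mapping_sum_single)
qed

lemma poly_ring_induct [consumes 1, case_names zero single add]:
  assumes "f \<in> poly_ring n" "P 0" "\<And>m c. m \<in> expos n \<Longrightarrow> P (single m c)"
    "\<And>f g. f \<in> poly_ring n \<Longrightarrow> g \<in> poly_ring n \<Longrightarrow> P f \<Longrightarrow> P g \<Longrightarrow> P (f + g)"
  shows "P f"
proof -
  have "(\<Sum>m\<in>A. single m (lookup f m)) \<in> poly_ring n \<and>
      P (\<Sum>m\<in>A. single m (lookup f m))" if "A \<subseteq> expos n" for A
    using that
  proof (induction A rule: infinite_finite_induct)
    case (insert m A)
    let ?s = "single m (lookup f m)"
      and ?t = "\<Sum>m\<in>A. single m (lookup f m)"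
    have s: "?s \<in> poly_ring n" using insert.prems by (simp add: poly_ring_def)
    have t: "?t \<in> poly_ring n" "P ?t" using insert.IH insert.prems by auto
    have "keys (?s + ?t) \<subseteq> expos n"
      using Poly_Mapping.keys_add[of ?s ?t] s t(1) unfolding poly_ring_def by blast
    moreover have "P (?s + ?t)" using assms(4)[OF s t(1) assms(3) t(2)] insert.prems by simp
    ultimately show ?case unfolding sum.insert[OF insert.hyps] by (simp add: poly_ring_def)
  qed (simp_all add: assms(2) poly_ring_def)
  from this[of "keys f"] show ?thesis
    using assms(1) by (simp add: poly_ring_def flip: poly_mapping_sum_single)
qed

section \<open>The toric ideal and its Groebner basis\<close>

lemma gen_submodule_superset: "S \<subseteq> gen_submodule R sc S"
  by (rule subsetI) (rule gen_submodule.gen)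

definition expo_le :: "expo \<Rightarrow> expo \<Rightarrow> bool" where
  "expo_le a b \<longleftrightarrow> (\<forall>j. lookup a j \<le> lookup b j)"

lemma expo_le_add_diff: "expo_le a b \<Longrightarrow> (b - a) + a = b"
  by (rule poly_mapping_eqI) (simp add: expo_le_def lookup_add lookup_minus)

lemma expo_le_add: "expo_le a b \<Longrightarrow> expo_le a (c + b)"
  by (simp add: expo_le_def lookup_add trans_le_add2)

lemma lookup_pos_expo: "lookup (pos_expo u) j = (if j < dim_vec u then nat (u $ j) else 0)"
proof -
  have "lookup (pos_expo u) j = (\<Sum>i<dim_vec u. if i = j then nat (u $ j) else 0)"
    unfolding pos_expo_def lookup_sum by (rule sum.cong) (auto simp: lookup_single when_def)
  then show ?thesis by (simp add: sum.delta')
qed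

lemma lookup_neg_expo: "lookup (neg_expo u) j = (if j < dim_vec u then nat (- (u $ j)) else 0)"
proof -
  have "lookup (neg_expo u) j = (\<Sum>i<dim_vec u. if i = j then nat (- (u $ j)) else 0)"
    unfolding neg_expo_def lookup_sum by (rule sum.cong) (auto simp: lookup_single when_def)
  then show ?thesis by (simp add: sum.delta')
qed

lemma pos_expo_in_expos: "pos_expo u \<in> expos (dim_vec u)" and neg_expo_in_expos: "neg_expo u \<in> expos (dim_vec u)"
  by (simp_all add: expos_iff lookup_pos_expo lookup_neg_expo)

lemma monomial_ideal_keys:
  assumes "f \<in> gen_ideal R (pmonom ` E)" "m \<in> keys f"
  shows "\<exists>e\<in>E. expo_le e m"
  using assms
proof (induction arbitrary: m)
  case (gen x)
  then show ?case by (auto simp: expo_le_def)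
next
  case (add x y)
  then have "m \<in> keys x \<or> m \<in> keys y" using Poly_Mapping.keys_add[of x y] by blast
  then show ?case using add.IH by blast
next
  case (scale a x)
  then obtain b c where "m = b + c" "c \<in> keys x" using keys_mult[of a x] by blast
  moreover from scale.IH[OF this(2)] obtain e where "e \<in> E" "expo_le e c" by blast
  ultimately show ?case using expo_le_add by blast
qed simp

lemma single_in_poly_ring: "m \<in> expos n \<Longrightarrow> single m c \<in> poly_ring n"
  by (simp add: poly_ring_def)

definition lattice_equiv :: "nat \<Rightarrow> expo \<Rightarrow> expo \<Rightarrow> bool" where
  "lattice_equiv q m m' \<longleftrightarrow> (\<exists>a b. \<forall>j<5 * q.
     int (lookup m j) - int (lookup m' j) = ca j * a + cb j * b)"

lemma lattice_equiv_shift: "lattice_equiv q m m' \<Longrightarrow> lattice_equiv q (k + m) (k + m')"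
  by (simp add: lattice_equiv_def lookup_add)

lemma lattice_equiv_sym: "lattice_equiv q m m' \<Longrightarrow> lattice_equiv q m' m"
proof -
  assume "lattice_equiv q m m'"
  then obtain a b where ab: "\<And>j. j < 5 * q \<Longrightarrow>
      int (lookup m j) - int (lookup m' j) = ca j * a + cb j * b"
    unfolding lattice_equiv_def by blast
  have "int (lookup m' j) - int (lookup m j) = ca j * (- a) + cb j * (- b)"
    if "j < 5 * q" for j using ab[OF that] by (simp add: algebra_simps)
  then show ?thesis unfolding lattice_equiv_def by blast
qed

lemma lattice_equiv_trans:
  assumes "lattice_equiv q m m'" "lattice_equiv q m' m''"
  shows "lattice_equiv q m m''"
proof -
  obtain a b where ab: "\<And>j. j < 5 * q \<Longrightarrow>
      int (lookup m j) - int (lookup m' j) = ca j * a + cb j * b"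
    using assms(1) unfolding lattice_equiv_def by blast
  obtain c d where cd: "\<And>j. j < 5 * q \<Longrightarrow>
      int (lookup m' j) - int (lookup m'' j) = ca j * c + cb j * d"
    using assms(2) unfolding lattice_equiv_def by blast
  have "int (lookup m j) - int (lookup m'' j) = ca j * (a + c) + cb j * (b + d)"
    if "j < 5 * q" for j using ab[OF that] cd[OF that] by (simp add: algebra_simps)
  then show ?thesis unfolding lattice_equiv_def by blast
qed

lemma lattice_equiv_pos_neg: "lattice_equiv q (pos_expo (latt q a b)) (neg_expo (latt q a b))"
  unfolding lattice_equiv_def
proof (intro exI allI impI)
  fix j assume "j < 5 * q"
  then show "int (lookup (pos_expo (latt q a b)) j) - int (lookup (neg_expo (latt q a b)) j)
      = ca j * a + cb j * b"
    by (simp add: lookup_pos_expo lookup_neg_expo)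
qed

text \<open>The coefficients of an element of the toric ideal add up to zero on every class of exponents modulo
  the lattice. This holds for the binomials, whose two terms are in the same class, and it is preserved
  by multiplication with a monomial, which sends classes to classes; the functional \<open>G\<close> is arbitrary in
  order that the induction allows for this shift.\<close>

lemma toric_ideal_invariant_functional:
  assumes q: "q \<ge> 1" and f: "f \<in> toric_ideal (A_mat q)"
    and G: "\<And>m m'. lattice_equiv q m m' \<Longrightarrow> G m = G m'"
  shows "lin_ext (\<lambda>m c. G m * c) f = (0 :: complex)"
  using f G unfolding toric_ideal_def
proof (induction arbitrary: G)
  case (gen x)
  then obtain a b where x: "x = toric_binomial (latt q a b)" using ker_A_mat[OF q] by auto
  have "lin_ext (\<lambda>m c. G m * c) (x + pmonom (neg_expo (latt q a b))) = lin_ext (\<lambda>m c. G m * c) (pmonom (pos_expo (latt q a b)))"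
    by (simp add: x toric_binomial_def)
  then have "lin_ext (\<lambda>m c. G m * c) x + G (neg_expo (latt q a b)) = G (pos_expo (latt q a b))"
    by (simp add: lin_ext_add distrib_left lin_ext_single)
  then show ?case using gen.prems[OF lattice_equiv_pos_neg[of q a b]] by simp
next
  case (add x y)
  have "lin_ext (\<lambda>m c. G m * c) x = 0" by (rule add.IH(1)) (rule add.prems)
  moreover have "lin_ext (\<lambda>m c. G m * c) y = 0" by (rule add.IH(2)) (rule add.prems)
  ultimately show ?case by (simp add: lin_ext_add distrib_left)
next
  case (scale a x)
  have mono: "lin_ext (\<lambda>m c. G m * c) (single k d * x) = 0" for k d
  proof -
    have "lin_ext (\<lambda>m c. G m * c) (single k d * y) = d * lin_ext (\<lambda>m c. G (k + m) * c) y" for y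
      by (induction y rule: cpoly_induct)
        (simp_all add: lin_ext_add distrib_left lin_ext_single mult_single)
    moreover have "lin_ext (\<lambda>m c. G (k + m) * c) x = 0"
      by (rule scale.IH) (rule scale.prems, rule lattice_equiv_shift)
    ultimately show ?thesis by simp
  qed
  have "lin_ext (\<lambda>m c. G m * c) (b * x) = 0" for b
    by (induction b rule: cpoly_induct) (simp_all add: mono distrib_right lin_ext_add distrib_left)
  then show ?case .
qed simp

definition grob :: "nat \<Rightarrow> int vec set" where
  "grob q = {latt q 1 (- 2), latt q 0 1, latt q (- 1) 3}"

text \<open>The first, second or third vector of \<open>grob q\<close> serves, according as \<open>a\<close> is positive, zero or
  negative. Positivity of the weight bounds \<open>b\<close> from below by a multiple of \<open>a\<close>, and this bounds the
  entries of the types at which the chosen vector is positive.\<close>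

lemma pos_expo_grob_below:
  assumes w: "good_weight q w" and pos: "of_int a * w_a q w + of_int b * w_b q w > 0"
  shows "\<exists>g\<in>grob q. expo_le (pos_expo g) (pos_expo (latt q a b))"
proof -
  have wc: "2 * w_b q w < w_a q w" "w_a q w < 3 * w_b q w"
    using w unfolding good_weight_def by blast+
  then have wb: "w_b q w > 0" by linarith
  have le: "expo_le (pos_expo (latt q c d)) (pos_expo (latt q a b))"
    if "\<And>j. ca j * c + cb j * d \<le> 0 \<or> ca j * c + cb j * d \<le> ca j * a + cb j * b" for c d
    unfolding expo_le_def lookup_pos_expo
  proof
    fix j
    have "nat (ca j * c + cb j * d) \<le> nat (ca j * a + cb j * b)" using that[of j] by linarith
    then show "(if j < dim_vec (latt q c d) then nat (latt q c d $ j) else 0)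
        \<le> (if j < dim_vec (latt q a b) then nat (latt q a b $ j) else 0)" by simp
  qed
  consider "a \<ge> 1" | "a = 0" | "a \<le> - 1" by linarith
  then show ?thesis
  proof cases
    case 1
    have "7 * a + 2 * b \<ge> 3"
    proof (cases "b \<ge> - 2 * a")
      case True
      then show ?thesis using 1 by linarith
    next
      case False
      define y where "y = - 2 * a - b"
      have y: "y \<ge> 1" using False by (simp add: y_def)
      have "of_int y * w_b q w < of_int a * (w_a q w - 2 * w_b q w)"
        using pos by (simp add: y_def algebra_simps)
      also have "\<dots> < of_int a * w_b q w"
        using 1 wc by (intro mult_strict_left_mono) auto
      finally have "of_int y < (of_int a :: real)" using wb by (simp add: mult_less_cancel_right)
      then have "y < a" by simp
      then show ?thesis using y unfolding y_def by linarith
    qed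
    then have "ca j * 1 + cb j * (- 2) \<le> 0 \<or> ca j * 1 + cb j * (- 2) \<le> ca j * a + cb j * b" for j
      using mod5_cases[of j] coefficients_by_type[of j] 1 by auto
    from le[OF this] show ?thesis unfolding grob_def by blast
  next
    case 2
    then have "of_int b * w_b q w > 0" using pos by simp
    then have "b \<ge> 1" using wb by (simp add: zero_less_mult_iff)
    then have "ca j * 0 + cb j * 1 \<le> 0 \<or> ca j * 0 + cb j * 1 \<le> ca j * a + cb j * b" for j
      using mod5_cases[of j] coefficients_by_type[of j] 2 by auto
    from le[OF this] show ?thesis unfolding grob_def by blast
  next
    case 3
    have "of_int (- a) * (2 * w_b q w) \<le> of_int (- a) * w_a q w"
      using 3 wc by (intro mult_left_mono) auto
    then have "of_int (- 2 * a) * w_b q w \<le> of_int (- a) * w_a q w" by simp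
    also have "\<dots> < of_int b * w_b q w" using pos by simp
    finally have "real_of_int (- 2 * a) < of_int b" using wb by (simp only: mult_less_cancel_right)
    then have "b > - 2 * a" by linarith
    then have "ca j * (- 1) + cb j * 3 \<le> 0 \<or> ca j * (- 1) + cb j * 3 \<le> ca j * a + cb j * b" for j
      using mod5_cases[of j] coefficients_by_type[of j] 3 by auto
    from le[OF this] show ?thesis unfolding grob_def by blast
  qed
qed

lemma pmonom_nonzero: "single m (1 :: complex) \<noteq> 0"
  by (metis lookup_single_eq lookup_zero one_neq_zero)

lemma expo_weight_pos_neg:
  assumes "w \<in> carrier_vec (5 * q)"
  shows "expo_weight w (pos_expo (latt q a b)) - expo_weight w (neg_expo (latt q a b))
    = of_int a * w_a q w + of_int b * w_b q w"
proof -
  have int: "real (nat k) - real (nat (- k)) = of_int k" for k by linarith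
  have "expo_weight w (pos_expo (latt q a b)) - expo_weight w (neg_expo (latt q a b))
      = (\<Sum>j<5 * q. w $ j * (real (nat (ca j * a + cb j * b)) - real (nat (- (ca j * a + cb j * b)))))"
    using assms by (simp add: expo_weight_def lookup_pos_expo lookup_neg_expo right_diff_distrib sum_subtractf)
  also have "\<dots> = weight_pairing w (latt q a b)"
    unfolding int weight_pairing_def by (simp add: scalar_prod_def atLeast0LessThan)
  finally show ?thesis unfolding weight_latt[OF assms] .
qed

lemma grob_weight_pos:
  assumes "good_weight q w" "latt q a b \<in> {latt q 1 (- 2), latt q 0 1, latt q (- 1) 3}" "q \<ge> 1"
  shows "of_int a * w_a q w + of_int b * w_b q w > 0"
proof -
  have "(a, b) = (1, - 2) \<or> (a, b) = (0, 1) \<or> (a, b) = (- 1, 3)"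
    using assms(2) latt_inj[OF assms(3)] by blast
  then show ?thesis using assms(1) unfolding good_weight_def by auto
qed

lemma initial_form_grob:
  assumes q: "q \<ge> 1" and w: "good_weight q w" and g: "g \<in> grob q"
  shows "initial_form (expo_weight w) (toric_binomial g) = pmonom (pos_expo g)"
proof -
  obtain a b where ab: "g = latt q a b" using g unfolding grob_def by blast
  have wc: "w \<in> carrier_vec (5 * q)" using w unfolding good_weight_def by blast
  have "of_int a * w_a q w + of_int b * w_b q w > 0"
    by (rule grob_weight_pos[OF w _ q]) (use g in \<open>simp add: ab grob_def\<close>)
  then have lt: "expo_weight w (neg_expo g) < expo_weight w (pos_expo g)"
    using expo_weight_pos_neg[OF wc, of a b] unfolding ab by linarith
  have "initial_form (expo_weight w) (pmonom (pos_expo g) + (- pmonom (neg_expo g))) = pmonom (pos_expo g)"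
    by (rule initial_form_eqI[where \<delta> = "expo_weight w (pos_expo g)"]) (use lt in \<open>auto simp: pmonom_nonzero\<close>)
  then show ?thesis by (simp add: toric_binomial_def)
qed

lemma toric_ideal_subset: "f \<in> toric_ideal (A_mat q) \<Longrightarrow> q \<ge> 1 \<Longrightarrow> f \<in> poly_ring (5 * q)"
  unfolding toric_ideal_def
proof (induction rule: gen_submodule.induct)
  case (gen x)
  then obtain a b where x: "x = toric_binomial (latt q a b)" using ker_A_mat by auto
  have "keys x \<subseteq> {pos_expo (latt q a b), neg_expo (latt q a b)}"
    unfolding x toric_binomial_def using keys_diff[of "pmonom (pos_expo (latt q a b))" "pmonom (neg_expo (latt q a b))"] by auto
  moreover have "{pos_expo (latt q a b), neg_expo (latt q a b)} \<subseteq> expos (5 * q)"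
    using pos_expo_in_expos[of "latt q a b"] neg_expo_in_expos[of "latt q a b"] by simp
  ultimately show ?case unfolding poly_ring_def by blast
next
  case (add x y)
  then show ?case using Poly_Mapping.keys_add[of x y] unfolding poly_ring_def by blast
next
  case (scale a x)
  have "keys (a * x) \<subseteq> {b + c | b c. b \<in> keys a \<and> c \<in> keys x}"
    by (rule keys_mult)
  moreover have "b + c \<in> expos (5 * q)" if "b \<in> keys a" "c \<in> keys x" for b c
    using that scale unfolding poly_ring_def by (intro expos_add) auto
  ultimately show ?case unfolding poly_ring_def by blast
qed (simp add: poly_ring_def)

text \<open>The initial form is a single term, as the weight separates monomials. Since the coefficients on its
  class add up to zero, there is a second term in this class, of smaller weight. The difference of the
  two exponents is a lattice vector of positive weight, the positive part of which divides the initial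
  term.\<close>

lemma initial_form_toric:
  assumes q: "q \<ge> 1" and w: "good_weight q w" "rat_indep w" and f: "f \<in> toric_ideal (A_mat q)" "f \<noteq> 0"
  obtains m c where "initial_form (expo_weight w) f = single m c" "m \<in> expos (5 * q)"
    "\<exists>g\<in>grob q. expo_le (pos_expo g) m"
proof -
  have wc: "w \<in> carrier_vec (5 * q)" using w(1) unfolding good_weight_def by blast
  have keys: "keys f \<subseteq> expos (5 * q)"
    using toric_ideal_subset[OF f(1) q] by (simp add: poly_ring_def)
  have "inj_on (expo_weight w) (expos (5 * q))"
    by (rule inj_onI) (rule expo_weight_inj[OF w(2) wc])
  then have "inj_on (expo_weight w) (keys f)" using keys by (rule inj_on_subset)
  from leads_exists[OF f(2) this] obtain m where m: "leads (expo_weight w) m f" by blast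
  then have m_in: "m \<in> keys f" and less: "\<And>m'. m' \<in> keys f \<Longrightarrow> m' \<noteq> m \<Longrightarrow> expo_weight w m' < expo_weight w m"
    unfolding leads_def by blast+
  let ?c = "lookup f m"
  have c: "?c \<noteq> 0" using m_in by (simp only: in_keys_iff) simp
  have "initial_form (expo_weight w) (single m ?c + restrict_keys (- {m}) f) = single m ?c"
  proof (rule initial_form_eqI[where \<delta> = "expo_weight w m"])
    show "single m ?c \<noteq> 0" using c by (metis lookup_single_eq lookup_zero)
    show "expo_weight w k = expo_weight w m" if "k \<in> keys (single m ?c)" for k
      using that by (simp split: if_splits)
    show "expo_weight w k < expo_weight w m" if "k \<in> keys (restrict_keys (- {m}) f)" for k
      using that less[of k] by (simp add: keys_restrict_keys)
  qed
  moreover have "single m ?c + restrict_keys (- {m}) f = f"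
    by (rule poly_mapping_eqI) (auto simp: lookup_add lookup_restrict_keys lookup_single when_def)
  ultimately have ini: "initial_form (expo_weight w) f = single m ?c" by simp
  define G where "G = (\<lambda>m'. if lattice_equiv q m m' then 1 else (0 :: complex))"
  have G: "G k = G k'" if "lattice_equiv q k k'" for k k'
    unfolding G_def using lattice_equiv_trans[OF _ that, of m] lattice_equiv_trans[OF _ lattice_equiv_sym[OF that], of m] by metis
  have Gm: "G m = 1" unfolding G_def lattice_equiv_def by (auto intro!: exI[of _ 0])
  have "(\<Sum>k\<in>keys f. G k * lookup f k) = 0"
    using toric_ideal_invariant_functional[OF q f(1) G] unfolding lin_ext_def .
  then have "?c + (\<Sum>k\<in>keys f - {m}. G k * lookup f k) = 0"
    using sum.remove[OF finite_keys m_in, of "\<lambda>k. G k * lookup f k"] Gm by simp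
  then have "(\<Sum>k\<in>keys f - {m}. G k * lookup f k) \<noteq> 0" using c by auto
  then obtain m' where m': "m' \<in> keys f - {m}" "G m' * lookup f m' \<noteq> 0"
    by (rule sum.not_neutral_contains_not_neutral)
  then have "lattice_equiv q m m'" unfolding G_def by (auto split: if_splits)
  then obtain a b where ab: "\<And>j. j < 5 * q \<Longrightarrow>
      int (lookup m j) - int (lookup m' j) = ca j * a + cb j * b"
    unfolding lattice_equiv_def by blast
  have "expo_weight w m - expo_weight w m' = (\<Sum>j<5 * q. w $ j * of_int (int (lookup m j) - int (lookup m' j)))"
    using wc by (simp add: expo_weight_def right_diff_distrib sum_subtractf)
  also have "\<dots> = (\<Sum>j<5 * q. w $ j * of_int (ca j * a + cb j * b))"
    by (rule sum.cong) (use ab in auto)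
  also have "\<dots> = weight_pairing w (latt q a b)"
    unfolding weight_pairing_def by (simp add: scalar_prod_def atLeast0LessThan)
  also have "\<dots> = of_int a * w_a q w + of_int b * w_b q w" by (rule weight_latt[OF wc])
  finally have "of_int a * w_a q w + of_int b * w_b q w > 0" using less[of m'] m'(1) by auto
  from pos_expo_grob_below[OF w(1) this] obtain g where g: "g \<in> grob q" "expo_le (pos_expo g) (pos_expo (latt q a b))" by blast
  have "expo_le (pos_expo (latt q a b)) m"
    unfolding expo_le_def lookup_pos_expo
  proof
    fix j
    show "(if j < dim_vec (latt q a b) then nat (latt q a b $ j) else 0) \<le> lookup m j"
      using ab[of j] by (cases "j < 5 * q") simp_all
  qed
  with g have "expo_le (pos_expo g) m" unfolding expo_le_def using order_trans by blast
  with g(1) show ?thesis using that[OF ini] keys m_in by blast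
qed

lemma initial_ideal_toric:
  assumes q: "q \<ge> 1" and w: "good_weight q w" "rat_indep w"
  shows "initial_ideal (5 * q) w (toric_ideal (A_mat q)) = gen_ideal (poly_ring (5 * q)) (pmonom ` pos_expo ` grob q)"
proof
  show "initial_ideal (5 * q) w (toric_ideal (A_mat q)) \<subseteq> gen_ideal (poly_ring (5 * q)) (pmonom ` pos_expo ` grob q)"
    unfolding initial_ideal_def
  proof (rule gen_submodule_mono, rule subsetI)
    fix x assume "x \<in> initial_form (expo_weight w) ` toric_ideal (A_mat q)"
    then obtain f where f: "f \<in> toric_ideal (A_mat q)" "x = initial_form (expo_weight w) f" by blast
    show "x \<in> gen_ideal (poly_ring (5 * q)) (pmonom ` pos_expo ` grob q)"
    proof (cases "f = 0")
      case True
      then show ?thesis using f(2) by (simp add: gen_submodule.zero)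
    next
      case False
      obtain m c where m: "x = single m c" "m \<in> expos (5 * q)" "\<exists>g\<in>grob q. expo_le (pos_expo g) m"
        using initial_form_toric[OF q w f(1) False] unfolding f(2) by metis
      then obtain g where g: "g \<in> grob q" "expo_le (pos_expo g) m" by blast
      have "single (m - pos_expo g) c * pmonom (pos_expo g) \<in> gen_ideal (poly_ring (5 * q)) (pmonom ` pos_expo ` grob q)"
        by (intro gen_submodule.scale gen_submodule.gen single_in_poly_ring expos_minus m(2) imageI g(1))
      then show ?thesis unfolding m(1) by (simp add: mult_single expo_le_add_diff[OF g(2)])
    qed
  qed
  show "gen_ideal (poly_ring (5 * q)) (pmonom ` pos_expo ` grob q) \<subseteq> initial_ideal (5 * q) w (toric_ideal (A_mat q))"
    unfolding initial_ideal_def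
  proof (rule gen_submodule_mono, rule subsetI)
    fix x assume "x \<in> pmonom ` pos_expo ` grob q"
    then obtain g where g: "g \<in> grob q" "x = pmonom (pos_expo g)" by blast
    then have "g \<in> ker_lattice (A_mat q)" using latt_in_ker[OF q] unfolding grob_def by blast
    then have "toric_binomial g \<in> toric_ideal (A_mat q)"
      unfolding toric_ideal_def by (blast intro: gen_submodule.gen)
    moreover have "x = initial_form (expo_weight w) (toric_binomial g)"
      using initial_form_grob[OF q w(1) g(1)] g(2) by simp
    ultimately show "x \<in> gen_ideal (poly_ring (5 * q)) (initial_form (expo_weight w) ` toric_ideal (A_mat q))"
      by (blast intro: gen_submodule.gen)
  qed
qed

lemma monomial_initial_toric:
  assumes q: "q \<ge> 1" and w: "good_weight q w" "rat_indep w"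
  shows "monomial_ideal (5 * q) (initial_ideal (5 * q) w (toric_ideal (A_mat q)))"
proof -
  have "pos_expo ` grob q \<subseteq> expos (5 * q)"
  proof
    fix x assume "x \<in> pos_expo ` grob q"
    then obtain g where g: "g \<in> grob q" "x = pos_expo g" by blast
    then have "dim_vec g = 5 * q" unfolding grob_def by auto
    then show "x \<in> expos (5 * q)" using pos_expo_in_expos[of g] g(2) by simp
  qed
  then show ?thesis unfolding monomial_ideal_def initial_ideal_toric[OF q w] by blast
qed

lemma not_expo_le: "lookup a j > lookup b j \<Longrightarrow> \<not> expo_le a b"
  unfolding expo_le_def by (metis not_le)

text \<open>One column of each of the types 0, 1 and 3 suffices to compare the exponents of the Groebner basis.\<close>

lemma lookup_grob:
  assumes "q \<ge> 1"
  shows "map (lookup (pos_expo (latt q 1 (- 2)))) [0, Suc 0, 3] = [1, 0, 3]"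
    "map (lookup (neg_expo (latt q 1 (- 2)))) [0, Suc 0, 3] = [0, 2, 0]"
    "map (lookup (pos_expo (latt q 0 1))) [0, Suc 0, 3] = [0, 1, 2]"
    "map (lookup (neg_expo (latt q 0 1))) [0, Suc 0, 3] = [0, 0, 0]"
    "map (lookup (pos_expo (latt q (- 1) 3))) [0, Suc 0, 3] = [0, 3, 0]"
    "map (lookup (neg_expo (latt q (- 1) 3))) [0, Suc 0, 3] = [1, 0, 1]"
  using assms by (simp_all add: lookup_pos_expo lookup_neg_expo) (simp_all add: ca_def cb_def)

lemma grob_reduced:
  assumes q: "q \<ge> 1" and g: "g \<in> grob q" "h \<in> grob q" "h \<noteq> g" and m: "m \<in> {pos_expo g, neg_expo g}"
  shows "\<not> expo_le (pos_expo h) m"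
proof -
  note L = lookup_grob[OF q, unfolded list.map list.inject]
  have "\<exists>j\<in>{0, Suc 0, 3}. lookup (pos_expo h) j > lookup (pos_expo g) j"
    using g unfolding grob_def by (elim insertE emptyE) (simp_all add: L)
  moreover have "\<exists>j\<in>{0, Suc 0, 3}. lookup (pos_expo h) j > lookup (neg_expo g) j"
    using g unfolding grob_def by (elim insertE emptyE) (simp_all add: L)
  ultimately show ?thesis using m not_expo_le by blast
qed

lemma groebner_vectors_grob:
  assumes q: "q \<ge> 1" and w: "good_weight q w" "rat_indep w"
  shows "groebner_vectors (A_mat q) w (grob q)"
proof -
  have ker: "grob q \<subseteq> ker_lattice (A_mat q)" using latt_in_ker[OF q] unfolding grob_def by blast
  have ini: "initial_form (expo_weight w) ` toric_binomial ` S = pmonom ` pos_expo ` S" if "S \<subseteq> grob q" for S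
  proof -
    have "(\<lambda>g. initial_form (expo_weight w) (toric_binomial g)) ` S = (\<lambda>g. pmonom (pos_expo g)) ` S"
      by (rule image_cong[OF refl]) (use initial_form_grob[OF q w(1)] that in blast)
    then show ?thesis by (simp add: image_image)
  qed
  have red: "pmonom m \<notin> gen_ideal (poly_ring (5 * q)) (initial_form (expo_weight w) ` (toric_binomial ` grob q - {toric_binomial g}))"
    if g: "g \<in> grob q" and m: "m \<in> keys (toric_binomial g)" for g m
  proof
    assume mem: "pmonom m \<in> gen_ideal (poly_ring (5 * q)) (initial_form (expo_weight w) ` (toric_binomial ` grob q - {toric_binomial g}))"
    have "toric_binomial ` grob q - {toric_binomial g} \<subseteq> toric_binomial ` (grob q - {g})" by blast
    then have "initial_form (expo_weight w) ` (toric_binomial ` grob q - {toric_binomial g})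
        \<subseteq> initial_form (expo_weight w) ` toric_binomial ` (grob q - {g})" by (rule image_mono)
    also have "\<dots> = pmonom ` pos_expo ` (grob q - {g})" by (rule ini) blast
    also have "\<dots> \<subseteq> gen_ideal (poly_ring (5 * q)) (pmonom ` pos_expo ` (grob q - {g}))"
      by (rule gen_submodule_superset)
    finally have "initial_form (expo_weight w) ` (toric_binomial ` grob q - {toric_binomial g})
        \<subseteq> gen_ideal (poly_ring (5 * q)) (pmonom ` pos_expo ` (grob q - {g}))" .
    from gen_submodule_mono[OF this] mem have "pmonom m \<in> gen_ideal (poly_ring (5 * q)) (pmonom ` pos_expo ` (grob q - {g}))"
      by (rule subsetD)
    from monomial_ideal_keys[OF this, of m] obtain h where h: "h \<in> grob q" "h \<noteq> g" "expo_le (pos_expo h) m" by auto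
    have "m \<in> {pos_expo g, neg_expo g}"
      using m keys_diff[of "pmonom (pos_expo g)" "pmonom (neg_expo g)"] unfolding toric_binomial_def by auto
    from grob_reduced[OF q g h(1,2) this] h(3) show False by blast
  qed
  have "reduced_groebner_basis (5 * q) w (toric_ideal (A_mat q)) (toric_binomial ` grob q)"
    unfolding reduced_groebner_basis_def
  proof (intro conjI ballI)
    show "finite (toric_binomial ` grob q)" unfolding grob_def by simp
    show "toric_binomial ` grob q \<subseteq> toric_ideal (A_mat q)"
      unfolding toric_ideal_def by (rule subset_trans[OF image_mono[OF ker] gen_submodule_superset])
    show "gen_ideal (poly_ring (5 * q)) (initial_form (expo_weight w) ` toric_binomial ` grob q)
        = initial_ideal (5 * q) w (toric_ideal (A_mat q))"
      unfolding initial_ideal_toric[OF q w] ini[OF order_refl] ..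
    show "\<exists>m. initial_form (expo_weight w) g = pmonom m" if "g \<in> toric_binomial ` grob q" for g
      using that initial_form_grob[OF q w(1)] by blast
    show "pmonom m \<notin> gen_ideal (poly_ring (5 * q)) (initial_form (expo_weight w) ` (toric_binomial ` grob q - {g}))"
      if "g \<in> toric_binomial ` grob q" "m \<in> keys g" for g m
      using that red by blast
  qed
  then show ?thesis unfolding groebner_vectors_def using ker initial_form_grob[OF q w(1)] by simp
qed

text \<open>The coordinates \<open>3 u\<^sub>0 + u\<^sub>1\<close> and \<open>2 u\<^sub>0 + u\<^sub>1\<close> with respect to the first and the last of the
  Groebner basis vectors are nonnegative on the cone. These two vectors form a lattice basis and the
  remaining one is their sum, so that the semigroup is free.\<close>

lemma normal_grob:
  assumes q: "q \<ge> 1"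
  shows "normal_semigroup (5 * q) (combinations (5 * q) \<nat> (grob q))"
proof -
  let ?n = "5 * q"
  define nice :: "int vec \<Rightarrow> bool" where "nice u \<longleftrightarrow> (\<forall>j<?n. u $ j = ca j * u $ 0 + cb j * u $ 1) \<and>
     3 * u $ 0 + u $ 1 \<ge> 0 \<and> 2 * u $ 0 + u $ 1 \<ge> 0" for u
  have idx: "0 < ?n" "1 < ?n" using q by auto
  have closed: "nice u" if S: "\<And>g. g \<in> S \<Longrightarrow> nice g" and u: "u \<in> combinations ?n K S" and K: "K \<subseteq> {0..}" for S u K
  proof -
    obtain F c where F: "finite F" "F \<subseteq> S" "\<And>g. g \<in> F \<Longrightarrow> c g \<in> K"
      and eq: "\<And>j. j < ?n \<Longrightarrow> real_of_int (u $ j) = (\<Sum>g\<in>F. c g * real_of_int (g $ j))"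
      using u unfolding combinations_def by blast
    have nice: "nice g" if "g \<in> F" for g using S F(2) that by blast
    have entry: "g $ j = ca j * g $ 0 + cb j * g $ 1" if "g \<in> F" "j < ?n" for g j
      using nice[OF that(1)] that(2) unfolding nice_def by blast
    have c0: "c g \<ge> 0" if "g \<in> F" for g using F(3)[OF that] K by auto
    have "u $ j = ca j * u $ 0 + cb j * u $ 1" if j: "j < ?n" for j
    proof -
      have "real_of_int (u $ j) = (\<Sum>g\<in>F. c g * real_of_int (ca j * g $ 0 + cb j * g $ 1))"
        unfolding eq[OF j] by (rule sum.cong[OF refl]) (simp only: entry[OF _ j, symmetric])
      also have "\<dots> = (\<Sum>g\<in>F. ca j * (c g * g $ 0) + cb j * (c g * g $ 1))"
        by (rule sum.cong[OF refl]) (simp add: algebra_simps)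
      also have "\<dots> = ca j * real_of_int (u $ 0) + cb j * real_of_int (u $ 1)"
        unfolding eq[OF idx(1)] eq[OF idx(2)] by (simp add: sum.distrib sum_distrib_left)
      finally have "real_of_int (u $ j) = real_of_int (ca j * u $ 0 + cb j * u $ 1)" by simp
      then show ?thesis by (simp only: of_int_eq_iff)
    qed
    moreover have "real_of_int (k * u $ 0 + u $ 1) \<ge> 0" if k: "\<And>g. g \<in> F \<Longrightarrow> k * g $ 0 + g $ 1 \<ge> 0" for k
    proof -
      have "real_of_int (k * u $ 0 + u $ 1) = k * (\<Sum>g\<in>F. c g * real_of_int (g $ 0)) + (\<Sum>g\<in>F. c g * real_of_int (g $ 1))"
        using eq[OF idx(1)] eq[OF idx(2)] by simp
      also have "\<dots> = (\<Sum>g\<in>F. k * (c g * real_of_int (g $ 0)) + c g * real_of_int (g $ 1))"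
        by (simp add: sum.distrib sum_distrib_left)
      also have "\<dots> = (\<Sum>g\<in>F. c g * real_of_int (k * g $ 0 + g $ 1))"
        by (rule sum.cong[OF refl]) (simp add: algebra_simps)
      also have "\<dots> \<ge> 0"
      proof (rule sum_nonneg)
        fix g assume g: "g \<in> F"
        have "real_of_int (k * g $ 0 + g $ 1) \<ge> 0" using k[OF g] by (simp only: of_int_0_le_iff)
        then show "0 \<le> c g * real_of_int (k * g $ 0 + g $ 1)" using c0[OF g] by (rule mult_nonneg_nonneg[rotated])
      qed
      finally show ?thesis .
    qed
    from this[of 3] this[of 2] have "3 * u $ 0 + u $ 1 \<ge> 0" "2 * u $ 0 + u $ 1 \<ge> 0"
      using nice unfolding nice_def by (simp_all only: of_int_0_le_iff)
    ultimately show ?thesis unfolding nice_def by blast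
  qed
  have "nice g" if "g \<in> grob q" for g
    using that idx unfolding grob_def nice_def by auto
  then have C: "nice u" if "u \<in> combinations ?n \<nat> (grob q)" for u
    by (rule closed[OF _ that]) (auto elim: Nats_cases)
  show ?thesis
    unfolding normal_semigroup_def
  proof
    fix u assume "u \<in> combinations ?n \<int> (combinations ?n \<nat> (grob q)) \<inter> combinations ?n {0..} (combinations ?n \<nat> (grob q))"
    then have u: "u \<in> combinations ?n {0..} (combinations ?n \<nat> (grob q))" by blast
    then have uc: "u \<in> carrier_vec ?n" unfolding combinations_def by blast
    have "nice u" using closed[OF C u] by simp
    then have entry: "\<And>j. j < ?n \<Longrightarrow> u $ j = ca j * u $ 0 + cb j * u $ 1"
      and ge: "3 * u $ 0 + u $ 1 \<ge> 0" "2 * u $ 0 + u $ 1 \<ge> 0" unfolding nice_def by blast+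
    let ?g1 = "latt q 1 (- 2)" and ?g3 = "latt q (- 1) 3"
    have ne: "?g1 \<noteq> ?g3" using latt_inj[OF q, of 1 "- 2" "- 1" 3] by auto
    let ?c = "\<lambda>g. if g = ?g1 then real_of_int (3 * u $ 0 + u $ 1) else real_of_int (2 * u $ 0 + u $ 1)"
    have nat: "real_of_int k \<in> \<nat>" if "k \<ge> 0" for k using that by (metis of_int_of_nat_eq of_nat_in_Nats zero_le_imp_eq_int)
    have sum: "real_of_int (u $ j) = (\<Sum>g\<in>{?g1, ?g3}. ?c g * real_of_int (g $ j))" if j: "j < ?n" for j
    proof -
      have "(\<Sum>g\<in>{?g1, ?g3}. ?c g * real_of_int (g $ j)) =
         real_of_int ((3 * u $ 0 + u $ 1) * (ca j - 2 * cb j) + (2 * u $ 0 + u $ 1) * (3 * cb j - ca j))"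
        using ne j by (simp add: algebra_simps)
      also have "(3 * u $ 0 + u $ 1) * (ca j - 2 * cb j) + (2 * u $ 0 + u $ 1) * (3 * cb j - ca j) = ca j * u $ 0 + cb j * u $ 1"
        by (simp add: algebra_simps)
      also have "\<dots> = u $ j" by (rule entry[OF j, symmetric])
      finally show ?thesis by simp
    qed
    have nat': "\<forall>g\<in>{?g1, ?g3}. ?c g \<in> \<nat>" using nat[OF ge(1)] nat[OF ge(2)] by simp
    have sub: "{?g1, ?g3} \<subseteq> grob q" unfolding grob_def by blast
    show "u \<in> combinations ?n \<nat> (grob q)"
      unfolding combinations_def
      by (intro CollectI conjI uc exI[of _ "{?g1, ?g3}"] exI[of _ ?c] allI impI sum nat' sub) simp_all
  qed
qed

text \<open>Every initial monomial of the Groebner basis involves a variable of type 1 or 3, and the fake exponent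
  vanishes at these types.\<close>

lemma fake_exponent_v:
  assumes q: "q \<ge> 1" and w: "good_weight q w" "rat_indep w"
  shows "fake_exponent (A_mat q) (map_mat complex_of_int (A_mat q) *\<^sub>v v_vec q) w (v_vec q)"
  unfolding fake_exponent_def
proof (intro conjI ballI impI)
  fix p assume "pmonom p \<in> initial_ideal (dim_col (A_mat q)) w (toric_ideal (A_mat q))"
  then have "pmonom p \<in> gen_ideal (poly_ring (5 * q)) (pmonom ` pos_expo ` grob q)"
    using initial_ideal_toric[OF q w] by simp
  from monomial_ideal_keys[OF this, of p] obtain g where g: "g \<in> grob q" "expo_le (pos_expo g) p" by auto
  note L = lookup_grob[OF q, unfolded list.map list.inject]
  have "\<exists>j\<in>{1, 3}. lookup (pos_expo g) j > 0"
  proof -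
    consider "g = latt q 1 (- 2)" | "g = latt q 0 1" | "g = latt q (- 1) 3" using g(1) unfolding grob_def by blast
    then show ?thesis
    proof cases
      case 1
      show ?thesis unfolding 1 by (rule bexI[of _ 3]) (simp_all add: L)
    next
      case 2
      show ?thesis unfolding 2 by (rule bexI[of _ 1]) (simp_all add: L)
    next
      case 3
      show ?thesis unfolding 3 by (rule bexI[of _ 1]) (simp_all add: L)
    qed
  qed
  then obtain j where j: "j \<in> {1, 3}" "lookup (pos_expo g) j > 0" by blast
  then have pj: "lookup p j > 0" using g(2) unfolding expo_le_def by (metis less_le_trans)
  have jn: "j < 5 * q" using j(1) q by auto
  have "v_entry j = 0" using j(1) by (auto simp: v_entry_def)
  then have "(\<Prod>k<lookup p j. v_vec q $ j - of_nat k) = 0"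
    using pj jn by (intro prod_zero) (auto simp: v_vec_def)
  then show "falling (v_vec q) p = 0"
    unfolding falling_def using jn by (intro prod_zero) auto
qed simp_all

section \<open>Substitution of linear forms\<close>

text \<open>The polynomial ring in \<open>n\<close> variables and the power series ring in \<open>n\<close> variables are subsets of types
  with infinitely many variables, hence the rings below are carrier sets.\<close>

definition subring_set :: "'a::comm_ring_1 set \<Rightarrow> bool" where
  "subring_set R \<longleftrightarrow> 0 \<in> R \<and> 1 \<in> R \<and> (\<forall>x\<in>R. \<forall>y\<in>R. x + y \<in> R \<and> x - y \<in> R \<and> x * y \<in> R)"

lemma subring_setD:
  assumes "subring_set R"
  shows "0 \<in> R" "1 \<in> R" "\<And>x y. x \<in> R \<Longrightarrow> y \<in> R \<Longrightarrow> x + y \<in> R" "\<And>x y. x \<in> R \<Longrightarrow> y \<in> R \<Longrightarrow> x - y \<in> R"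
    "\<And>x y. x \<in> R \<Longrightarrow> y \<in> R \<Longrightarrow> x * y \<in> R" "\<And>x. x \<in> R \<Longrightarrow> - x \<in> R"
proof -
  show "0 \<in> R" "1 \<in> R" "\<And>x y. x \<in> R \<Longrightarrow> y \<in> R \<Longrightarrow> x + y \<in> R" "\<And>x y. x \<in> R \<Longrightarrow> y \<in> R \<Longrightarrow> x * y \<in> R"
    and d: "\<And>x y. x \<in> R \<Longrightarrow> y \<in> R \<Longrightarrow> x - y \<in> R"
    using assms unfolding subring_set_def by blast+
  show "- x \<in> R" if "x \<in> R" for x using d[OF \<open>0 \<in> R\<close> that] by simp
qed

lemma subring_set_power: "subring_set R \<Longrightarrow> x \<in> R \<Longrightarrow> x ^ k \<in> R"
  by (induction k) (simp_all add: subring_setD)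

lemma subring_set_prod: "subring_set R \<Longrightarrow> (\<And>i. i \<in> A \<Longrightarrow> f i \<in> R) \<Longrightarrow> prod f A \<in> R"
  by (induction A rule: infinite_finite_induct) (simp_all add: subring_setD)

lemma subring_set_sum: "subring_set R \<Longrightarrow> (\<And>i. i \<in> A \<Longrightarrow> f i \<in> R) \<Longrightarrow> sum f A \<in> R"
  by (induction A rule: infinite_finite_induct) (simp_all add: subring_setD)

lemma gen_ideal_subset:
  assumes R: "subring_set R" and S: "S \<subseteq> R"
  shows "gen_ideal R S \<subseteq> R"
proof
  fix x assume "x \<in> gen_ideal R S"
  then show "x \<in> R" by induction (use S in \<open>auto intro: subring_setD[OF R]\<close>)
qed

lemma gen_ideal_two:
  assumes R: "subring_set R"
  shows "gen_ideal R {a, b} = {x * a + y * b | x y. x \<in> R \<and> y \<in> R}"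
proof (intro equalityI subsetI)
  note r = subring_setD[OF R]
  fix f assume "f \<in> gen_ideal R {a, b}"
  then have "\<exists>x y. x \<in> R \<and> y \<in> R \<and> f = x * a + y * b"
  proof induction
    case zero
    show ?case by (rule exI[of _ 0], rule exI[of _ 0]) (simp add: r)
  next
    case (gen f)
    then consider "f = a" | "f = b" by blast
    then show ?case
    proof cases
      case 1
      then show ?thesis by (intro exI[of _ 1] exI[of _ 0]) (simp add: r)
    next
      case 2
      then show ?thesis by (intro exI[of _ 0] exI[of _ 1]) (simp add: r)
    qed
  next
    case (add f g)
    then obtain x y x' y' where "x \<in> R" "y \<in> R" "f = x * a + y * b" "x' \<in> R" "y' \<in> R" "g = x' * a + y' * b" by blast
    then show ?case by (intro exI[of _ "x + x'"] exI[of _ "y + y'"]) (simp add: r algebra_simps)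
  next
    case (scale c f)
    then obtain x y where "x \<in> R" "y \<in> R" "f = x * a + y * b" by blast
    then show ?case using scale(1) by (intro exI[of _ "c * x"] exI[of _ "c * y"]) (simp add: r algebra_simps)
  qed
  then show "f \<in> {x * a + y * b | x y. x \<in> R \<and> y \<in> R}" by blast
next
  fix f assume "f \<in> {x * a + y * b | x y. x \<in> R \<and> y \<in> R}"
  then obtain x y where "x \<in> R" "y \<in> R" "f = x * a + y * b" by blast
  then show "f \<in> gen_ideal R {a, b}"
    by (simp add: gen_submodule.add gen_submodule.scale gen_submodule.gen)
qed

lemma gen_ideal_hom_image:
  assumes add: "\<And>x y. \<phi> (x + y) = \<phi> x + \<phi> y" and mult: "\<And>x y. \<phi> (x * y) = \<phi> x * \<phi> y"
    and R: "\<phi> ` R \<subseteq> R'" and x: "x \<in> gen_ideal R S"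
  shows "\<phi> x \<in> gen_ideal R' (\<phi> ` S)"
proof -
  have "\<phi> 0 + \<phi> 0 = \<phi> 0 + 0" using add[of 0 0] by simp
  then have z: "\<phi> 0 = 0" by (rule add_left_imp_eq)
  show ?thesis
    using x
  proof induction
    case zero
    show ?case unfolding z by (rule gen_submodule.zero)
  next
    case (gen x)
    then show ?case by (intro gen_submodule.gen imageI)
  next
    case (add x y)
    show ?case unfolding assms(1) using add.IH by (rule gen_submodule.add)
  next
    case (scale a x)
    have "\<phi> a \<in> R'" using R scale(1) by blast
    then show ?case unfolding mult using scale.IH by (rule gen_submodule.scale)
  qed
qed

lemma gen_ideal_cong_gens:
  assumes "S \<subseteq> gen_ideal R T" "T \<subseteq> gen_ideal R S"
  shows "gen_ideal R S = gen_ideal R T"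
  using gen_submodule_mono[OF assms(1)] gen_submodule_mono[OF assms(2)] by (rule equalityI)

definition mono_val :: "(nat \<Rightarrow> 'a::comm_ring_1) \<Rightarrow> expo \<Rightarrow> 'a" where
  "mono_val L k = (\<Prod>j\<in>keys k. L j ^ lookup k j)"

lemma mono_val_on:
  assumes "finite S" "keys k \<subseteq> S"
  shows "mono_val L k = (\<Prod>j\<in>S. L j ^ lookup k j)"
  unfolding mono_val_def
  by (rule prod.mono_neutral_left[OF assms]) (simp add: not_in_keys_iff_lookup_eq_zero)

lemma mono_val_expos: "k \<in> expos n \<Longrightarrow> mono_val L k = (\<Prod>j<n. L j ^ lookup k j)"
  by (rule mono_val_on) (simp_all add: expos_def)

lemma mono_val_zero [simp]: "mono_val L 0 = 1"
  by (simp add: mono_val_def)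

lemma mono_val_add: "mono_val L (k + l) = mono_val L k * mono_val L l"
proof -
  let ?S = "keys k \<union> keys l"
  have "mono_val L (k + l) = (\<Prod>j\<in>?S. L j ^ lookup (k + l) j)"
    by (rule mono_val_on) (simp_all add: Poly_Mapping.keys_add)
  also have "\<dots> = (\<Prod>j\<in>?S. L j ^ lookup k j) * (\<Prod>j\<in>?S. L j ^ lookup l j)"
    by (simp add: lookup_add power_add prod.distrib)
  also have "\<dots> = mono_val L k * mono_val L l"
    by (simp add: mono_val_on[of ?S])
  finally show ?thesis .
qed

lemma mono_val_single: "mono_val L (single j i) = L j ^ i"
  by (subst mono_val_on[of "{j}"]) auto

lemma single_power: "single (m :: expo) (1 :: complex) ^ i = single (of_nat i * m) 1"
proof (induction i)
  case (Suc i)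
  then show ?case by (simp add: mult_single distrib_right)
qed (simp add: single_one)

lemma pmonom_prod: "finite A \<Longrightarrow> (\<Prod>j\<in>A. single (f j :: expo) (1 :: complex)) = single (sum f A) 1"
  by (induction A rule: finite_induct) (simp_all add: mult_single single_one)

lemma expo_of_nat_mult: "of_nat i * single j (1 :: nat) = (single j i :: expo)"
  by (induction i) (simp_all add: distrib_right single_add[symmetric] add.commute)

lemma mono_val_pvar: "mono_val pvar m = pmonom m"
proof -
  have "mono_val pvar m = (\<Prod>j\<in>keys m. single (single j (lookup m j)) 1)"
    unfolding mono_val_def pvar_def by (simp add: single_power expo_of_nat_mult del: One_nat_def)
  also have "\<dots> = pmonom (\<Sum>j\<in>keys m. single j (lookup m j))"
    by (rule pmonom_prod) simp
  also have "(\<Sum>j\<in>keys m. single j (lookup m j)) = m"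
  proof (rule poly_mapping_eqI)
    fix k
    have "(\<Sum>j\<in>keys m. lookup (single j (lookup m j)) k)
        = (\<Sum>j\<in>keys m. if j = k then lookup m k else 0)"
      by (rule sum.cong) (auto simp: lookup_single when_def)
    then show "lookup (\<Sum>j\<in>keys m. single j (lookup m j)) k = lookup m k"
      by (simp add: lookup_sum sum.delta not_in_keys_iff_lookup_eq_zero)
  qed
  finally show ?thesis .
qed

lemma pconst_mult_single: "pconst c * single m d = single m (c * d)"
  by (simp add: pconst_def mult_single)

lemma pconst_add: "pconst (c + d) = pconst c + pconst d"
  by (simp add: pconst_def single_add)

lemma pconst_mult: "pconst (c * d) = pconst c * pconst d"
  by (simp add: pconst_def mult_single)

lemma pconst_zero [simp]: "pconst 0 = 0" and pconst_one [simp]: "pconst 1 = 1"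
  by (simp_all add: pconst_def)

lemma pconst_of_int: "pconst (of_int i) = of_int i"
  by (simp add: pconst_def)

definition psubst :: "(nat \<Rightarrow> cpoly) \<Rightarrow> cpoly \<Rightarrow> cpoly" where
  "psubst L = lin_ext (\<lambda>k c. pconst c * mono_val L k)"

lemma psubst_single: "psubst L (single k c) = pconst c * mono_val L k"
  unfolding psubst_def by (rule lin_ext_single) simp

lemma psubst_add: "psubst L (f + g) = psubst L f + psubst L g"
  unfolding psubst_def by (rule lin_ext_add) (simp add: pconst_add distrib_right)

lemma psubst_zero [simp]: "psubst L 0 = 0"
  by (simp add: psubst_def)

lemma psubst_mult: "psubst L (f * g) = psubst L f * psubst L g"
proof (induction f rule: cpoly_induct)
  case (single m c)
  show ?case
    by (induction g rule: cpoly_induct)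
      (simp_all add: mult_single psubst_single psubst_add distrib_left pconst_mult mono_val_add algebra_simps)
qed (simp_all add: distrib_right psubst_add)

lemma psubst_pvar: "psubst L (pvar j) = L j"
  unfolding pvar_def psubst_single by (simp add: mono_val_single)

lemma psubst_pconst: "psubst L (pconst c) = pconst c"
  unfolding pconst_def psubst_single by (simp add: pconst_def)

lemma psubst_one [simp]: "psubst L 1 = 1"
  using psubst_pconst[of L 1] by simp

lemma psubst_power: "psubst L (f ^ k) = psubst L f ^ k"
  by (induction k) (simp_all add: psubst_mult)

lemma psubst_prod: "psubst L (prod f A) = (\<Prod>x\<in>A. psubst L (f x))"
  by (induction A rule: infinite_finite_induct) (simp_all add: psubst_mult)

lemma psubst_sum: "psubst L (sum f A) = (\<Sum>x\<in>A. psubst L (f x))"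
  by (induction A rule: infinite_finite_induct) (simp_all add: psubst_add)

lemma psubst_mono_val: "psubst L (mono_val M k) = mono_val (\<lambda>j. psubst L (M j)) k"
  unfolding mono_val_def by (simp add: psubst_prod psubst_power)

lemma psubst_psubst: "psubst L (psubst M f) = psubst (\<lambda>j. psubst L (M j)) f"
  by (induction f rule: cpoly_induct)
    (simp_all add: psubst_single psubst_add psubst_mult psubst_pconst psubst_mono_val)

lemma psubst_id: "psubst pvar f = f"
  by (induction f rule: cpoly_induct)
    (simp_all add: psubst_single psubst_add mono_val_pvar pconst_mult_single)

lemma poly_ring_subring: "subring_set (poly_ring n)"
  unfolding subring_set_def
proof (intro conjI ballI)
  fix x y assume xy: "x \<in> poly_ring n" "y \<in> poly_ring n"
  show "x + y \<in> poly_ring n" using xy Poly_Mapping.keys_add[of x y] unfolding poly_ring_def by blast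
  show "x - y \<in> poly_ring n" using xy keys_diff[of x y] unfolding poly_ring_def by blast
  have "a + b \<in> expos n" if "a \<in> keys x" "b \<in> keys y" for a b
    using that xy unfolding poly_ring_def by (intro expos_add) auto
  then show "x * y \<in> poly_ring n" using keys_mult[of x y] unfolding poly_ring_def by blast
qed (simp_all add: poly_ring_def)

lemmas poly_ring_closed = subring_setD[OF poly_ring_subring] subring_set_power[OF poly_ring_subring]

lemma pconst_in_poly_ring [simp]: "pconst c \<in> poly_ring n"
  by (simp add: pconst_def single_in_poly_ring)

lemma pvar_in_poly_ring: "j < n \<Longrightarrow> pvar j \<in> poly_ring n"
  unfolding pvar_def by (rule single_in_poly_ring) (simp add: expos_iff lookup_single when_def)

lemma of_int_in_poly_ring [simp]: "of_int i \<in> poly_ring n"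
  using pconst_in_poly_ring[of "of_int i" n] by (simp add: pconst_of_int)

lemma psubst_in_poly_ring:
  assumes "f \<in> poly_ring n" "\<And>j. j < n \<Longrightarrow> L j \<in> poly_ring m"
  shows "psubst L f \<in> poly_ring m"
  using assms(1)
proof (induction rule: poly_ring_induct)
  case (single k c)
  have "(\<Prod>j<n. L j ^ lookup k j) \<in> poly_ring m"
    by (rule subring_set_prod[OF poly_ring_subring]) (simp add: assms(2) poly_ring_closed)
  then show ?case unfolding psubst_single mono_val_expos[OF single] by (simp add: poly_ring_closed)
qed (simp_all add: psubst_add poly_ring_closed)

lemma psubst_cong:
  assumes "f \<in> poly_ring n" "\<And>j. j < n \<Longrightarrow> L j = M j"
  shows "psubst L f = psubst M f"
  using assms(1)
  by (induction rule: poly_ring_induct) (simp_all add: psubst_add psubst_single mono_val_expos assms(2))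

subsection \<open>Homogeneous parts\<close>

lemma mdeg_on: "finite S \<Longrightarrow> keys m \<subseteq> S \<Longrightarrow> mdeg m = (\<Sum>j\<in>S. lookup m j)"
  unfolding mdeg_def by (rule sum.mono_neutral_left) (simp_all add: not_in_keys_iff_lookup_eq_zero)

lemma mdeg_add: "mdeg (a + b) = mdeg a + mdeg b"
proof -
  let ?S = "keys a \<union> keys b"
  have "mdeg (a + b) = (\<Sum>j\<in>?S. lookup (a + b) j)"
    by (rule mdeg_on) (simp_all add: Poly_Mapping.keys_add)
  then show ?thesis by (simp add: lookup_add sum.distrib mdeg_on[of ?S])
qed

lemma mdeg_zero [simp]: "mdeg 0 = 0"
  by (simp add: mdeg_def)

lemma mdeg_single [simp]: "mdeg (single j i) = i"
  by (subst mdeg_on[of "{j}"]) auto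

lemma hom_part_zero [simp]: "0 \<in> hom_part k"
  by (simp add: hom_part_def)

lemma hom_part_add: "f \<in> hom_part k \<Longrightarrow> g \<in> hom_part k \<Longrightarrow> f + g \<in> hom_part k"
  unfolding hom_part_def using Poly_Mapping.keys_add[of f g] by blast

lemma hom_part_diff: "f \<in> hom_part k \<Longrightarrow> g \<in> hom_part k \<Longrightarrow> f - g \<in> hom_part k"
  unfolding hom_part_def using keys_diff[of f g] by blast

lemma hom_part_mult: "f \<in> hom_part k \<Longrightarrow> g \<in> hom_part l \<Longrightarrow> f * g \<in> hom_part (k + l)"
  unfolding hom_part_def using keys_mult[of f g] by (auto simp: mdeg_add)

lemma hom_part_pconst: "pconst c \<in> hom_part 0"
  by (simp add: hom_part_def pconst_def)

lemma hom_part_pconst_mult: "f \<in> hom_part k \<Longrightarrow> pconst c * f \<in> hom_part k"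
  using hom_part_mult[OF hom_part_pconst] by fastforce

lemma hom_part_one: "1 \<in> hom_part 0"
  using hom_part_pconst[of 1] by simp

lemma hom_part_power: "f \<in> hom_part k \<Longrightarrow> f ^ i \<in> hom_part (i * k)"
  by (induction i) (simp_all add: hom_part_one hom_part_mult)

lemma hom_part_pvar: "pvar j \<in> hom_part 1"
  by (simp add: hom_part_def pvar_def)

lemma hom_part_sum: "(\<And>x. x \<in> A \<Longrightarrow> f x \<in> hom_part k) \<Longrightarrow> sum f A \<in> hom_part k"
  by (induction A rule: infinite_finite_induct) (simp_all add: hom_part_add)

lemma hom_part_prod_powers:
  assumes "\<And>x. x \<in> A \<Longrightarrow> f x \<in> hom_part 1" "finite A"
  shows "(\<Prod>x\<in>A. f x ^ e x) \<in> hom_part (\<Sum>x\<in>A. e x)"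
  using assms(2,1)
  by (induction A rule: finite_induct) (auto simp: hom_part_one intro!: hom_part_mult hom_part_power[of _ 1, simplified])

lemma psubst_hom_part:
  assumes "f \<in> hom_part d" "\<And>j. L j \<in> hom_part 1"
  shows "psubst L f \<in> hom_part d"
proof -
  have "pconst c * mono_val L k \<in> hom_part d" if "k \<in> keys f" for k c
  proof -
    have "mdeg k = d" using that assms(1) by (simp add: hom_part_def)
    then have "mono_val L k \<in> hom_part d"
      unfolding mono_val_def mdeg_def using hom_part_prod_powers[of "keys k" L] assms(2) by fastforce
    then show ?thesis by (rule hom_part_pconst_mult)
  qed
  then show ?thesis unfolding psubst_def lin_ext_def by (intro hom_part_sum)
qed

definition hcomp :: "nat \<Rightarrow> cpoly \<Rightarrow> cpoly" where
  "hcomp d = restrict_keys {m. mdeg m = d}"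

lemma hcomp_hom_part: "hcomp d f \<in> hom_part d"
  by (simp add: hcomp_def hom_part_def keys_restrict_keys)

lemma hcomp_id: "f \<in> hom_part d \<Longrightarrow> hcomp d f = f"
  unfolding hcomp_def by (rule restrict_keys_id) (simp add: hom_part_def)

lemma hcomp_add: "hcomp d (f + g) = hcomp d f + hcomp d g"
  unfolding hcomp_def by (rule restrict_keys_add)

lemma hcomp_in_poly_ring: "f \<in> poly_ring n \<Longrightarrow> hcomp d f \<in> poly_ring n"
  by (auto simp: hcomp_def poly_ring_def keys_restrict_keys)

lemma hcomp_mult_hom:
  assumes g: "g \<in> hom_part k"
  shows "hcomp d (f * g) = (if d < k then 0 else hcomp (d - k) f * g)"
proof (cases "d < k")
  case True
  have "hcomp d (f * g) = 0"
    unfolding hcomp_def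
  proof (rule restrict_keys_eq_0)
    fix m assume "m \<in> keys (f * g)"
    then obtain a b where "m = a + b" "b \<in> keys g" using keys_mult[of f g] by blast
    then show "m \<notin> {m. mdeg m = d}" using g True by (auto simp: hom_part_def mdeg_add)
  qed
  with True show ?thesis by simp
next
  case False
  let ?S = "{m. mdeg m = d - k}"
  have "f * g = hcomp (d - k) f * g + restrict_keys (- ?S) f * g"
    unfolding hcomp_def distrib_right[symmetric] by (simp flip: restrict_keys_split)
  then have "hcomp d (f * g) = hcomp d (hcomp (d - k) f * g) + hcomp d (restrict_keys (- ?S) f * g)"
    by (metis hcomp_add)
  moreover have "hcomp (d - k) f * g \<in> hom_part d"
    using hom_part_mult[OF hcomp_hom_part g, of "d - k" f] False by simp
  moreover have "hcomp d (restrict_keys (- ?S) f * g) = 0"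
    unfolding hcomp_def
  proof (rule restrict_keys_eq_0)
    fix m assume "m \<in> keys (restrict_keys (- ?S) f * g)"
    then obtain a b where "m = a + b" "a \<in> keys (restrict_keys (- ?S) f)" "b \<in> keys g"
      using keys_mult[of "restrict_keys (- ?S) f" g] by blast
    then show "m \<notin> {m. mdeg m = d}" using g False by (auto simp: hom_part_def mdeg_add keys_restrict_keys)
  qed
  ultimately show ?thesis using False by (simp add: hcomp_id)
qed

lemma hcomp_gen_ideal_two:
  assumes a: "a \<in> hom_part i" and b: "b \<in> hom_part j" and f: "f \<in> gen_ideal (poly_ring n) {a, b}"
  shows "\<exists>x y. x \<in> poly_ring n \<and> y \<in> poly_ring n \<and> hcomp d f = x * a + y * b \<and>
    x \<in> hom_part (d - i) \<and> y \<in> hom_part (d - j) \<and> (d < i \<longrightarrow> x = 0) \<and> (d < j \<longrightarrow> y = 0)"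
proof -
  obtain x y where xy: "x \<in> poly_ring n" "y \<in> poly_ring n" "f = x * a + y * b"
    using f unfolding gen_ideal_two[OF poly_ring_subring] by blast
  let ?x = "if d < i then 0 else hcomp (d - i) x" and ?y = "if d < j then 0 else hcomp (d - j) y"
  have "hcomp d f = ?x * a + ?y * b"
    unfolding xy(3) hcomp_add hcomp_mult_hom[OF a] hcomp_mult_hom[OF b] by simp
  moreover have "?x \<in> poly_ring n" "?y \<in> poly_ring n"
    using xy by (simp_all add: hcomp_in_poly_ring poly_ring_closed)
  moreover have "?x \<in> hom_part (d - i)" "?y \<in> hom_part (d - j)" by (simp_all add: hcomp_hom_part)
  ultimately show ?thesis by (intro exI[of _ ?x] exI[of _ ?y]) simp
qed

subsection \<open>Monomial multiples\<close>

lemma lookup_pmonom_mult: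
  "lookup (pmonom e * f) m = (if expo_le e m then lookup f (m - e) else 0)"
proof (induction f rule: cpoly_induct)
  case (single k c)
  have "e + k = m \<longleftrightarrow> expo_le e m \<and> k = m - e"
  proof
    assume "e + k = m"
    then show "expo_le e m \<and> k = m - e" by (auto simp: expo_le_def lookup_add)
  next
    assume "expo_le e m \<and> k = m - e"
    then show "e + k = m" using expo_le_add_diff[of e m] by (simp add: add.commute)
  qed
  then show ?case by (auto simp: mult_single lookup_single when_def)
qed (simp_all add: distrib_left lookup_add)

lemma pmonom_dvd:
  assumes "f \<in> poly_ring n" "\<And>m. m \<in> keys f \<Longrightarrow> expo_le e m"
  shows "\<exists>g\<in>poly_ring n. f = pmonom e * g"
proof
  let ?g = "\<Sum>m\<in>keys f. single (m - e) (lookup f m)"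
  have "pmonom e * ?g = (\<Sum>m\<in>keys f. single m (lookup f m))"
    unfolding sum_distrib_left
  proof (rule sum.cong[OF refl])
    fix m assume "m \<in> keys f"
    from expo_le_add_diff[OF assms(2)[OF this]]
    show "pmonom e * single (m - e) (lookup f m) = single m (lookup f m)"
      by (simp add: mult_single add.commute)
  qed
  then show "f = pmonom e * ?g" by (simp flip: poly_mapping_sum_single)
  show "?g \<in> poly_ring n"
    by (rule subring_set_sum[OF poly_ring_subring])
      (use assms(1) in \<open>auto simp: poly_ring_def intro!: single_in_poly_ring expos_minus\<close>)
qed

abbreviation xexp :: "nat \<Rightarrow> nat \<Rightarrow> expo" where "xexp j i \<equiv> single j i"

lemma pvar_power: "pvar j ^ i = pmonom (xexp j i)"
  unfolding pvar_def by (simp add: single_power expo_of_nat_mult del: One_nat_def)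

lemma expo_le_xexp: "expo_le (xexp j i) m \<longleftrightarrow> i \<le> lookup m j"
  by (auto simp: expo_le_def lookup_single when_def)

lemma coprime_variables:
  assumes "f \<in> poly_ring n" "j \<noteq> k" "pvar j ^ a * f = pvar k ^ b * g"
  shows "\<exists>h\<in>poly_ring n. f = h * pvar k ^ b"
proof -
  have "expo_le (xexp k b) m" if m: "m \<in> keys f" for m
  proof -
    have le: "expo_le (xexp j a) (xexp j a + m)" by (simp add: expo_le_xexp lookup_add)
    have "lookup (pvar j ^ a * f) (xexp j a + m) = lookup f m"
      unfolding pvar_power lookup_pmonom_mult using le by simp
    moreover have "lookup f m \<noteq> 0" using m by (simp only: in_keys_iff) simp
    ultimately have "lookup (pmonom (xexp k b) * g) (xexp j a + m) \<noteq> 0"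
      using assms(3) unfolding pvar_power by simp
    then have "expo_le (xexp k b) (xexp j a + m)" unfolding lookup_pmonom_mult by (simp split: if_splits)
    then show ?thesis using assms(2) by (simp add: expo_le_xexp lookup_add lookup_single)
  qed
  from pmonom_dvd[OF assms(1) this] show ?thesis by (simp add: pvar_power mult.commute)
qed

subsection \<open>Pairs of independent linear forms in two variables\<close>

definition lform :: "complex \<Rightarrow> complex \<Rightarrow> cpoly" where
  "lform a b = pconst a * pvar 0 + pconst b * pvar 1"

definition indep_forms :: "cpoly \<Rightarrow> cpoly \<Rightarrow> bool" where
  "indep_forms l m \<longleftrightarrow> (\<exists>a b c d. l = lform a b \<and> m = lform c d \<and> a * d - b * c \<noteq> 0)"

lemma lform_in_poly_ring: "lform a b \<in> poly_ring 2"
  by (simp add: lform_def poly_ring_closed pvar_in_poly_ring)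

lemma lform_hom_part: "lform a b \<in> hom_part 1"
  by (simp add: lform_def hom_part_add hom_part_pconst_mult hom_part_pvar del: One_nat_def)

lemma indep_forms_in: "indep_forms l m \<Longrightarrow> l \<in> poly_ring 2 \<and> m \<in> poly_ring 2 \<and> l \<in> hom_part 1 \<and> m \<in> hom_part 1"
  unfolding indep_forms_def using lform_in_poly_ring lform_hom_part by blast

text \<open>The matrix of the coefficients is invertible, so that \<open>l\<close> and \<open>m\<close> are the new variables of a linear
  change of coordinates. Statements on two independent forms thus reduce to statements on the variables.\<close>

lemma indep_forms_coordinates:
  assumes "indep_forms l m"
  obtains to_forms from_forms :: "cpoly \<Rightarrow> cpoly" where
    "\<And>f g. to_forms (f + g) = to_forms f + to_forms g" "\<And>f g. to_forms (f * g) = to_forms f * to_forms g"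
    "\<And>f g. from_forms (f + g) = from_forms f + from_forms g" "\<And>f g. from_forms (f * g) = from_forms f * from_forms g"
    "\<And>c. to_forms (pconst c) = pconst c" "\<And>c. from_forms (pconst c) = pconst c"
    "to_forms (pvar 0) = l" "to_forms (pvar 1) = m"
    "\<And>f. f \<in> poly_ring 2 \<Longrightarrow> to_forms f \<in> poly_ring 2" "\<And>f. f \<in> poly_ring 2 \<Longrightarrow> from_forms f \<in> poly_ring 2"
    "\<And>f. from_forms (to_forms f) = f" "\<And>f. to_forms (from_forms f) = f"
proof -
  obtain a b c d where lm: "l = lform a b" "m = lform c d" and det: "a * d - b * c \<noteq> 0"
    using assms unfolding indep_forms_def by blast
  define D where "D = a * d - b * c"
  have D: "D \<noteq> 0" using det by (simp add: D_def)
  let ?L = "\<lambda>j. if j = 0 then lform a b else if j = 1 then lform c d else pvar j"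
  let ?M = "\<lambda>j. if j = 0 then lform (d / D) (- b / D) else if j = 1 then lform (- c / D) (a / D) else pvar j"
  have sub: "psubst L (lform x y) = pconst x * L 0 + pconst y * L 1" for L x y
    by (simp add: lform_def psubst_add psubst_mult psubst_pconst psubst_pvar)
  have comb: "pconst x * lform p r + pconst y * lform s t = lform (x * p + y * s) (x * r + y * t)" for x y p r s t
    by (simp add: lform_def pconst_add pconst_mult algebra_simps)
  have unit: "lform 1 0 = pvar 0" "lform 0 1 = pvar 1" by (simp_all add: lform_def)
  have inv: "d / D * a + - b / D * c = 1" "d / D * b + - b / D * d = 0"
    "- c / D * a + a / D * c = 0" "- c / D * b + a / D * d = 1"
    using D by (simp_all add: field_simps) (simp_all add: D_def algebra_simps)
  have inv': "a * (d / D) + b * (- c / D) = 1" "a * (- b / D) + b * (a / D) = 0"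
    "c * (d / D) + d * (- c / D) = 0" "c * (- b / D) + d * (a / D) = 1"
    using D by (simp_all add: field_simps) (simp_all add: D_def algebra_simps)
  have inv_from: "psubst ?L (?M j) = pvar j" for j
  proof -
    consider "j = 0" | "j = 1" | "j \<noteq> 0" "j \<noteq> 1" by blast
    then show ?thesis
    proof cases
      case 1
      have "psubst ?L (?M j) = pconst (d / D) * lform a b + pconst (- b / D) * lform c d"
        unfolding 1 by (simp only: simp_thms if_True if_False sub zero_neq_one one_neq_zero)
      then show ?thesis unfolding comb inv unit 1 .
    next
      case 2
      have "psubst ?L (?M j) = pconst (- c / D) * lform a b + pconst (a / D) * lform c d"
        unfolding 2 by (simp only: simp_thms if_True if_False sub zero_neq_one one_neq_zero)
      then show ?thesis unfolding comb inv unit 2 .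
    next
      case 3
      then show ?thesis by (simp add: psubst_pvar)
    qed
  qed
  have inv_to: "psubst ?M (?L j) = pvar j" for j
  proof -
    consider "j = 0" | "j = 1" | "j \<noteq> 0" "j \<noteq> 1" by blast
    then show ?thesis
    proof cases
      case 1
      have "psubst ?M (?L j) = pconst a * lform (d / D) (- b / D) + pconst b * lform (- c / D) (a / D)"
        unfolding 1 by (simp only: simp_thms if_True if_False sub zero_neq_one one_neq_zero)
      then show ?thesis unfolding comb inv' unit 1 .
    next
      case 2
      have "psubst ?M (?L j) = pconst c * lform (d / D) (- b / D) + pconst d * lform (- c / D) (a / D)"
        unfolding 2 by (simp only: simp_thms if_True if_False sub zero_neq_one one_neq_zero)
      then show ?thesis unfolding comb inv' unit 2 .
    next
      case 3
      then show ?thesis by (simp add: psubst_pvar)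
    qed
  qed
  show ?thesis
  proof (rule that[of "psubst ?L" "psubst ?M"])
    show "psubst ?L (pvar 0) = l" "psubst ?L (pvar 1) = m" by (simp_all add: psubst_pvar lm)
    show "psubst ?M (psubst ?L f) = f" for f unfolding psubst_psubst inv_to by (rule psubst_id)
    show "psubst ?L (psubst ?M f) = f" for f unfolding psubst_psubst inv_from by (rule psubst_id)
    show "psubst ?L f \<in> poly_ring 2" if "f \<in> poly_ring 2" for f
      by (rule psubst_in_poly_ring[OF that]) (auto simp: lform_in_poly_ring)
    show "psubst ?M f \<in> poly_ring 2" if "f \<in> poly_ring 2" for f
      by (rule psubst_in_poly_ring[OF that]) (auto simp: lform_in_poly_ring)
  qed (simp_all add: psubst_add psubst_mult psubst_pconst)
qed

lemma hom_power:
  assumes "\<And>f g. \<phi> (f * g) = \<phi> f * \<phi> g" "\<And>c. \<phi> (pconst c) = pconst c"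
  shows "\<phi> (f ^ k) = (\<phi> f :: cpoly) ^ k"
proof (induction k)
  case 0
  show ?case using assms(2)[of 1] by simp
qed (simp add: assms(1))

text \<open>In the coordinates \<open>l, m\<close> this is divisibility by a power of a variable, which is visible on the
  exponents.\<close>

lemma coprime_forms:
  assumes lm: "indep_forms l m" and f: "f \<in> poly_ring 2" and eq: "l ^ a * f = m ^ b * g"
  shows "\<exists>h\<in>poly_ring 2. f = h * m ^ b"
proof -
  obtain T F :: "cpoly \<Rightarrow> cpoly" where T: "\<And>f g. T (f * g) = T f * T g" "\<And>c. T (pconst c) = pconst c"
    and F: "\<And>f g. F (f * g) = F f * F g" "\<And>c. F (pconst c) = pconst c"
    and var: "T (pvar 0) = l" "T (pvar 1) = m"
    and ring: "\<And>f. f \<in> poly_ring 2 \<Longrightarrow> T f \<in> poly_ring 2" "\<And>f. f \<in> poly_ring 2 \<Longrightarrow> F f \<in> poly_ring 2"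
    and inv: "\<And>f. F (T f) = f" "\<And>f. T (F f) = f"
    by (rule indep_forms_coordinates[OF lm]) (blast intro: that)
  have Fl: "F l = pvar 0" "F m = pvar 1" using inv(1)[of "pvar 0"] inv(1)[of "pvar 1"] var by simp_all
  have "F (l ^ a * f) = F (m ^ b * g)" using eq by simp
  then have "pvar 0 ^ a * F f = pvar 1 ^ b * F g" by (simp add: F hom_power[of F, OF F] Fl)
  then obtain h where h: "h \<in> poly_ring 2" "F f = h * pvar 1 ^ b"
    using coprime_variables[OF ring(2)[OF f], of 0 1 a b "F g"] by (auto simp del: One_nat_def)
  have "f = T (h * pvar 1 ^ b)" using inv(2)[of f] h(2) by simp
  then have "f = T h * m ^ b" by (simp add: T hom_power[of T, OF T] var del: One_nat_def)
  then show ?thesis using ring(1)[OF h(1)] by blast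
qed

lemma monomial_ideal_membership:
  assumes f: "f \<in> poly_ring 2"
  shows "f \<in> gen_ideal (poly_ring 2) {pvar 0 ^ q, pvar 1 ^ q} \<longleftrightarrow>
    (\<forall>m\<in>keys f. q \<le> lookup m 0 \<or> q \<le> lookup m 1)"
proof
  have gens: "{pvar 0 ^ q, pvar 1 ^ q} = pmonom ` {xexp 0 q, xexp 1 q}" by (simp add: pvar_power)
  assume "f \<in> gen_ideal (poly_ring 2) {pvar 0 ^ q, pvar 1 ^ q}"
  then have mem: "f \<in> gen_ideal (poly_ring 2) (pmonom ` {xexp 0 q, xexp 1 q})" unfolding gens .
  show "\<forall>m\<in>keys f. q \<le> lookup m 0 \<or> q \<le> lookup m 1"
  proof
    fix m assume "m \<in> keys f"
    from monomial_ideal_keys[OF mem this] show "q \<le> lookup m 0 \<or> q \<le> lookup m 1"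
      by (auto simp: expo_le_xexp)
  qed
next
  assume keys: "\<forall>m\<in>keys f. q \<le> lookup m 0 \<or> q \<le> lookup m 1"
  let ?S = "{m. q \<le> lookup m 0}"
  have "restrict_keys ?S f \<in> poly_ring 2" "restrict_keys (- ?S) f \<in> poly_ring 2"
    using f by (auto simp: poly_ring_def keys_restrict_keys)
  moreover have "expo_le (xexp 0 q) m" if "m \<in> keys (restrict_keys ?S f)" for m
    using that by (simp add: keys_restrict_keys expo_le_xexp)
  moreover have "expo_le (xexp 1 q) m" if "m \<in> keys (restrict_keys (- ?S) f)" for m
    using that keys by (auto simp: keys_restrict_keys expo_le_xexp)
  ultimately obtain g h where g: "g \<in> poly_ring 2" "restrict_keys ?S f = pmonom (xexp 0 q) * g"
    and h: "h \<in> poly_ring 2" "restrict_keys (- ?S) f = pmonom (xexp 1 q) * h"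
    using pmonom_dvd[of "restrict_keys ?S f" 2 "xexp 0 q"] pmonom_dvd[of "restrict_keys (- ?S) f" 2 "xexp 1 q"] by blast
  have "f = g * pvar 0 ^ q + h * pvar 1 ^ q"
    using restrict_keys_split[of f ?S] g(2) h(2) by (simp add: pvar_power mult.commute)
  then show "f \<in> gen_ideal (poly_ring 2) {pvar 0 ^ q, pvar 1 ^ q}"
    unfolding gen_ideal_two[OF poly_ring_subring] using g(1) h(1) by blast
qed

lemma expo2_eq: "m \<in> expos 2 \<Longrightarrow> m = xexp 0 (lookup m 0) + xexp 1 (lookup m 1)"
  by (rule expos_eqI[where n = 2])
    (auto simp: expos_iff lookup_add lookup_single when_def less_2_cases_iff split: if_splits)

lemma lookup_xexp2: "lookup (xexp 0 i + xexp 1 j) 0 = i" "lookup (xexp 0 i + xexp 1 j) 1 = j"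
  by (simp_all add: lookup_add lookup_single)

lemma xexp2_eq_iff: "xexp 0 i + xexp 1 j = xexp 0 i' + xexp 1 j' \<longleftrightarrow> i = i' \<and> j = j'"
  by (metis lookup_xexp2)

lemma pvar_powers: "pvar 0 ^ i * pvar 1 ^ j = pmonom (xexp 0 i + xexp 1 j)"
  by (simp add: pvar_power mult_single)

text \<open>In the coordinates \<open>l, m\<close> the ideal is spanned by the monomials divisible by one of the two \<open>q\<close>-th
  powers of the variables, and the remaining monomials represent a basis of the quotient.\<close>

lemma forms_basis:
  assumes lm: "indep_forms l m"
  shows "f \<in> poly_ring 2 \<Longrightarrow> \<exists>c. f - (\<Sum>(i, j)\<in>{..<q} \<times> {..<q}. pconst (c (i, j)) * (l ^ i * m ^ j)) \<in> gen_ideal (poly_ring 2) {l ^ q, m ^ q}"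
    and "(\<Sum>(i, j)\<in>{..<q} \<times> {..<q}. pconst (c (i, j)) * (l ^ i * m ^ j)) \<in> gen_ideal (poly_ring 2) {l ^ q, m ^ q} \<Longrightarrow>
      i < q \<Longrightarrow> j < q \<Longrightarrow> c (i, j) = 0"
proof -
  obtain T F :: "cpoly \<Rightarrow> cpoly" where Tadd: "\<And>f g. T (f + g) = T f + T g"
    and T: "\<And>f g. T (f * g) = T f * T g" "\<And>c. T (pconst c) = pconst c"
    and Fadd: "\<And>f g. F (f + g) = F f + F g"
    and F: "\<And>f g. F (f * g) = F f * F g" "\<And>c. F (pconst c) = pconst c"
    and var: "T (pvar 0) = l" "T (pvar 1) = m"
    and ring: "\<And>f. f \<in> poly_ring 2 \<Longrightarrow> T f \<in> poly_ring 2" "\<And>f. f \<in> poly_ring 2 \<Longrightarrow> F f \<in> poly_ring 2"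
    and inv: "\<And>f. F (T f) = f" "\<And>f. T (F f) = f"
    by (rule indep_forms_coordinates[OF lm]) (blast intro: that)
  have F0: "F 0 = 0" "T 0 = 0" using F(2)[of 0] T(2)[of 0] by simp_all
  have Fl: "F l = pvar 0" "F m = pvar 1" using inv(1)[of "pvar 0"] inv(1)[of "pvar 1"] var by simp_all
  have Tsum: "T (sum g A) = (\<Sum>x\<in>A. T (g x))" for g :: "nat \<times> nat \<Rightarrow> cpoly" and A
    by (induction A rule: infinite_finite_induct) (simp_all add: F0 Tadd)
  let ?I = "{..<q} \<times> {..<q}"
  let ?s = "\<lambda>c. \<Sum>(i, j)\<in>?I. pconst (c (i, j)) * (l ^ i * m ^ j)"
  let ?t = "\<lambda>c. \<Sum>(i, j)\<in>?I. pconst (c (i, j)) * (pvar 0 ^ i * pvar 1 ^ j)"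
  have Tt: "T (?t c) = ?s c" for c
    unfolding Tsum by (simp add: case_prod_unfold T hom_power[of T, OF T] var del: One_nat_def)
  have mem: "T g \<in> gen_ideal (poly_ring 2) {l ^ q, m ^ q}" if "g \<in> gen_ideal (poly_ring 2) {pvar 0 ^ q, pvar 1 ^ q}" for g
    using gen_ideal_hom_image[of T "poly_ring 2" "poly_ring 2" g, OF Tadd T(1) _ that] ring(1)
    by (simp add: image_subset_iff hom_power[of T, OF T] var del: One_nat_def)
  have mem': "F g \<in> gen_ideal (poly_ring 2) {pvar 0 ^ q, pvar 1 ^ q}" if "g \<in> gen_ideal (poly_ring 2) {l ^ q, m ^ q}" for g
    using gen_ideal_hom_image[of F "poly_ring 2" "poly_ring 2" g, OF Fadd F(1) _ that] ring(2)
    by (simp add: image_subset_iff hom_power[of F, OF F] Fl del: One_nat_def)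
  have t_single: "?t c = (\<Sum>p\<in>?I. single (xexp 0 (fst p) + xexp 1 (snd p)) (c p))" for c
    by (rule sum.cong[OF refl]) (simp add: case_prod_unfold pvar_powers pconst_mult_single del: One_nat_def)
  have look: "lookup (?t c) (xexp 0 i + xexp 1 j) = (if i < q \<and> j < q then c (i, j) else 0)" for c i j
  proof -
    have "lookup (?t c) (xexp 0 i + xexp 1 j) = (\<Sum>p\<in>?I. if p = (i, j) then c (i, j) else 0)"
      unfolding t_single lookup_sum
      by (rule sum.cong[OF refl]) (auto simp: lookup_single when_def xexp2_eq_iff simp del: One_nat_def)
    then show ?thesis by (simp add: sum.delta)
  qed
  have t_ring: "?t c \<in> poly_ring 2" for c
    unfolding t_single by (rule subring_set_sum[OF poly_ring_subring])
      (auto intro!: single_in_poly_ring expos_add simp: expos_iff lookup_single when_def split: if_splits)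
  show "\<exists>c. f - ?s c \<in> gen_ideal (poly_ring 2) {l ^ q, m ^ q}" if f: "f \<in> poly_ring 2"
  proof -
    let ?c = "\<lambda>(i, j). lookup (F f) (xexp 0 i + xexp 1 j)"
    have "F f - ?t ?c \<in> gen_ideal (poly_ring 2) {pvar 0 ^ q, pvar 1 ^ q}"
    proof (subst monomial_ideal_membership)
      show r: "F f - ?t ?c \<in> poly_ring 2" using ring(2)[OF f] t_ring by (rule poly_ring_closed(4))
      show "\<forall>m\<in>keys (F f - ?t ?c). q \<le> lookup m 0 \<or> q \<le> lookup m 1"
      proof (intro ballI, rule ccontr)
        fix m assume m: "m \<in> keys (F f - ?t ?c)"
          and small: "\<not> (q \<le> lookup m 0 \<or> q \<le> lookup m 1)"
        have "m \<in> expos 2" using r m unfolding poly_ring_def by blast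
        from expo2_eq[OF this] obtain i j where ij: "m = xexp 0 i + xexp 1 j" by blast
        have "i < q" "j < q" using small unfolding ij lookup_xexp2 by auto
        then have "lookup (F f - ?t ?c) m = 0" unfolding ij lookup_minus look by simp
        then show False using m by (simp add: not_in_keys_iff_lookup_eq_zero[symmetric])
      qed
    qed
    from mem[OF this] have "T (F f - ?t ?c) \<in> gen_ideal (poly_ring 2) {l ^ q, m ^ q}" .
    moreover have "T (F f - ?t ?c) = f - ?s ?c"
    proof (rule eq_diff_eq[THEN iffD2])
      have "T (F f - ?t ?c) + T (?t ?c) = T (F f)" unfolding Tadd[symmetric] by simp
      then show "T (F f - ?t ?c) + ?s ?c = f" unfolding Tt inv(2) .
    qed
    ultimately have "f - ?s ?c \<in> gen_ideal (poly_ring 2) {l ^ q, m ^ q}" by (simp only:)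
    then show ?thesis by (rule exI[of _ ?c])
  qed
  show "c (i, j) = 0" if s: "?s c \<in> gen_ideal (poly_ring 2) {l ^ q, m ^ q}" and ij: "i < q" "j < q"
  proof -
    have "F (?s c) = ?t c" using inv(1)[of "?t c"] unfolding Tt .
    then have "?t c \<in> gen_ideal (poly_ring 2) {pvar 0 ^ q, pvar 1 ^ q}" using mem'[OF s] by simp
    then have keys: "\<forall>m\<in>keys (?t c). q \<le> lookup m 0 \<or> q \<le> lookup m 1"
      using monomial_ideal_membership[OF t_ring] by blast
    have "xexp 0 i + xexp 1 j \<notin> keys (?t c)"
    proof
      assume "xexp 0 i + xexp 1 j \<in> keys (?t c)"
      with keys have "q \<le> lookup (xexp 0 i + xexp 1 j) 0 \<or> q \<le> lookup (xexp 0 i + xexp 1 j) 1"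
        by (rule bspec)
      then show False unfolding lookup_xexp2 using ij by linarith
    qed
    then have "lookup (?t c) (xexp 0 i + xexp 1 j) = 0" by (simp only: not_in_keys_iff_lookup_eq_zero)
    then show ?thesis unfolding look using ij by simp
  qed
qed

section \<open>Quotient dimensions and quotient isomorphisms\<close>

lemma has_quot_dimI:
  fixes sc :: "complex \<Rightarrow> 'a \<Rightarrow> 'a::ab_group_add" and x :: "'i \<Rightarrow> 'a"
  assumes vs: "vector_space sc" and W: "module.subspace sc W" and I: "finite I"
    and x: "\<And>i. i \<in> I \<Longrightarrow> x i \<in> V"
    and span: "\<And>f. f \<in> V \<Longrightarrow> \<exists>c. f - (\<Sum>i\<in>I. sc (c i) (x i)) \<in> W"
    and indep: "\<And>c i. (\<Sum>i\<in>I. sc (c i) (x i)) \<in> W \<Longrightarrow> i \<in> I \<Longrightarrow> c i = 0"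
  shows "has_quot_dim sc V W (card I)"
proof -
  interpret vector_space sc by (rule vs)
  have inj: "inj_on x I"
  proof (rule inj_onI, rule ccontr)
    fix i j assume ij: "i \<in> I" "j \<in> I" "x i = x j" "i \<noteq> j"
    let ?c = "\<lambda>k. if k = i then 1 else if k = j then - 1 else (0 :: complex)"
    have "(\<Sum>k\<in>I. sc (?c k) (x k)) = (\<Sum>k\<in>{i, j}. sc (?c k) (x k))"
      by (rule sum.mono_neutral_right) (use I ij in auto)
    also have "\<dots> = 0" using ij by simp
    finally have "?c i = 0" using subspace_0[OF W] indep[of ?c i] ij(1) by simp
    then show False by simp
  qed
  have spW: "span W = W" using W by (rule span_eq_iff[THEN iffD2])
  have "V \<subseteq> span (W \<union> x ` I)"
  proof
    fix f assume "f \<in> V"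
    then obtain c where c: "f - (\<Sum>i\<in>I. sc (c i) (x i)) \<in> W" using span by blast
    have "f - (\<Sum>i\<in>I. sc (c i) (x i)) \<in> span (W \<union> x ` I)" by (rule span_base) (use c in blast)
    moreover have "(\<Sum>i\<in>I. sc (c i) (x i)) \<in> span (W \<union> x ` I)"
      by (intro span_sum span_scale span_base) blast
    ultimately have "f - (\<Sum>i\<in>I. sc (c i) (x i)) + (\<Sum>i\<in>I. sc (c i) (x i)) \<in> span (W \<union> x ` I)"
      by (rule span_add)
    then show "f \<in> span (W \<union> x ` I)" by simp
  qed
  moreover have "x i \<notin> span (W \<union> (x ` I - {x i}))" if i: "i \<in> I" for i
  proof
    assume "x i \<in> span (W \<union> (x ` I - {x i}))"
    moreover have "x ` I - {x i} = x ` (I - {i})" using inj i by (auto simp: inj_on_def)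
    ultimately have "x i \<in> span (W \<union> x ` (I - {i}))" by simp
    then obtain w y where wy: "w \<in> W" "y \<in> span (x ` (I - {i}))" "x i = w + y"
      unfolding span_Un spW by blast
    have fin: "finite (x ` (I - {i}))" using I by simp
    obtain u where "y = (\<Sum>v\<in>x ` (I - {i}). sc (u v) v)" using wy(2) unfolding span_finite[OF fin] by blast
    moreover have "inj_on x (I - {i})" using inj by (rule inj_on_subset) blast
    ultimately have y: "y = (\<Sum>j\<in>I - {i}. sc (u (x j)) (x j))" by (simp add: sum.reindex)
    let ?c = "\<lambda>j. if j = i then 1 else - u (x j)"
    have "(\<Sum>j\<in>I. sc (?c j) (x j)) = x i + (\<Sum>j\<in>I - {i}. sc (?c j) (x j))"
      by (subst sum.remove[OF I i]) simp
    also have "(\<Sum>j\<in>I - {i}. sc (?c j) (x j)) = - y"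
      unfolding y sum_negf[symmetric] by (rule sum.cong) auto
    finally have "(\<Sum>j\<in>I. sc (?c j) (x j)) = w" using wy(3) by simp
    then have "?c i = 0" using wy(1) indep[of ?c i] i by simp
    then show False by simp
  qed
  ultimately show ?thesis
    unfolding has_quot_dim_def using I x card_image[OF inj] by (intro exI[of _ "x ` I"]) auto
qed

text \<open>Steinitz' exchange needs finite families. Only the finitely many elements of \<open>W\<close> matter that occur
  when the elements of \<open>Y\<close> are expressed by \<open>X\<close>; a basis of their span is added to both families.\<close>

lemma quot_independent_bound:
  fixes sc :: "complex \<Rightarrow> 'a \<Rightarrow> 'a::ab_group_add"
  assumes vs: "vector_space sc" and W: "module.subspace sc W" and fin: "finite X" "finite Y"
    and Y: "Y \<subseteq> module.span sc (W \<union> X)" and ind: "\<And>y. y \<in> Y \<Longrightarrow> y \<notin> module.span sc (W \<union> (Y - {y}))"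
  shows "card Y \<le> card X"
proof -
  interpret vector_space sc by (rule vs)
  have spW: "span W = W" using W by (rule span_eq_iff[THEN iffD2])
  have "\<forall>y\<in>Y. \<exists>w. w \<in> W \<and> y - w \<in> span X"
  proof
    fix y assume "y \<in> Y"
    then have "y \<in> span (W \<union> X)" using Y by blast
    then obtain w z where "w \<in> W" "z \<in> span X" "y = w + z" unfolding span_Un spW by blast
    then show "\<exists>w. w \<in> W \<and> y - w \<in> span X" by (intro exI[of _ w]) simp
  qed
  from bchoice[OF this] obtain w where w: "\<And>y. y \<in> Y \<Longrightarrow> w y \<in> W" "\<And>y. y \<in> Y \<Longrightarrow> y - w y \<in> span X" by blast
  obtain B where B: "B \<subseteq> w ` Y" "independent B" "w ` Y \<subseteq> span B"
    using maximal_independent_subset[of "w ` Y"] by blast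
  have BW: "B \<subseteq> W" using B(1) w(1) by blast
  have finB: "finite B" using B(1) fin(2) finite_subset by blast
  have "independent (B \<union> Z)" if "Z \<subseteq> Y" for Z
    using finite_subset[OF that fin(2)] that
  proof (induction Z rule: finite_induct)
    case empty
    then show ?case using B(2) by simp
  next
    case (insert y Z)
    have "B \<union> Z \<subseteq> W \<union> (Y - {y})" using BW insert by blast
    then have "span (B \<union> Z) \<subseteq> span (W \<union> (Y - {y}))" by (rule span_mono)
    then have "y \<notin> span (B \<union> Z)" using ind[of y] insert.prems by blast
    moreover have "independent (B \<union> Z)" using insert by blast
    ultimately have "independent (insert y (B \<union> Z))" by (rule independent_insertI)
    then show ?case by simp
  qed
  from this[OF order_refl] have indep: "independent (B \<union> Y)" .
  have "B \<union> Y \<subseteq> span (B \<union> X)"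
  proof
    fix v assume "v \<in> B \<union> Y"
    then show "v \<in> span (B \<union> X)"
    proof
      assume "v \<in> B"
      then show ?thesis by (intro span_base) blast
    next
      assume v: "v \<in> Y"
      have "w v \<in> span (B \<union> X)" using B(3) v span_mono[of B "B \<union> X"] by blast
      moreover have "v - w v \<in> span (B \<union> X)" using w(2)[OF v] span_mono[of X "B \<union> X"] by blast
      ultimately have "w v + (v - w v) \<in> span (B \<union> X)" by (rule span_add)
      then show ?thesis by simp
    qed
  qed
  then have "card (B \<union> Y) \<le> card (B \<union> X)"
    using independent_span_bound[OF _ indep, of "B \<union> X"] finB fin(1) by simp
  moreover have "B \<inter> Y = {}"
  proof -
    have "y \<notin> W" if "y \<in> Y" for y using ind[OF that] span_base[of y "W \<union> (Y - {y})"] by blast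
    then show ?thesis using BW by blast
  qed
  then have "card (B \<union> Y) = card B + card Y" using finB fin(2) by (rule card_Un_disjoint[rotated 2])
  moreover have "card (B \<union> X) \<le> card B + card X" by (rule card_Un_le)
  ultimately show ?thesis by linarith
qed

lemma has_quot_dim_unique:
  fixes sc :: "complex \<Rightarrow> 'a \<Rightarrow> 'a::ab_group_add"
  assumes vs: "vector_space sc" and W: "module.subspace sc W"
    and k: "has_quot_dim sc V W k" and k': "has_quot_dim sc V W k'"
  shows "k = k'"
proof -
  obtain X where X: "finite X" "card X = k" "X \<subseteq> V" "V \<subseteq> module.span sc (W \<union> X)"
      "\<And>x. x \<in> X \<Longrightarrow> x \<notin> module.span sc (W \<union> (X - {x}))"
    using k unfolding has_quot_dim_def by blast
  obtain Y where Y: "finite Y" "card Y = k'" "Y \<subseteq> V" "V \<subseteq> module.span sc (W \<union> Y)"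
      "\<And>x. x \<in> Y \<Longrightarrow> x \<notin> module.span sc (W \<union> (Y - {x}))"
    using k' unfolding has_quot_dim_def by blast
  have "card X \<le> card Y"
    by (rule quot_independent_bound[OF vs W Y(1) X(1) _ X(5)]) (use X(3) Y(4) in blast)+
  moreover have "card Y \<le> card X"
    by (rule quot_independent_bound[OF vs W X(1) Y(1) _ Y(5)]) (use Y(3) X(4) in blast)+
  ultimately show ?thesis using X(2) Y(2) by simp
qed

definition ideal_set :: "'a::comm_ring_1 set \<Rightarrow> 'a set \<Rightarrow> bool" where
  "ideal_set R D \<longleftrightarrow> D \<subseteq> R \<and> 0 \<in> D \<and> (\<forall>x\<in>D. \<forall>y\<in>D. x + y \<in> D) \<and> (\<forall>a\<in>R. \<forall>x\<in>D. a * x \<in> D)"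

lemma ideal_set_gen: "subring_set R \<Longrightarrow> S \<subseteq> R \<Longrightarrow> ideal_set R (gen_ideal R S)"
  unfolding ideal_set_def using gen_ideal_subset[of R S] by (auto intro: gen_submodule.intros)

lemma ideal_set_closed:
  assumes R: "subring_set R" and D: "ideal_set R D"
  shows "0 \<in> D" "\<And>x y. x \<in> D \<Longrightarrow> y \<in> D \<Longrightarrow> x + y \<in> D" "\<And>a x. a \<in> R \<Longrightarrow> x \<in> D \<Longrightarrow> a * x \<in> D"
    "\<And>x y. x \<in> D \<Longrightarrow> y \<in> D \<Longrightarrow> x - y \<in> D"
proof -
  show "0 \<in> D" and add: "\<And>x y. x \<in> D \<Longrightarrow> y \<in> D \<Longrightarrow> x + y \<in> D" and mult: "\<And>a x. a \<in> R \<Longrightarrow> x \<in> D \<Longrightarrow> a * x \<in> D"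
    using D unfolding ideal_set_def by blast+
  show "x - y \<in> D" if "x \<in> D" "y \<in> D" for x y
  proof -
    have "- 1 \<in> R" by (rule subring_setD(6)[OF R subring_setD(2)[OF R]])
    from add[OF that(1) mult[OF this that(2)]] show ?thesis by simp
  qed
qed

text \<open>The quotient \<open>\<alpha>\<close> is unique modulo \<open>D : a\<close>. As a map to the quotient by \<open>D : a\<close> the choice is
  therefore additive and linear.\<close>

definition divide_by :: "'b set \<Rightarrow> 'b set \<Rightarrow> 'b \<Rightarrow> ('a \<Rightarrow> 'b) \<Rightarrow> 'a \<Rightarrow> 'b::comm_ring_1" where
  "divide_by R D a \<sigma> f = (SOME \<alpha>. \<alpha> \<in> R \<and> \<sigma> f - \<alpha> * a \<in> D)"

lemma quotient_iso_divide_by: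
  assumes R': "subring_set R'" and D: "ideal_set R' D" and a: "a \<in> R'"
    and R: "subring_set R"
    and add: "\<And>f g. f \<in> R \<Longrightarrow> g \<in> R \<Longrightarrow> \<sigma> (f + g) = \<sigma> f + \<sigma> g"
    and mult: "\<And>f g. f \<in> R \<Longrightarrow> g \<in> R \<Longrightarrow> \<sigma> (f * g) = \<sigma> f * \<sigma> g"
    and surj: "\<sigma> ` R = R'"
    and M: "M = {f \<in> R. \<exists>\<alpha>\<in>R'. \<sigma> f - \<alpha> * a \<in> D}" and M': "M' = {f \<in> R. \<sigma> f \<in> D}"
    and N': "N' = {\<alpha> \<in> R'. \<alpha> * a \<in> D}"
  shows "quotient_iso R \<sigma> M M' R' N' (divide_by R' D a \<sigma>)"
    and "f \<in> M \<Longrightarrow> \<alpha> \<in> R' \<Longrightarrow> \<sigma> f - \<alpha> * a \<in> D \<Longrightarrow> divide_by R' D a \<sigma> f - \<alpha> \<in> N'"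
proof -
  let ?\<phi> = "divide_by R' D a \<sigma>"
  note r = subring_setD[OF R] and r' = subring_setD[OF R'] and d = ideal_set_closed[OF R' D]
  have \<sigma>R: "\<sigma> f \<in> R'" if "f \<in> R" for f using surj that by blast
  have \<phi>: "?\<phi> f \<in> R'" "\<sigma> f - ?\<phi> f * a \<in> D" if "f \<in> M" for f
  proof -
    have "\<exists>\<alpha>. \<alpha> \<in> R' \<and> \<sigma> f - \<alpha> * a \<in> D" using that unfolding M by blast
    from someI_ex[OF this] show "?\<phi> f \<in> R'" "\<sigma> f - ?\<phi> f * a \<in> D" unfolding divide_by_def by blast+
  qed
  have MR: "f \<in> R" if "f \<in> M" for f using that unfolding M by blast
  have MI: "f \<in> M" if "f \<in> R" "\<alpha> \<in> R'" "\<sigma> f - \<alpha> * a \<in> D" for f \<alpha>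
    unfolding M using that by blast
  have addM: "f + g \<in> M" if "f \<in> M" "g \<in> M" for f g
  proof -
    have "\<sigma> (f + g) - (?\<phi> f + ?\<phi> g) * a \<in> D"
      using d(2)[OF \<phi>(2)[OF that(1)] \<phi>(2)[OF that(2)]] add[OF MR[OF that(1)] MR[OF that(2)]]
      by (simp add: algebra_simps)
    then show ?thesis
      by (rule MI[OF r(3)[OF MR[OF that(1)] MR[OF that(2)]] r'(3)[OF \<phi>(1)[OF that(1)] \<phi>(1)[OF that(2)]]])
  qed
  have multM: "c * f \<in> M" if "c \<in> R" "f \<in> M" for c f
  proof -
    have "\<sigma> (c * f) - (\<sigma> c * ?\<phi> f) * a \<in> D"
      using d(3)[OF \<sigma>R[OF that(1)] \<phi>(2)[OF that(2)]] mult[OF that(1) MR[OF that(2)]]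
      by (simp add: algebra_simps)
    then show ?thesis
      by (rule MI[OF r(5)[OF that(1) MR[OF that(2)]] r'(5)[OF \<sigma>R[OF that(1)] \<phi>(1)[OF that(2)]]])
  qed
  have uniq: "?\<phi> f - \<alpha> \<in> N'" if "f \<in> M" "\<alpha> \<in> R'" "\<sigma> f - \<alpha> * a \<in> D" for f \<alpha>
  proof -
    have "(?\<phi> f - \<alpha>) * a = (\<sigma> f - \<alpha> * a) - (\<sigma> f - ?\<phi> f * a)" by (simp add: algebra_simps)
    then have "(?\<phi> f - \<alpha>) * a \<in> D" using d(4)[OF that(3) \<phi>(2)[OF that(1)]] by simp
    then show ?thesis unfolding N' using r'(4)[OF \<phi>(1)[OF that(1)] that(2)] by simp
  qed
  then show "f \<in> M \<Longrightarrow> \<alpha> \<in> R' \<Longrightarrow> \<sigma> f - \<alpha> * a \<in> D \<Longrightarrow> divide_by R' D a \<sigma> f - \<alpha> \<in> N'" .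
  show "quotient_iso R \<sigma> M M' R' N' ?\<phi>"
    unfolding quotient_iso_def
  proof (intro conjI ballI)
    show "?\<phi> f \<in> R'" if "f \<in> M" for f using \<phi>(1) that .
    show "?\<phi> (f + g) - (?\<phi> f + ?\<phi> g) \<in> N'" if fg: "f \<in> M" "g \<in> M" for f g
    proof (rule uniq[OF addM[OF fg]])
      show "?\<phi> f + ?\<phi> g \<in> R'" by (rule r'(3)[OF \<phi>(1)[OF fg(1)] \<phi>(1)[OF fg(2)]])
      show "\<sigma> (f + g) - (?\<phi> f + ?\<phi> g) * a \<in> D"
        using d(2)[OF \<phi>(2)[OF fg(1)] \<phi>(2)[OF fg(2)]] add[OF MR[OF fg(1)] MR[OF fg(2)]]
        by (simp add: algebra_simps)
    qed
    show "?\<phi> (c * f) - \<sigma> c * ?\<phi> f \<in> N'" if cf: "c \<in> R" "f \<in> M" for c f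
    proof (rule uniq[OF multM[OF cf]])
      show "\<sigma> c * ?\<phi> f \<in> R'" by (rule r'(5)[OF \<sigma>R[OF cf(1)] \<phi>(1)[OF cf(2)]])
      show "\<sigma> (c * f) - \<sigma> c * ?\<phi> f * a \<in> D"
        using d(3)[OF \<sigma>R[OF cf(1)] \<phi>(2)[OF cf(2)]] mult[OF cf(1) MR[OF cf(2)]]
        by (simp add: algebra_simps)
    qed
    show "?\<phi> f \<in> N' \<longleftrightarrow> f \<in> M'" if f: "f \<in> M" for f
    proof
      assume "?\<phi> f \<in> N'"
      then have "?\<phi> f * a \<in> D" unfolding N' by blast
      from d(2)[OF \<phi>(2)[OF f] this] show "f \<in> M'" unfolding M' using MR[OF f] by simp
    next
      assume "f \<in> M'"
      then have "\<sigma> f \<in> D" unfolding M' by blast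
      from d(4)[OF this \<phi>(2)[OF f]] show "?\<phi> f \<in> N'" unfolding N' using \<phi>(1)[OF f] by simp
    qed
    show "\<exists>f\<in>M. ?\<phi> f - g \<in> N'" if g: "g \<in> R'" for g
    proof -
      have "g * a \<in> R'" by (rule r'(5)[OF g a])
      then obtain f where f: "f \<in> R" "\<sigma> f = g * a" unfolding surj[symmetric] by (metis imageE)
      then have z: "\<sigma> f - g * a \<in> D" using d(1) by simp
      then have "f \<in> M" by (rule MI[OF f(1) g])
      from uniq[OF this g z] show ?thesis using \<open>f \<in> M\<close> by blast
    qed
  qed
qed

section \<open>The graded model\<close>

lemma vector_space_pscale: "vector_space pscale"
  by unfold_locales (simp_all add: pscale_def pconst_add pconst_mult algebra_simps)

lemma ideal_subspace:
  assumes "ideal_set (poly_ring n) D"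
  shows "module.subspace pscale (D \<inter> hom_part k)"
proof -
  interpret vector_space pscale by (rule vector_space_pscale)
  note d = ideal_set_closed[OF poly_ring_subring assms]
  show ?thesis
    by (rule subspaceI) (auto simp: pscale_def d hom_part_add hom_part_pconst_mult)
qed

lemma fps_square_geometric_nth:
  "fps_nth (fps_X ^ q * (\<Sum>i<q. fps_X ^ i) ^ 2 :: int fps) k
     = int (card {(i, j). i < q \<and> j < q \<and> i + j + q = k})"
proof -
  have fin: "finite {(i, j). i < q \<and> j < q \<and> i + j + q = k}"
    by (rule finite_subset[of _ "{..<q} \<times> {..<q}"]) auto
  have "(fps_X ^ q * (\<Sum>i<q. fps_X ^ i) ^ 2 :: int fps) = (\<Sum>i<q. \<Sum>j<q. fps_X ^ (i + j + q))"
  proof -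
    have "(\<Sum>i<q. fps_X ^ i) ^ 2 = (\<Sum>i<q. \<Sum>j<q. fps_X ^ i * fps_X ^ j :: int fps)"
      by (simp only: power2_eq_square sum_product)
    then have "fps_X ^ q * (\<Sum>i<q. fps_X ^ i) ^ 2 = (\<Sum>i<q. \<Sum>j<q. fps_X ^ q * (fps_X ^ i * fps_X ^ j) :: int fps)"
      by (simp only: sum_distrib_left)
    moreover have "fps_X ^ q * (fps_X ^ i * fps_X ^ j) = (fps_X ^ (i + j + q) :: int fps)" for i j
      by (simp add: power_add mult_ac)
    ultimately show ?thesis by (simp only:)
  qed
  then have "fps_nth (fps_X ^ q * (\<Sum>i<q. fps_X ^ i) ^ 2 :: int fps) k
      = (\<Sum>i<q. \<Sum>j<q. if k = i + j + q then 1 else 0)"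
    by (simp only: fps_sum_nth fps_X_power_nth)
  also have "\<dots> = (\<Sum>p\<in>{..<q} \<times> {..<q}. if k = fst p + snd p + q then 1 else 0)"
    by (simp only: sum.cartesian_product case_prod_unfold)
  also have "\<dots> = (\<Sum>p\<in>{(i, j). i < q \<and> j < q \<and> i + j + q = k}. 1)"
    by (rule sum.mono_neutral_cong_right) auto
  finally show ?thesis by simp
qed

text \<open>The forms stand for \<open>\<lambda>\<^sub>3, - \<lambda>\<^sub>1, \<lambda>\<^sub>2\<close>. Multiplication by \<open>Y\<^sup>q\<close> identifies the quotient of the
  polynomial ring by \<open>\<langle>Z\<^sup>q, X\<^sup>q\<rangle>\<close> with the quotient of \<open>\<langle>Y\<^sup>q, Z\<^sup>q\<rangle>\<close> by \<open>\<langle>Z\<^sup>q, X\<^sup>q Y\<^sup>q\<rangle>\<close>, which is the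
  source of the shift by \<open>q\<close>.\<close>

locale three_forms =
  fixes q :: nat and X Y Z :: cpoly
  assumes YZ: "indep_forms Y Z" and XY: "indep_forms X Y" and ZX: "indep_forms Z X"
begin

abbreviation "Jintr \<equiv> gen_ideal (poly_ring 2) {Y ^ q, Z ^ q}"
abbreviation "Jamb \<equiv> gen_ideal (poly_ring 2) {Z ^ q, X ^ q * Y ^ q}"
abbreviation "Jquot \<equiv> gen_ideal (poly_ring 2) {Z ^ q, X ^ q}"

lemma forms_in: "X \<in> poly_ring 2" "Y \<in> poly_ring 2" "Z \<in> poly_ring 2"
    "X \<in> hom_part 1" "Y \<in> hom_part 1" "Z \<in> hom_part 1"
  using indep_forms_in[OF YZ] indep_forms_in[OF XY] by blast+

lemma powers_in: "X ^ k \<in> poly_ring 2" "Y ^ k \<in> poly_ring 2" "Z ^ k \<in> poly_ring 2"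
    "X ^ k \<in> hom_part k" "Y ^ k \<in> hom_part k" "Z ^ k \<in> hom_part k"
  using forms_in hom_part_power[of X 1 k] hom_part_power[of Y 1 k] hom_part_power[of Z 1 k]
  by (simp_all add: poly_ring_closed)

lemma ideals: "ideal_set (poly_ring 2) Jintr" "ideal_set (poly_ring 2) Jamb" "ideal_set (poly_ring 2) Jquot"
  by (rule ideal_set_gen[OF poly_ring_subring]; simp add: powers_in poly_ring_closed)+

lemma Jamb_colon: "\<alpha> \<in> poly_ring 2 \<Longrightarrow> \<alpha> * Y ^ q \<in> Jamb \<longleftrightarrow> \<alpha> \<in> Jquot"
proof
  assume \<alpha>: "\<alpha> \<in> poly_ring 2" and "\<alpha> * Y ^ q \<in> Jamb"
  then obtain u v where uv: "u \<in> poly_ring 2" "v \<in> poly_ring 2" "\<alpha> * Y ^ q = u * Z ^ q + v * (X ^ q * Y ^ q)"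
    unfolding gen_ideal_two[OF poly_ring_subring] by blast
  then have "Y ^ q * (\<alpha> - v * X ^ q) = Z ^ q * u" by (simp add: algebra_simps)
  moreover have "\<alpha> - v * X ^ q \<in> poly_ring 2" using \<alpha> uv(2) powers_in by (simp add: poly_ring_closed)
  ultimately obtain h where h: "h \<in> poly_ring 2" "\<alpha> - v * X ^ q = h * Z ^ q"
    using coprime_forms[OF YZ] by blast
  then have "\<alpha> = h * Z ^ q + v * X ^ q" by (simp add: algebra_simps)
  then show "\<alpha> \<in> Jquot" unfolding gen_ideal_two[OF poly_ring_subring] using h(1) uv(2) by blast
next
  assume "\<alpha> \<in> Jquot"
  then obtain u v where uv: "u \<in> poly_ring 2" "v \<in> poly_ring 2" "\<alpha> = u * Z ^ q + v * X ^ q"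
    unfolding gen_ideal_two[OF poly_ring_subring] by blast
  have "\<alpha> * Y ^ q = (u * Y ^ q) * Z ^ q + v * (X ^ q * Y ^ q)" unfolding uv(3) by (simp add: algebra_simps)
  moreover have "u * Y ^ q \<in> poly_ring 2" using uv(1) powers_in by (simp add: poly_ring_closed)
  ultimately show "\<alpha> * Y ^ q \<in> Jamb" unfolding gen_ideal_two[OF poly_ring_subring] using uv(2) by blast
qed

lemma Jintr_eq: "Jintr = {f \<in> poly_ring 2. \<exists>\<alpha>\<in>poly_ring 2. f - \<alpha> * Y ^ q \<in> Jamb}"
proof (intro equalityI subsetI)
  fix f assume f: "f \<in> Jintr"
  then obtain u v where uv: "u \<in> poly_ring 2" "v \<in> poly_ring 2" "f = u * Y ^ q + v * Z ^ q"
    unfolding gen_ideal_two[OF poly_ring_subring] by blast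
  have "f - u * Y ^ q = v * Z ^ q + 0 * (X ^ q * Y ^ q)" using uv(3) by simp
  then have "f - u * Y ^ q \<in> Jamb"
    unfolding gen_ideal_two[OF poly_ring_subring] using uv(2) poly_ring_closed(1)[of 2] by blast
  moreover have "f \<in> poly_ring 2" using f ideals(1) unfolding ideal_set_def by blast
  ultimately show "f \<in> {f \<in> poly_ring 2. \<exists>\<alpha>\<in>poly_ring 2. f - \<alpha> * Y ^ q \<in> Jamb}" using uv(1) by blast
next
  fix f assume "f \<in> {f \<in> poly_ring 2. \<exists>\<alpha>\<in>poly_ring 2. f - \<alpha> * Y ^ q \<in> Jamb}"
  then obtain \<alpha> where \<alpha>: "\<alpha> \<in> poly_ring 2" "f - \<alpha> * Y ^ q \<in> Jamb" by blast
  then obtain u v where uv: "u \<in> poly_ring 2" "v \<in> poly_ring 2" "f - \<alpha> * Y ^ q = u * Z ^ q + v * (X ^ q * Y ^ q)"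
    unfolding gen_ideal_two[OF poly_ring_subring] by blast
  have "f = (\<alpha> + v * X ^ q) * Y ^ q + u * Z ^ q" using uv(3) by (simp add: algebra_simps)
  moreover have "\<alpha> + v * X ^ q \<in> poly_ring 2" using \<alpha>(1) uv(2) powers_in by (simp add: poly_ring_closed)
  ultimately show "f \<in> Jintr" unfolding gen_ideal_two[OF poly_ring_subring] using uv(1) by blast
qed

lemma graded_iso:
  "\<exists>\<phi>. quotient_iso (poly_ring 2) id Jintr Jamb (poly_ring 2) Jquot \<phi> \<and>
    degree_shifting q Jintr (poly_ring 2) Jquot \<phi>"
proof -
  have Jamb: "Jamb = {f \<in> poly_ring 2. id f \<in> Jamb}" using ideals(2) unfolding ideal_set_def by auto
  have Jquot: "Jquot = {\<alpha> \<in> poly_ring 2. \<alpha> * Y ^ q \<in> Jamb}"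
    using Jamb_colon ideals(3) unfolding ideal_set_def by blast
  have Jintr: "Jintr = {f \<in> poly_ring 2. \<exists>\<alpha>\<in>poly_ring 2. id f - \<alpha> * Y ^ q \<in> Jamb}"
    using Jintr_eq by simp
  let ?\<phi> = "divide_by (poly_ring 2) Jamb (Y ^ q) id"
  have iso: "quotient_iso (poly_ring 2) id Jintr Jamb (poly_ring 2) Jquot ?\<phi>"
    by (rule quotient_iso_divide_by(1)[OF poly_ring_subring ideals(2) powers_in(2) poly_ring_subring _ _ _ Jintr Jamb Jquot]) simp_all
  have uniq: "?\<phi> f - \<alpha> \<in> Jquot" if "f \<in> Jintr" "\<alpha> \<in> poly_ring 2" "f - \<alpha> * Y ^ q \<in> Jamb" for f \<alpha>
    by (rule quotient_iso_divide_by(2)[OF poly_ring_subring ideals(2) powers_in(2) poly_ring_subring _ _ _ Jintr Jamb Jquot that(1,2)])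
      (use that(3) in simp_all)
  have "degree_shifting q Jintr (poly_ring 2) Jquot ?\<phi>"
    unfolding degree_shifting_def
  proof (intro allI ballI)
    fix i f assume f: "f \<in> Jintr \<inter> hom_part i"
    then obtain x y where xy: "x \<in> poly_ring 2" "y \<in> poly_ring 2" "hcomp i f = x * Y ^ q + y * Z ^ q"
      "x \<in> hom_part (i - q)" "i < q \<longrightarrow> x = 0"
      using hcomp_gen_ideal_two[where n = 2 and d = i and f = f, OF powers_in(5)[of q] powers_in(6)[of q]] by blast
    have "hcomp i f = f" using f by (simp add: hcomp_id)
    then have "f = x * Y ^ q + y * Z ^ q" using xy(3) by (rule trans[OF sym])
    then have "f - x * Y ^ q = y * Z ^ q + 0 * (X ^ q * Y ^ q)" by simp
    then have "f - x * Y ^ q \<in> Jamb"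
      unfolding gen_ideal_two[OF poly_ring_subring] using xy(2) poly_ring_closed(1)[of 2] by blast
    then have "?\<phi> f - x \<in> Jquot" using uniq xy(1) f by blast
    then show "if i < q then ?\<phi> f \<in> Jquot else \<exists>g\<in>poly_ring 2 \<inter> hom_part (i - q). ?\<phi> f - g \<in> Jquot"
      using xy(1,4,5) by auto
  qed
  with iso show ?thesis by blast
qed

text \<open>In degree \<open>k\<close> a basis is given by the products \<open>Y\<^sup>q Z\<^sup>i X\<^sup>j\<close> with \<open>i, j < q\<close> and \<open>i + j + q = k\<close>,
  obtained from the basis of the quotient by \<open>\<langle>Z\<^sup>q, X\<^sup>q\<rangle>\<close> through multiplication by \<open>Y\<^sup>q\<close>.\<close>

lemma has_quot_dim_degree:
  "has_quot_dim pscale (Jintr \<inter> hom_part k) (Jamb \<inter> hom_part k) (card {(i, j). i < q \<and> j < q \<and> i + j + q = k})"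
proof -
  let ?I = "{(i, j). i < q \<and> j < q \<and> i + j + q = k}"
  let ?x = "\<lambda>(i, j). Y ^ q * (Z ^ i * X ^ j)"
  let ?s = "\<lambda>c. \<Sum>(i, j)\<in>{..<q} \<times> {..<q}. pconst (c (i, j)) * (Z ^ i * X ^ j)"
  have fin: "finite ?I" by (rule finite_subset[of _ "{..<q} \<times> {..<q}"]) auto
  have hom: "pconst c * (Y ^ q * (Z ^ i * X ^ j)) \<in> hom_part (i + j + q)" for c i j
    using hom_part_pconst_mult[OF hom_part_mult[OF powers_in(5)[of q] hom_part_mult[OF powers_in(6)[of i] powers_in(4)[of j]]], of c]
    by (simp add: add.commute add.left_commute)
  have hom': "hcomp k (pconst c * (Y ^ q * (Z ^ i * X ^ j))) = (if i + j + q = k then pconst c * (Y ^ q * (Z ^ i * X ^ j)) else 0)" for c i j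
  proof (cases "i + j + q = k")
    case True
    then show ?thesis using hom[of c i j] by (simp add: hcomp_id)
  next
    case False
    have "hcomp k (pconst c * (Y ^ q * (Z ^ i * X ^ j))) = 0"
      unfolding hcomp_def by (rule restrict_keys_eq_0) (use hom[of c i j] False in \<open>auto simp: hom_part_def\<close>)
    with False show ?thesis by simp
  qed
  have hsum: "hcomp k (sum g A) = (\<Sum>p\<in>A. hcomp k (g p))" for g :: "nat \<times> nat \<Rightarrow> cpoly" and A
  proof -
    have "hcomp k 0 = 0" unfolding hcomp_def by (rule restrict_keys_eq_0) simp
    then show ?thesis by (induction A rule: infinite_finite_induct) (simp_all add: hcomp_add)
  qed
  have part: "hcomp k (?s c * Y ^ q) = (\<Sum>p\<in>?I. pscale (c p) (?x p))" for c
  proof -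
    have "?s c * Y ^ q = (\<Sum>p\<in>{..<q} \<times> {..<q}. pconst (c p) * (Y ^ q * (Z ^ fst p * X ^ snd p)))"
      unfolding sum_distrib_right by (rule sum.cong[OF refl]) (simp add: case_prod_unfold mult_ac)
    then have "hcomp k (?s c * Y ^ q) = (\<Sum>p\<in>{..<q} \<times> {..<q}. if fst p + snd p + q = k then pconst (c p) * (Y ^ q * (Z ^ fst p * X ^ snd p)) else 0)"
      by (simp only: hsum hom')
    also have "\<dots> = (\<Sum>p\<in>?I. pscale (c p) (?x p))"
      by (rule sum.mono_neutral_cong_right) (auto simp: pscale_def)
    finally show ?thesis .
  qed
  have xJ: "Y ^ q * g \<in> Jintr" if "g \<in> poly_ring 2" for g
  proof -
    have "Y ^ q * g = g * Y ^ q + 0 * Z ^ q" by (simp add: mult.commute)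
    then show ?thesis unfolding gen_ideal_two[OF poly_ring_subring] using that poly_ring_closed(1)[of 2] by blast
  qed
  have s_ring: "?s c \<in> poly_ring 2" for c
    by (rule subring_set_sum[OF poly_ring_subring]) (auto simp: poly_ring_closed powers_in)
  show ?thesis
  proof (rule has_quot_dimI[OF vector_space_pscale ideal_subspace[OF ideals(2)] fin])
    fix p assume "p \<in> ?I"
    then obtain i j where p: "p = (i, j)" "i + j + q = k" by blast
    have "Y ^ q * (Z ^ i * X ^ j) \<in> Jintr" by (rule xJ) (simp add: poly_ring_closed powers_in)
    moreover have "Y ^ q * (Z ^ i * X ^ j) \<in> hom_part k" using hom[of 1 i j] p(2) by simp
    ultimately show "?x p \<in> Jintr \<inter> hom_part k" unfolding p(1) by simp
  next
    fix f assume f: "f \<in> Jintr \<inter> hom_part k"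
    then obtain u v where uv: "u \<in> poly_ring 2" "v \<in> poly_ring 2" "f = u * Y ^ q + v * Z ^ q"
      unfolding gen_ideal_two[OF poly_ring_subring] by blast
    obtain c where "u - ?s c \<in> Jquot" using forms_basis(1)[OF ZX uv(1), of q] by blast
    then have c: "(u - ?s c) * Y ^ q \<in> Jamb" using Jamb_colon[of "u - ?s c"] uv(1) s_ring by (simp add: poly_ring_closed)
    have "v * Z ^ q = v * Z ^ q + 0 * (X ^ q * Y ^ q)" by simp
    then have vZ: "v * Z ^ q \<in> Jamb"
      unfolding gen_ideal_two[OF poly_ring_subring] using uv(2) poly_ring_closed(1)[of 2] by blast
    have "(u - ?s c) * Y ^ q + v * Z ^ q \<in> Jamb" using ideal_set_closed(2)[OF poly_ring_subring ideals(2) c vZ] .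
    then have mem: "f - ?s c * Y ^ q \<in> Jamb" unfolding uv(3) by (simp add: algebra_simps)
    have "X ^ q * Y ^ q \<in> hom_part (q + q)" by (rule hom_part_mult[OF powers_in(4) powers_in(5)])
    then obtain x y where "x \<in> poly_ring 2" "y \<in> poly_ring 2" "hcomp k (f - ?s c * Y ^ q) = x * Z ^ q + y * (X ^ q * Y ^ q)"
      using hcomp_gen_ideal_two[where j = "q + q" and d = k, OF powers_in(6) _ mem] by blast
    then have hmem: "hcomp k (f - ?s c * Y ^ q) \<in> Jamb" unfolding gen_ideal_two[OF poly_ring_subring] by blast
    have "hcomp k f = hcomp k (f - ?s c * Y ^ q) + hcomp k (?s c * Y ^ q)" using hcomp_add[of k "f - ?s c * Y ^ q" "?s c * Y ^ q"] by simp
    moreover have "hcomp k f = f" by (rule hcomp_id) (use f in blast)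
    ultimately have "f = hcomp k (f - ?s c * Y ^ q) + (\<Sum>p\<in>?I. pscale (c p) (?x p))" unfolding part by (rule trans[OF sym, rotated])
    then have diff: "f - (\<Sum>p\<in>?I. pscale (c p) (?x p)) = hcomp k (f - ?s c * Y ^ q)"
      by (rule diff_eq_eq[THEN iffD2])
    have "f - (\<Sum>p\<in>?I. pscale (c p) (?x p)) \<in> Jamb \<inter> hom_part k"
      unfolding diff using hmem hcomp_hom_part by (rule IntI)
    then show "\<exists>c. f - (\<Sum>p\<in>?I. pscale (c p) (?x p)) \<in> Jamb \<inter> hom_part k" by (rule exI[of _ c])
  next
    fix c p assume mem: "(\<Sum>p\<in>?I. pscale (c p) (?x p)) \<in> Jamb \<inter> hom_part k" and p: "p \<in> ?I"
    let ?c = "\<lambda>p. if p \<in> ?I then c p else 0"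
    have "?s ?c * Y ^ q = (\<Sum>p\<in>{..<q} \<times> {..<q}. if p \<in> ?I then pscale (c p) (?x p) else 0)"
      unfolding sum_distrib_right
    proof (rule sum.cong[OF refl])
      fix p :: "nat \<times> nat"
      obtain i j where p: "p = (i, j)" by fastforce
      show "(case p of (i, j) \<Rightarrow> pconst (?c (i, j)) * (Z ^ i * X ^ j)) * Y ^ q = (if p \<in> ?I then pscale (c p) (?x p) else 0)"
      proof (cases "(i, j) \<in> ?I")
        case True
        show ?thesis unfolding p prod.case if_P[OF True] pscale_def by (simp only: mult_ac)
      next
        case False
        show ?thesis unfolding p prod.case if_not_P[OF False] by simp
      qed
    qed
    also have "\<dots> = (\<Sum>p\<in>?I. pscale (c p) (?x p))"
      by (rule sum.mono_neutral_cong_right) auto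
    finally have eq: "?s ?c * Y ^ q = (\<Sum>p\<in>?I. pscale (c p) (?x p))" .
    have "?s ?c * Y ^ q \<in> Jamb" unfolding eq using mem by (rule IntD1)
    then have Jq: "?s ?c \<in> Jquot" by (rule Jamb_colon[OF s_ring, THEN iffD1])
    obtain i j where ij: "p = (i, j)" "i < q" "j < q" using p by blast
    have "?c (i, j) = 0" by (rule forms_basis(2)[OF ZX Jq ij(2,3)])
    then show "c p = 0" using p unfolding ij(1) by simp
  qed
qed

lemma hilbert_series_eq: "hilbert_series Jintr Jamb = fps_X ^ q * (\<Sum>i<q. fps_X ^ i) ^ 2"
proof (rule fps_ext)
  fix k
  have "(THE m. has_quot_dim pscale (Jintr \<inter> hom_part k) (Jamb \<inter> hom_part k) m) = card {(i, j). i < q \<and> j < q \<and> i + j + q = k}"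
  proof (rule the_equality)
    show "has_quot_dim pscale (Jintr \<inter> hom_part k) (Jamb \<inter> hom_part k) (card {(i, j). i < q \<and> j < q \<and> i + j + q = k})"
      by (rule has_quot_dim_degree)
    show "m = card {(i, j). i < q \<and> j < q \<and> i + j + q = k}"
      if "has_quot_dim pscale (Jintr \<inter> hom_part k) (Jamb \<inter> hom_part k) m" for m
      by (rule has_quot_dim_unique[OF vector_space_pscale ideal_subspace[OF ideals(2)] that has_quot_dim_degree])
  qed
  then show "fps_nth (hilbert_series Jintr Jamb) k = fps_nth (fps_X ^ q * (\<Sum>i<q. fps_X ^ i) ^ 2) k"
    unfolding fps_square_geometric_nth hilbert_series_def by simp
qed

end

section \<open>The ambient and the intrinsic ideal for an arbitrary Gale dual\<close>

lemma types_single_image: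
  assumes "t < 5"
  shows "types q {t} = (\<lambda>i. 5 * i + t) ` {..<q}"
proof (intro equalityI subsetI)
  fix j assume "j \<in> types q {t}"
  then have j: "j < 5 * q" "j mod 5 = t" by (simp_all add: types_def)
  have eq: "5 * (j div 5) + t = j" using j(2) mult_div_mod_eq[of 5 j] by simp
  have "j div 5 < q" using j(1) by linarith
  then show "j \<in> (\<lambda>i. 5 * i + t) ` {..<q}" using eq by (intro image_eqI[of _ _ "j div 5"]) simp_all
next
  fix j assume "j \<in> (\<lambda>i. 5 * i + t) ` {..<q}"
  then obtain i where "j = 5 * i + t" "i < q" by blast
  then show "j \<in> types q {t}" using assms by (simp add: types_def)
qed

lemma card_types_single:
  assumes "t < 5"
  shows "card (types q {t}) = q"
proof -
  have "inj_on (\<lambda>i. 5 * i + t) {..<q}" by (rule inj_onI) simp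
  then show ?thesis unfolding types_single_image[OF assms] by (simp add: card_image)
qed

lemma prod_types_single:
  fixes f :: "nat \<Rightarrow> 'a::comm_ring_1"
  assumes "t < 5" "\<And>j. j < 5 * q \<Longrightarrow> j mod 5 = t \<Longrightarrow> f j = x"
  shows "(\<Prod>j\<in>types q {t}. f j) = x ^ q"
proof -
  have "(\<Prod>j\<in>types q {t}. f j) = (\<Prod>j\<in>types q {t}. x)"
    by (rule prod.cong[OF refl]) (use assms(2) in \<open>simp add: types_def\<close>)
  then show ?thesis by (simp add: card_types_single[OF assms(1)])
qed

lemma prod_types_two:
  fixes f :: "nat \<Rightarrow> 'a::comm_ring_1"
  assumes "s \<noteq> t"
  shows "(\<Prod>j\<in>types q {s, t}. f j) = (\<Prod>j\<in>types q {s}. f j) * (\<Prod>j\<in>types q {t}. f j)"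
proof -
  have "types q {s, t} = types q {s} \<union> types q {t}" by (auto simp: types_def)
  moreover have "types q {s} \<inter> types q {t} = {}" using assms by (auto simp: types_def)
  ultimately show ?thesis by (simp add: prod.union_disjoint)
qed

lemma lform_comb: "of_int r * lform a b + of_int s * lform c d = lform (of_int r * a + of_int s * c) (of_int r * b + of_int s * d)"
  by (simp add: lform_def pconst_add pconst_mult pconst_of_int algebra_simps)

lemma lform_nonzero:
  assumes "a \<noteq> 0 \<or> b \<noteq> 0"
  shows "lform a b \<noteq> 0"
proof
  assume z: "lform a b = 0"
  have "lform a b = single (xexp 0 1) a + single (xexp 1 1) b"
    by (simp add: lform_def pvar_def pconst_mult_single del: One_nat_def)
  moreover have "xexp 0 1 \<noteq> xexp 1 1"
    by (metis lookup_single_eq lookup_single_not_eq one_neq_zero)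
  ultimately have "lookup (lform a b) (xexp 0 1) = a" "lookup (lform a b) (xexp 1 1) = b"
    by (simp_all add: lookup_add lookup_single when_def)
  then show False using assms z by simp
qed

lemma indep_forms_nonzero:
  assumes "indep_forms l m"
  shows "l \<noteq> 0"
proof -
  obtain a b c d where l: "l = lform a b" and det: "a * d - b * c \<noteq> 0" using assms unfolding indep_forms_def by blast
  have "a \<noteq> 0 \<or> b \<noteq> 0" using det by auto
  then show ?thesis unfolding l by (rule lform_nonzero)
qed

lemma indep_forms_comb:
  assumes "indep_forms X Y" "r * s' - r' * s \<noteq> 0"
  shows "indep_forms (of_int r * X + of_int s * Y) (of_int r' * X + of_int s' * Y)"
proof -
  obtain a b c d where X: "X = lform a b" and Y: "Y = lform c d" and det: "a * d - b * c \<noteq> 0"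
    using assms(1) unfolding indep_forms_def by blast
  have "(of_int r * a + of_int s * c) * (of_int r' * b + of_int s' * d) - (of_int r * b + of_int s * d) * (of_int r' * a + of_int s' * c)
      = of_int (r * s' - r' * s) * (a * d - b * c)" by (simp add: algebra_simps)
  moreover have "\<dots> \<noteq> 0" using assms(2) det by (simp only: mult_eq_0_iff of_int_eq_0_iff) simp
  ultimately have "(of_int r * a + of_int s * c) * (of_int r' * b + of_int s' * d) - (of_int r * b + of_int s * d) * (of_int r' * a + of_int s' * c) \<noteq> 0"
    by simp
  then show ?thesis unfolding X Y lform_comb indep_forms_def by blast
qed

lemma lookup_fscale: "lookup (fscale a x) G = a * lookup x G"
  unfolding fscale_def by (simp add: Poly_Mapping.map.rep_eq when_def)

lemma fscale_single: "fscale a (single G b) = single G (a * b)"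
  by (rule poly_mapping_eqI) (simp add: lookup_fscale lookup_single when_def)

lemma fscale_diff: "fscale a (x - y) = fscale a x - fscale a y"
  by (rule poly_mapping_eqI) (simp add: lookup_fscale lookup_minus algebra_simps)

text \<open>The first two generators are opposite to each other, so that one coefficient \<open>\<beta>\<close> accounts for both.
  It links the two coordinates.\<close>

lemma two_generator_coordinates:
  assumes ne: "S \<noteq> T" and z: "z \<in> gen_submodule (poly_ring n) fscale
    {single S a - single T b, single T b - single S a,
     single S c, single T d}"
  shows "\<exists>\<beta> \<gamma> \<delta>. \<beta> \<in> poly_ring n \<and> \<gamma> \<in> poly_ring n \<and> \<delta> \<in> poly_ring n \<and>
    lookup z S = \<beta> * a + \<gamma> * c \<and> lookup z T = \<delta> * d - \<beta> * b"
proof -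
  let ?P = "\<lambda>z \<beta> \<gamma> \<delta>. \<beta> \<in> poly_ring n \<and> \<gamma> \<in> poly_ring n \<and> \<delta> \<in> poly_ring n \<and>
    lookup z S = \<beta> * a + \<gamma> * c \<and> lookup z T = \<delta> * d - \<beta> * b"
  note ST = ne ne[symmetric]
  note l = lookup_minus lookup_single ST
  have units: "0 \<in> poly_ring n" "1 \<in> poly_ring n" "- 1 \<in> poly_ring n" by (simp_all add: poly_ring_closed)
  have "\<exists>\<beta> \<gamma> \<delta>. ?P z \<beta> \<gamma> \<delta>"
    using z
  proof induction
    case zero
    have "?P 0 0 0 0" by (simp add: units)
    then show ?case by blast
  next
    case (gen z)
    have "?P (single S a - single T b) 1 0 0"
      "?P (single T b - single S a) (- 1) 0 0"
      "?P (single S c) 0 1 0" "?P (single T d) 0 0 1"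
      by (simp_all add: units l)
    with gen show ?case by blast
  next
    case (add x y)
    then obtain \<beta> \<gamma> \<delta> \<beta>' \<gamma>' \<delta>' where "?P x \<beta> \<gamma> \<delta>" "?P y \<beta>' \<gamma>' \<delta>'" by blast
    then have "?P (x + y) (\<beta> + \<beta>') (\<gamma> + \<gamma>') (\<delta> + \<delta>')"
      by (simp add: poly_ring_closed lookup_add ring_distribs)
    then show ?case by blast
  next
    case (scale f x)
    then obtain \<beta> \<gamma> \<delta> where "?P x \<beta> \<gamma> \<delta>" by blast
    then have "?P (fscale f x) (f * \<beta>) (f * \<gamma>) (f * \<delta>)"
      using scale.hyps(1) by (simp add: poly_ring_closed lookup_fscale ring_distribs mult.assoc)
    then show ?case by blast
  qed
  then show ?thesis .
qed

text \<open>All forms of an arbitrary Gale dual are combinations of the forms \<open>X\<close> and \<open>Y\<close> of the types 0 and 1,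
  with the same coefficients as the entries of the lattice vectors.\<close>

locale gale =
  fixes q :: nat and B :: "int mat"
  assumes q: "q \<ge> 1" and B: "gale_dual (A_mat q) B"
begin

definition "X = ell B 0"
definition "Y = ell B 1"
definition "Z = of_int 7 * X + of_int 2 * Y"

lemma dim_B: "dim_row B = 5 * q" "dim_col B = 2"
  using gale_dual_rows(1)[OF q B] by auto

lemma ell_lform: "ell B j = lform (of_int (B $$ (j, 0))) (of_int (B $$ (j, 1)))"
  unfolding ell_def dim_B by (simp add: numeral_2_eq_2 lform_def pconst_of_int)

lemma ell_row: "j < 5 * q \<Longrightarrow> ell B j = of_int (ca j) * X + of_int (cb j) * Y"
  unfolding X_def Y_def ell_lform[of j] ell_lform[of 0] ell_lform[of 1] lform_comb
  using gale_dual_rows(2)[OF q B, of j 0] gale_dual_rows(2)[OF q B, of j 1] by (simp del: One_nat_def)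

lemma indep_XY: "indep_forms X Y"
proof -
  have "of_int (B $$ (0, 0) * B $$ (1, 1) - B $$ (0, 1) * B $$ (1, 0)) \<noteq> (0 :: complex)"
    using gale_dual_rows(3)[OF q B] by (simp only: of_int_eq_0_iff) simp
  then have "of_int (B $$ (0, 0)) * of_int (B $$ (1, 1)) - of_int (B $$ (0, 1)) * of_int (B $$ (1, 0)) \<noteq> (0 :: complex)"
    by (simp only: of_int_mult of_int_diff) simp
  then show ?thesis unfolding indep_forms_def X_def Y_def ell_lform[of 0] ell_lform[of 1] by blast
qed

sublocale three_forms q X Y Z
proof
  show "indep_forms X Y" by (rule indep_XY)
  show "indep_forms Y Z" using indep_forms_comb[OF indep_XY, of 0 2 7 1] by (simp add: Z_def)
  show "indep_forms Z X" using indep_forms_comb[OF indep_XY, of 7 0 1 2] by (simp add: Z_def)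
qed

lemma ell_by_type:
  assumes "j < 5 * q"
  shows "j mod 5 = 0 \<Longrightarrow> ell B j = X" "j mod 5 = 1 \<Longrightarrow> ell B j = Y" "j mod 5 = 2 \<Longrightarrow> ell B j = - X"
    "j mod 5 = 3 \<Longrightarrow> ell B j = Z"
  using ell_row[OF assms] coefficients_by_type[of j] by (simp_all add: Z_def)

lemma ell_prod_types:
  "ell_prod B (types q {0}) = X ^ q" "ell_prod B (types q {1}) = Y ^ q"
  "ell_prod B (types q {2}) = (- X) ^ q" "ell_prod B (types q {3}) = Z ^ q"
  unfolding ell_prod_def by (rule prod_types_single; simp add: ell_by_type)+

lemma ell_prod_two:
  "ell_prod B (types q {0, 3}) = X ^ q * Z ^ q" "ell_prod B (types q {1, 2}) = Y ^ q * (- X) ^ q"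
  using ell_prod_types prod_types_two[of 0 3 "ell B" q] prod_types_two[of 1 2 "ell B" q]
  unfolding ell_prod_def by simp_all

lemma X_nonzero: "X ^ q \<noteq> 0"
  using indep_forms_nonzero[OF indep_XY] by simp

lemma neg_X_power: "(- X) ^ q = (- 1) ^ q * X ^ q"
  by (rule power_minus)

lemma sign_in: "(- 1) ^ q \<in> poly_ring 2"
  by (simp add: poly_ring_closed)

lemma sign_square: "(- 1) ^ q * ((- 1) ^ q * f) = (f :: cpoly)"
  by (simp add: mult.assoc[symmetric] power_mult_distrib[symmetric])

text \<open>Both generators of the ideal are divisible by \<open>X\<^sup>q\<close>, which is cancelled.\<close>

lemma J_intr_eq: "J_intr (A_mat q) B (v_vec q) (fam q) = Jintr"
proof -
  have J: "J_intr (A_mat q) B (v_vec q) (fam q) = {g \<in> poly_ring 2. g * X ^ q \<in> gen_ideal (poly_ring 2) {X ^ q * Z ^ q, Y ^ q * (- X) ^ q}}"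
    unfolding J_intr_def colon_def min_P_supports[OF q] nsupp_minus_core dim_B
    by (simp only: image_insert image_empty ell_prod_types ell_prod_two)
  show ?thesis
    unfolding J
  proof (intro equalityI subsetI)
    fix f assume "f \<in> {g \<in> poly_ring 2. g * X ^ q \<in> gen_ideal (poly_ring 2) {X ^ q * Z ^ q, Y ^ q * (- X) ^ q}}"
    then obtain u v where uv: "u \<in> poly_ring 2" "v \<in> poly_ring 2" "f * X ^ q = u * (X ^ q * Z ^ q) + v * (Y ^ q * (- X) ^ q)"
      unfolding gen_ideal_two[OF poly_ring_subring] by blast
    have "f * X ^ q = (v * (- 1) ^ q * Y ^ q + u * Z ^ q) * X ^ q"
      unfolding uv(3) neg_X_power by (simp add: algebra_simps)
    then have "f = v * (- 1) ^ q * Y ^ q + u * Z ^ q" using X_nonzero by (simp only: mult_cancel_right) simp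
    moreover have "v * (- 1) ^ q \<in> poly_ring 2" using uv(2) sign_in by (rule poly_ring_closed(5))
    ultimately show "f \<in> Jintr" unfolding gen_ideal_two[OF poly_ring_subring] using uv(1) by blast
  next
    fix f assume "f \<in> Jintr"
    then obtain u v where uv: "u \<in> poly_ring 2" "v \<in> poly_ring 2" "f = u * Y ^ q + v * Z ^ q"
      unfolding gen_ideal_two[OF poly_ring_subring] by blast
    have "f * X ^ q = v * (X ^ q * Z ^ q) + u * Y ^ q * ((- 1) ^ q * ((- 1) ^ q * X ^ q))"
      unfolding uv(3) sign_square by (simp add: algebra_simps)
    then have "f * X ^ q = v * (X ^ q * Z ^ q) + (u * (- 1) ^ q) * (Y ^ q * (- X) ^ q)"
      unfolding neg_X_power by (simp add: mult_ac)
    moreover have "u * (- 1) ^ q \<in> poly_ring 2" using uv(1) sign_in by (rule poly_ring_closed(5))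
    ultimately have "f * X ^ q \<in> gen_ideal (poly_ring 2) {X ^ q * Z ^ q, Y ^ q * (- X) ^ q}"
      unfolding gen_ideal_two[OF poly_ring_subring] using uv(2) by blast
    moreover have "f \<in> poly_ring 2" using uv powers_in by (simp add: poly_ring_closed)
    ultimately show "f \<in> {g \<in> poly_ring 2. g * X ^ q \<in> gen_ideal (poly_ring 2) {X ^ q * Z ^ q, Y ^ q * (- X) ^ q}}" by blast
  qed
qed

lemma T02: "types q {0} \<noteq> types q {2}" "types q {2} \<noteq> types q {0}"
  using types_eq_iff[OF q, of "{0}" "{2}"] by auto

abbreviation "T0 \<equiv> types q {0}"
abbreviation "T2 \<equiv> types q {2}"

lemma type_differences: "T0 - T2 = T0" "T2 - T0 = T2" "types q {0, 3} - T0 = types q {3}" "types q {1, 2} - T2 = types q {1}"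
  by (auto simp: types_def)

lemma Z_submodule_eq: "Z_submodule (A_mat q) B (v_vec q) (fam q) = gen_submodule (poly_ring 2) fscale
    {single T0 ((- X) ^ q) - single T2 (X ^ q),
     single T2 (X ^ q) - single T0 ((- X) ^ q),
     single T0 (Z ^ q), single T2 (Y ^ q)}"
proof -
  have G: "some_G (fam q) (types q {0, 3}) = T0" "some_G (fam q) (types q {1, 2}) = T2"
    using some_G_fam[OF q, of "{0, 3}"] some_G_fam[OF q, of "{1, 2}"] by simp_all
  have 1: "{single G (ell_prod B (G' - G)) - single G' (ell_prod B (G - G'))
        | G G'. G \<in> {T0, T2} \<and> G' \<in> {T0, T2} \<and> G \<noteq> G'}
      = {single T0 ((- X) ^ q) - single T2 (X ^ q),
         single T2 (X ^ q) - single T0 ((- X) ^ q)}" (is "?S = ?T")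
  proof -
    have "?S = {single T0 (ell_prod B (T2 - T0)) - single T2 (ell_prod B (T0 - T2)),
       single T2 (ell_prod B (T0 - T2)) - single T0 (ell_prod B (T2 - T0))}"
      using T02 by blast
    then show ?thesis unfolding type_differences ell_prod_types .
  qed
  have 2: "{single (some_G (fam q) H) (ell_prod B (H - some_G (fam q) H)) | H. H \<in> {types q {0, 3}, types q {1, 2}}}
      = {single T0 (Z ^ q), single T2 (Y ^ q)}" (is "?S = ?T")
  proof -
    have "?S = {single (some_G (fam q) (types q {0, 3})) (ell_prod B (types q {0, 3} - some_G (fam q) (types q {0, 3}))),
        single (some_G (fam q) (types q {1, 2})) (ell_prod B (types q {1, 2} - some_G (fam q) (types q {1, 2})))}"
      by blast
    then show ?thesis unfolding G type_differences ell_prod_types .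
  qed
  show ?thesis
    unfolding Z_submodule_def min_M_supports[OF q] min_P_supports[OF q] dim_B 1 2 by (simp only: insert_is_Un[symmetric] Un_insert_left Un_empty_left)
qed

lemma Z_submodule_coordinates:
  assumes "z \<in> Z_submodule (A_mat q) B (v_vec q) (fam q)"
  shows "\<exists>\<beta> \<gamma> \<delta>. \<beta> \<in> poly_ring 2 \<and> \<gamma> \<in> poly_ring 2 \<and> \<delta> \<in> poly_ring 2 \<and>
    lookup z T0 = \<beta> * (- X) ^ q + \<gamma> * Z ^ q \<and> lookup z T2 = \<delta> * Y ^ q - \<beta> * X ^ q"
  using assms unfolding Z_submodule_eq by (rule two_generator_coordinates[OF T02(1)])

lemma eps_elem_eq: "eps_elem B (v_vec q) (fam q) = single T0 1"
proof -
  have "some_G (fam q) T0 = T0" using some_G_fam[OF q, of "{0}"] by simp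
  then show ?thesis unfolding eps_elem_def nsupp_minus_core Let_def by (simp add: ell_prod_def)
qed

text \<open>The second coordinate of a multiple of the distinguished element vanishes. By coprimality of \<open>X\<^sup>q\<close> and \<open>Y\<^sup>q\<close>
  this forces the coefficient of the relation between the two minimal supports to be a multiple of
  \<open>Y\<^sup>q\<close>, and its contribution to the first coordinate is a multiple of \<open>X\<^sup>q Y\<^sup>q\<close>.\<close>

lemma J_amb_eq: "J_amb (A_mat q) B (v_vec q) (fam q) = Jamb"
proof -
  have J: "J_amb (A_mat q) B (v_vec q) (fam q) = {a \<in> poly_ring 2. single T0 a \<in> Z_submodule (A_mat q) B (v_vec q) (fam q)}"
    unfolding J_amb_def eps_elem_eq dim_B fscale_single by simp
  show ?thesis
    unfolding J
  proof (intro equalityI subsetI)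
    fix a assume a: "a \<in> {a \<in> poly_ring 2. single T0 a \<in> Z_submodule (A_mat q) B (v_vec q) (fam q)}"
    then have "single T0 a \<in> Z_submodule (A_mat q) B (v_vec q) (fam q)" by blast
    from Z_submodule_coordinates[OF this] obtain b c d where
      in2: "b \<in> poly_ring 2" "c \<in> poly_ring 2" "d \<in> poly_ring 2"
      and eq: "lookup (single T0 a) T0 = b * (- X) ^ q + c * Z ^ q"
        "lookup (single T0 a) T2 = d * Y ^ q - b * X ^ q" by blast
    have a_eq: "a = b * (- X) ^ q + c * Z ^ q" using eq(1) by simp
    have "d * Y ^ q - b * X ^ q = 0" using eq(2) T02 by (simp add: lookup_single)
    then have "X ^ q * b = Y ^ q * d" by (simp add: mult.commute)
    from coprime_forms[OF XY in2(1) this] obtain h where h: "h \<in> poly_ring 2" "b = h * Y ^ q" by blast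
    have "a = c * Z ^ q + (h * (- 1) ^ q) * (X ^ q * Y ^ q)"
      unfolding a_eq h(2) neg_X_power by (simp add: mult_ac)
    moreover have "h * (- 1) ^ q \<in> poly_ring 2" using h(1) sign_in by (rule poly_ring_closed(5))
    ultimately show "a \<in> Jamb" unfolding gen_ideal_two[OF poly_ring_subring] using in2(2) by blast
  next
    fix a assume "a \<in> Jamb"
    then obtain c h where ch: "c \<in> poly_ring 2" "h \<in> poly_ring 2" and a: "a = c * Z ^ q + h * (X ^ q * Y ^ q)"
      unfolding gen_ideal_two[OF poly_ring_subring] by blast
    let ?s = "(- 1) ^ q :: cpoly"
    let ?g1 = "single T0 ((- X) ^ q) - single T2 (X ^ q)"
      and ?g2 = "single T0 (Z ^ q)" and ?g3 = "single T2 (Y ^ q)"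
    have b: "h * ?s * Y ^ q \<in> poly_ring 2" "h * ?s * X ^ q \<in> poly_ring 2"
      using ch(2) sign_in powers_in by (simp_all add: poly_ring_closed)
    have "fscale (h * ?s * Y ^ q) ?g1 + fscale c ?g2 + fscale (h * ?s * X ^ q) ?g3 \<in> Z_submodule (A_mat q) B (v_vec q) (fam q)"
      unfolding Z_submodule_eq
      by (intro gen_submodule.add gen_submodule.scale b ch(1) gen_submodule.gen) simp_all
    moreover have "fscale (h * ?s * Y ^ q) ?g1 + fscale c ?g2 + fscale (h * ?s * X ^ q) ?g3
        = single T0 (h * ?s * Y ^ q * (- X) ^ q + c * Z ^ q)"
      by (simp add: fscale_diff fscale_single single_add mult_ac)
    moreover have "h * ?s * Y ^ q * (- X) ^ q + c * Z ^ q = a"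
    proof -
      have "h * ?s * Y ^ q * (- X) ^ q = h * Y ^ q * (?s * (?s * X ^ q))"
        unfolding neg_X_power by (simp only: mult_ac)
      then show ?thesis unfolding sign_square a by (simp add: mult_ac add.commute)
    qed
    ultimately have "single T0 a \<in> Z_submodule (A_mat q) B (v_vec q) (fam q)" by (simp only:)
    moreover have "a \<in> poly_ring 2" unfolding a using ch powers_in by (simp add: poly_ring_closed)
    ultimately show "a \<in> {a \<in> poly_ring 2. single T0 a \<in> Z_submodule (A_mat q) B (v_vec q) (fam q)}" by blast
  qed
qed

lemma D_hilbert_series_eq: "D_hilbert_series (A_mat q) B (v_vec q) (fam q) = fps_X ^ q * (\<Sum>i<q. fps_X ^ i) ^ 2"
  unfolding D_hilbert_series_def J_intr_eq J_amb_eq by (rule hilbert_series_eq)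

end

section \<open>Power series as sequences of homogeneous polynomials\<close>

text \<open>A series in finitely many variables is the sequence of its homogeneous parts, which are polynomials.
  In this form, products, linear substitutions and ideals with homogeneous generators are determined in
  every degree by polynomials.\<close>

definition hpart :: "nat \<Rightarrow> nat \<Rightarrow> mfps \<Rightarrow> cpoly" where
  "hpart n d f = (\<Sum>m\<in>{m \<in> expos n. mdeg m = d}. single m (mcoeff f m))"

definition of_parts :: "(nat \<Rightarrow> cpoly) \<Rightarrow> mfps" where
  "of_parts p = Abs_mfps (\<lambda>m. lookup (p (mdeg m)) m)"

lemma mcoeff_of_parts: "mcoeff (of_parts p) m = lookup (p (mdeg m)) m"
  by (simp add: of_parts_def Abs_mfps_inverse)

lemma mcoeff_of_poly: "mcoeff (mfps_of_poly f) = lookup f"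
  by (simp add: mfps_of_poly_def Abs_mfps_inverse)

lemma finite_degree_expos: "finite {m \<in> expos n. mdeg m = d}"
proof (rule finite_subset[OF _ finite_bounded_expos[of n d]])
  have "lookup m j \<le> mdeg m" for m j
  proof (cases "j \<in> keys m")
    case True
    then show ?thesis unfolding mdeg_def by (rule member_le_sum) simp_all
  next
    case False
    then show ?thesis by (simp add: not_in_keys_iff_lookup_eq_zero)
  qed
  then show "{m \<in> expos n. mdeg m = d} \<subseteq> {m \<in> expos n. \<forall>j<n. lookup m j \<le> d}" by auto
qed

lemma lookup_hpart: "lookup (hpart n d f) m = (if m \<in> expos n \<and> mdeg m = d then mcoeff f m else 0)"
proof -
  have "lookup (hpart n d f) m = (\<Sum>k\<in>{m \<in> expos n. mdeg m = d}. if k = m then mcoeff f m else 0)"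
    unfolding hpart_def lookup_sum by (rule sum.cong) (auto simp: lookup_single when_def)
  then show ?thesis using finite_degree_expos[of n d] by (simp add: sum.delta)
qed

lemma hpart_in: "hpart n d f \<in> poly_ring n" "hpart n d f \<in> hom_part d"
proof -
  have "m \<in> expos n \<and> mdeg m = d" if "m \<in> keys (hpart n d f)" for m
    using that unfolding in_keys_iff lookup_hpart by presburger
  then show "hpart n d f \<in> poly_ring n" "hpart n d f \<in> hom_part d"
    unfolding poly_ring_def hom_part_def by blast+
qed

lemma hpart_of_parts:
  assumes "p d \<in> poly_ring n" "p d \<in> hom_part d"
  shows "hpart n d (of_parts p) = p d"
proof (rule poly_mapping_eqI)
  fix m
  have "lookup (p d) m = 0" if "\<not> (m \<in> expos n \<and> mdeg m = d)"
    using that assms unfolding poly_ring_def hom_part_def by (auto simp: not_in_keys_iff_lookup_eq_zero[symmetric])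
  then show "lookup (hpart n d (of_parts p)) m = lookup (p d) m"
    by (auto simp: lookup_hpart mcoeff_of_parts)
qed

lemma of_parts_in: "(\<And>d. p d \<in> poly_ring n) \<Longrightarrow> of_parts p \<in> mfps_ring n"
  unfolding mfps_ring_def poly_ring_def by (auto simp: mcoeff_of_parts subset_iff in_keys_iff)

lemma mfps_ring_eqI:
  assumes "f \<in> mfps_ring n" "g \<in> mfps_ring n" "\<And>d. hpart n d f = hpart n d g"
  shows "f = g"
proof (rule mfps_eqI)
  fix m
  show "mcoeff f m = mcoeff g m"
  proof (cases "m \<in> expos n")
    case True
    then show ?thesis using arg_cong[OF assms(3)[of "mdeg m"], of "\<lambda>p. lookup p m"]
      by (simp add: lookup_hpart)
  next
    case False
    then show ?thesis using assms(1,2) unfolding mfps_ring_def by (metis (mono_tags, lifting) mem_Collect_eq)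
  qed
qed

lemma mcoeff_simps: "mcoeff (f + g) m = mcoeff f m + mcoeff g m" "mcoeff (f - g) m = mcoeff f m - mcoeff g m"
  "mcoeff 0 m = 0" "mcoeff 1 m = (if m = 0 then 1 else 0)"
  "mcoeff (f * g) m = (\<Sum>(a, b)\<in>splits m. mcoeff f a * mcoeff g b)"
  by (simp_all add: plus_mfps.rep_eq minus_mfps.rep_eq zero_mfps.rep_eq one_mfps.rep_eq times_mfps.rep_eq)

lemma mfps_ring_subring: "subring_set (mfps_ring n)"
  unfolding subring_set_def
proof (intro conjI ballI)
  fix f g assume fg: "f \<in> mfps_ring n" "g \<in> mfps_ring n"
  show "f * g \<in> mfps_ring n"
    unfolding mfps_ring_def
  proof (intro CollectI allI impI)
    fix m assume "mcoeff (f * g) m \<noteq> 0"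
    then obtain ab where ab: "ab \<in> splits m" "(case ab of (a, b) \<Rightarrow> mcoeff f a * mcoeff g b) \<noteq> 0"
      unfolding mcoeff_simps by (rule sum.not_neutral_contains_not_neutral)
    obtain a b where "ab = (a, b)" by force
    then have "a + b = m" "mcoeff f a \<noteq> 0" "mcoeff g b \<noteq> 0" using ab by (auto simp: splits_def)
    then show "m \<in> expos n" using fg expos_add unfolding mfps_ring_def by blast
  qed
  have "mcoeff f m \<noteq> 0 \<or> mcoeff g m \<noteq> 0" if "mcoeff (f + g) m \<noteq> 0 \<or> mcoeff (f - g) m \<noteq> 0" for m
    using that by (auto simp: mcoeff_simps)
  then show "f + g \<in> mfps_ring n" "f - g \<in> mfps_ring n" using fg unfolding mfps_ring_def by blast+
qed (auto simp: mfps_ring_def mcoeff_simps split: if_splits)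

lemmas mfps_ring_closed = subring_setD[OF mfps_ring_subring] subring_set_power[OF mfps_ring_subring]

lemma lookup_times_splits:
  "lookup (f * g :: cpoly) m = (\<Sum>(a, b)\<in>splits m. lookup f a * lookup g b)"
proof (induction f rule: cpoly_induct)
  case (single k c)
  show ?case
  proof (induction g rule: cpoly_induct)
    case (single l d)
    have "(\<Sum>(a, b)\<in>splits m. lookup (single k c) a * lookup (single l d) b)
        = (\<Sum>p\<in>splits m. if p = (k, l) then c * d else 0)"
      by (rule sum.cong) (auto simp: lookup_single when_def split: if_splits)
    also have "\<dots> = (if k + l = m then c * d else 0)" using finite_splits[of m] by (simp add: sum.delta) (simp add: splits_def)
    finally show ?case by (simp add: mult_single lookup_single when_def)
  qed (simp_all add: distrib_left lookup_add case_prod_unfold sum.distrib)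
qed (simp_all add: distrib_right lookup_add case_prod_unfold sum.distrib)

lemma mfps_of_poly_hom: "mfps_of_poly (f + g) = mfps_of_poly f + mfps_of_poly g"
  "mfps_of_poly (f - g) = mfps_of_poly f - mfps_of_poly g"
  "mfps_of_poly (f * g) = mfps_of_poly f * mfps_of_poly g" "mfps_of_poly 0 = 0" "mfps_of_poly 1 = 1"
  by (rule mfps_eqI; simp add: mcoeff_of_poly mcoeff_simps lookup_add lookup_minus lookup_times_splits lookup_one when_def)+

lemma mfps_of_poly_power: "mfps_of_poly (f ^ k) = mfps_of_poly f ^ k"
  by (induction k) (simp_all add: mfps_of_poly_hom)

lemma mfps_of_poly_sum: "mfps_of_poly (sum f A) = (\<Sum>x\<in>A. mfps_of_poly (f x))"
  by (induction A rule: infinite_finite_induct) (simp_all add: mfps_of_poly_hom)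

lemma mfps_of_poly_prod: "mfps_of_poly (prod f A) = (\<Prod>x\<in>A. mfps_of_poly (f x))"
  by (induction A rule: infinite_finite_induct) (simp_all add: mfps_of_poly_hom)

lemma mfps_of_poly_of_int: "mfps_of_poly (of_int i) = of_int i"
  by (induction i rule: int_induct[where k = 0]) (simp_all add: mfps_of_poly_hom)

lemma mfps_of_poly_in: "f \<in> poly_ring n \<Longrightarrow> mfps_of_poly f \<in> mfps_ring n"
  by (auto simp: mfps_ring_def poly_ring_def mcoeff_of_poly in_keys_iff)

lemma hpart_of_poly: "f \<in> poly_ring n \<Longrightarrow> hpart n d (mfps_of_poly f) = hcomp d f"
  by (rule poly_mapping_eqI)
    (auto simp: lookup_hpart mcoeff_of_poly hcomp_def lookup_restrict_keys poly_ring_def subset_iff in_keys_iff)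

lemma hpart_add: "hpart n d (f + g) = hpart n d f + hpart n d g"
  and hpart_diff: "hpart n d (f - g) = hpart n d f - hpart n d g"
  by (rule poly_mapping_eqI; simp add: lookup_hpart lookup_add lookup_minus mcoeff_simps)+

lemma hpart_zero [simp]: "hpart n d 0 = 0"
  using hpart_diff[of n d 0 0] by simp

lemma hpart_sum: "hpart n d (sum f A) = (\<Sum>x\<in>A. hpart n d (f x))"
  by (induction A rule: infinite_finite_induct) (simp_all add: hpart_add)

lemma hpart_mult: "hpart n d (f * g) = (\<Sum>i\<le>d. hpart n i f * hpart n (d - i) g)"
proof (rule poly_mapping_eqI)
  fix m
  let ?t = "\<lambda>i (a, b). lookup (hpart n i f) a * lookup (hpart n (d - i) g) b"
  have "lookup (\<Sum>i\<le>d. hpart n i f * hpart n (d - i) g) m = (\<Sum>i\<le>d. \<Sum>p\<in>splits m. ?t i p)"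
    unfolding lookup_sum lookup_times_splits by (simp add: case_prod_unfold)
  also have "\<dots> = (\<Sum>p\<in>splits m. \<Sum>i\<le>d. ?t i p)" by (rule sum.swap)
  also have "\<dots> = (\<Sum>p\<in>splits m. if m \<in> expos n \<and> mdeg m = d then (case p of (a, b) \<Rightarrow> mcoeff f a * mcoeff g b) else 0)"
  proof (rule sum.cong[OF refl])
    fix p assume "p \<in> splits m"
    then obtain a b where p: "p = (a, b)" and ab: "a + b = m" by (auto simp: splits_def)
    have "(\<Sum>i\<le>d. ?t i p) = (\<Sum>i\<le>d. if i = mdeg a then
        (if m \<in> expos n \<and> mdeg m = d then mcoeff f a * mcoeff g b else 0) else 0)"
      unfolding p ab[symmetric]
      by (rule sum.cong) (auto simp: lookup_hpart expos_add_iff mdeg_add)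
    also have "\<dots> = (if m \<in> expos n \<and> mdeg m = d then mcoeff f a * mcoeff g b else 0)"
      using ab by (auto simp: sum.delta' sum.delta mdeg_add)
    finally show "(\<Sum>i\<le>d. ?t i p) = (if m \<in> expos n \<and> mdeg m = d then (case p of (a, b) \<Rightarrow> mcoeff f a * mcoeff g b) else 0)"
      unfolding p by simp
  qed
  also have "\<dots> = lookup (hpart n d (f * g)) m"
    unfolding lookup_hpart mcoeff_simps by (cases "m \<in> expos n \<and> mdeg m = d") (simp_all only: if_True if_False simp_thms sum.neutral_const)
  finally show "lookup (hpart n d (f * g)) m = lookup (\<Sum>i\<le>d. hpart n i f * hpart n (d - i) g) m" ..
qed

lemma hcomp_other_degree: "f \<in> hom_part k \<Longrightarrow> d \<noteq> k \<Longrightarrow> hcomp d f = 0"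
  unfolding hcomp_def by (rule restrict_keys_eq_0) (auto simp: hom_part_def)

lemma hpart_mult_hom:
  assumes a: "a \<in> poly_ring n" "a \<in> hom_part k"
  shows "hpart n d (f * mfps_of_poly a) = (if d < k then 0 else hpart n (d - k) f * a)"
proof -
  have "hpart n d (f * mfps_of_poly a) = (\<Sum>i\<le>d. if i + k = d then hpart n i f * a else 0)"
    unfolding hpart_mult hpart_of_poly[OF a(1)]
    by (rule sum.cong) (auto simp: hcomp_id[OF a(2)] hcomp_other_degree[OF a(2)])
  also have "\<dots> = (if d < k then 0 else hpart n (d - k) f * a)"
  proof (cases "d < k")
    case True
    then show ?thesis by (simp add: sum.neutral)
  next
    case False
    have "(\<Sum>i\<le>d. if i + k = d then hpart n i f * a else 0) = (\<Sum>i\<le>d. if i = d - k then hpart n i f * a else 0)"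
      by (rule sum.cong) (use False in auto)
    then show ?thesis using False by simp
  qed
  finally show ?thesis .
qed

lemma hcomp_sum: "hcomp d (sum f A) = (\<Sum>x\<in>A. hcomp d (f x))"
  by (induction A rule: infinite_finite_induct) (simp_all add: hcomp_add hcomp_id)

lemma gen_ideal_finite:
  assumes R: "subring_set R" and G: "finite G" and f: "f \<in> gen_ideal R G"
  shows "\<exists>x. (\<forall>g\<in>G. x g \<in> R) \<and> f = (\<Sum>g\<in>G. x g * g)"
  using f
proof induction
  case zero
  have "(\<forall>g\<in>G. (0 :: 'a) \<in> R) \<and> 0 = (\<Sum>g\<in>G. 0 * g)" using subring_setD(1)[OF R] by simp
  then show ?case by (intro exI[of _ "\<lambda>_. 0"])
next
  case (gen f)
  have "(\<Sum>g\<in>G. (if g = f then 1 else 0) * g) = (\<Sum>g\<in>G. if g = f then f else 0)" by (rule sum.cong) auto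
  then have "f = (\<Sum>g\<in>G. (if g = f then 1 else 0) * g)" using gen G by (simp add: sum.delta)
  then show ?case using subring_setD(1,2)[OF R] by (intro exI[of _ "\<lambda>g. if g = f then 1 else 0"]) simp
next
  case (add f g)
  then obtain x y where "\<forall>h\<in>G. x h \<in> R" "f = (\<Sum>h\<in>G. x h * h)" "\<forall>h\<in>G. y h \<in> R" "g = (\<Sum>h\<in>G. y h * h)" by blast
  then show ?case using subring_setD(3)[OF R]
    by (intro exI[of _ "\<lambda>h. x h + y h"]) (simp add: distrib_right sum.distrib)
next
  case (scale c f)
  then obtain x where "\<forall>h\<in>G. x h \<in> R" "f = (\<Sum>h\<in>G. x h * h)" by blast
  then show ?case using scale.hyps(1) subring_setD(5)[OF R]
    by (intro exI[of _ "\<lambda>h. c * x h"]) (simp add: sum_distrib_left mult.assoc)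
qed

lemma gen_ideal_sum: "(\<And>x. x \<in> A \<Longrightarrow> f x \<in> gen_ideal R S) \<Longrightarrow> sum f A \<in> gen_ideal R S"
  by (induction A rule: infinite_finite_induct) (simp_all add: gen_submodule.zero gen_submodule.add)

text \<open>In every degree the coefficients of a representation can be replaced by their homogeneous parts of
  the complementary degree; these are the parts of power series, which represent \<open>f\<close>.\<close>

lemma gen_ideal_series_iff:
  assumes G: "finite G" "\<And>g. g \<in> G \<Longrightarrow> g \<in> poly_ring n" "\<And>g. g \<in> G \<Longrightarrow> g \<in> hom_part (k g)"
  shows "f \<in> gen_ideal (mfps_ring n) (mfps_of_poly ` G) \<longleftrightarrow>
    f \<in> mfps_ring n \<and> (\<forall>d. hpart n d f \<in> gen_ideal (poly_ring n) G)"
proof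
  assume f: "f \<in> gen_ideal (mfps_ring n) (mfps_of_poly ` G)"
  have "mfps_of_poly ` G \<subseteq> mfps_ring n" using G(2) mfps_of_poly_in by blast
  from gen_ideal_subset[OF mfps_ring_subring this] f have fR: "f \<in> mfps_ring n" by blast
  have "hpart n d f \<in> gen_ideal (poly_ring n) G" for d
    using f
  proof (induction arbitrary: d)
    case (gen f)
    then obtain g where g: "g \<in> G" "f = mfps_of_poly g" by blast
    have "hpart n d f = (if d = k g then g else 0)"
      unfolding g(2) hpart_of_poly[OF G(2)[OF g(1)]]
      by (simp add: hcomp_id[OF G(3)[OF g(1)]] hcomp_other_degree[OF G(3)[OF g(1)]])
    then show ?case using g(1) by (simp add: gen_submodule.zero gen_submodule.gen)
  next
    case (scale a x)
    show ?case unfolding hpart_mult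
      by (intro gen_ideal_sum gen_submodule.scale[of _ "poly_ring n" _ "(*)"] hpart_in scale.IH)
  qed (simp_all add: gen_submodule.zero gen_submodule.add hpart_add)
  with fR show "f \<in> mfps_ring n \<and> (\<forall>d. hpart n d f \<in> gen_ideal (poly_ring n) G)" by blast
next
  assume f: "f \<in> mfps_ring n \<and> (\<forall>d. hpart n d f \<in> gen_ideal (poly_ring n) G)"
  have "\<forall>d. \<exists>x. (\<forall>g\<in>G. x g \<in> poly_ring n) \<and> hpart n d f = (\<Sum>g\<in>G. x g * g)"
    using f gen_ideal_finite[OF poly_ring_subring G(1)] by blast
  from choice[OF this] obtain x where
    x: "\<And>d g. g \<in> G \<Longrightarrow> x d g \<in> poly_ring n" "\<And>d. hpart n d f = (\<Sum>g\<in>G. x d g * g)" by blast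
  define y where "y g = of_parts (\<lambda>e. hcomp e (x (e + k g) g))" for g
  have y: "y g \<in> mfps_ring n" "hpart n e (y g) = hcomp e (x (e + k g) g)" if "g \<in> G" for g e
    unfolding y_def using x(1)[OF that] by (simp_all add: of_parts_in hpart_of_parts hcomp_in_poly_ring hcomp_hom_part)
  have in_ring: "y g * mfps_of_poly g \<in> mfps_ring n" if "g \<in> G" for g
    using y(1)[OF that] mfps_of_poly_in[OF G(2)[OF that]] by (rule mfps_ring_closed)
  have "f = (\<Sum>g\<in>G. y g * mfps_of_poly g)"
  proof (rule mfps_ring_eqI[of _ n])
    show "f \<in> mfps_ring n" using f by blast
    show "(\<Sum>g\<in>G. y g * mfps_of_poly g) \<in> mfps_ring n"
      using in_ring by (rule subring_set_sum[OF mfps_ring_subring])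
    fix d
    have "hpart n d (\<Sum>g\<in>G. y g * mfps_of_poly g) = (\<Sum>g\<in>G. hcomp d (x d g * g))"
      unfolding hpart_sum
      by (rule sum.cong[OF refl]) (simp add: hpart_mult_hom[OF G(2,3)] hcomp_mult_hom[OF G(3)] y(2))
    also have "\<dots> = hcomp d (hpart n d f)" unfolding x(2) hcomp_sum ..
    also have "\<dots> = hpart n d f" by (rule hcomp_id[OF hpart_in(2)])
    finally show "hpart n d f = hpart n d (\<Sum>g\<in>G. y g * mfps_of_poly g)" ..
  qed
  moreover have "(\<Sum>g\<in>G. y g * mfps_of_poly g) \<in> gen_ideal (mfps_ring n) (mfps_of_poly ` G)"
    by (intro gen_ideal_sum gen_submodule.scale[of _ "mfps_ring n" _ "(*)"] y(1) gen_submodule.gen imageI)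
  ultimately show "f \<in> gen_ideal (mfps_ring n) (mfps_of_poly ` G)" by simp
qed

lemma series_cancel:
  assumes a: "a \<in> poly_ring n" "a \<in> hom_part k" "a \<noteq> 0" and xy: "x \<in> mfps_ring n" "y \<in> mfps_ring n"
    and eq: "x * mfps_of_poly a = y * mfps_of_poly a"
  shows "x = y"
proof (rule mfps_ring_eqI[OF xy])
  fix d
  have "hpart n d x * a = hpart n d y * a"
    using arg_cong[OF eq, of "hpart n (d + k)"] by (simp add: hpart_mult_hom[OF a(1,2)])
  then show "hpart n d x = hpart n d y" using a(3) by simp
qed

text \<open>In degree \<open>d + i\<close> the equation shows that the part of \<open>x\<close> of degree \<open>d\<close> is divisible by \<open>b\<close>, and
  the homogeneous quotients are collected to a series.\<close>

lemma series_coprime: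
  assumes a: "a \<in> poly_ring n" "a \<in> hom_part i" and b: "b \<in> poly_ring n" "b \<in> hom_part j"
    and coprime: "\<And>f g. f \<in> poly_ring n \<Longrightarrow> a * f = b * g \<Longrightarrow> \<exists>h\<in>poly_ring n. f = h * b"
    and xy: "x \<in> mfps_ring n" "y \<in> mfps_ring n" and eq: "x * mfps_of_poly a = y * mfps_of_poly b"
  shows "\<exists>h\<in>mfps_ring n. x = h * mfps_of_poly b"
proof -
  have "\<exists>h. h \<in> poly_ring n \<and> hpart n d x = h * b" for d
  proof -
    have "hpart n d x * a = (if d + i < j then 0 else hpart n (d + i - j) y * b)"
      using arg_cong[OF eq, of "hpart n (d + i)"] by (simp add: hpart_mult_hom[OF a] hpart_mult_hom[OF b])
    also have "\<dots> = b * (if d + i < j then 0 else hpart n (d + i - j) y)" by (simp add: mult.commute)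
    finally have "a * hpart n d x = b * (if d + i < j then 0 else hpart n (d + i - j) y)" by (simp only: mult.commute)
    from coprime[OF hpart_in(1) this] show ?thesis by blast
  qed
  then obtain h where h: "\<And>d. h d \<in> poly_ring n" "\<And>d. hpart n d x = h d * b" by metis
  let ?h = "of_parts (\<lambda>e. hcomp e (h (e + j)))"
  have hR: "?h \<in> mfps_ring n" by (intro of_parts_in hcomp_in_poly_ring h(1))
  have hp: "hpart n e ?h = hcomp e (h (e + j))" for e
    by (simp add: hpart_of_parts hcomp_in_poly_ring hcomp_hom_part h(1))
  have "x = ?h * mfps_of_poly b"
  proof (rule mfps_ring_eqI[OF xy(1)])
    show "?h * mfps_of_poly b \<in> mfps_ring n" using hR mfps_of_poly_in[OF b(1)] by (rule mfps_ring_closed)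
    fix d
    have "hpart n d x = hcomp d (h d * b)" unfolding h(2)[symmetric] by (rule hcomp_id[OF hpart_in(2), symmetric])
    then show "hpart n d x = hpart n d (?h * mfps_of_poly b)"
      unfolding hpart_mult_hom[OF b] hcomp_mult_hom[OF b(2)] hp by simp
  qed
  with hR show ?thesis by blast
qed

section \<open>The substitution of a Gale dual and its kernel\<close>

lemma ell_in: "ell B j \<in> poly_ring (dim_col B)" "ell B j \<in> hom_part 1"
  unfolding ell_def
  by (intro subring_set_sum[OF poly_ring_subring] poly_ring_closed(5) of_int_in_poly_ring pvar_in_poly_ring, simp)
    (intro hom_part_sum, simp only: pconst_of_int[symmetric], intro hom_part_pconst_mult hom_part_pvar)

lemma hpart_gale_subst: "hpart (dim_col B) d (gale_subst B f) = psubst (ell B) (hpart (dim_row B) d f)"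
  and gale_subst_in: "gale_subst B f \<in> mfps_ring (dim_col B)"
proof -
  let ?p = "\<lambda>d. psubst (ell B) (hpart (dim_row B) d f)"
  have p: "?p d \<in> poly_ring (dim_col B)" "?p d \<in> hom_part d" for d
    using psubst_in_poly_ring[OF hpart_in(1)] psubst_hom_part[OF hpart_in(2)] ell_in by blast+
  have coeff: "mcoeff f m * lookup (\<Prod>j<dim_row B. ell B j ^ lookup m j) k
      = lookup (psubst (ell B) (single m (mcoeff f m))) k" if "m \<in> expos (dim_row B)" for m k
  proof -
    have "lookup (pconst c * g) k = c * lookup g k" for c g
      by (induction g rule: cpoly_induct)
        (simp_all add: pconst_mult_single lookup_single when_def distrib_left lookup_add)
    then show ?thesis unfolding psubst_single mono_val_expos[OF that] by simp
  qed
  have eq: "gale_subst B f = of_parts ?p"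
  proof (rule mfps_eqI)
    fix k
    show "mcoeff (gale_subst B f) k = mcoeff (of_parts ?p) k"
      unfolding gale_subst_def mcoeff_of_parts Abs_mfps_inverse[OF UNIV_I] hpart_def psubst_sum lookup_sum
      by (rule sum.cong) (use coeff in auto)
  qed
  show "hpart (dim_col B) d (gale_subst B f) = ?p d" unfolding eq by (rule hpart_of_parts[of ?p, OF p])
  show "gale_subst B f \<in> mfps_ring (dim_col B)" unfolding eq by (intro of_parts_in p(1))
qed

lemma gale_subst_add: "gale_subst B (f + g) = gale_subst B f + gale_subst B g"
  by (rule mfps_ring_eqI[OF gale_subst_in mfps_ring_closed(3)[OF gale_subst_in gale_subst_in]])
    (simp add: hpart_gale_subst hpart_add psubst_add)

lemma gale_subst_mult: "gale_subst B (f * g) = gale_subst B f * gale_subst B g"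
  by (rule mfps_ring_eqI[OF gale_subst_in mfps_ring_closed(5)[OF gale_subst_in gale_subst_in]])
    (simp add: hpart_gale_subst hpart_mult psubst_sum psubst_mult)

lemma gale_subst_zero [simp]: "gale_subst B 0 = 0"
  using gale_subst_add[of B 0 0] by simp

lemma gale_subst_diff: "gale_subst B (f - g) = gale_subst B f - gale_subst B g"
  using gale_subst_add[of B "f - g" g] by (simp add: eq_diff_eq)

lemma psubst_hcomp:
  assumes "\<And>j. L j \<in> hom_part 1"
  shows "psubst L (hcomp d f) = hcomp d (psubst L f)"
proof (induction f rule: cpoly_induct)
  case (single m c)
  have "single m c \<in> hom_part (mdeg m)" by (simp add: hom_part_def)
  moreover from psubst_hom_part[of _ _ L, OF this assms] have "psubst L (single m c) \<in> hom_part (mdeg m)" .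
  ultimately show ?case by (cases "d = mdeg m") (simp_all add: hcomp_id hcomp_other_degree)
qed (simp_all add: hcomp_add psubst_add hcomp_id)

lemma gale_subst_of_poly:
  assumes "f \<in> poly_ring (dim_row B)"
  shows "gale_subst B (mfps_of_poly f) = mfps_of_poly (psubst (ell B) f)"
proof -
  have in_ring: "psubst (ell B) f \<in> poly_ring (dim_col B)" using psubst_in_poly_ring[OF assms] ell_in by blast
  show ?thesis
    by (rule mfps_ring_eqI[OF gale_subst_in mfps_of_poly_in[OF in_ring]])
      (simp add: hpart_gale_subst hpart_of_poly assms in_ring psubst_hcomp[OF ell_in(2)])
qed

lemma num_in_poly_ring: "numeral k \<in> poly_ring n"
  using of_int_in_poly_ring[of "numeral k" n] by simp

lemma num_hom_part: "f \<in> hom_part d \<Longrightarrow> numeral k * f \<in> hom_part d"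
  using hom_part_pconst_mult[of f d "of_int (numeral k)"] by (simp only: pconst_of_int) simp

lemma psubst_of_int: "psubst L (of_int i) = of_int i"
  using psubst_pconst[of L "of_int i"] by (simp only: pconst_of_int)

lemma psubst_numeral: "psubst L (numeral k) = numeral k"
  using psubst_of_int[of L "numeral k"] by simp

lemma psubst_uminus: "psubst L (- f) = - psubst L f"
  using psubst_add[of L f "- f"] by (simp add: minus_unique)

lemma psubst_diff: "psubst L (f - g) = psubst L f - psubst L g"
  using psubst_add[of L f "- g"] by (simp add: psubst_uminus)

lemma power_cong_ideal:
  assumes R: "subring_set R" and D: "ideal_set R D" and xy: "x \<in> R" "y \<in> R" "x - y \<in> D"
  shows "x ^ k - y ^ k \<in> D"
proof (induction k)
  case (Suc k)
  note d = ideal_set_closed[OF R D]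
  have "x ^ Suc k - y ^ Suc k = x * (x ^ k - y ^ k) + y ^ k * (x - y)" by (simp add: algebra_simps)
  moreover have "x * (x ^ k - y ^ k) \<in> D" "y ^ k * (x - y) \<in> D"
    using D Suc xy subring_set_power[OF R xy(2)] unfolding ideal_set_def by blast+
  ultimately show ?case using D unfolding ideal_set_def by simp
qed (use D in \<open>simp add: ideal_set_def\<close>)

lemma prod_cong_ideal:
  assumes R: "subring_set R" and D: "ideal_set R D"
    and xy: "\<And>j. j \<in> A \<Longrightarrow> x j \<in> R \<and> y j \<in> R \<and> x j - y j \<in> D"
  shows "prod x A - prod y A \<in> D"
  using xy
proof (induction A rule: infinite_finite_induct)
  case (insert j A)
  have "prod x (insert j A) - prod y (insert j A) = x j * (prod x A - prod y A) + prod y A * (x j - y j)"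
    using insert.hyps by (simp add: algebra_simps)
  moreover have "x j \<in> R" "x j - y j \<in> D" "prod y A \<in> R" "prod x A - prod y A \<in> D"
    using insert subring_set_prod[OF R, of A y] by auto
  ultimately show ?case using D unfolding ideal_set_def by simp
qed (use D in \<open>simp_all add: ideal_set_def\<close>)

text \<open>The variables and their images agree modulo \<open>D\<close>, hence so do all polynomials in them.\<close>

lemma psubst_cong_ideal:
  assumes D: "ideal_set (poly_ring n) D" and L: "\<And>j. j < n \<Longrightarrow> L j \<in> poly_ring n \<and> pvar j - L j \<in> D"
    and f: "f \<in> poly_ring n"
  shows "f - psubst L f \<in> D"
  using f
proof (induction rule: poly_ring_induct)
  case zero
  then show ?case using D by (simp add: ideal_set_def)
next
  case (single m c)
  have "mono_val pvar m - mono_val L m \<in> D"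
    unfolding mono_val_expos[OF single]
    using L poly_ring_closed(7)[of _ n] power_cong_ideal[OF poly_ring_subring D]
    by (intro prod_cong_ideal[OF poly_ring_subring D]) (auto simp: pvar_in_poly_ring)
  moreover have "single m c - psubst L (single m c) = pconst c * (mono_val pvar m - mono_val L m)"
    by (simp add: psubst_single mono_val_pvar pconst_mult_single right_diff_distrib)
  ultimately show ?case using D pconst_in_poly_ring[of c n] unfolding ideal_set_def by simp
next
  case (add f g)
  have "f + g - psubst L (f + g) = (f - psubst L f) + (g - psubst L g)" by (simp add: psubst_add)
  then show ?case using add.IH D unfolding ideal_set_def by (metis (no_types, lifting))
qed

text \<open>The linear form defined by row \<open>i\<close> of the matrix.\<close>

definition U_form :: "nat \<Rightarrow> cpoly" where
  "U_form i = pvar (i + 2) - of_int (ca (i + 2)) * pvar 0 - of_int (cb (i + 2)) * pvar 1"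

locale standard_gale =
  fixes q :: nat
  assumes q1: "q \<ge> 1"
begin

sublocale gale q "B_mat q"
  by unfold_locales (use q1 gale_dual_B_mat in auto)

abbreviation "\<Phi> \<equiv> gale_subst (B_mat q)"
abbreviation "R \<equiv> mfps_ring (5 * q)"
abbreviation "S \<equiv> mfps_ring 2"
abbreviation "U \<equiv> U_ideal (A_mat q)"

lemma X_eq: "X = pvar 0 + pvar 1"
  and Y_eq: "Y = - (2 * pvar 0 + 3 * pvar 1)"
  and Z_eq: "Z = 3 * pvar 0 + pvar 1"
proof -
  have "B_mat q $$ (0, 0) = 1" "B_mat q $$ (0, 1) = 1" "B_mat q $$ (1, 0) = - 2" "B_mat q $$ (1, 1) = - 3"
    using q1 by (simp_all add: B_mat_def)
  then show X: "X = pvar 0 + pvar 1" and Y: "Y = - (2 * pvar 0 + 3 * pvar 1)"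
    unfolding X_def Y_def ell_def dim_B by (simp_all add: numeral_2_eq_2)
  show "Z = 3 * pvar 0 + pvar 1" unfolding Z_def X Y by (simp add: algebra_simps)
qed

lemma U_form_in: "i < 5 * q - 2 \<Longrightarrow> U_form i \<in> poly_ring (5 * q)" "U_form i \<in> hom_part 1"
proof -
  show "U_form i \<in> hom_part 1" unfolding U_form_def pconst_of_int[symmetric]
    by (intro hom_part_diff hom_part_pconst_mult hom_part_pvar)
  assume "i < 5 * q - 2"
  then show "U_form i \<in> poly_ring (5 * q)" unfolding U_form_def
    by (intro poly_ring_closed(4,5) of_int_in_poly_ring pvar_in_poly_ring) simp_all
qed

lemma U_ideal_eq: "U = gen_ideal R (mfps_of_poly ` U_form ` {..<5 * q - 2})"
proof -
  have "(\<Sum>j<5 * q. of_int (A_mat q $$ (i, j)) * tvar j) = mfps_of_poly (U_form i)" if "i < 5 * q - 2" for i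
    unfolding A_mat_row_sum[OF that] U_form_def tvar_def mfps_of_poly_hom mfps_of_poly_of_int ..
  then show ?thesis unfolding U_ideal_def dim_A_mat image_image by (intro arg_cong[where f = "gen_ideal R"] image_cong) simp_all
qed

lemma \<Phi>_in: "\<Phi> f \<in> S"
  using gale_subst_in[of "B_mat q"] unfolding dim_B .

lemma hpart_\<Phi>: "hpart 2 d (\<Phi> f) = psubst (ell (B_mat q)) (hpart (5 * q) d f)"
  using hpart_gale_subst[of "B_mat q"] unfolding dim_B .

text \<open>With the chosen Gale dual the coordinates \<open>s\<^sub>1, s\<^sub>2\<close> are integral combinations of the forms of the
  types 0 and 1. The corresponding combinations of \<open>t\<^sub>0, t\<^sub>1\<close> lift them to the source.\<close>

definition lift_var :: "nat \<Rightarrow> cpoly" where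
  "lift_var j = (if j = 0 then 3 * pvar 0 + pvar 1 else - (2 * pvar 0 + pvar 1))"

lemma ell_lift: "j < 2 \<Longrightarrow> psubst (ell (B_mat q)) (lift_var j) = pvar j"
proof -
  assume "j < 2"
  then have "j = 0 \<or> j = 1" by linarith
  moreover have e: "ell (B_mat q) 0 = pvar 0 + pvar 1" "ell (B_mat q) 1 = - (2 * pvar 0 + 3 * pvar 1)"
    using X_eq Y_eq unfolding X_def Y_def .
  have "psubst (ell (B_mat q)) (lift_var 0) = pvar 0" "psubst (ell (B_mat q)) (lift_var 1) = pvar 1"
    unfolding lift_var_def
    by (simp_all add: psubst_add psubst_diff psubst_mult psubst_uminus psubst_numeral psubst_pvar e del: One_nat_def)
  ultimately show ?thesis by blast
qed

lemma lift_ell: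
  assumes "j < 5 * q"
  shows "psubst lift_var (ell (B_mat q) j) = of_int (ca j) * pvar 0 + of_int (cb j) * pvar 1"
  unfolding ell_row[OF assms] X_eq Y_eq psubst_add psubst_mult psubst_uminus psubst_numeral psubst_of_int psubst_pvar
  by (simp add: lift_var_def algebra_simps)

lemma lift_var_in: "lift_var j \<in> poly_ring (5 * q)" "lift_var j \<in> hom_part 1"
proof -
  have "0 < 5 * q" "1 < 5 * q" using q1 by simp_all
  then show "lift_var j \<in> poly_ring (5 * q)" unfolding lift_var_def
    by (auto intro!: poly_ring_closed num_in_poly_ring pvar_in_poly_ring)
  have uminus: "- f \<in> hom_part 1" if "f \<in> hom_part 1" for f using hom_part_diff[OF hom_part_zero that] by simp
  show "lift_var j \<in> hom_part 1" unfolding lift_var_def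
    by (auto intro!: hom_part_add uminus num_hom_part hom_part_pvar simp del: One_nat_def minus_add_distrib)
qed

lemma \<Phi>_surj: "\<Phi> ` R = S"
proof (intro equalityI subsetI)
  fix g assume g: "g \<in> S"
  let ?p = "\<lambda>d. psubst lift_var (hpart 2 d g)"
  have p: "?p d \<in> poly_ring (5 * q)" "?p d \<in> hom_part d" for d
    using psubst_in_poly_ring[OF hpart_in(1)] psubst_hom_part[OF hpart_in(2)] lift_var_in by blast+
  have "\<Phi> (of_parts ?p) = g"
  proof (rule mfps_ring_eqI[OF \<Phi>_in g])
    fix d
    have "psubst (ell (B_mat q)) (?p d) = psubst pvar (hpart 2 d g)"
      unfolding psubst_psubst by (rule psubst_cong[OF hpart_in(1)]) (rule ell_lift)
    then show "hpart 2 d (\<Phi> (of_parts ?p)) = hpart 2 d g"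
      unfolding hpart_\<Phi> hpart_of_parts[of ?p, OF p] psubst_id .
  qed
  moreover have "of_parts ?p \<in> R" by (intro of_parts_in p(1))
  ultimately show "g \<in> \<Phi> ` R" by (metis imageI)
qed (use \<Phi>_in in blast)

text \<open>Substituting and lifting back sends \<open>t\<^sub>j\<close> to the combination of \<open>t\<^sub>0\<close> and \<open>t\<^sub>1\<close> that is congruent to
  \<open>t\<^sub>j\<close> modulo the linear forms. In every degree a polynomial in the kernel is therefore congruent to
  zero.\<close>

lemma \<Phi>_kernel:
  assumes "f \<in> R"
  shows "\<Phi> f = 0 \<longleftrightarrow> f \<in> U"
proof
  assume z: "\<Phi> f = 0"
  let ?G = "U_form ` {..<5 * q - 2}"
  let ?D = "gen_ideal (poly_ring (5 * q)) ?G"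
  let ?L = "\<lambda>j. of_int (ca j) * pvar 0 + of_int (cb j) * pvar 1 :: cpoly"
  have D: "ideal_set (poly_ring (5 * q)) ?D"
    by (rule ideal_set_gen[OF poly_ring_subring]) (use U_form_in(1) in blast)
  have L: "?L j \<in> poly_ring (5 * q) \<and> pvar j - ?L j \<in> ?D" if j: "j < 5 * q" for j
  proof
    show "?L j \<in> poly_ring (5 * q)"
      using q1 by (intro poly_ring_closed(3,5) of_int_in_poly_ring pvar_in_poly_ring) simp_all
    consider "j = 0" | "j = 1" | i where "j = i + 2" using zero_one_or_more[of j] by blast
    then show "pvar j - ?L j \<in> ?D"
    proof cases
      case (3 i)
      then have "pvar j - ?L j = U_form i" "i < 5 * q - 2" using j unfolding U_form_def by (simp_all add: algebra_simps)
      then show ?thesis by (auto intro: gen_submodule.gen)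
    qed (simp_all add: gen_submodule.zero)
  qed
  have "hpart (5 * q) d f \<in> ?D" for d
  proof -
    have "psubst ?L (hpart (5 * q) d f) = psubst lift_var (psubst (ell (B_mat q)) (hpart (5 * q) d f))"
      unfolding psubst_psubst by (rule psubst_cong[OF hpart_in(1)]) (rule lift_ell[symmetric])
    also have "\<dots> = 0" unfolding hpart_\<Phi>[symmetric] z by simp
    finally show ?thesis using psubst_cong_ideal[OF D L hpart_in(1), of d f] by simp
  qed
  then show "f \<in> U" unfolding U_ideal_eq
    by (subst gen_ideal_series_iff[where k = "\<lambda>_. 1"]) (use U_form_in assms in auto)
next
  assume "f \<in> U"
  then show "\<Phi> f = 0" unfolding U_ideal_eq
  proof induction
    case (gen f)
    then obtain i where i: "i < 5 * q - 2" "f = mfps_of_poly (U_form i)" by blast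
    have "psubst (ell (B_mat q)) (U_form i) = 0"
      using i(1) ell_row[of "i + 2"] unfolding U_form_def
      by (simp add: psubst_diff psubst_mult psubst_of_int psubst_pvar X_def[symmetric] Y_def[symmetric] del: One_nat_def add_2_eq_Suc')
    then show ?case unfolding i(2) using gale_subst_of_poly[of "U_form i" "B_mat q"] U_form_in(1)[OF i(1)] dim_B
      by (simp add: mfps_of_poly_hom)
  qed (simp_all add: gale_subst_add gale_subst_mult)
qed

end

section \<open>The obstruction module of the construction\<close>

lemma gen_ideal_eq_two:
  assumes "subring_set R"
  shows "f \<in> gen_ideal R {a, b} \<longleftrightarrow> (\<exists>x\<in>R. \<exists>y\<in>R. f = x * a + y * b)"
  unfolding gen_ideal_two[OF assms] by blast

lemma squarefree_monomial: "finite J \<Longrightarrow> (\<Prod>j\<in>J. pvar j) = pmonom (\<Sum>j\<in>J. xexp j 1)"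
  unfolding pvar_def by (rule pmonom_prod)

lemma lookup_squarefree: "finite J \<Longrightarrow> lookup (\<Sum>j\<in>J. xexp j 1) k = (if k \<in> J then 1 else 0)"
  unfolding lookup_sum by (simp add: lookup_single when_def sum.delta)

text \<open>The exponents in \<open>f\<close> lie above the exponent of the second monomial because the first one does not
  contribute to these variables.\<close>

lemma coprime_squarefree:
  assumes J: "finite J" "finite K" "J \<inter> K = {}" and f: "f \<in> poly_ring n"
    and eq: "(\<Prod>j\<in>J. pvar j) * f = (\<Prod>j\<in>K. pvar j) * g"
  shows "\<exists>h\<in>poly_ring n. f = h * (\<Prod>j\<in>K. pvar j)"
proof -
  let ?d = "\<Sum>j\<in>J. xexp j 1" and ?e = "\<Sum>j\<in>K. xexp j 1"
  have eq': "pmonom ?d * f = pmonom ?e * g" using eq unfolding squarefree_monomial[OF J(1)] squarefree_monomial[OF J(2)] .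
  have "expo_le ?e m" if m: "m \<in> keys f" for m
  proof -
    have "lookup (pmonom ?d * f) (?d + m) = lookup f m"
      unfolding lookup_pmonom_mult by (simp add: expo_le_def lookup_add)
    then have "lookup (pmonom ?e * g) (?d + m) \<noteq> 0" using m unfolding eq' in_keys_iff by simp
    then have "expo_le ?e (?d + m)" unfolding lookup_pmonom_mult by presburger
    then have le: "(if k \<in> K then 1 else 0) \<le> (if k \<in> J then 1 else 0) + lookup m k" for k
      unfolding expo_le_def lookup_add lookup_squarefree[OF J(1)] lookup_squarefree[OF J(2)] by blast
    show ?thesis unfolding expo_le_def lookup_squarefree[OF J(2)]
    proof
      fix k
      show "(if k \<in> K then 1 else 0) \<le> lookup m k" using le[of k] J(3) by (cases "k \<in> K"; cases "k \<in> J") auto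
    qed
  qed
  from pmonom_dvd[OF f this] show ?thesis unfolding squarefree_monomial[OF J(2)] by (metis mult.commute)
qed

lemma hom_part_squarefree: "finite J \<Longrightarrow> (\<Prod>j\<in>J. pvar j) \<in> hom_part (card J)"
  by (induction J rule: finite_induct)
    (use hom_part_mult[OF hom_part_pvar] hom_part_one in auto)

lemma tmonom_of_poly: "tmonom J = mfps_of_poly (\<Prod>j\<in>J. pvar j)"
  unfolding tmonom_def tvar_def mfps_of_poly_prod ..

lemma squarefree_in: "J \<subseteq> {..<n} \<Longrightarrow> (\<Prod>j\<in>J. pvar j) \<in> poly_ring n"
  by (rule subring_set_prod[OF poly_ring_subring]) (auto intro: pvar_in_poly_ring)

lemma tmonom_in: "J \<subseteq> {..<n} \<Longrightarrow> tmonom J \<in> mfps_ring n"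
  unfolding tmonom_of_poly by (intro mfps_of_poly_in squarefree_in)

lemma tmonom_dvd:
  assumes "finite J" "I \<subseteq> J"
  shows "tmonom J = tmonom (J - I) * tmonom I"
  unfolding tmonom_def using prod.subset_diff[OF assms(2,1)] by simp

lemma tmonom_coprime:
  assumes J: "J \<subseteq> {..<n}" "K \<subseteq> {..<n}" "J \<inter> K = {}" and xy: "x \<in> mfps_ring n" "y \<in> mfps_ring n"
    and eq: "x * tmonom J = y * tmonom K"
  shows "\<exists>h\<in>mfps_ring n. x = h * tmonom K \<and> y = h * tmonom J"
proof -
  have fin: "finite J" "finite K" using J(1,2) finite_subset by blast+
  obtain h where h: "h \<in> mfps_ring n" "x = h * tmonom K"
    using series_coprime[OF squarefree_in[OF J(1)] hom_part_squarefree[OF fin(1)] squarefree_in[OF J(2)] hom_part_squarefree[OF fin(2)]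
        _ xy eq[unfolded tmonom_of_poly]] coprime_squarefree[OF fin J(3)]
    unfolding tmonom_of_poly by metis
  have ne: "(\<Prod>j\<in>K. pvar j) \<noteq> 0" unfolding squarefree_monomial[OF fin(2)] by (rule pmonom_nonzero)
  have "y * tmonom K = (h * tmonom J) * tmonom K" using eq unfolding h(2) by (simp add: mult_ac)
  from series_cancel[OF squarefree_in[OF J(2)] hom_part_squarefree[OF fin(2)] ne xy(2) _ this[unfolded tmonom_of_poly]]
  have "y = h * tmonom J"
    unfolding tmonom_of_poly using h(1) tmonom_in[OF J(1), unfolded tmonom_of_poly] by (blast intro: mfps_ring_closed(5))
  with h show ?thesis by blast
qed

context standard_gale
begin

declare One_nat_def [simp del]

text \<open>The forms of the types 1 and 2 are \<open>- \<lambda>\<^sub>1\<close> and \<open>- \<lambda>\<^sub>3\<close>, so that the sign \<open>(- 1)\<^sup>q\<close> appears in the images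
  of the monomials.\<close>

abbreviation "t0 \<equiv> tmonom (types q {0})"
abbreviation "t1 \<equiv> tmonom (types q {1})"
abbreviation "t2 \<equiv> tmonom (types q {2})"
abbreviation "t3 \<equiv> tmonom (types q {3})"
definition "l1 = 2 * pvar 0 + 3 * pvar 1"
abbreviation "L1 \<equiv> mfps_of_poly (l1 ^ q)"
abbreviation "L2 \<equiv> mfps_of_poly (Z ^ q)"
abbreviation "L3 \<equiv> mfps_of_poly (X ^ q)"
abbreviation "sgn_q \<equiv> (- 1) ^ q :: mfps"

lemma types_less: "types q T \<subseteq> {..<5 * q}"
  by (auto simp: types_def)

lemma monoms_in: "t0 \<in> R" "t1 \<in> R" "t2 \<in> R" "t3 \<in> R"
  by (rule tmonom_in[OF types_less])+

lemma l1_in: "l1 \<in> poly_ring 2" unfolding l1_def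
  by (intro poly_ring_closed num_in_poly_ring pvar_in_poly_ring) simp_all

lemma L_in: "L1 \<in> S" "L2 \<in> S" "L3 \<in> S"
  by (intro mfps_of_poly_in poly_ring_closed(7) l1_in powers_in)+

lemma sgn_in: "sgn_q \<in> mfps_ring n"
  by (intro mfps_ring_closed(6,7) mfps_ring_closed(2))

lemma sgn_sgn: "sgn_q * (sgn_q * f) = f"
  by (simp add: mult.assoc[symmetric] power_mult_distrib[symmetric])

lemma sgn_of_poly: "mfps_of_poly ((- f) ^ q) = sgn_q * mfps_of_poly (f ^ q)"
proof -
  have "mfps_of_poly (- f) = - mfps_of_poly f" for f using mfps_of_poly_hom(2)[of 0 f] by (simp add: mfps_of_poly_hom(4))
  then show ?thesis unfolding mfps_of_poly_power by (simp add: power_minus[of "mfps_of_poly f"])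
qed

lemma \<Phi>_tmonom: "\<Phi> (tmonom (types q T)) = mfps_of_poly (ell_prod (B_mat q) (types q T))"
  unfolding tmonom_of_poly ell_prod_def
  using gale_subst_of_poly[OF squarefree_in, of "types q T" "B_mat q"] types_less dim_B
  by (simp add: psubst_prod psubst_pvar)

lemma \<Phi>_monoms: "\<Phi> t0 = L3" "\<Phi> t1 = sgn_q * L1" "\<Phi> t2 = sgn_q * L3" "\<Phi> t3 = L2"
  unfolding \<Phi>_tmonom ell_prod_types Y_eq l1_def[symmetric] sgn_of_poly by (rule refl)+

lemma tmonom_two: "s \<noteq> t \<Longrightarrow> tmonom (types q {s, t}) = tmonom (types q {s}) * tmonom (types q {t})"
  unfolding tmonom_def by (rule prod_types_two)

lemma e_monom_eq: "e_monom (v_vec q) (fam q) = t0"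
  unfolding e_monom_def nsupp_minus_core ..

lemma M_ideal_eq: "M_ideal (A_mat q) (fam q) = gen_ideal R {t0, t2}"
  unfolding M_ideal_def M_supports_fam by simp

text \<open>The monomials of the supports other than the two minimal ones are multiples of those.\<close>

lemma P_ideal_eq: "P_ideal (A_mat q) (v_vec q) (fam q) = gen_ideal R {t0 * t3, t1 * t2}"
proof -
  have two: "{t0 * t3, t1 * t2} = tmonom ` {types q {0, 3}, types q {1, 2}}"
    by (simp add: tmonom_two)
  have "tmonom X \<in> gen_ideal R (tmonom ` {types q {0, 3}, types q {1, 2}})"
    if X: "X \<in> P_supports (A_mat q) (v_vec q) (fam q)" for X
  proof -
    have less: "X \<subseteq> {..<5 * q}"
      using X unfolding P_supports_def all_nsupps_A_mat[OF q] fam_def types_def by auto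
    then have fin: "finite X" using finite_subset by blast
    obtain H where H: "H \<in> {types q {0, 3}, types q {1, 2}}" "H \<subseteq> X" using P_supports_fam_large[OF q X] by blast
    have "tmonom (X - H) \<in> R" using less by (intro tmonom_in) blast
    then show ?thesis unfolding tmonom_dvd[OF fin H(2)]
      by (intro gen_submodule.scale[of _ R _ "(*)"] gen_submodule.gen imageI H(1))
  qed
  moreover have "tmonom ` {types q {0, 3}, types q {1, 2}} \<subseteq> gen_ideal R (tmonom ` P_supports (A_mat q) (v_vec q) (fam q))"
    using P_supports_fam_mem[OF q] by (auto intro: gen_submodule.gen)
  ultimately show ?thesis unfolding P_ideal_def dim_A_mat two
    by (intro gen_ideal_cong_gens image_subsetI) auto
qed

lemma U_ideal_set: "ideal_set R U"
  unfolding U_ideal_eq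
  by (rule ideal_set_gen[OF mfps_ring_subring]) (use U_form_in(1) mfps_of_poly_in in blast)

lemma U_times_M: "f \<in> ideal_times R U (gen_ideal R {t0, t2}) \<longleftrightarrow> (\<exists>u\<in>U. \<exists>u'\<in>U. f = u * t0 + u' * t2)"
proof
  note u = U_ideal_set[unfolded ideal_set_def]
  assume "f \<in> ideal_times R U (gen_ideal R {t0, t2})"
  then show "\<exists>u\<in>U. \<exists>u'\<in>U. f = u * t0 + u' * t2"
    unfolding ideal_times_def
  proof induction
    case zero
    have "0 = 0 * t0 + 0 * t2" by simp
    then show ?case using u by blast
  next
    case (gen f)
    then obtain x r r' where x: "x \<in> U" "r \<in> R" "r' \<in> R" "f = x * (r * t0 + r' * t2)"
      unfolding gen_ideal_eq_two[OF mfps_ring_subring] by blast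
    have "f = (r * x) * t0 + (r' * x) * t2" unfolding x(4) by (simp add: algebra_simps)
    moreover have "r * x \<in> U" "r' * x \<in> U" using u x by blast+
    ultimately show ?case by blast
  next
    case (add f g)
    then obtain x x' y y' where xy: "x \<in> U" "x' \<in> U" "f = x * t0 + x' * t2" "y \<in> U" "y' \<in> U" "g = y * t0 + y' * t2" by blast
    have "f + g = (x + y) * t0 + (x' + y') * t2" unfolding xy(3,6) by (simp add: algebra_simps)
    moreover have "x + y \<in> U" "x' + y' \<in> U" using u xy by blast+
    ultimately show ?case by blast
  next
    case (scale c f)
    then obtain x x' where x: "x \<in> U" "x' \<in> U" "f = x * t0 + x' * t2" by blast
    have "c * f = (c * x) * t0 + (c * x') * t2" unfolding x(3) by (simp add: algebra_simps)
    moreover have "c * x \<in> U" "c * x' \<in> U" using u x scale.hyps(1) by blast+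
    ultimately show ?case by blast
  qed
next
  assume "\<exists>u\<in>U. \<exists>u'\<in>U. f = u * t0 + u' * t2"
  then obtain u u' where "u \<in> U" "u' \<in> U" "f = u * t0 + u' * t2" by blast
  moreover have "t0 \<in> gen_ideal R {t0, t2}" "t2 \<in> gen_ideal R {t0, t2}" by (simp_all add: gen_submodule.gen)
  ultimately show "f \<in> ideal_times R U (gen_ideal R {t0, t2})"
    unfolding ideal_times_def by (blast intro: gen_submodule.add gen_submodule.gen)
qed

lemma U_in: "u \<in> U \<Longrightarrow> u \<in> R" and \<Phi>_U: "u \<in> U \<Longrightarrow> \<Phi> u = 0"
proof -
  show *: "u \<in> U \<Longrightarrow> u \<in> R" for u using U_ideal_set unfolding ideal_set_def by blast
  then show "u \<in> U \<Longrightarrow> \<Phi> u = 0" using \<Phi>_kernel by blast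
qed

lemma \<Phi>_lift: "g \<in> S \<Longrightarrow> \<exists>f\<in>R. \<Phi> f = g"
  using \<Phi>_surj by (metis imageE)

lemma Q_ideal_eq: "f \<in> Q_ideal (A_mat q) (v_vec q) (fam q) \<longleftrightarrow>
   (\<exists>u\<in>U. \<exists>u'\<in>U. \<exists>x\<in>R. \<exists>y\<in>R. f = (u * t0 + u' * t2) + (x * (t0 * t3) + y * (t1 * t2)))"
  unfolding Q_ideal_def dim_A_mat M_ideal_eq P_ideal_eq ideal_plus_def mem_Collect_eq
    gen_ideal_eq_two[OF mfps_ring_subring] U_times_M
  by (intro iffI; (elim exE conjE bexE)?; blast)

lemma l1_power: "l1 ^ q \<in> poly_ring 2" "l1 ^ q \<in> hom_part q" "l1 ^ q = (- 1) ^ q * Y ^ q"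
proof -
  show "l1 ^ q \<in> poly_ring 2" by (rule poly_ring_closed(7)[OF l1_in])
  show eq: "l1 ^ q = (- 1) ^ q * Y ^ q" unfolding Y_eq l1_def[symmetric] power_mult_distrib[symmetric] by (simp only: minus_mult_minus mult_1)
  have "l1 \<in> hom_part 1" unfolding l1_def by (intro hom_part_add num_hom_part hom_part_pvar)
  from hom_part_power[OF this, of q] show "l1 ^ q \<in> hom_part q" by simp
qed

text \<open>Cancellation and divisibility for \<open>\<lambda>\<^sub>1\<^sup>q, \<lambda>\<^sub>2\<^sup>q, \<lambda>\<^sub>3\<^sup>q\<close> in the ring of power series follow degree by
  degree from the corresponding facts on independent forms.\<close>

lemma L_cancel: "x \<in> S \<Longrightarrow> y \<in> S \<Longrightarrow> x * L3 = y * L3 \<Longrightarrow> x = y"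
  by (rule series_cancel[OF powers_in(1) powers_in(4) X_nonzero])

lemma L31_coprime:
  assumes xy: "x \<in> S" "y \<in> S" and eq: "x * L3 = y * L1"
  shows "\<exists>h\<in>S. x = h * L1"
proof (rule series_coprime[OF powers_in(1) powers_in(4) l1_power(1,2) _ xy eq])
  fix f g assume f: "f \<in> poly_ring 2" and "X ^ q * f = l1 ^ q * g"
  then have "X ^ q * f = Y ^ q * ((- 1) ^ q * g)" unfolding l1_power(3) by (simp add: mult_ac)
  from coprime_forms[OF XY f this] obtain h where h: "h \<in> poly_ring 2" "f = h * Y ^ q" by blast
  have "f = (h * (- 1) ^ q) * l1 ^ q" unfolding l1_power(3) h(2) by (simp only: mult.assoc sign_square)
  moreover have "h * (- 1) ^ q \<in> poly_ring 2" using h(1) sign_in by (rule poly_ring_closed(5))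
  ultimately show "\<exists>h\<in>poly_ring 2. f = h * l1 ^ q" by blast
qed

lemma L12_coprime:
  assumes xy: "x \<in> S" "y \<in> S" and eq: "x * L1 = y * L2"
  shows "\<exists>h\<in>S. x = h * L2"
proof (rule series_coprime[OF l1_power(1,2) powers_in(3,6) _ xy eq])
  fix f g assume f: "f \<in> poly_ring 2" and "l1 ^ q * f = Z ^ q * g"
  then have "(- 1) ^ q * (Y ^ q * f) = Z ^ q * g" unfolding l1_power(3) by (simp add: mult_ac)
  then have "Y ^ q * f = Z ^ q * ((- 1) ^ q * g)" using sign_square[of "Y ^ q * f"] by (simp add: mult_ac)
  from coprime_forms[OF YZ f this] show "\<exists>h\<in>poly_ring 2. f = h * Z ^ q" .
qed

abbreviation "Den \<equiv> gen_ideal S {L2, L1 * L3}"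
abbreviation "Num \<equiv> gen_ideal S {L1, L2}"

text \<open>An equation \<open>f t0 = u t0 + u' t2 + x t0 t3 + y t1 t2\<close> with \<open>u, u'\<close> in \<open>U\<close> is a relation between the
  coprime monomials \<open>t0\<close> and \<open>t2\<close>, so that \<open>f - u - x t3 = h t2\<close> and \<open>u' + y t1 = h t0\<close>. The image of
  the second equation shows that the image of \<open>h\<close> is divisible by \<open>\<lambda>\<^sub>1\<^sup>q\<close>, and the image of the first
  one lies in the ideal. Conversely, \<open>f\<close> is congruent modulo \<open>U\<close> to a combination of \<open>t3\<close> and \<open>t1 t2\<close>,
  and the multiple of this combination by \<open>t0\<close> is in \<open>P\<close>.\<close>

lemma D_den_eq: "D_den (A_mat q) (v_vec q) (fam q) = {f \<in> R. \<Phi> f \<in> Den}"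
proof (intro equalityI subsetI)
  note r = mfps_ring_closed and s = mfps_ring_closed
  note hom = gale_subst_add gale_subst_diff gale_subst_mult
  fix f assume "f \<in> D_den (A_mat q) (v_vec q) (fam q)"
  then obtain u u' x y where f: "f \<in> R" and u: "u \<in> U" "u' \<in> U" and xy: "x \<in> R" "y \<in> R"
    and eq: "f * t0 = (u * t0 + u' * t2) + (x * (t0 * t3) + y * (t1 * t2))"
    unfolding D_den_def colon_def e_monom_eq dim_A_mat Q_ideal_eq by blast
  have "(f - u - x * t3) * t0 = (u' + y * t1) * t2"
    using eq by (simp add: algebra_simps)
  moreover have "f - u - x * t3 \<in> R" "u' + y * t1 \<in> R" using f u[THEN U_in] xy monoms_in by (simp_all add: r)
  moreover have "types q {0} \<inter> types q {2} = {}" by (auto simp: types_def)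
  ultimately obtain h where h: "h \<in> R" "f - u - x * t3 = h * t2" "u' + y * t1 = h * t0"
    using tmonom_coprime[OF types_less types_less, of "{0}" "{2}" "f - u - x * t3" "u' + y * t1"] by blast
  have f_eq: "\<Phi> f = \<Phi> x * L2 + \<Phi> h * (sgn_q * L3)"
  proof -
    have "f = u + x * t3 + h * t2" using h(2) by (simp add: algebra_simps)
    then show ?thesis by (simp add: hom \<Phi>_monoms \<Phi>_U u)
  qed
  have "\<Phi> y * (sgn_q * L1) = \<Phi> h * L3"
    using arg_cong[OF h(3), of \<Phi>] by (simp add: hom \<Phi>_monoms \<Phi>_U u)
  then have "\<Phi> h * L3 = (\<Phi> y * sgn_q) * L1" by (simp add: mult.assoc)
  from L31_coprime[OF \<Phi>_in s(5)[OF \<Phi>_in sgn_in] this] obtain k where k: "k \<in> S" "\<Phi> h = k * L1" by blast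
  have "\<Phi> f = \<Phi> x * L2 + (k * sgn_q) * (L1 * L3)" unfolding f_eq k(2) by (simp add: mult_ac)
  moreover have "k * sgn_q \<in> S" using k(1) sgn_in by (rule s(5))
  ultimately show "f \<in> {f \<in> R. \<Phi> f \<in> Den}" unfolding gen_ideal_eq_two[OF mfps_ring_subring] using f \<Phi>_in by blast
next
  note r = mfps_ring_closed
  note hom = gale_subst_add gale_subst_diff gale_subst_mult
  fix f assume "f \<in> {f \<in> R. \<Phi> f \<in> Den}"
  then obtain x' y' where f: "f \<in> R" and xy': "x' \<in> S" "y' \<in> S" "\<Phi> f = x' * L2 + y' * (L1 * L3)"
    unfolding gen_ideal_eq_two[OF mfps_ring_subring] by blast
  obtain x y where xy: "x \<in> R" "\<Phi> x = x'" "y \<in> R" "\<Phi> y = y'" using \<Phi>_lift xy'(1,2) by metis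
  let ?u = "f - x * t3 - y * (t1 * t2)"
  have R: "?u \<in> R" using f xy monoms_in by (simp add: r)
  have "\<Phi> ?u = \<Phi> f - x' * L2 - y' * (L1 * (sgn_q * (sgn_q * L3)))"
    by (simp add: hom \<Phi>_monoms xy mult_ac)
  also have "\<dots> = 0" unfolding sgn_sgn xy'(3) by simp
  finally have u: "?u \<in> U" using \<Phi>_kernel[OF R] by blast
  have "0 \<in> U" using U_ideal_set unfolding ideal_set_def by blast
  moreover have "f * t0 = (?u * t0 + 0 * t2) + (x * (t0 * t3) + (y * t0) * (t1 * t2))" by (simp add: algebra_simps)
  moreover have "y * t0 \<in> R" using xy(3) monoms_in(1) by (rule r(5))
  ultimately show "f \<in> D_den (A_mat q) (v_vec q) (fam q)"
    unfolding D_den_def colon_def e_monom_eq dim_A_mat Q_ideal_eq using f u xy(1) by blast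
qed

text \<open>The substitution kills exactly \<open>U\<close>. The image of \<open>P\<close> is generated by \<open>\<lambda>\<^sub>2\<^sup>q \<lambda>\<^sub>3\<^sup>q\<close> and
  \<open>\<lambda>\<^sub>1\<^sup>q \<lambda>\<^sub>3\<^sup>q\<close>, and the factor \<open>\<lambda>\<^sub>3\<^sup>q\<close>, which is the image of \<open>t0\<close>, cancels.\<close>

lemma D_num_eq: "D_num (A_mat q) (v_vec q) (fam q) = {f \<in> R. \<Phi> f \<in> Num}"
proof -
  note r = mfps_ring_closed and s = mfps_ring_closed
  note hom = gale_subst_add gale_subst_diff gale_subst_mult
  have num: "f \<in> D_num (A_mat q) (v_vec q) (fam q) \<longleftrightarrow>
      f \<in> R \<and> (\<exists>u\<in>U. \<exists>x\<in>R. \<exists>y\<in>R. f * t0 = u + (x * (t0 * t3) + y * (t1 * t2)))" for f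
    unfolding D_num_def colon_def e_monom_eq dim_A_mat P_ideal_eq ideal_plus_def mem_Collect_eq
      gen_ideal_eq_two[OF mfps_ring_subring] by blast
  show ?thesis
  proof (intro equalityI subsetI)
    fix f assume "f \<in> D_num (A_mat q) (v_vec q) (fam q)"
    then obtain u x y where f: "f \<in> R" and u: "u \<in> U" and xy: "x \<in> R" "y \<in> R"
      and eq: "f * t0 = u + (x * (t0 * t3) + y * (t1 * t2))" unfolding num by blast
    have "\<Phi> f * L3 = \<Phi> x * (L3 * L2) + \<Phi> y * (L1 * (sgn_q * (sgn_q * L3)))"
      using arg_cong[OF eq, of \<Phi>] by (simp add: hom \<Phi>_monoms \<Phi>_U u mult_ac)
    then have "\<Phi> f * L3 = (\<Phi> y * L1 + \<Phi> x * L2) * L3" unfolding sgn_sgn by (simp add: algebra_simps)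
    moreover have "\<Phi> y * L1 + \<Phi> x * L2 \<in> S" by (simp add: s \<Phi>_in L_in)
    ultimately have "\<Phi> f = \<Phi> y * L1 + \<Phi> x * L2" using L_cancel[OF \<Phi>_in] by blast
    then show "f \<in> {f \<in> R. \<Phi> f \<in> Num}" unfolding gen_ideal_eq_two[OF mfps_ring_subring] using f \<Phi>_in by blast
  next
    fix f assume "f \<in> {f \<in> R. \<Phi> f \<in> Num}"
    then obtain x' y' where f: "f \<in> R" and xy': "x' \<in> S" "y' \<in> S" "\<Phi> f = x' * L1 + y' * L2"
      unfolding gen_ideal_eq_two[OF mfps_ring_subring] by blast
    obtain x y where xy: "x \<in> R" "\<Phi> x = x'" "y \<in> R" "\<Phi> y = y'" using \<Phi>_lift xy'(1,2) by metis
    let ?u = "f * t0 - y * (t0 * t3) - x * (t1 * t2)"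
    have R: "?u \<in> R" using f xy monoms_in by (simp add: r)
    have "\<Phi> ?u = \<Phi> f * L3 - y' * (L3 * L2) - x' * (L1 * (sgn_q * (sgn_q * L3)))"
      by (simp add: hom \<Phi>_monoms xy mult_ac)
    also have "\<dots> = 0" unfolding sgn_sgn xy'(3) by (simp add: algebra_simps)
    finally have "?u \<in> U" using \<Phi>_kernel[OF R] by blast
    moreover have "f * t0 = ?u + (y * (t0 * t3) + x * (t1 * t2))" by simp
    ultimately show "f \<in> D_num (A_mat q) (v_vec q) (fam q)" unfolding num using f xy(1,3) by blast
  qed
qed

lemma Den_set: "ideal_set S Den" and Num_set: "ideal_set S Num"
  using L_in mfps_ring_closed(5)[OF L_in(1,3)] by (simp_all add: ideal_set_gen[OF mfps_ring_subring])

lemma \<Phi>_D_den: "\<Phi> ` D_den (A_mat q) (v_vec q) (fam q) = Den"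
proof (intro equalityI subsetI)
  fix g assume g: "g \<in> Den"
  then have "g \<in> S" using Den_set unfolding ideal_set_def by blast
  then obtain f where "f \<in> R" "\<Phi> f = g" using \<Phi>_lift by blast
  then show "g \<in> \<Phi> ` D_den (A_mat q) (v_vec q) (fam q)" unfolding D_den_eq using g by blast
qed (use D_den_eq in blast)

lemma Pi_colon: "colon S (Pi_ideal (A_mat q) (B_mat q) (v_vec q) (fam q)) (\<Phi> (e_monom (v_vec q) (fam q))) = Num"
proof -
  note s = mfps_ring_closed
  note hom = gale_subst_add gale_subst_mult
  have Pi: "g \<in> Pi_ideal (A_mat q) (B_mat q) (v_vec q) (fam q) \<longleftrightarrow> (\<exists>x\<in>S. \<exists>y\<in>S. g = (x * L1 + y * L2) * L3)" for g
  proof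
    assume "g \<in> Pi_ideal (A_mat q) (B_mat q) (v_vec q) (fam q)"
    then obtain f where "f \<in> gen_ideal R {t0 * t3, t1 * t2}" "g = \<Phi> f" unfolding Pi_ideal_def P_ideal_eq by blast
    then obtain x y where "g = \<Phi> (x * (t0 * t3) + y * (t1 * t2))"
      unfolding gen_ideal_eq_two[OF mfps_ring_subring] by blast
    then have "g = \<Phi> x * (L3 * L2) + \<Phi> y * (L1 * (sgn_q * (sgn_q * L3)))"
      by (simp add: hom \<Phi>_monoms mult_ac)
    then have "g = (\<Phi> y * L1 + \<Phi> x * L2) * L3" unfolding sgn_sgn by (simp add: algebra_simps)
    then show "\<exists>x\<in>S. \<exists>y\<in>S. g = (x * L1 + y * L2) * L3" using \<Phi>_in by blast
  next
    assume "\<exists>x\<in>S. \<exists>y\<in>S. g = (x * L1 + y * L2) * L3"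
    then obtain x' y' where g: "x' \<in> S" "y' \<in> S" "g = (x' * L1 + y' * L2) * L3" by blast
    obtain x y where xy: "x \<in> R" "\<Phi> x = x'" "y \<in> R" "\<Phi> y = y'" using \<Phi>_lift g(1,2) by metis
    have "\<Phi> (y * (t0 * t3) + x * (t1 * t2)) = y' * (L3 * L2) + x' * (L1 * (sgn_q * (sgn_q * L3)))"
      by (simp add: hom \<Phi>_monoms xy mult_ac)
    also have "\<dots> = g" unfolding sgn_sgn g(3) by (simp add: algebra_simps)
    finally have "g = \<Phi> (y * (t0 * t3) + x * (t1 * t2))" ..
    moreover have "y * (t0 * t3) + x * (t1 * t2) \<in> gen_ideal R {t0 * t3, t1 * t2}"
      unfolding gen_ideal_eq_two[OF mfps_ring_subring] using xy by blast
    ultimately show "g \<in> Pi_ideal (A_mat q) (B_mat q) (v_vec q) (fam q)" unfolding Pi_ideal_def P_ideal_eq by (metis imageI)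
  qed
  show ?thesis
  proof (intro equalityI subsetI)
    fix g assume "g \<in> colon S (Pi_ideal (A_mat q) (B_mat q) (v_vec q) (fam q)) (\<Phi> (e_monom (v_vec q) (fam q)))"
    then obtain x y where xy: "g \<in> S" "x \<in> S" "y \<in> S" "g * L3 = (x * L1 + y * L2) * L3"
      unfolding colon_def e_monom_eq \<Phi>_monoms(1) mem_Collect_eq Pi by blast
    moreover have "x * L1 + y * L2 \<in> S" using xy L_in by (simp add: s)
    ultimately have "g = x * L1 + y * L2" using L_cancel by blast
    then show "g \<in> Num" unfolding gen_ideal_eq_two[OF mfps_ring_subring] using xy by blast
  next
    fix g assume "g \<in> Num"
    then obtain x y where xy: "x \<in> S" "y \<in> S" "g = x * L1 + y * L2"
      unfolding gen_ideal_eq_two[OF mfps_ring_subring] by blast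
    moreover have "x * L1 + y * L2 \<in> S" using xy L_in by (simp add: s)
    ultimately show "g \<in> colon S (Pi_ideal (A_mat q) (B_mat q) (v_vec q) (fam q)) (\<Phi> (e_monom (v_vec q) (fam q)))"
      unfolding colon_def e_monom_eq \<Phi>_monoms(1) mem_Collect_eq Pi by blast
  qed
qed

lemma Den_colon:
  assumes "\<alpha> \<in> S"
  shows "\<alpha> * L1 \<in> Den \<longleftrightarrow> \<alpha> \<in> gen_ideal S {L2, L3}"
proof
  note s = mfps_ring_closed
  assume "\<alpha> * L1 \<in> Den"
  then obtain x y where xy: "x \<in> S" "y \<in> S" "\<alpha> * L1 = x * L2 + y * (L1 * L3)"
    unfolding gen_ideal_eq_two[OF mfps_ring_subring] by blast
  have "(\<alpha> - y * L3) * L1 = x * L2" using xy(3) by (simp add: algebra_simps)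
  moreover have "\<alpha> - y * L3 \<in> S" using assms xy L_in by (simp add: s)
  ultimately obtain h where h: "h \<in> S" "\<alpha> - y * L3 = h * L2" using L12_coprime xy(1) by blast
  then have "\<alpha> = h * L2 + y * L3" by (simp add: algebra_simps)
  then show "\<alpha> \<in> gen_ideal S {L2, L3}" unfolding gen_ideal_eq_two[OF mfps_ring_subring] using h(1) xy(2) by blast
next
  assume "\<alpha> \<in> gen_ideal S {L2, L3}"
  then obtain x y where xy: "x \<in> S" "y \<in> S" "\<alpha> = x * L2 + y * L3"
    unfolding gen_ideal_eq_two[OF mfps_ring_subring] by blast
  have "\<alpha> * L1 = (x * L1) * L2 + y * (L1 * L3)" unfolding xy(3) by (simp add: algebra_simps)
  moreover have "x * L1 \<in> S" using xy(1) L_in(1) by (rule mfps_ring_closed(5))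
  ultimately show "\<alpha> * L1 \<in> Den" unfolding gen_ideal_eq_two[OF mfps_ring_subring] using xy(2) by blast
qed

lemma Num_iff:
  assumes "g \<in> S"
  shows "g \<in> Num \<longleftrightarrow> (\<exists>\<alpha>\<in>S. g - \<alpha> * L1 \<in> Den)"
proof
  assume "g \<in> Num"
  then obtain x y where xy: "x \<in> S" "y \<in> S" "g = x * L1 + y * L2"
    unfolding gen_ideal_eq_two[OF mfps_ring_subring] by blast
  have "g - x * L1 = y * L2 + 0 * (L1 * L3)" unfolding xy(3) by simp
  then show "\<exists>\<alpha>\<in>S. g - \<alpha> * L1 \<in> Den"
    unfolding gen_ideal_eq_two[OF mfps_ring_subring] using xy mfps_ring_closed(1) by blast
next
  assume "\<exists>\<alpha>\<in>S. g - \<alpha> * L1 \<in> Den"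
  then obtain \<alpha> x y where a: "\<alpha> \<in> S" "x \<in> S" "y \<in> S" "g - \<alpha> * L1 = x * L2 + y * (L1 * L3)"
    unfolding gen_ideal_eq_two[OF mfps_ring_subring] by blast
  have "g = (\<alpha> + y * L3) * L1 + x * L2" using a(4) by (simp add: algebra_simps)
  moreover have "\<alpha> + y * L3 \<in> S" using a L_in by (simp add: mfps_ring_closed)
  ultimately show "g \<in> Num" unfolding gen_ideal_eq_two[OF mfps_ring_subring] using a(2) by blast
qed

lemma series_iso: "\<exists>\<psi>. quotient_iso R \<Phi> (D_num (A_mat q) (v_vec q) (fam q)) (D_den (A_mat q) (v_vec q) (fam q))
    S (gen_ideal S {L2, L3}) \<psi>"
proof -
  have "gen_ideal S {L2, L3} \<subseteq> S" using gen_ideal_subset[OF mfps_ring_subring, of "{L2, L3}" 2] L_in by simp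
  then have N': "gen_ideal S {L2, L3} = {\<alpha> \<in> S. \<alpha> * L1 \<in> Den}" using Den_colon by blast
  have M: "D_num (A_mat q) (v_vec q) (fam q) = {f \<in> R. \<exists>\<alpha>\<in>S. \<Phi> f - \<alpha> * L1 \<in> Den}"
    unfolding D_num_eq using Num_iff[OF \<Phi>_in] by blast
  show ?thesis
    by (rule exI, rule quotient_iso_divide_by(1)[OF mfps_ring_subring Den_set L_in(1) mfps_ring_subring
          gale_subst_add gale_subst_mult \<Phi>_surj M D_den_eq N'])
qed

subsection \<open>The dimension of the obstruction module\<close>

text \<open>In degree \<open>d\<close> only the coefficients with \<open>i + j = d\<close> matter. They are taken from the representation
  of the part of degree \<open>d\<close> in the basis of the polynomial quotient.\<close>

lemma series_basis:
  shows "\<alpha> \<in> S \<Longrightarrow> \<exists>c. \<alpha> - mfps_of_poly (\<Sum>(i, j)\<in>{..<q} \<times> {..<q}. pconst (c (i, j)) * (Z ^ i * X ^ j)) \<in> gen_ideal S {L2, L3}"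
    and "mfps_of_poly (\<Sum>(i, j)\<in>{..<q} \<times> {..<q}. pconst (c (i, j)) * (Z ^ i * X ^ j)) \<in> gen_ideal S {L2, L3} \<Longrightarrow>
      i < q \<Longrightarrow> j < q \<Longrightarrow> c (i, j) = 0"
proof -
  let ?s = "\<lambda>c. \<Sum>(i, j)\<in>{..<q} \<times> {..<q}. pconst (c (i, j)) * (Z ^ i * X ^ j)"
  have s_in: "?s c \<in> poly_ring 2" for c
    by (rule subring_set_sum[OF poly_ring_subring]) (use powers_in in \<open>auto intro!: poly_ring_closed(5) pconst_in_poly_ring\<close>)
  have hcomp_s: "hcomp d (?s c) = ?s (\<lambda>(i, j). if i + j = d then c (i, j) else 0)" for c d
    unfolding hcomp_sum
  proof (rule sum.cong[OF refl])
    fix p :: "nat \<times> nat"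
    obtain i j where p: "p = (i, j)" by force
    have "pconst (c (i, j)) * (Z ^ i * X ^ j) \<in> hom_part (i + j)"
      by (intro hom_part_pconst_mult hom_part_mult powers_in)
    then show "hcomp d (case p of (i, j) \<Rightarrow> pconst (c (i, j)) * (Z ^ i * X ^ j))
        = (case p of (i, j) \<Rightarrow> pconst (case (i, j) of (i, j) \<Rightarrow> if i + j = d then c (i, j) else 0) * (Z ^ i * X ^ j))"
      unfolding p by (cases "i + j = d") (simp_all add: hcomp_id hcomp_other_degree)
  qed
  have iff: "f \<in> gen_ideal S {L2, L3} \<longleftrightarrow> f \<in> S \<and> (\<forall>d. hpart 2 d f \<in> Jquot)" for f
  proof -
    have "g \<in> poly_ring 2" "g \<in> hom_part q" if "g \<in> {Z ^ q, X ^ q}" for g using that powers_in by auto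
    from gen_ideal_series_iff[of "{Z ^ q, X ^ q}" 2 "\<lambda>_. q" f, OF _ this] show ?thesis by simp
  qed
  show "\<exists>c. \<alpha> - mfps_of_poly (?s c) \<in> gen_ideal S {L2, L3}" if \<alpha>: "\<alpha> \<in> S"
  proof -
    have "\<forall>d. \<exists>c. hpart 2 d \<alpha> - ?s c \<in> Jquot" using forms_basis(1)[OF ZX hpart_in(1)] by blast
    from choice[OF this] obtain c where c: "\<And>d. hpart 2 d \<alpha> - ?s (c d) \<in> Jquot" by blast
    let ?c = "\<lambda>(i, j). c (i + j) (i, j)"
    have "hpart 2 d (\<alpha> - mfps_of_poly (?s ?c)) \<in> Jquot" for d
    proof -
      have "hcomp d (?s ?c) = hcomp d (?s (c d))"
        unfolding hcomp_s by (rule sum.cong) auto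
      then have "hpart 2 d (\<alpha> - mfps_of_poly (?s ?c)) = hcomp d (hpart 2 d \<alpha>) - hcomp d (?s (c d))"
        unfolding hpart_diff hpart_of_poly[OF s_in] by (simp only: hcomp_id[OF hpart_in(2)])
      also have "\<dots> = hcomp d (hpart 2 d \<alpha> - ?s (c d))" using hcomp_add[of d "hpart 2 d \<alpha> - ?s (c d)" "?s (c d)"] by simp
      also have "\<dots> \<in> Jquot" using hcomp_gen_ideal_two[OF powers_in(6) powers_in(4) c, of d]
        unfolding gen_ideal_eq_two[OF poly_ring_subring] by blast
      finally show ?thesis .
    qed
    moreover have "\<alpha> - mfps_of_poly (?s ?c) \<in> S" using \<alpha> mfps_of_poly_in[OF s_in] by (rule mfps_ring_closed(4))
    ultimately have "\<alpha> - mfps_of_poly (?s ?c) \<in> gen_ideal S {L2, L3}" unfolding iff by blast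
    then show ?thesis by (rule exI[of _ ?c])
  qed
  show "c (i, j) = 0" if *: "mfps_of_poly (?s c) \<in> gen_ideal S {L2, L3}" and ij: "i < q" "j < q"
  proof -
    have "?s (\<lambda>(i', j'). if i' + j' = i + j then c (i', j') else 0) \<in> Jquot"
      using * unfolding iff hpart_of_poly[OF s_in] hcomp_s by blast
    from forms_basis(2)[OF ZX this ij] show ?thesis by simp
  qed
qed

lemma vector_space_mscale: "vector_space mscale"
  by unfold_locales (simp_all add: mscale_def pconst_add pconst_mult mfps_of_poly_hom algebra_simps)

lemma \<Phi>_mscale: "\<Phi> (mscale c f) = mscale c (\<Phi> f)"
  unfolding mscale_def gale_subst_mult by (simp add: gale_subst_of_poly psubst_pconst)

lemma quotient_dimension: "has_quot_dim mscale (D_num (A_mat q) (v_vec q) (fam q)) (D_den (A_mat q) (v_vec q) (fam q)) (q ^ 2)"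
proof -
  let ?I = "{..<q} \<times> {..<q}"
  interpret vector_space mscale by (rule vector_space_mscale)
  have s_in: "Z ^ i * X ^ j \<in> poly_ring 2" for i j using powers_in by (intro poly_ring_closed(5))
  have "\<exists>f\<in>R. \<Phi> f = mfps_of_poly (Z ^ i * X ^ j) * L1" for i j
    by (intro \<Phi>_lift mfps_ring_closed(5) mfps_of_poly_in[OF s_in] L_in)
  then have "\<exists>f. f \<in> R \<and> \<Phi> f = mfps_of_poly (Z ^ fst p * X ^ snd p) * L1" for p by blast
  then obtain x where x: "\<And>p. x p \<in> R" "\<And>p. \<Phi> (x p) = mfps_of_poly (Z ^ fst p * X ^ snd p) * L1" by metis
  let ?s = "\<lambda>c. \<Sum>(i, j)\<in>?I. pconst (c (i, j)) * (Z ^ i * X ^ j)"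
  have scale_in: "mscale c f \<in> R" if "f \<in> R" for c f
    unfolding mscale_def by (intro mfps_ring_closed(5) mfps_of_poly_in pconst_in_poly_ring that)
  have \<Phi>_sum: "\<Phi> (\<Sum>p\<in>A. g p) = (\<Sum>p\<in>A. \<Phi> (g p))" for g :: "nat \<times> nat \<Rightarrow> mfps" and A
    by (induction A rule: infinite_finite_induct) (simp_all add: gale_subst_add)
  have comb_in: "(\<Sum>p\<in>?I. mscale (c p) (x p)) \<in> R" for c
    by (rule subring_set_sum[OF mfps_ring_subring]) (intro scale_in x(1))
  have comb: "\<Phi> (\<Sum>p\<in>?I. mscale (c p) (x p)) = mfps_of_poly (?s c) * L1" for c
    unfolding \<Phi>_sum \<Phi>_mscale x(2) mfps_of_poly_sum sum_distrib_right
    by (rule sum.cong) (auto simp: mscale_def mfps_of_poly_hom mult_ac)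
  have sub: "subspace (D_den (A_mat q) (v_vec q) (fam q))"
  proof (rule subspaceI)
    show "0 \<in> D_den (A_mat q) (v_vec q) (fam q)" unfolding D_den_eq
      using gen_submodule.zero[of S "(*)" "{L2, L1 * L3}"] mfps_ring_closed(1) by simp
  next
    fix f g assume f: "f \<in> D_den (A_mat q) (v_vec q) (fam q)" and g: "g \<in> D_den (A_mat q) (v_vec q) (fam q)"
    then show "f + g \<in> D_den (A_mat q) (v_vec q) (fam q)"
      unfolding D_den_eq by (simp add: gale_subst_add gen_submodule.add mfps_ring_closed(3))
  next
    fix c f assume f: "f \<in> D_den (A_mat q) (v_vec q) (fam q)"
    have "mscale c (\<Phi> f) \<in> Den" unfolding mscale_def
      by (intro gen_submodule.scale[of _ S _ "(*)"] mfps_of_poly_in pconst_in_poly_ring) (use f D_den_eq in blast)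
    then show "mscale c f \<in> D_den (A_mat q) (v_vec q) (fam q)"
      using f scale_in[of f c] unfolding D_den_eq by (simp add: \<Phi>_mscale)
  qed
  have "has_quot_dim mscale (D_num (A_mat q) (v_vec q) (fam q)) (D_den (A_mat q) (v_vec q) (fam q)) (card ?I)"
  proof (rule has_quot_dimI[OF vector_space_mscale sub, of ?I x])
    show "finite ?I" by simp
    fix p
    have "mfps_of_poly (Z ^ fst p * X ^ snd p) * L1 \<in> Num"
      by (intro gen_submodule.scale[of _ S _ "(*)"] mfps_of_poly_in[OF s_in] gen_submodule.gen) simp
    then show "x p \<in> D_num (A_mat q) (v_vec q) (fam q)" unfolding D_num_eq using x by simp
  next
    fix f assume "f \<in> D_num (A_mat q) (v_vec q) (fam q)"
    then have f: "f \<in> R" "\<Phi> f \<in> Num" unfolding D_num_eq by blast+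
    then obtain \<alpha> where \<alpha>: "\<alpha> \<in> S" "\<Phi> f - \<alpha> * L1 \<in> Den" using Num_iff[OF \<Phi>_in] by blast
    obtain c where c: "\<alpha> - mfps_of_poly (?s c) \<in> gen_ideal S {L2, L3}" using series_basis(1)[OF \<alpha>(1)] by blast
    have sub: "gen_ideal S {L2, L3} \<subseteq> S" using gen_ideal_subset[OF mfps_ring_subring, of "{L2, L3}" 2] L_in by simp
    have "(\<alpha> - mfps_of_poly (?s c)) * L1 \<in> Den" using c sub Den_colon by blast
    then have "(\<Phi> f - \<alpha> * L1) + (\<alpha> - mfps_of_poly (?s c)) * L1 \<in> Den" using \<alpha>(2) by (rule gen_submodule.add[rotated])
    then have "\<Phi> (f - (\<Sum>p\<in>?I. mscale (c p) (x p))) \<in> Den"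
      unfolding gale_subst_diff comb by (simp add: algebra_simps)
    moreover have "f - (\<Sum>p\<in>?I. mscale (c p) (x p)) \<in> R" using f(1) comb_in by (rule mfps_ring_closed(4))
    ultimately show "\<exists>c. f - (\<Sum>p\<in>?I. mscale (c p) (x p)) \<in> D_den (A_mat q) (v_vec q) (fam q)" unfolding D_den_eq by blast
  next
    fix c p assume *: "(\<Sum>p\<in>?I. mscale (c p) (x p)) \<in> D_den (A_mat q) (v_vec q) (fam q)" and p: "p \<in> ?I"
    obtain i j where ij: "p = (i, j)" "i < q" "j < q" using p by blast
    have s_in2: "?s c \<in> poly_ring 2"
      by (rule subring_set_sum[OF poly_ring_subring]) (use s_in poly_ring_closed(5)[OF pconst_in_poly_ring] in auto)
    have "mfps_of_poly (?s c) * L1 \<in> Den" using * unfolding D_den_eq mem_Collect_eq comb by blast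
    then have "mfps_of_poly (?s c) \<in> gen_ideal S {L2, L3}" using Den_colon[OF mfps_of_poly_in[OF s_in2]] by blast
    from series_basis(2)[OF this ij(2,3)] show "c p = 0" unfolding ij(1) .
  qed
  then show ?thesis by (simp add: power2_eq_square)
qed

end

section \<open>Choice of the direction\<close>

lemma weyl_of_poly_in: "f \<in> poly_ring n \<Longrightarrow> weyl_of_poly f \<in> weyl_algebra n"
proof -
  assume f: "f \<in> poly_ring n"
  have "keys (weyl_of_poly f) \<subseteq> (\<Union>m\<in>keys f. keys (single (0 :: expo, m) (lookup f m)))"
    unfolding weyl_of_poly_def by (rule keys_sum)
  also have "\<dots> \<subseteq> expos n \<times> expos n" using f unfolding poly_ring_def by auto
  finally show ?thesis unfolding weyl_algebra_def by blast
qed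

lemma euler_operator_in: "euler_operator A \<beta> i \<in> weyl_algebra (dim_col A)"
proof -
  let ?t = "\<lambda>j. single (xexp j 1, xexp j 1) (of_int (A $$ (i, j)) :: complex)"
  have "keys (\<Sum>j<dim_col A. ?t j) \<subseteq> (\<Union>j\<in>{..<dim_col A}. keys (?t j))" by (rule keys_sum)
  also have "\<dots> \<subseteq> expos (dim_col A) \<times> expos (dim_col A)" by (auto simp: expos_iff lookup_single when_def split: if_splits)
  finally have "keys (\<Sum>j<dim_col A. ?t j) \<subseteq> expos (dim_col A) \<times> expos (dim_col A)" .
  moreover have "keys (single (0 :: expo, 0 :: expo) (\<beta> $ i)) \<subseteq> expos (dim_col A) \<times> expos (dim_col A)"
    by simp
  ultimately show ?thesis unfolding weyl_algebra_def euler_operator_def mem_Collect_eq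
    by (intro order_trans[OF keys_diff] Un_least)
qed

lemma left_ideal_hypergeometric:
  assumes "q \<ge> 1"
  shows "left_ideal (5 * q) (hypergeometric_ideal (A_mat q) \<beta>)"
proof -
  have "weyl_of_poly ` toric_ideal (A_mat q) \<union> euler_operator (A_mat q) \<beta> ` {..<dim_row (A_mat q)} \<subseteq> weyl_algebra (5 * q)"
    using weyl_of_poly_in[OF toric_ideal_subset[OF _ assms]] euler_operator_in[of "A_mat q"] by auto
  from left_ideal_gen[OF this] show ?thesis unfolding hypergeometric_ideal_def by simp
qed

text \<open>The bound \<open>7 / 40\<close> is the sum of \<open>5 q\<close> terms of size \<open>7 / (200 q)\<close>.\<close>

lemma weight_sum_near:
  assumes q: "q \<ge> 1" and near: "\<And>j. j < 5 * q \<Longrightarrow> \<bar>w $ j - (if j = 0 then 5 else if j = 1 then 2 else 0)\<bar> < 1 / (200 * real q)"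
    and c: "\<And>j. \<bar>c j\<bar> \<le> 7"
  shows "\<bar>(\<Sum>j<5 * q. w $ j * of_int (c j)) - (5 * of_int (c 0) + 2 * of_int (c 1))\<bar> \<le> 7 / 40"
proof -
  let ?x = "\<lambda>j. if j = 0 then 5 else if j = 1 then 2 else (0 :: real)"
  have "(\<Sum>j<5 * q. ?x j * of_int (c j)) = (\<Sum>j\<in>{0, 1}. ?x j * of_int (c j))"
    by (rule sum.mono_neutral_right) (use q in auto)
  then have "(\<Sum>j<5 * q. w $ j * of_int (c j)) - (5 * of_int (c 0) + 2 * of_int (c 1))
      = (\<Sum>j<5 * q. (w $ j - ?x j) * of_int (c j))" by (simp add: left_diff_distrib sum_subtractf)
  also have "\<bar>\<dots>\<bar> \<le> (\<Sum>j<5 * q. \<bar>(w $ j - ?x j) * of_int (c j)\<bar>)" by (rule sum_abs)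
  also have "\<dots> \<le> (\<Sum>j<5 * q. 1 / (200 * real q) * 7)"
  proof (rule sum_mono)
    fix j assume "j \<in> {..<5 * q}"
    then have "\<bar>w $ j - ?x j\<bar> \<le> 1 / (200 * real q)" using near[of j] by simp
    moreover have "\<bar>of_int (c j)\<bar> \<le> (7 :: real)" using c[of j] by linarith
    ultimately show "\<bar>(w $ j - ?x j) * of_int (c j)\<bar> \<le> 1 / (200 * real q) * 7"
      unfolding abs_mult by (intro mult_mono) simp_all
  qed
  also have "\<dots> = 7 / 40" using q by simp
  finally show ?thesis .
qed

text \<open>Near the vector with entries 5, 2 at the columns 0, 1 and zero elsewhere, the two weights that enter
  in the inequalities stay close to 5 and 2, and the ratio \<open>5 / 2\<close> lies between 2 and 3.\<close>

lemma exists_direction: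
  assumes q: "q \<ge> 1"
  obtains w where "good_weight q w" "rat_indep w" "generic_direction (A_mat q) \<beta> w"
proof -
  let ?x = "vec (5 * q) (\<lambda>j. if j = 0 then 5 else if j = 1 then 2 else (0 :: real))"
  have pos: "(0 :: real) < 1 / (200 * real q)" using q by simp
  show ?thesis
  proof (rule groebner_fan_interior_dense[OF left_ideal_hypergeometric[OF q, of \<beta>] vec_carrier pos])
    fix w assume w: "w \<in> carrier_vec (5 * q)" "rat_indep w" "\<And>j. j < 5 * q \<Longrightarrow> \<bar>w $ j - ?x $ j\<bar> < 1 / (200 * real q)"
    "\<exists>C\<in>small_groebner_fan (5 * q) (hypergeometric_ideal (A_mat q) \<beta>). w \<in> weight_interior (5 * q) C"
  have near: "\<bar>w $ j - (if j = 0 then 5 else if j = 1 then 2 else 0)\<bar> < 1 / (200 * real q)" if "j < 5 * q" for j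
    using w(3)[OF that] that by simp
  have "\<bar>w_a q w - 5\<bar> \<le> 7 / 40" "\<bar>w_b q w - 2\<bar> \<le> 7 / 40"
    using weight_sum_near[OF q near, of ca] weight_sum_near[OF q near, of cb]
    unfolding w_a_def w_b_def by (simp_all add: ca_def cb_def)
  then have "2 * w_b q w < w_a q w" "w_a q w < 3 * w_b q w" by linarith+
  then have good: "good_weight q w" unfolding good_weight_def using w(1) by blast
  from monomial_initial_toric[OF q good w(2)] have "generic_direction (A_mat q) \<beta> w"
    unfolding generic_direction_def using w(1,4) by simp
  with good w(2) show ?thesis by (rule that)
  qed
qed

lemma weight_pairing_nonzero:
  assumes w: "w \<in> carrier_vec n" "rat_indep w" and u: "u \<in> carrier_vec n" "u \<noteq> 0\<^sub>v n"
  shows "weight_pairing w u \<noteq> 0"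
proof
  assume "weight_pairing w u = 0"
  then have "(\<Sum>j<n. of_int (u $ j) * w $ j) = 0"
    using u(1) unfolding weight_pairing_def by (simp add: scalar_prod_def atLeast0LessThan mult.commute)
  then have "\<forall>j<n. u $ j = 0" using w unfolding rat_indep_def by (auto dest!: spec[of _ "\<lambda>j. u $ j"])
  then have "u = 0\<^sub>v n" using u(1) by (intro eq_vecI) simp_all
  then show False using u(2) by blast
qed

theorem theorem6p2:
  fixes q :: nat
  assumes "q \<ge> 1"
  shows "\<exists>(d::nat) (A::int mat) (\<beta>::complex vec) (w::real vec) (\<Gamma>::int vec set)
           (v::complex vec) (\<N>::nat set set) (B::int mat).
     A \<in> carrier_mat d (5 * q) \<and> homogeneous_matrix A \<and> lattice_rank A = 2 \<and>
     \<beta> \<in> carrier_vec d \<and>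
     connected_column_matroid A \<and>
     generic_direction A \<beta> w \<and>
     (\<forall>u\<in>ker_lattice A. u \<noteq> 0\<^sub>v (5 * q) \<longrightarrow> weight_pairing w u \<noteq> 0) \<and>
     groebner_vectors A w \<Gamma> \<and>
     normal_semigroup (5 * q) (combinations (5 * q) \<nat> \<Gamma>) \<and>
     fake_exponent A \<beta> w v \<and> (\<forall>j<5 * q. v $ j \<in> {-1, 0}) \<and>
     negative_support_family A w v \<N> \<and> ordered_family A v \<N> \<and>
     (\<forall>B'. gale_dual A B' \<longrightarrow>
        D_hilbert_series A B' v \<N> = fps_X ^ q * (\<Sum>i<q. fps_X ^ i) ^ 2) \<and>
     has_quot_dim mscale (D_num A v \<N>) (D_den A v \<N>) (q ^ 2) \<and>
     gale_dual A B \<and>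
     (let l1 = 2 * pvar 0 + 3 * pvar 1;
          l2 = 3 * pvar 0 + pvar 1;
          l3 = pvar 0 + pvar 1
      in
        gale_subst B ` D_den A v \<N> =
          gen_ideal (mfps_ring 2) {mfps_of_poly (l2 ^ q), mfps_of_poly (l1 ^ q * l3 ^ q)} \<and>
        colon (mfps_ring 2) (Pi_ideal A B v \<N>) (gale_subst B (e_monom v \<N>)) =
          gen_ideal (mfps_ring 2) {mfps_of_poly (l1 ^ q), mfps_of_poly (l2 ^ q)} \<and>
        (\<exists>\<phi>. quotient_iso (poly_ring 2) id (J_intr A B v \<N>) (J_amb A B v \<N>)
               (poly_ring 2) (gen_ideal (poly_ring 2) {l2 ^ q, l3 ^ q}) \<phi> \<and>
             degree_shifting q (J_intr A B v \<N>)
               (poly_ring 2) (gen_ideal (poly_ring 2) {l2 ^ q, l3 ^ q}) \<phi>) \<and>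
        (\<exists>\<psi>. quotient_iso (mfps_ring (5 * q)) (gale_subst B) (D_num A v \<N>) (D_den A v \<N>)
               (mfps_ring 2)
               (gen_ideal (mfps_ring 2) {mfps_of_poly (l2 ^ q), mfps_of_poly (l3 ^ q)}) \<psi>))"
proof -
  interpret standard_gale q by unfold_locales (rule assms)
  let ?A = "A_mat q" and ?v = "v_vec q"
  let ?\<beta> = "map_mat complex_of_int ?A *\<^sub>v ?v"
  obtain w where w: "good_weight q w" "rat_indep w" "generic_direction ?A ?\<beta> w"
    by (rule exists_direction[OF assms])
  have wc: "w \<in> carrier_vec (5 * q)" using w(1) unfolding good_weight_def by blast
  have "\<forall>u\<in>ker_lattice ?A. u \<noteq> 0\<^sub>v (5 * q) \<longrightarrow> weight_pairing w u \<noteq> 0"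
    using weight_pairing_nonzero[OF wc w(2)] by (auto simp: mat_kernel_def)
  moreover have "?\<beta> \<in> carrier_vec (5 * q - 2)" using A_mat_carrier[of q] by simp
  moreover have "\<forall>j<5 * q. ?v $ j \<in> {-1, 0}" by (simp add: v_vec_def v_entry_def)
  moreover have "\<forall>B'. gale_dual ?A B' \<longrightarrow> D_hilbert_series ?A B' ?v (fam q) = fps_X ^ q * (\<Sum>i<q. fps_X ^ i) ^ 2"
  proof (intro allI impI)
    fix B' assume "gale_dual ?A B'"
    then interpret G: gale q B' using assms by unfold_locales
    show "D_hilbert_series ?A B' ?v (fam q) = fps_X ^ q * (\<Sum>i<q. fps_X ^ i) ^ 2" by (rule G.D_hilbert_series_eq)
  qed
  moreover have "let l1 = 2 * pvar 0 + 3 * pvar 1; l2 = 3 * pvar 0 + pvar 1; l3 = pvar 0 + pvar 1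
      in
        \<Phi> ` D_den ?A ?v (fam q) = gen_ideal S {mfps_of_poly (l2 ^ q), mfps_of_poly (l1 ^ q * l3 ^ q)} \<and>
        colon S (Pi_ideal ?A (B_mat q) ?v (fam q)) (\<Phi> (e_monom ?v (fam q))) =
          gen_ideal S {mfps_of_poly (l1 ^ q), mfps_of_poly (l2 ^ q)} \<and>
        (\<exists>\<phi>. quotient_iso (poly_ring 2) id (J_intr ?A (B_mat q) ?v (fam q)) (J_amb ?A (B_mat q) ?v (fam q))
               (poly_ring 2) (gen_ideal (poly_ring 2) {l2 ^ q, l3 ^ q}) \<phi> \<and>
             degree_shifting q (J_intr ?A (B_mat q) ?v (fam q))
               (poly_ring 2) (gen_ideal (poly_ring 2) {l2 ^ q, l3 ^ q}) \<phi>) \<and>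
        (\<exists>\<psi>. quotient_iso R \<Phi> (D_num ?A ?v (fam q)) (D_den ?A ?v (fam q)) S
               (gen_ideal S {mfps_of_poly (l2 ^ q), mfps_of_poly (l3 ^ q)}) \<psi>)"
    unfolding Let_def X_eq[symmetric] Z_eq[symmetric] l1_def[symmetric] mfps_of_poly_hom(3) J_intr_eq J_amb_eq
    by (intro conjI \<Phi>_D_den Pi_colon graded_iso series_iso)
  ultimately show ?thesis
    using A_mat_carrier homogeneous_A_mat[OF assms] lattice_rank_A_mat[OF assms] connected_A_mat[OF assms] w(3)
      groebner_vectors_grob[OF assms w(1,2)] normal_grob[OF assms] fake_exponent_v[OF assms w(1,2)]
      weight_minimal_fam[OF assms w(1)] ordered_fam[OF assms] quotient_dimension gale_dual_B_mat[OF assms]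
    by (intro exI[of _ "5 * q - 2"] exI[of _ ?A] exI[of _ ?\<beta>] exI[of _ w] exI[of _ "grob q"] exI[of _ ?v]
        exI[of _ "fam q"] exI[of _ "B_mat q"] conjI)
qed

end
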